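(* Let $C$ be the capacity of the noncoherent OFDM channel described in the context, with SNR parameter $p_x>0$ and effective coherence time $\hat T_{\rm c}(\cdot)$. Define $$\mathrm{UB}_{\rm coh}(p_x)=E\left[\log\left(1+Np_x|\tilde h_{0,0}|^2\right)\right],$$ $$\mathrm{UB}^{(\rm pk)}_{\rm low}(p_x)=Np_x\left|E[\tilde h_{0,0}]\right|^2+p_x-\frac1N\log\left(1+\frac{Np_x}{1+\frac{p_x}{2}(\hat T_{\rm c}(p_x)-N)}\right),$$ $$\mathrm{UB}^{(\rm qd)}_{\rm low}(p_x)=Np_x\left|E[\tilde h_{0,0}]\right|^2+\alpha\,\frac{p_x^2(\hat T_{\rm c}(p_x)-N)}{2+p_x(\hat T_{\rm c}(p_x)-N)}+\frac12\alpha Np_x^2 .$$ Then under the peak power constraint $$C\le\min\left(\mathrm{UB}^{(\rm pk)}_{\rm low}(p_x),\mathrm{UB}_{\rm coh}(p_x)\right),$$ and under the quadratic power constraint (with constant $\alpha\ge1$) $$C\le\min\left(\mathrm{UB}^{(\rm qd)}_{\rm low}(p_x),\mathrm{UB}_{\rm coh}(p_x)\right).$$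
   Context: Conventions: logarithms are natural, $\dagger$ is conjugate transpose, indices start at $0$, $\mathcal{CN}(m,\Sigma)$ is the proper (circularly symmetric) complex Gaussian law. Channel model. Fix integers $1\le L\le N$ and $p_x>0$. Let $F$ be the $N\times N$ DFT matrix, $F_{m,n}=N^{-1/2}e^{-2\pi j mn/N}$. For $k\ge0$ let $H_k=(h_{k,0},\dots,h_{k,L-1},0,\dots,0)^T\in\mathbb C^N$ be the random channel impulse response and $\tilde H_k=F^\dagger H_k=(\tilde h_{k,0},\dots,\tilde h_{k,N-1})^T$. Assumptions: the sequence $(H_k)$ is jointly proper complex Gaussian, stationary and ergodic in $k$; different taps are uncorrelated and all taps have the same normalized autocorrelation, so that the covariance matrix of the stacked vector $(H_0^T,\dots,H_k^T)^T$ is the Kronecker product $\Delta_k\otimes \mathsf C_H$, where $\mathsf C_H$ is an $N\times N$ diagonal nonnegative matrix (zero outside its first $L$ diagonal entries) with $\mathrm{Tr}\,\mathsf C_H=1$, and $\Delta_k$ is the $(k+1)\times(k+1)$ Toeplitz positive semi-definite matrix, with unit diagonal, of the common normalized tap autocorrelation. $D_k\in\mathbb C^k$ is the vector with entries $(\Delta_k)_{i,k}$, $i=0,\dots,k-1$. The mean $E[H_k]$ does not depend on $k$ and has at most one nonzero entry (frequency-flat mean). The received signal is $$\tilde Y_k=\sqrt N\,\mathrm{diag}(\tilde H_k)\tilde X_k+\tilde W_k,$$ with $\tilde W_k$ i.i.d. $\mathcal{CN}(0,I)$ in $\mathbb C^N$, and with inputs, channel and noise mutually independent (neither transmitter nor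 receiver knows the channel realization; both know its statistics). Power constraints. With $p_k=\tilde X_k^\dagger\tilde X_k$: the peak constraint is $p_k\le Np_x$ almost surely for all $k$; the quadratic constraint is $E[p_k]\le Np_x$ and $E[p_k^2]\le\alpha N^2p_x^2$ for all $k$, where $\alpha\ge1$ is a constant. Capacity. $C=\lim_{n\to\infty}\sup\frac1{N(n+1)}I(\tilde X_0,\dots,\tilde X_n;\tilde Y_0,\dots,\tilde Y_n)$, the supremum being over input distributions of $(\tilde X_0,\dots,\tilde X_n)$ satisfying the constraint under consideration. Effective coherence time. For $p>0$, $$\hat T_{\rm c}(p)=2N\lim_{k\to\infty}D_k^\dagger\left(Np\,[\Delta_{k-1}-D_kD_k^\dagger]+I\right)^{-1}D_k+N .$$ If $\hat T_{\rm c}=+\infty$, expressions in $\hat T_{\rm c}$ are read as limits. *)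

theory Defs
  imports
    "HOL-Probability.Probability"
    "Jordan_Normal_Form.Schur_Decomposition"
    "Jordan_Normal_Form.Gauss_Jordan_Elimination"
begin

section \<open>Proper Gaussian, stationary and ergodic processes\<close>

text \<open>A real Gaussian variable is allowed to be degenerate (almost surely constant), since the
  covariance matrices of the channel may be singular.\<close>

definition gaussian_rv :: "'w measure \<Rightarrow> ('w \<Rightarrow> real) \<Rightarrow> bool" where
  "gaussian_rv P X \<longleftrightarrow> X \<in> borel_measurable P \<and>
     ((\<exists>m. AE \<omega> in P. X \<omega> = m) \<or>
      (\<exists>m \<sigma>. \<sigma> > 0 \<and> distributed P lborel X (\<lambda>x. ennreal (normal_density m \<sigma> x))))"

text \<open>Complex covariance \<open>E[(X - E X) (Y - E Y)\<^sup>*]\<close> and pseudo-covariance (without conjugate).\<close>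

definition ccov :: "'w measure \<Rightarrow> ('w \<Rightarrow> complex) \<Rightarrow> ('w \<Rightarrow> complex) \<Rightarrow> complex" where
  "ccov P X Y = (\<integral>\<omega>. (X \<omega> - (\<integral>\<xi>. X \<xi> \<partial>P)) * cnj (Y \<omega> - (\<integral>\<xi>. Y \<xi> \<partial>P)) \<partial>P)"

definition pseudo_cov :: "'w measure \<Rightarrow> ('w \<Rightarrow> complex) \<Rightarrow> ('w \<Rightarrow> complex) \<Rightarrow> complex" where
  "pseudo_cov P X Y = (\<integral>\<omega>. (X \<omega> - (\<integral>\<xi>. X \<xi> \<partial>P)) * (Y \<omega> - (\<integral>\<xi>. Y \<xi> \<partial>P)) \<partial>P)"

text \<open>The terms \<open>Re (\<Sum>i\<in>A. a i * Z i \<omega>)\<close> are exactly the real linear combinations of the real and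
  imaginary parts of the \<open>Z i\<close>, so the second conjunct is joint Gaussianity; the third one is
  properness.\<close>

definition jointly_proper_gaussian ::
    "'w measure \<Rightarrow> 'i set \<Rightarrow> ('i \<Rightarrow> 'w \<Rightarrow> complex) \<Rightarrow> bool" where
  "jointly_proper_gaussian P I Z \<longleftrightarrow>
     (\<forall>i\<in>I. Z i \<in> borel_measurable P) \<and>
     (\<forall>A a. finite A \<and> A \<subseteq> I \<longrightarrow> gaussian_rv P (\<lambda>\<omega>. Re (\<Sum>i\<in>A. a i * Z i \<omega>))) \<and>
     (\<forall>i\<in>I. \<forall>j\<in>I. pseudo_cov P (Z i) (Z j) = 0)"

definition path_law :: "'w measure \<Rightarrow> 'a measure \<Rightarrow> (nat \<Rightarrow> 'w \<Rightarrow> 'a) \<Rightarrow> (nat \<Rightarrow> 'a) measure" where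
  "path_law P S Z = distr P (\<Pi>\<^sub>M k\<in>UNIV. S) (\<lambda>\<omega> k. Z k \<omega>)"

definition shift_path :: "(nat \<Rightarrow> 'a) \<Rightarrow> nat \<Rightarrow> 'a" where
  "shift_path x = (\<lambda>k. x (Suc k))"

definition stationary_process :: "'w measure \<Rightarrow> 'a measure \<Rightarrow> (nat \<Rightarrow> 'w \<Rightarrow> 'a) \<Rightarrow> bool" where
  "stationary_process P S Z \<longleftrightarrow>
     distr (path_law P S Z) (\<Pi>\<^sub>M k\<in>UNIV. S) shift_path = path_law P S Z"

definition ergodic_process :: "'w measure \<Rightarrow> 'a measure \<Rightarrow> (nat \<Rightarrow> 'w \<Rightarrow> 'a) \<Rightarrow> bool" where
  "ergodic_process P S Z \<longleftrightarrow>
     (\<forall>A\<in>sets (\<Pi>\<^sub>M k\<in>UNIV. S). shift_path -` A \<inter> space (\<Pi>\<^sub>M k\<in>UNIV. S) = A \<longrightarrow>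
        measure (path_law P S Z) A = 0 \<or> measure (path_law P S Z) A = 1)"

section \<open>The OFDM channel\<close>

text \<open>Vectors in \<open>\<complex>\<^sup>N\<close> are extensional functions on \<open>{..<N}\<close>.\<close>

abbreviation cvec_space :: "nat \<Rightarrow> (nat \<Rightarrow> complex) measure" where
  "cvec_space N \<equiv> (\<Pi>\<^sub>M m\<in>{..<N}. borel)"

text \<open>Sequences of \<open>n + 1\<close> such vectors, indexed by the times \<open>0, \<dots>, n\<close>.\<close>

abbreviation block_space :: "nat \<Rightarrow> nat \<Rightarrow> (nat \<Rightarrow> nat \<Rightarrow> complex) measure" where
  "block_space N n \<equiv> (\<Pi>\<^sub>M k\<in>{..n}. cvec_space N)"

definition dft :: "nat \<Rightarrow> nat \<Rightarrow> nat \<Rightarrow> complex" where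
  "dft N m n = exp (- 2 * of_real pi * \<i> * of_nat m * of_nat n / of_nat N) / of_real (sqrt (real N))"

text \<open>\<open>h k l\<close> is the random tap number \<open>l < L\<close> at time \<open>k\<close>; the impulse response
  \<open>H\<^sub>k\<close> is padded with zeros up to length \<open>N\<close>.\<close>

definition impulse_response ::
    "nat \<Rightarrow> nat \<Rightarrow> (nat \<Rightarrow> nat \<Rightarrow> 'w \<Rightarrow> complex) \<Rightarrow> nat \<Rightarrow> 'w \<Rightarrow> nat \<Rightarrow> complex" where
  "impulse_response N L h k \<omega> = (\<lambda>l\<in>{..<N}. if l < L then h k l \<omega> else 0)"

text \<open>Component \<open>m\<close> of \<open>F\<^sup>\<dagger> H\<^sub>k\<close>.\<close>

definition freq_response ::
    "nat \<Rightarrow> nat \<Rightarrow> (nat \<Rightarrow> nat \<Rightarrow> 'w \<Rightarrow> complex) \<Rightarrow> nat \<Rightarrow> nat \<Rightarrow> 'w \<Rightarrow> complex" where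
  "freq_response N L h k m \<omega> = (\<Sum>l<N. cnj (dft N l m) * impulse_response N L h k \<omega> l)"

text \<open>With \<open>r\<close> the normalized tap autocorrelation at integer lags, \<open>Delta r k\<close> is the
  \<open>(k+1) \<times> (k+1)\<close> Toeplitz matrix.\<close>

definition Delta :: "(int \<Rightarrow> complex) \<Rightarrow> nat \<Rightarrow> complex mat" where
  "Delta r k = Matrix.mat (k + 1) (k + 1) (\<lambda>(i, j). r (int i - int j))"

text \<open>\<open>D\<^sub>k\<close> as a \<open>k \<times> 1\<close> matrix.\<close>

definition Dcol :: "(int \<Rightarrow> complex) \<Rightarrow> nat \<Rightarrow> complex mat" where
  "Dcol r k = Matrix.mat k 1 (\<lambda>(i, _). Delta r k $$ (i, k))"

definition psd_mat :: "complex mat \<Rightarrow> bool" where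
  "psd_mat A \<longleftrightarrow> (\<forall>v\<in>carrier_vec (dim_row A).
      Im ((A *\<^sub>v v) \<bullet>c v) = 0 \<and> 0 \<le> Re ((A *\<^sub>v v) \<bullet>c v))"

definition kronecker :: "'a::times mat \<Rightarrow> 'a mat \<Rightarrow> 'a mat" where
  "kronecker A B = Matrix.mat (dim_row A * dim_row B) (dim_col A * dim_col B)
     (\<lambda>(i, j). A $$ (i div dim_row B, j div dim_col B) * B $$ (i mod dim_row B, j mod dim_col B))"

text \<open>Covariance matrix of the stacked vector \<open>(H\<^sub>0\<^sup>T, \<dots>, H\<^sub>k\<^sup>T)\<^sup>T\<close>, whose entry
  number \<open>a\<close> is entry \<open>a mod N\<close> of \<open>H\<close> at time \<open>a div N\<close>.\<close>

definition stacked_cov ::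
    "'w measure \<Rightarrow> nat \<Rightarrow> (nat \<Rightarrow> 'w \<Rightarrow> nat \<Rightarrow> complex) \<Rightarrow> nat \<Rightarrow> complex mat" where
  "stacked_cov P N H k = Matrix.mat ((k + 1) * N) ((k + 1) * N)
     (\<lambda>(a, b). ccov P (\<lambda>\<omega>. H (a div N) \<omega> (a mod N)) (\<lambda>\<omega>. H (b div N) \<omega> (b mod N)))"

locale ofdm_channel = prob_space P
  for P :: "'w measure" +
  fixes N L :: nat
    and h :: "nat \<Rightarrow> nat \<Rightarrow> 'w \<Rightarrow> complex"
    and r :: "int \<Rightarrow> complex"
    and CH :: "real mat"
  assumes L_ge_1: "1 \<le> L" and L_le_N: "L \<le> N"
    and gaussian: "jointly_proper_gaussian P (UNIV \<times> {..<N})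
                     (\<lambda>(k, l) \<omega>. impulse_response N L h k \<omega> l)"
    and stationary: "stationary_process P (cvec_space N) (impulse_response N L h)"
    and ergodic: "ergodic_process P (cvec_space N) (impulse_response N L h)"
    and CH_carrier: "CH \<in> carrier_mat N N"
    and CH_diagonal: "diagonal_mat CH"
    and CH_nonneg: "\<And>l. l < N \<Longrightarrow> 0 \<le> CH $$ (l, l)"
    and CH_zero: "\<And>l. L \<le> l \<Longrightarrow> l < N \<Longrightarrow> CH $$ (l, l) = 0"
    and CH_trace: "(\<Sum>l<N. CH $$ (l, l)) = 1"
    and Delta_unit_diag: "r 0 = 1"
    and Delta_psd: "\<And>k. psd_mat (Delta r k)"
    and covariance: "\<And>k. stacked_cov P N (impulse_response N L h) k =
                        kronecker (Delta r k) (map_mat of_real CH)"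
    and mean_const: "\<And>k l. l < N \<Longrightarrow>
          (\<integral>\<omega>. impulse_response N L h k \<omega> l \<partial>P) = (\<integral>\<omega>. impulse_response N L h 0 \<omega> l \<partial>P)"
    and mean_flat: "card {l. l < N \<and> (\<integral>\<omega>. impulse_response N L h 0 \<omega> l \<partial>P) \<noteq> 0} \<le> 1"

section \<open>Mutual information and capacity\<close>

text \<open>The law \<open>CN(0,1)\<close> on the complex plane.\<close>

definition std_complex_normal :: "complex measure" where
  "std_complex_normal = density lborel (\<lambda>z. ennreal (exp (- (cmod z)\<^sup>2) / pi))"

definition noise_law :: "nat \<Rightarrow> nat \<Rightarrow> (nat \<Rightarrow> nat \<Rightarrow> complex) measure" where
  "noise_law N n = (\<Pi>\<^sub>M k\<in>{..n}. \<Pi>\<^sub>M m\<in>{..<N}. std_complex_normal)"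

definition received ::
    "nat \<Rightarrow> nat \<Rightarrow> (nat \<Rightarrow> nat \<Rightarrow> 'w \<Rightarrow> complex) \<Rightarrow> nat \<Rightarrow>
      (nat \<Rightarrow> nat \<Rightarrow> complex) \<times> 'w \<times> (nat \<Rightarrow> nat \<Rightarrow> complex) \<Rightarrow> nat \<Rightarrow> nat \<Rightarrow> complex" where
  "received N L h n = (\<lambda>(x, \<omega>, w). \<lambda>k\<in>{..n}. \<lambda>m\<in>{..<N}.
      of_real (sqrt (real N)) * freq_response N L h k m \<omega> * x k m + w k m)"

text \<open>Mutual information, in nats, between inputs and outputs at the times \<open>0, \<dots>, n\<close> when the
  inputs have law \<open>\<mu>\<close>. Inputs, channel and noise are independent because the underlying
  probability space is a product.\<close>

definition io_information ::
    "'w measure \<Rightarrow> nat \<Rightarrow> nat \<Rightarrow> (nat \<Rightarrow> nat \<Rightarrow> 'w \<Rightarrow> complex) \<Rightarrow> nat \<Rightarrow>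
      (nat \<Rightarrow> nat \<Rightarrow> complex) measure \<Rightarrow> real" where
  "io_information P N L h n \<mu> =
     prob_space.mutual_information (\<mu> \<Otimes>\<^sub>M (P \<Otimes>\<^sub>M noise_law N n)) (exp 1)
       (block_space N n) (block_space N n) fst (received N L h n)"

definition input_laws :: "nat \<Rightarrow> nat \<Rightarrow> (nat \<Rightarrow> nat \<Rightarrow> complex) measure set" where
  "input_laws N n = {\<mu>. prob_space \<mu> \<and> sets \<mu> = sets (block_space N n)}"

definition symbol_energy :: "nat \<Rightarrow> (nat \<Rightarrow> nat \<Rightarrow> complex) \<Rightarrow> nat \<Rightarrow> real" where
  "symbol_energy N x k = (\<Sum>m<N. (cmod (x k m))\<^sup>2)"

definition peak_inputs :: "nat \<Rightarrow> real \<Rightarrow> nat \<Rightarrow> (nat \<Rightarrow> nat \<Rightarrow> complex) measure set" where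
  "peak_inputs N px n =
     {\<mu> \<in> input_laws N n. \<forall>k\<le>n. AE x in \<mu>. symbol_energy N x k \<le> real N * px}"

definition quad_inputs ::
    "nat \<Rightarrow> real \<Rightarrow> real \<Rightarrow> nat \<Rightarrow> (nat \<Rightarrow> nat \<Rightarrow> complex) measure set" where
  "quad_inputs N \<alpha> px n =
     {\<mu> \<in> input_laws N n. \<forall>k\<le>n.
        (\<integral>\<^sup>+x. ennreal (symbol_energy N x k) \<partial>\<mu>) \<le> ennreal (real N * px) \<and>
        (\<integral>\<^sup>+x. ennreal ((symbol_energy N x k)\<^sup>2) \<partial>\<mu>) \<le> ennreal (\<alpha> * (real N)\<^sup>2 * px\<^sup>2)}"

definition capacity ::
    "'w measure \<Rightarrow> nat \<Rightarrow> nat \<Rightarrow> (nat \<Rightarrow> nat \<Rightarrow> 'w \<Rightarrow> complex) \<Rightarrow>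
      (nat \<Rightarrow> (nat \<Rightarrow> nat \<Rightarrow> complex) measure set) \<Rightarrow> ereal" where
  "capacity P N L h admissible =
     lim (\<lambda>n. SUP \<mu>\<in>admissible n. ereal (io_information P N L h n \<mu> / (real N * real (n + 1))))"

section \<open>Effective coherence time and the upper bounds\<close>

text \<open>The quadratic form is real, as its matrix is Hermitian. The value at \<open>k = 0\<close>, where
  \<open>Delta r (k - 1)\<close> has the wrong size, is irrelevant for the limit below.\<close>

definition coh_form :: "nat \<Rightarrow> (int \<Rightarrow> complex) \<Rightarrow> real \<Rightarrow> nat \<Rightarrow> real" where
  "coh_form N r p k =
     Re ((mat_adjoint (Dcol r k) *
          the (mat_inverse (of_real (real N * p) \<cdot>\<^sub>m (Delta r (k - 1) - Dcol r k * mat_adjoint (Dcol r k))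
                            + 1\<^sub>m k)) *
          Dcol r k) $$ (0, 0))"

definition coh_time :: "nat \<Rightarrow> (int \<Rightarrow> complex) \<Rightarrow> real \<Rightarrow> ereal" where
  "coh_time N r p = 2 * ereal (real N) * lim (\<lambda>k. ereal (coh_form N r p k)) + ereal (real N)"

text \<open>An expression \<open>f T\<close> in the coherence time, read as a limit if \<open>T = \<infinity>\<close>.\<close>

definition at_coh_time :: "(real \<Rightarrow> real) \<Rightarrow> ereal \<Rightarrow> real" where
  "at_coh_time f T = (if T = \<infinity> then Lim at_top f else f (real_of_ereal T))"

definition mean_gain :: "'w measure \<Rightarrow> nat \<Rightarrow> nat \<Rightarrow> (nat \<Rightarrow> nat \<Rightarrow> 'w \<Rightarrow> complex) \<Rightarrow> real" where
  "mean_gain P N L h = (cmod (\<integral>\<omega>. freq_response N L h 0 0 \<omega> \<partial>P))\<^sup>2"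

definition UB_coh ::
    "'w measure \<Rightarrow> nat \<Rightarrow> nat \<Rightarrow> (nat \<Rightarrow> nat \<Rightarrow> 'w \<Rightarrow> complex) \<Rightarrow> real \<Rightarrow> real" where
  "UB_coh P N L h px = (\<integral>\<omega>. ln (1 + real N * px * (cmod (freq_response N L h 0 0 \<omega>))\<^sup>2) \<partial>P)"

definition UB_low_pk ::
    "'w measure \<Rightarrow> nat \<Rightarrow> nat \<Rightarrow> (nat \<Rightarrow> nat \<Rightarrow> 'w \<Rightarrow> complex) \<Rightarrow> (int \<Rightarrow> complex) \<Rightarrow> real \<Rightarrow> real" where
  "UB_low_pk P N L h r px = at_coh_time
     (\<lambda>T. real N * px * mean_gain P N L h + px
          - 1 / real N * ln (1 + real N * px / (1 + px / 2 * (T - real N))))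
     (coh_time N r px)"

definition UB_low_qd ::
    "'w measure \<Rightarrow> nat \<Rightarrow> nat \<Rightarrow> (nat \<Rightarrow> nat \<Rightarrow> 'w \<Rightarrow> complex) \<Rightarrow> (int \<Rightarrow> complex) \<Rightarrow>
      real \<Rightarrow> real \<Rightarrow> real" where
  "UB_low_qd P N L h r \<alpha> px = at_coh_time
     (\<lambda>T. real N * px * mean_gain P N L h
          + \<alpha> * (px\<^sup>2 * (T - real N) / (2 + px * (T - real N)))
          + 1 / 2 * \<alpha> * real N * px\<^sup>2)
     (coh_time N r px)"

end

theory Submission
  imports Defs "HOL-Real_Asymp.Real_Asymp"
begin

text \<open>Given the input \<open>x\<close>, with symbol energies \<open>p\<^sub>k\<close>, the output is proper Gaussian. By Gibbs' inequality
  the mutual information is at most the expected logarithm of the output density given the input, relative to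
  the law of the noise alone. Ordering the output components by time factors this density into innovation variances,
  and those of symbol \<open>k\<close> multiply to at least \<open>1 + \<epsilon>\<^sub>k p\<^sub>k\<close>, where \<open>\<epsilon>\<^sub>k\<close> is the error of predicting the
  normalized fading process from its noisy past. The prediction filter that is optimal when all past energies
  equal \<open>N p\<^sub>x\<close> is a dual certificate that bounds \<open>\<epsilon>\<^sub>k\<close> from below by an affine function of the past
  energies, for arbitrary inputs, and its value at constant energies is expressed through the coherence time. Either
  power constraint then bounds the expectation of \<open>p\<^sub>k - ln (1 + \<epsilon>\<^sub>k p\<^sub>k)\<close>. The coherent bound is
  Gibbs' inequality with, as reference, the output law of a known channel with white Gaussian inputs. The limit defining the capacity exists by
  Fekete's lemma: independent concatenation of input laws is admissible, and by stationarity of the channel it makes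
  the information superadditive.\<close>

section \<open>Complex Gaussian integrals\<close>

text \<open>The channel covariance may be singular, so the channel need not have a density. Only the
  noise has one, and all laws are handled by densities relative to it, evaluated through
  characteristic functions. Under arbitrary inputs the innovation variances v have no tractable
  form. They enter as ln v + s/v, where s is the variance of a combination with leading coefficient
  1; this is at least 1 + ln s, so a lower bound for s valid for all such combinations is enough,
  and one filter that does not depend on the input can certify it. The constants of the low-power
  bounds come from q = N p_x and Q, the limit of the quadratic form in the coherence time T: T - N =
  2 N Q, and 1/(1 + q Q) is the limiting prediction error at constant energy q. Under the quadratic
  constraint the products of current and past energies are the obstacle, as only single moments are
  bounded; an affine certificate leaves just products of two energies, which second moments control.
  Information is a real-valued integral and capacity a \<open>lim\<close>; both say nothing without
  integrability and convergence, so these are proved along the way.\<close>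

lemma (in prob_space) normal_distributed_char:
  assumes \<sigma>: "0 < \<sigma>" and D: "distributed M lborel X (normal_density \<mu> \<sigma>)"
  shows "(\<integral>\<omega>. iexp (t * X \<omega>) \<partial>M) = exp (\<i> * of_real (t * \<mu>) - of_real (\<sigma>\<^sup>2 * t\<^sup>2 / 2))"
proof -
  have D': "distributed M lborel (\<lambda>x. (X x - \<mu>) / \<sigma>) std_normal_density"
    using D normal_standard_normal_convert[OF \<sigma>] by blast
  have X[measurable]: "X \<in> borel_measurable M"
    using distributed_measurable[OF D] by simp
  have dd: "distr M lborel (\<lambda>x. (X x - \<mu>) / \<sigma>) = std_normal_distribution"
    using distributed_distr_eq_density[OF D'] by simp
  have "(\<integral>\<omega>. iexp (t * X \<omega>) \<partial>M) = (\<integral>\<omega>. iexp (t * \<mu>) * iexp (t * \<sigma> * ((X \<omega> - \<mu>) / \<sigma>)) \<partial>M)"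
    proof (intro Bochner_Integration.integral_cong refl)
    fix \<omega>
    have "t * X \<omega> = t * \<mu> + t * \<sigma> * ((X \<omega> - \<mu>) / \<sigma>)"
      using \<sigma> by (simp add: field_simps)
    then show "iexp (t * X \<omega>) = iexp (t * \<mu>) * iexp (t * \<sigma> * ((X \<omega> - \<mu>) / \<sigma>))"
      by (simp only: exp_add[symmetric] of_real_add distrib_left)
  qed
  also have "\<dots> = iexp (t * \<mu>) * (\<integral>\<omega>. iexp (t * \<sigma> * ((X \<omega> - \<mu>) / \<sigma>)) \<partial>M)"
    by simp
  also have "(\<integral>\<omega>. iexp (t * \<sigma> * ((X \<omega> - \<mu>) / \<sigma>)) \<partial>M)
     = (\<integral>x. iexp (t * \<sigma> * x) \<partial>(distr M lborel (\<lambda>x. (X x - \<mu>) / \<sigma>)))"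
    by (subst integral_distr) simp_all
  also have "\<dots> = char std_normal_distribution (t * \<sigma>)"
    unfolding dd char_def ..
  also have "\<dots> = of_real (exp (- ((t * \<sigma>)\<^sup>2) / 2))"
    by (simp add: char_std_normal_distribution)
  finally show ?thesis
    unfolding exp_of_real[symmetric] exp_add[symmetric] by (simp add: power_mult_distrib mult_ac)
qed

lemma integral_normal_density_iexp:
  assumes \<sigma>: "0 < \<sigma>"
  shows "(\<integral>s. normal_density \<mu> \<sigma> s *\<^sub>R iexp (t * s) \<partial>lborel)
    = exp (\<i> * of_real (t * \<mu>) - of_real (\<sigma>\<^sup>2 * t\<^sup>2 / 2))"
proof -
  interpret prob_space "density lborel (normal_density \<mu> \<sigma>)"
    by (rule prob_space_normal_density[OF \<sigma>])
  have "distributed (density lborel (normal_density \<mu> \<sigma>)) lborel (\<lambda>x. x) (normal_density \<mu> \<sigma>)"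
    by (auto simp: distributed_def intro!: measure_eqI simp: emeasure_distr)
  from normal_distributed_char[OF \<sigma> this, of t] show ?thesis
    by (subst (asm) integral_density) auto
qed

text \<open>No contour shift is needed for a complex \<beta>: its real part is absorbed into the
  mean of a normal density of variance 1/(2v), and its imaginary part becomes the argument of the
  characteristic function of that density.\<close>

lemma integral_gaussian_complex_linear:
  fixes \<beta> :: complex
  assumes v: "0 < (v::real)"
  shows "(\<integral>s. exp (- of_real (v * s\<^sup>2) + of_real s * \<beta>) \<partial>lborel) = of_real (sqrt (pi / v)) * exp (\<beta>\<^sup>2 / of_real (4 * v))"
proof -
  define a b where "a = Re \<beta>" and "b = Im \<beta>"
  have \<beta>: "\<beta> = Complex a b" by (simp add: a_def b_def)
  define \<sigma> where "\<sigma> = 1 / sqrt (2 * v)"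
  have \<sigma>: "0 < \<sigma>" and \<sigma>2: "\<sigma>\<^sup>2 = 1 / (2 * v)"
    using v by (simp_all add: \<sigma>_def power_divide)
  have nd: "normal_density (a / (2 * v)) \<sigma> s = sqrt (v / pi) * exp (- v * s\<^sup>2 + a * s - a\<^sup>2 / (4 * v))" for s
  proof -
    have "- (s - a / (2 * v))\<^sup>2 / (2 * \<sigma>\<^sup>2) = - v * s\<^sup>2 + a * s - a\<^sup>2 / (4 * v)"
      using v unfolding \<sigma>2 by (simp add: field_simps power2_eq_square)
    then show ?thesis
      using v unfolding normal_density_def \<sigma>2 by (simp add: real_sqrt_divide)
  qed
  have e: "exp (- of_real (v * s\<^sup>2) + of_real s * \<beta>)
     = of_real (sqrt (pi / v) * exp (a\<^sup>2 / (4 * v))) * (normal_density (a / (2 * v)) \<sigma> s *\<^sub>R iexp (b * s))" for s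
  proof -
    have "exp (- of_real (v * s\<^sup>2) + of_real s * \<beta>) = of_real (exp (- v * s\<^sup>2 + a * s)) * iexp (b * s)"
      unfolding \<beta> exp_of_real[symmetric] exp_add[symmetric] by (simp add: complex_eq_iff algebra_simps Complex_eq)
    moreover have "sqrt (pi / v) * exp (a\<^sup>2 / (4 * v)) * normal_density (a / (2 * v)) \<sigma> s = exp (- v * s\<^sup>2 + a * s)"
    proof -
      have "sqrt (pi / v) * sqrt (v / pi) = 1"
        using v by (simp add: real_sqrt_mult[symmetric])
      moreover have "exp (a\<^sup>2 / (4 * v)) * exp (- v * s\<^sup>2 + a * s - a\<^sup>2 / (4 * v)) = exp (- v * s\<^sup>2 + a * s)"
        unfolding exp_add[symmetric] by simp
      ultimately show ?thesis unfolding nd by (simp add: mult.assoc mult.left_commute)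
    qed
    ultimately show ?thesis
      by (simp add: scaleR_conv_of_real) (metis (no_types, opaque_lifting) mult.assoc of_real_mult)
  qed
  have "(\<integral>s. exp (- of_real (v * s\<^sup>2) + of_real s * \<beta>) \<partial>lborel) =
    of_real (sqrt (pi / v) * exp (a\<^sup>2 / (4 * v))) * exp (\<i> * of_real (b * (a / (2 * v))) - of_real (\<sigma>\<^sup>2 * b\<^sup>2 / 2))"
    unfolding e by (simp only: integral_mult_right_zero integral_normal_density_iexp[OF \<sigma>])
  also have "\<dots> = of_real (sqrt (pi / v)) * exp (\<beta>\<^sup>2 / of_real (4 * v))"
  proof -
    have "\<beta>\<^sup>2 / of_real (4 * v) = of_real (a\<^sup>2 / (4 * v)) + (\<i> * of_real (b * (a / (2 * v))) - of_real (\<sigma>\<^sup>2 * b\<^sup>2 / 2))"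
      unfolding \<beta> \<sigma>2 using v by (simp add: complex_eq_iff Complex_eq power2_eq_square field_simps)
    then show ?thesis by (simp only: exp_add exp_of_real of_real_mult mult.assoc)
  qed
  finally show ?thesis .
qed

lemma integrable_gaussian_complex_linear:
  assumes v: "0 < (v::real)"
  shows "integrable lborel (\<lambda>s. exp (- of_real (v * s\<^sup>2) + of_real s * (\<beta>::complex)))"
proof -
  define a where "a = Re \<beta>"
  define \<sigma> where "\<sigma> = 1 / sqrt (2 * v)"
  have \<sigma>: "0 < \<sigma>" and \<sigma>2: "\<sigma>\<^sup>2 = 1 / (2 * v)"
    using v by (simp_all add: \<sigma>_def power_divide)
  have nd: "normal_density (a / (2 * v)) \<sigma> s = sqrt (v / pi) * exp (- v * s\<^sup>2 + a * s - a\<^sup>2 / (4 * v))" for s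
  proof -
    have "- (s - a / (2 * v))\<^sup>2 / (2 * \<sigma>\<^sup>2) = - v * s\<^sup>2 + a * s - a\<^sup>2 / (4 * v)"
      using v unfolding \<sigma>2 by (simp add: field_simps power2_eq_square)
    then show ?thesis
      using v unfolding normal_density_def \<sigma>2 by (simp add: real_sqrt_divide)
  qed
  have "integrable lborel (\<lambda>s. sqrt (pi / v) * exp (a\<^sup>2 / (4 * v)) * normal_density (a / (2 * v)) \<sigma> s)"
    using \<sigma> by simp
  then show ?thesis
  proof (rule Bochner_Integration.integrable_bound)
    have "sqrt (pi / v) * sqrt (v / pi) = 1"
      using v by (simp add: real_sqrt_mult[symmetric])
    moreover have "exp (a\<^sup>2 / (4 * v)) * exp (- v * s\<^sup>2 + a * s - a\<^sup>2 / (4 * v)) = exp (- v * s\<^sup>2 + a * s)" for s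
      unfolding exp_add[symmetric] by simp
    ultimately have "sqrt (pi / v) * exp (a\<^sup>2 / (4 * v)) * normal_density (a / (2 * v)) \<sigma> s = exp (- v * s\<^sup>2 + a * s)" for s
      unfolding nd by (simp add: mult.assoc mult.left_commute)
    then show "AE s in lborel. norm (exp (- of_real (v * s\<^sup>2) + of_real s * \<beta>)) \<le>
        norm (sqrt (pi / v) * exp (a\<^sup>2 / (4 * v)) * normal_density (a / (2 * v)) \<sigma> s)"
      unfolding norm_exp_eq_Re by (simp add: a_def mult.commute)
  qed simp
qed

text \<open>The law of the real part, and of the imaginary part, of CN(0,1): each carries half of
  the unit variance.\<close>

definition half_normal :: "real measure" where
  "half_normal = density lborel (normal_density 0 (1 / sqrt 2))"

lemma half_normal_density: "normal_density 0 (1 / sqrt 2) s = exp (- s\<^sup>2) / sqrt pi"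
  by (simp add: normal_density_def power_divide)

interpretation half_normal: prob_space half_normal
  unfolding half_normal_def by (rule prob_space_normal_density) simp

lemma sets_half_normal[measurable_cong, simp]: "sets half_normal = sets borel"
  by (simp add: half_normal_def)

text \<open>Only 1 + c has to be positive, since the density of the law itself supplies decay.
  Negative c occurs in the coherent bound, where the reference law has a larger variance than the
  noise.\<close>

lemma half_normal_exp:
  assumes v: "0 < 1 + (c::real)"
  shows "(\<integral>s. exp (- of_real (c * s\<^sup>2) + of_real s * \<beta>) \<partial>half_normal)
          = of_real (1 / sqrt (1 + c)) * exp (\<beta>\<^sup>2 / of_real (4 * (1 + c)))" (is ?A)
    and "integrable half_normal (\<lambda>s. exp (- of_real (c * s\<^sup>2) + of_real s * (\<beta>::complex)))" (is ?B)
proof -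
  have e: "normal_density 0 (1 / sqrt 2) s *\<^sub>R exp (- of_real (c * s\<^sup>2) + of_real s * \<beta>)
     = of_real (1 / sqrt pi) * exp (- of_real ((1 + c) * s\<^sup>2) + of_real s * \<beta>)" for s
  proof -
    have "exp (- of_real ((1 + c) * s\<^sup>2) + of_real s * \<beta>) =
      of_real (exp (- s\<^sup>2)) * exp (- of_real (c * s\<^sup>2) + of_real s * \<beta>)"
      unfolding exp_of_real[symmetric] exp_add[symmetric] by (simp add: algebra_simps)
    then show ?thesis
      by (simp add: half_normal_density scaleR_conv_of_real)
  qed
  show ?A
    unfolding half_normal_def
  proof (subst integral_density)
    have "(\<integral>s. normal_density 0 (1 / sqrt 2) s *\<^sub>R exp (- of_real (c * s\<^sup>2) + of_real s * \<beta>) \<partial>lborel)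
       = of_real (1 / sqrt pi * sqrt (pi / (1 + c))) * exp (\<beta>\<^sup>2 / of_real (4 * (1 + c)))"
      unfolding e by (simp only: integral_mult_right_zero integral_gaussian_complex_linear[OF v]) simp
    then show "(\<integral>s. normal_density 0 (1 / sqrt 2) s *\<^sub>R exp (- of_real (c * s\<^sup>2) + of_real s * \<beta>) \<partial>lborel)
       = of_real (1 / sqrt (1 + c)) * exp (\<beta>\<^sup>2 / of_real (4 * (1 + c)))"
      by (simp add: real_sqrt_divide)
  qed auto
  show ?B
    unfolding half_normal_def
  proof (subst integrable_density)
    show "integrable lborel (\<lambda>s. normal_density 0 (1 / sqrt 2) s *\<^sub>R exp (- of_real (c * s\<^sup>2) + of_real s * \<beta>))"
      unfolding e by (intro integrable_mult_right integrable_gaussian_complex_linear[OF v])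
  qed auto
qed

lemma lborel_complex: "(lborel :: complex measure) = distr (lborel \<Otimes>\<^sub>M lborel) borel (\<lambda>(s, t). Complex s t)"
proof (rule lborel_eqI)
  have [measurable]: "(\<lambda>(s, t). Complex s t) \<in> borel_measurable (lborel \<Otimes>\<^sub>M lborel)"
    unfolding Complex_eq by measurable
  fix l u :: complex assume le: "\<And>b. b \<in> Basis \<Longrightarrow> l \<bullet> b \<le> u \<bullet> b"
  have le': "Re l \<le> Re u" "Im l \<le> Im u"
    using le[of 1] le[of \<i>] by (auto simp: Basis_complex_def)
  have "(\<lambda>(s, t). Complex s t) -` box l u \<inter> space (lborel \<Otimes>\<^sub>M lborel) = box (Re l) (Re u) \<times> box (Im l) (Im u)"
    by (auto simp: box_def Basis_complex_def space_pair_measure)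
  then show "emeasure (distr (lborel \<Otimes>\<^sub>M lborel) borel (\<lambda>(s, t). Complex s t)) (box l u) = (\<Prod>b\<in>Basis. (u - l) \<bullet> b)"
    using le' by (subst emeasure_distr)
      (auto simp: lborel.emeasure_pair_measure_Times Basis_complex_def ennreal_mult)
qed simp

lemma std_complex_normal_eq:
  "std_complex_normal = distr (half_normal \<Otimes>\<^sub>M half_normal) borel (\<lambda>(s, t). Complex s t)"
proof -
  have [measurable]: "(\<lambda>(s, t). Complex s t) \<in> borel_measurable (lborel \<Otimes>\<^sub>M lborel)"
    unfolding Complex_eq by measurable
  have "std_complex_normal = density (distr (lborel \<Otimes>\<^sub>M lborel) borel (\<lambda>(s, t). Complex s t))
       (\<lambda>z. ennreal (exp (- (cmod z)\<^sup>2) / pi))"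
    unfolding std_complex_normal_def lborel_complex ..
  also have "\<dots> = distr (density (lborel \<Otimes>\<^sub>M lborel) (\<lambda>x. ennreal (exp (- (cmod (case x of (s, t) \<Rightarrow> Complex s t))\<^sup>2) / pi)))
     borel (\<lambda>(s, t). Complex s t)"
    by (subst density_distr) (auto simp: split_beta')
  also have "density (lborel \<Otimes>\<^sub>M lborel) (\<lambda>x. ennreal (exp (- (cmod (case x of (s, t) \<Rightarrow> Complex s t))\<^sup>2) / pi))
     = density (lborel \<Otimes>\<^sub>M lborel) (\<lambda>(s, t). ennreal (normal_density 0 (1 / sqrt 2) s) * ennreal (normal_density 0 (1 / sqrt 2) t))"
    by (intro density_cong AE_I2)
       (auto simp: half_normal_density cmod_power2 ennreal_mult'[symmetric] exp_minus exp_add exp_diff field_simps)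
  also have "\<dots> = half_normal \<Otimes>\<^sub>M half_normal"
    unfolding half_normal_def
    by (subst pair_measure_density)
       (auto intro!: half_normal.sigma_finite_measure_axioms[unfolded half_normal_def] sigma_finite_lborel)
  finally show ?thesis .
qed

interpretation std_complex_normal: prob_space std_complex_normal
proof -
  interpret pair_prob_space half_normal half_normal ..
  have "(\<lambda>(s, t). Complex s t) \<in> borel_measurable (half_normal \<Otimes>\<^sub>M half_normal)"
    unfolding Complex_eq by measurable
  then show "prob_space std_complex_normal"
    unfolding std_complex_normal_eq by (rule prob_space_distr)
qed

lemma sets_std_complex_normal[measurable_cong, simp]: "sets std_complex_normal = sets borel"
  by (simp add: std_complex_normal_def)

lemma space_std_complex_normal[simp]: "space std_complex_normal = UNIV"
  by (simp add: std_complex_normal_def)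

lemma std_complex_normal_fubini:
  fixes f g :: "real \<Rightarrow> complex"
  assumes f: "integrable half_normal f" and g: "integrable half_normal g"
  shows "(\<integral>z. f (Re z) * g (Im z) \<partial>std_complex_normal) = (\<integral>s. f s \<partial>half_normal) * (\<integral>s. g s \<partial>half_normal)"
    and "integrable std_complex_normal (\<lambda>z. f (Re z) * g (Im z))"
proof -
  interpret pair_prob_space half_normal half_normal ..
  have [measurable]: "f \<in> borel_measurable borel" "g \<in> borel_measurable borel"
    using f g by (auto dest!: borel_measurable_integrable)
  have m[measurable]: "(\<lambda>(s, t). Complex s t) \<in> borel_measurable (half_normal \<Otimes>\<^sub>M half_normal)"
    unfolding Complex_eq by measurable
  have i: "integrable (half_normal \<Otimes>\<^sub>M half_normal) (\<lambda>x. f (fst x) * g (snd x))"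
  proof (rule Fubini_integrable)
    show "integrable half_normal (\<lambda>x. \<integral>y. norm (f (fst (x, y)) * g (snd (x, y))) \<partial>half_normal)"
      using f by (simp add: norm_mult)
  qed (use g in \<open>simp_all add: split_beta'\<close>)
  then show "integrable std_complex_normal (\<lambda>z. f (Re z) * g (Im z))"
    unfolding std_complex_normal_eq by (subst integrable_distr_eq) (auto simp: split_beta')
  show "(\<integral>z. f (Re z) * g (Im z) \<partial>std_complex_normal) = (\<integral>s. f s \<partial>half_normal) * (\<integral>s. g s \<partial>half_normal)"
    unfolding std_complex_normal_eq using integral_fst'[OF i]
    by (subst integral_distr) (auto simp: split_beta')
qed

lemma std_complex_normal_exp:
  fixes \<beta> \<gamma> :: complex
  assumes v: "0 < 1 + c"
  shows "(\<integral>z. exp (- of_real (c * (cmod z)\<^sup>2) + of_real (Re z) * \<beta> + of_real (Im z) * \<gamma>) \<partial>std_complex_normal)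
       = of_real (1 / (1 + c)) * exp ((\<beta>\<^sup>2 + \<gamma>\<^sup>2) / of_real (4 * (1 + c)))" (is ?A)
    and "integrable std_complex_normal (\<lambda>z. exp (- of_real (c * (cmod z)\<^sup>2) + of_real (Re z) * \<beta> + of_real (Im z) * \<gamma>))" (is ?B)
proof -
  have e: "exp (- of_real (c * (cmod z)\<^sup>2) + of_real (Re z) * \<beta> + of_real (Im z) * \<gamma>) =
     exp (- of_real (c * (Re z)\<^sup>2) + of_real (Re z) * \<beta>) * exp (- of_real (c * (Im z)\<^sup>2) + of_real (Im z) * \<gamma>)" for z
    unfolding exp_add[symmetric] by (simp add: cmod_power2 algebra_simps)
  have "of_real (1 / sqrt (1 + c)) * exp (\<beta>\<^sup>2 / of_real (4 * (1 + c))) * (of_real (1 / sqrt (1 + c)) * exp (\<gamma>\<^sup>2 / of_real (4 * (1 + c))))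
     = of_real ((1 / sqrt (1 + c)) * (1 / sqrt (1 + c))) * exp ((\<beta>\<^sup>2 + \<gamma>\<^sup>2) / of_real (4 * (1 + c)))"
    by (simp only: exp_add add_divide_distrib of_real_mult mult_ac)
  also have "(1 / sqrt (1 + c)) * (1 / sqrt (1 + c)) = 1 / (1 + c)"
    using v by simp
  finally show ?A
    unfolding e by (subst std_complex_normal_fubini) (auto intro: half_normal_exp[OF v] simp only: half_normal_exp[OF v])
  show ?B
    unfolding e by (intro std_complex_normal_fubini half_normal_exp v)
qed

section \<open>Moments, translates and Fourier transform of CN(0,1)\<close>

lemma half_normal_moments:
  "integrable half_normal (\<lambda>s. s)" "integrable half_normal (\<lambda>s. s\<^sup>2)"
  "(\<integral>s. s \<partial>half_normal) = 0" "(\<integral>s. s\<^sup>2 \<partial>half_normal) = 1 / 2"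
proof -
  have p: "0 < 1 / sqrt (2::real)" by simp
  show "integrable half_normal (\<lambda>s. s)" "integrable half_normal (\<lambda>s. s\<^sup>2)"
    using integrable_normal_moment[OF p, of 0 1] integrable_normal_moment[OF p, of 0 2]
    by (auto simp: half_normal_def integrable_density)
  show "(\<integral>s. s \<partial>half_normal) = 0"
    using integral_normal_moment_nz_1[OF p, of 0]
    by (auto simp: half_normal_def integral_density)
  show "(\<integral>s. s\<^sup>2 \<partial>half_normal) = 1 / 2"
    using integral_normal_moment_even[OF p, of 0 1]
    by (auto simp: half_normal_def integral_density power_divide)
qed

lemma std_complex_normal_moments:
  "integrable std_complex_normal (\<lambda>z. z)" "(\<integral>z. z \<partial>std_complex_normal) = 0"
  "integrable std_complex_normal (\<lambda>z. (cmod z)\<^sup>2)" "(\<integral>z. (cmod z)\<^sup>2 \<partial>std_complex_normal) = 1"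
proof -
  have r: "integrable half_normal (\<lambda>s. of_real s :: complex)" "integrable half_normal (\<lambda>s. of_real (s\<^sup>2) :: complex)"
    "integrable half_normal (\<lambda>s. 1 :: complex)"
    using half_normal_moments by (auto simp del: of_real_power)
  have i: "(\<integral>s. of_real s \<partial>half_normal) = (0::complex)" "(\<integral>s. of_real (s\<^sup>2) \<partial>half_normal) = (1/2::complex)"
    "(\<integral>s. 1 \<partial>half_normal) = (1::complex)"
    using half_normal_moments(3,4) by (simp_all only: integral_complex_of_real) (simp_all add: half_normal.prob_space)
  note f1 = std_complex_normal_fubini[OF r(1) r(3)] and f2 = std_complex_normal_fubini[OF r(3) r(1)]
   and f3 = std_complex_normal_fubini[OF r(2) r(3)] and f4 = std_complex_normal_fubini[OF r(3) r(2)]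
  have e: "z = of_real (Re z) * 1 + \<i> * (1 * of_real (Im z))" for z
    by (simp add: complex_eq_iff)
  have e2: "complex_of_real ((cmod z)\<^sup>2) = of_real ((Re z)\<^sup>2) * 1 + 1 * of_real ((Im z)\<^sup>2)" for z
    by (simp add: cmod_power2)
  show "integrable std_complex_normal (\<lambda>z. z)"
    by (subst e) (intro Bochner_Integration.integrable_add integrable_mult_right f1 f2)
  show "(\<integral>z. z \<partial>std_complex_normal) = 0"
    by (subst e, subst Bochner_Integration.integral_add) (use f1 f2 i in auto)
  have "integrable std_complex_normal (\<lambda>z. complex_of_real ((cmod z)\<^sup>2))"
    unfolding e2 by (intro Bochner_Integration.integrable_add f3 f4)
  then show *: "integrable std_complex_normal (\<lambda>z. (cmod z)\<^sup>2)"
    using integrable_Re by fastforce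
  have "(\<integral>z. complex_of_real ((cmod z)\<^sup>2) \<partial>std_complex_normal) = 1"
    unfolding e2 Bochner_Integration.integral_add[OF f3(2) f4(2)] f3(1) f4(1) i by simp
  then have "complex_of_real (\<integral>z. (cmod z)\<^sup>2 \<partial>std_complex_normal) = 1"
    by (subst integral_complex_of_real[symmetric]) simp
  then show "(\<integral>z. (cmod z)\<^sup>2 \<partial>std_complex_normal) = 1"
    by (simp only: of_real_eq_1_iff)
qed

lemma cmod_diff_power2: "(cmod (z - s))\<^sup>2 = (cmod z)\<^sup>2 - 2 * Re (cnj s * z) + (cmod s)\<^sup>2"
  unfolding cmod_power2 by (simp add: power2_eq_square algebra_simps)

text \<open>The Cameron-Martin formula in one complex dimension: the quotient of two Gaussian
  densities of equal variance has an exponent that is affine in z. Over a product space this yields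
  the likelihood of the output given input and channel.\<close>

lemma std_complex_normal_shift:
  "distr std_complex_normal std_complex_normal (\<lambda>z. s + z)
     = density std_complex_normal (\<lambda>z. ennreal (exp (2 * Re (cnj s * z) - (cmod s)\<^sup>2)))"
proof -
  have "density std_complex_normal (\<lambda>z. ennreal (exp (2 * Re (cnj s * z) - (cmod s)\<^sup>2)))
    = density lborel (\<lambda>z. ennreal (exp (- (cmod z)\<^sup>2) / pi) * ennreal (exp (2 * Re (cnj s * z) - (cmod s)\<^sup>2)))"
    unfolding std_complex_normal_def by (rule density_density_eq) auto
  also have "\<dots> = density lborel (\<lambda>z. ennreal (exp (- (cmod (z - s))\<^sup>2) / pi))"
    by (intro density_cong AE_I2)
       (auto simp: cmod_diff_power2 ennreal_mult'[symmetric] mult_exp_exp algebra_simps simp del: complex_cnj_mult)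
  also have "\<dots> = density (distr lborel borel ((+) s)) (\<lambda>z. ennreal (exp (- (cmod (z - s))\<^sup>2) / pi))"
    by (simp add: lborel_distr_plus)
  also have "\<dots> = distr (density lborel (\<lambda>z. ennreal (exp (- (cmod (s + z - s))\<^sup>2) / pi))) borel ((+) s)"
    by (subst density_distr) auto
  also have "\<dots> = distr std_complex_normal std_complex_normal (\<lambda>z. s + z)"
    unfolding std_complex_normal_def by (intro distr_cong) auto
  finally show ?thesis ..
qed

text \<open>The Gaussian integral in the shape that one noisy observation produces: c is the
  variance of the observed coordinate, \<kappa> its covariance with the test functional, w the
  innovation. The result displays the innovation variance v = 1 + c.\<close>

lemma std_complex_normal_exp_linear:
  assumes c: "0 \<le> c"
  defines "v \<equiv> 1 + c"
  shows "(\<integral>z. exp (of_real (- (c * (cmod z)\<^sup>2) + Re (z * \<kappa>)) + \<i> * of_real (2 * Re (z * w))) \<partial>std_complex_normal)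
       = exp (of_real (- ln v - (cmod w)\<^sup>2 / v + (cmod \<kappa>)\<^sup>2 / (4 * v)) + \<i> * of_real (Re (cnj \<kappa> * w) / v))"
proof -
  define \<beta> \<gamma> where "\<beta> = of_real (Re \<kappa>) + \<i> * of_real (2 * Re w)"
    and "\<gamma> = - of_real (Im \<kappa>) - \<i> * of_real (2 * Im w)"
  have v: "0 < v" using c by (simp add: v_def)
  have e: "of_real (- (c * (cmod z)\<^sup>2) + Re (z * \<kappa>)) + \<i> * of_real (2 * Re (z * w))
     = - of_real (c * (cmod z)\<^sup>2) + of_real (Re z) * \<beta> + of_real (Im z) * \<gamma>" for z
    by (simp add: \<beta>_def \<gamma>_def complex_eq_iff algebra_simps)
  have b: "(\<beta>\<^sup>2 + \<gamma>\<^sup>2) / of_real (4 * v) = of_real (- (cmod w)\<^sup>2 / v + (cmod \<kappa>)\<^sup>2 / (4 * v)) + \<i> * of_real (Re (cnj \<kappa> * w) / v)"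
    using v unfolding \<beta>_def \<gamma>_def cmod_power2 by (simp add: complex_eq_iff power2_eq_square field_simps)
  have "exp (of_real (- ln v - (cmod w)\<^sup>2 / v + (cmod \<kappa>)\<^sup>2 / (4 * v)) + \<i> * of_real (Re (cnj \<kappa> * w) / v))
    = exp (of_real (- ln v)) * exp ((\<beta>\<^sup>2 + \<gamma>\<^sup>2) / of_real (4 * v))"
    unfolding b exp_add[symmetric] by (rule arg_cong[where f=exp]) (simp add: algebra_simps)
  also have "exp (of_real (- ln v)) = complex_of_real (1 / v)"
    using v unfolding exp_of_real by (simp add: exp_minus field_simps)
  finally show ?thesis
    unfolding e using std_complex_normal_exp(1)[of c \<beta> \<gamma>] c by (simp add: v_def)
qed

text \<open>Read from right to left, this turns the quadratic exponent of a noise density into an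
  average of exponents that are linear in w, which a characteristic function can absorb.\<close>

lemma std_complex_normal_fourier:
  "(\<integral>z. exp (\<i> * of_real (2 * Re (z * w))) \<partial>std_complex_normal) = exp (of_real (- (cmod w)\<^sup>2))"
  using std_complex_normal_exp_linear[of 0 0 w] by simp

text \<open>If C k l = E[Z_k cnj(Z_l)], this is the variance of the combination of the centred Z_k
  with coefficients a, which is why the first coefficient stays unconjugated.\<close>

definition hform :: "nat \<Rightarrow> (nat \<Rightarrow> nat \<Rightarrow> complex) \<Rightarrow> (nat \<Rightarrow> complex) \<Rightarrow> complex" where
  "hform d C a = (\<Sum>k<d. \<Sum>l<d. a k * cnj (a l) * C k l)"

lemma hform_shift:
  assumes i: "i < d" and herm: "\<And>k l. k < d \<Longrightarrow> l < d \<Longrightarrow> C l k = cnj (C k l)"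
  shows "Re (hform d C (\<lambda>k. a k - (if k = i then \<zeta> else 0)))
     = Re (hform d C a) - 2 * Re (\<zeta> * (\<Sum>l<d. cnj (a l) * C i l)) + (cmod \<zeta>)\<^sup>2 * Re (C i i)"
proof -
  let ?b = "\<lambda>k. if k = i then \<zeta> else 0"
  have 1: "(\<Sum>k<d. \<Sum>l<d. ?b k * cnj (a l) * C k l) = \<zeta> * (\<Sum>l<d. cnj (a l) * C i l)"
  proof -
    have "(\<Sum>k<d. \<Sum>l<d. ?b k * cnj (a l) * C k l) = (\<Sum>k<d. if k = i then \<zeta> * (\<Sum>l<d. cnj (a l) * C i l) else 0)"
      by (intro sum.cong refl) (auto simp: sum_distrib_left mult.assoc)
    then show ?thesis using i by simp
  qed
  have 2: "(\<Sum>k<d. \<Sum>l<d. a k * cnj (?b l) * C k l) = cnj (\<zeta> * (\<Sum>l<d. cnj (a l) * C i l))"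
  proof -
    have "(\<Sum>l<d. a k * cnj (?b l) * C k l) = a k * cnj \<zeta> * C k i" for k
    proof -
      have "(\<Sum>l<d. a k * cnj (?b l) * C k l) = (\<Sum>l<d. if l = i then a k * cnj \<zeta> * C k i else 0)"
        by (intro sum.cong) auto
      then show ?thesis using i by simp
    qed
    then have "(\<Sum>k<d. \<Sum>l<d. a k * cnj (?b l) * C k l) = (\<Sum>k<d. a k * cnj \<zeta> * C k i)" by simp
    also have "\<dots> = (\<Sum>k<d. cnj (\<zeta> * (cnj (a k) * C i k)))"
      by (intro sum.cong refl) (use herm[OF i] in \<open>auto simp: mult_ac\<close>)
    finally show ?thesis by (simp add: sum_distrib_left)
  qed
  have 3: "(\<Sum>k<d. \<Sum>l<d. ?b k * cnj (?b l) * C k l) = \<zeta> * cnj \<zeta> * C i i"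
  proof -
    have "(\<Sum>l<d. ?b k * cnj (?b l) * C k l) = (\<Sum>l<d. if l = i then ?b k * cnj \<zeta> * C k i else 0)" for k
      by (intro sum.cong) auto
    then have "(\<Sum>l<d. ?b k * cnj (?b l) * C k l) = (if k = i then \<zeta> * cnj \<zeta> * C i i else 0)" for k
      using i by simp
    then show ?thesis using i by simp
  qed
  have "hform d C (\<lambda>k. a k - ?b k) = hform d C a - (\<Sum>k<d. \<Sum>l<d. ?b k * cnj (a l) * C k l)
     - (\<Sum>k<d. \<Sum>l<d. a k * cnj (?b l) * C k l) + (\<Sum>k<d. \<Sum>l<d. ?b k * cnj (?b l) * C k l)"
    unfolding hform_def sum_subtractf[symmetric] sum.distrib[symmetric]
    by (intro sum.cong refl) (simp add: algebra_simps)
  moreover define q where "q = (\<Sum>l<d. cnj (a l) * C i l)"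
  ultimately have "hform d C (\<lambda>k. a k - ?b k) = hform d C a - \<zeta> * q - cnj (\<zeta> * q) + \<zeta> * cnj \<zeta> * C i i"
    unfolding 1 2 3 by simp
  then show ?thesis
    unfolding q_def[symmetric] by (simp add: complex_mult_cnj cmod_power2)
qed

text \<open>Subtracting \<open>C k i * C i l / v\<close> is the covariance update on observing
  coordinate i in noise, with v the variance of the observation. On the form it removes the squared
  modulus of a single linear functional.\<close>

lemma hform_rank_one:
  assumes i: "i < d" and herm: "\<And>k l. k < d \<Longrightarrow> l < d \<Longrightarrow> C l k = cnj (C k l)"
  shows "hform d (\<lambda>k l. C k l - C k i * C i l / of_real v) a
     = hform d C a - of_real ((cmod (\<Sum>l<d. cnj (a l) * C i l))\<^sup>2 / v)"
proof -
  have "(\<Sum>k<d. a k * C k i) = cnj (\<Sum>l<d. cnj (a l) * C i l)"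
    using herm[OF i] by (auto intro!: sum.cong)
  then have "of_real ((cmod (\<Sum>l<d. cnj (a l) * C i l))\<^sup>2) = (\<Sum>k<d. a k * C k i) * (\<Sum>l<d. cnj (a l) * C i l)"
    by (simp only: complex_norm_square mult.commute)
  also have "\<dots> = (\<Sum>k<d. \<Sum>l<d. a k * C k i * (cnj (a l) * C i l))"
    by (rule sum_product)
  finally have "of_real ((cmod (\<Sum>l<d. cnj (a l) * C i l))\<^sup>2 / v) = (\<Sum>k<d. \<Sum>l<d. a k * C k i * (cnj (a l) * C i l)) / of_real v"
    by (simp only: of_real_divide)
  then show ?thesis
    unfolding hform_def sum_divide_distrib
    by (simp add: sum_subtractf[symmetric] algebra_simps)
qed

section \<open>Innovations of noisy Gaussian observations\<close>

lemma exp_of_real_imag_mult: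
  "exp (of_real a + \<i> * of_real b) * exp (\<i> * of_real e) = exp (of_real a + \<i> * of_real (b + e))"
  "exp (of_real a + \<i> * of_real b) * exp (of_real c + \<i> * of_real e) = exp (of_real (a + c) + \<i> * of_real (b + e))"
  "exp (of_real a + \<i> * of_real b) * exp (of_real c) = exp (of_real (a + c) + \<i> * of_real b)"
  unfolding exp_add[symmetric] by (simp_all add: algebra_simps)

lemma exp_of_real_imag_cong:
  "a = a' \<Longrightarrow> b = b' \<Longrightarrow> exp (of_real a + \<i> * of_real b) = exp (of_real a' + \<i> * of_real b')"
  by simp

text \<open>One Kalman step for an unnormalised posterior. The assumption on characteristic
  functions weighted by exp(E) says that Z is Gaussian with mean m, covariance C and total mass
  exp(K); a noisy observation of coordinate i multiplies the weight by exp(-|y - Z_i|^2). Written as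
  an average over \<zeta> of oscillating exponentials, this factor only shifts the i-th coefficient
  of the characteristic function by 2\<zeta>, and what remains is a Gaussian integral over \<zeta>.
  Degenerate covariances need no separate case.\<close>

lemma (in prob_space) gaussian_observation_step:
  fixes Z :: "nat \<Rightarrow> 'a \<Rightarrow> complex" and E :: "'a \<Rightarrow> real" and y :: complex
  assumes Z[measurable]: "\<And>k. k < d \<Longrightarrow> Z k \<in> borel_measurable M"
    and E[measurable]: "E \<in> borel_measurable M" and E_nonpos: "\<And>\<omega>. E \<omega> \<le> 0"
    and herm: "\<And>k l. k < d \<Longrightarrow> l < d \<Longrightarrow> C l k = cnj (C k l)"
    and char: "\<And>a. (\<integral>\<omega>. exp (of_real (E \<omega>) + \<i> * of_real (Re (\<Sum>k<d. a k * Z k \<omega>))) \<partial>M)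
        = exp (of_real (K - Re (hform d C a) / 4) + \<i> * of_real (Re (\<Sum>k<d. a k * m k)))"
    and i: "i < d"
  defines "v \<equiv> 1 + Re (C i i)" and "w \<equiv> y - m i"
  shows "0 < v"
    and "(\<integral>\<omega>. exp (of_real (E \<omega> - (cmod (y - Z i \<omega>))\<^sup>2) + \<i> * of_real (Re (\<Sum>k<d. a k * Z k \<omega>))) \<partial>M)
        = exp (of_real (K - ln v - (cmod w)\<^sup>2 / v - Re (hform d (\<lambda>k l. C k l - C k i * C i l / of_real v) a) / 4)
            + \<i> * of_real (Re (\<Sum>k<d. a k * (m k + C k i / of_real v * w))))"
proof -
  \<comment> \<open>Nonnegativity of the variance is extracted from the characteristic function: its
    modulus cannot exceed the mass exp(K), its value at 0, and at a unit vector the modulus is exp(K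
    - C_ii/4).\<close>
  have c: "0 \<le> Re (C i i)"
  proof -
    define b where "b k = (0::complex) - (if k = i then 1 else 0)" for k
    have "Re (hform d C b) = Re (C i i)"
      unfolding b_def using hform_shift[where a="\<lambda>_. 0" and \<zeta>=1 and C=C and d=d and i=i, OF i herm] by (simp add: hform_def)
    moreover have "norm (\<integral>\<omega>. exp (of_real (E \<omega>) + \<i> * of_real (Re (\<Sum>k<d. b k * Z k \<omega>))) \<partial>M) \<le> (\<integral>\<omega>. exp (E \<omega>) \<partial>M)"
      by (rule order_trans[OF integral_norm_bound]) (simp add: norm_exp_eq_Re)
    moreover have "complex_of_real (\<integral>\<omega>. exp (E \<omega>) \<partial>M) = of_real (exp K)"
      using char[of "\<lambda>_. 0"] by (simp add: hform_def exp_of_real flip: integral_complex_of_real)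
    then have "(\<integral>\<omega>. exp (E \<omega>) \<partial>M) = exp K"
      by (simp only: of_real_eq_iff)
    ultimately show ?thesis
      unfolding char[of b] by (simp add: norm_exp_eq_Re)
  qed
  then show "0 < v" by (simp add: v_def)
  define q where "q = (\<Sum>l<d. cnj (a l) * C i l)"
  interpret SP: pair_prob_space M std_complex_normal ..
  \<comment> \<open>Two readings of one integrand: with the shifted coefficients the integral over
    \<omega> is a known characteristic function, and in the form \<open>Fe\<close> the integral over
    \<zeta> restores the noise factor. Fubini applies since E \<le> 0 bounds the modulus by
    1.\<close>
  define F where "F \<omega> \<zeta> = exp (of_real (E \<omega>) + \<i> * of_real (Re (\<Sum>k<d. (a k - (if k = i then 2 * \<zeta> else 0)) * Z k \<omega>)))
      * exp (\<i> * of_real (2 * Re (\<zeta> * y)))" for \<omega> \<zeta>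
  have Fe: "F \<omega> \<zeta> = exp (of_real (E \<omega>) + \<i> * of_real (Re (\<Sum>k<d. a k * Z k \<omega>))) * exp (\<i> * of_real (2 * Re (\<zeta> * (y - Z i \<omega>))))" for \<omega> \<zeta>
  proof -
    have "(\<Sum>k<d. (a k - (if k = i then 2 * \<zeta> else 0)) * Z k \<omega>) = (\<Sum>k<d. a k * Z k \<omega>) - 2 * \<zeta> * Z i \<omega>"
    proof -
      have "(\<Sum>k<d. (a k - (if k = i then 2 * \<zeta> else 0)) * Z k \<omega>) = (\<Sum>k<d. a k * Z k \<omega> - (if k = i then 2 * \<zeta> * Z i \<omega> else 0))"
        by (intro sum.cong) (auto simp: algebra_simps)
      then show ?thesis using i by (simp add: sum_subtractf)
    qed
    then have "Re (\<Sum>k<d. (a k - (if k = i then 2 * \<zeta> else 0)) * Z k \<omega>) = Re (\<Sum>k<d. a k * Z k \<omega>) - Re (2 * \<zeta> * Z i \<omega>)"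
      by (simp only: minus_complex.simps)
    then show ?thesis
      unfolding F_def exp_of_real_imag_mult by (intro exp_of_real_imag_cong) (simp_all add: algebra_simps del: Re_sum)
  qed
  have [measurable]: "(\<lambda>(\<omega>, \<zeta>). F \<omega> \<zeta>) \<in> borel_measurable (M \<Otimes>\<^sub>M std_complex_normal)"
    unfolding Fe using i by measurable
  have Fb: "norm (F \<omega> \<zeta>) \<le> 1" for \<omega> \<zeta>
    unfolding F_def norm_mult norm_exp_eq_Re using E_nonpos[of \<omega>] by simp
  have Fi: "integrable (M \<Otimes>\<^sub>M std_complex_normal) (\<lambda>(\<omega>, \<zeta>). F \<omega> \<zeta>)"
    by (rule SP.P.integrable_const_bound[where B=1]) (use Fb in auto)
  have "(\<integral>\<omega>. exp (of_real (E \<omega> - (cmod (y - Z i \<omega>))\<^sup>2) + \<i> * of_real (Re (\<Sum>k<d. a k * Z k \<omega>))) \<partial>M)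
      = (\<integral>\<omega>. (\<integral>\<zeta>. F \<omega> \<zeta> \<partial>std_complex_normal) \<partial>M)"
  proof (intro Bochner_Integration.integral_cong refl)
    fix \<omega>
    have "(\<integral>\<zeta>. F \<omega> \<zeta> \<partial>std_complex_normal) = exp (of_real (E \<omega>) + \<i> * of_real (Re (\<Sum>k<d. a k * Z k \<omega>))) * exp (of_real (- (cmod (y - Z i \<omega>))\<^sup>2))"
      unfolding Fe integral_mult_right_zero std_complex_normal_fourier ..
    also have "\<dots> = exp (of_real (E \<omega> - (cmod (y - Z i \<omega>))\<^sup>2) + \<i> * of_real (Re (\<Sum>k<d. a k * Z k \<omega>)))"
      unfolding exp_of_real_imag_mult by simp
    finally show "exp (of_real (E \<omega> - (cmod (y - Z i \<omega>))\<^sup>2) + \<i> * of_real (Re (\<Sum>k<d. a k * Z k \<omega>))) = (\<integral>\<zeta>. F \<omega> \<zeta> \<partial>std_complex_normal)" ..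
  qed
  also have "\<dots> = (\<integral>\<zeta>. (\<integral>\<omega>. F \<omega> \<zeta> \<partial>M) \<partial>std_complex_normal)"
    by (rule SP.Fubini_integral[OF Fi, symmetric])
  also have "\<dots> = (\<integral>\<zeta>. exp (of_real (K - Re (hform d C a) / 4) + \<i> * of_real (Re (\<Sum>k<d. a k * m k)))
      * exp (of_real (- (Re (C i i) * (cmod \<zeta>)\<^sup>2) + Re (\<zeta> * q)) + \<i> * of_real (2 * Re (\<zeta> * w))) \<partial>std_complex_normal)"
  proof (intro Bochner_Integration.integral_cong refl)
    fix \<zeta>
    have h: "Re (hform d C (\<lambda>k. a k - (if k = i then 2 * \<zeta> else 0)))
       = Re (hform d C a) - 4 * Re (\<zeta> * q) + 4 * (cmod \<zeta>)\<^sup>2 * Re (C i i)"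
      using hform_shift[where a=a and \<zeta>="2 * \<zeta>" and C=C and d=d and i=i, OF i herm] by (simp add: q_def[symmetric] norm_mult mult.assoc power_mult_distrib)
    have s: "(\<Sum>k<d. (a k - (if k = i then 2 * \<zeta> else 0)) * m k) = (\<Sum>k<d. a k * m k) - 2 * \<zeta> * m i"
    proof -
      have "(\<Sum>k<d. (a k - (if k = i then 2 * \<zeta> else 0)) * m k) = (\<Sum>k<d. a k * m k - (if k = i then 2 * \<zeta> * m i else 0))"
        by (intro sum.cong) (auto simp: algebra_simps)
      then show ?thesis using i by (simp add: sum_subtractf)
    qed
    show "(\<integral>\<omega>. F \<omega> \<zeta> \<partial>M) = exp (of_real (K - Re (hform d C a) / 4) + \<i> * of_real (Re (\<Sum>k<d. a k * m k)))
      * exp (of_real (- (Re (C i i) * (cmod \<zeta>)\<^sup>2) + Re (\<zeta> * q)) + \<i> * of_real (2 * Re (\<zeta> * w)))"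
      unfolding F_def integral_mult_left_zero char h s
      unfolding exp_of_real_imag_mult minus_complex.simps w_def
      by (rule exp_of_real_imag_cong) (simp_all add: field_simps del: Re_sum)
  qed
  also have "\<dots> = exp (of_real (K - Re (hform d C a) / 4) + \<i> * of_real (Re (\<Sum>k<d. a k * m k)))
    * exp (of_real (- ln v - (cmod w)\<^sup>2 / v + (cmod q)\<^sup>2 / (4 * v)) + \<i> * of_real (Re (cnj q * w) / v))"
    unfolding integral_mult_right_zero std_complex_normal_exp_linear[OF c] v_def ..
  also have "\<dots> = exp (of_real (K - ln v - (cmod w)\<^sup>2 / v - Re (hform d (\<lambda>k l. C k l - C k i * C i l / of_real v) a) / 4)
            + \<i> * of_real (Re (\<Sum>k<d. a k * (m k + C k i / of_real v * w))))"
  proof -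
    have h: "Re (hform d (\<lambda>k l. C k l - C k i * C i l / of_real v) a) = Re (hform d C a) - (cmod q)\<^sup>2 / v"
      using arg_cong[where f=Re, OF hform_rank_one[OF i herm, where a=a and v=v]] by (simp add: q_def)
    have "cnj q = (\<Sum>k<d. a k * C k i)"
      unfolding q_def using herm[OF i] by (auto intro!: sum.cong)
    then have "(\<Sum>k<d. a k * (m k + C k i / of_real v * w)) = (\<Sum>k<d. a k * m k) + cnj q * w / of_real v"
      by (simp add: sum_distrib_left sum_distrib_right sum_divide_distrib sum.distrib distrib_left mult_ac)
    then have "Re (\<Sum>k<d. a k * (m k + C k i / of_real v * w)) = Re (\<Sum>k<d. a k * m k) + Re (cnj q * w) / v"
      by (simp only: plus_complex.simps Re_divide_of_real)
    then show ?thesis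
      unfolding h exp_of_real_imag_mult by (intro exp_of_real_imag_cong) (simp_all add: field_simps del: Re_sum times_complex.simps)
  qed
  finally show "(\<integral>\<omega>. exp (of_real (E \<omega> - (cmod (y - Z i \<omega>))\<^sup>2) + \<i> * of_real (Re (\<Sum>k<d. a k * Z k \<omega>))) \<partial>M) = \<dots>" .
qed

text \<open>Iterates the observation step. After i observations, \<open>v\<close> and
  \<open>b\<close> describe the innovations so far, \<open>B\<close> applied to y is the posterior
  mean of the coordinates and \<open>C'\<close> their posterior covariance. For Gaussian variables
  none of these depends on the observed values, so they are quantified before y.\<close>

lemma (in prob_space) gaussian_innovations:
  fixes Z :: "nat \<Rightarrow> 'a \<Rightarrow> complex"
  assumes Z[measurable]: "\<And>k. k < d \<Longrightarrow> Z k \<in> borel_measurable M"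
    and herm: "\<And>k l. k < d \<Longrightarrow> l < d \<Longrightarrow> C l k = cnj (C k l)"
    and char: "\<And>a. (\<integral>\<omega>. iexp (Re (\<Sum>k<d. a k * Z k \<omega>)) \<partial>M) = exp (of_real (- Re (hform d C a) / 4))"
    and i: "i \<le> d"
  shows "\<exists>v b B C'. (\<forall>j<i. 0 < (v j :: real)) \<and> (\<forall>k<d. \<forall>l<d. C' l k = cnj (C' k l)) \<and>
     (\<forall>y a. (\<integral>\<omega>. exp (of_real (- (\<Sum>j<i. (cmod (y j - Z j \<omega>))\<^sup>2)) + \<i> * of_real (Re (\<Sum>k<d. a k * Z k \<omega>))) \<partial>M)
        = exp (of_real (- (\<Sum>j<i. ln (v j) + (cmod (y j - (\<Sum>l<j. b j l * y l)))\<^sup>2 / v j) - Re (hform d C' a) / 4)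
           + \<i> * of_real (Re (\<Sum>k<d. a k * (\<Sum>j<i. B k j * y j)))))"
  using i
proof (induction i)
  case 0
  show ?case
  proof (rule exI, rule exI, rule exI[of _ "\<lambda>_ _. 0"], rule exI[of _ C], intro conjI allI impI)
    show "C l k = cnj (C k l)" if "k < d" "l < d" for k l
      using herm that by blast
  qed (use char in simp_all)
next
  case (Suc i)
  then have i: "i < d" by simp
  from Suc.IH[OF Suc_leD[OF Suc.prems]] obtain v :: "nat \<Rightarrow> real" and b B C' where v: "\<And>j. j < i \<Longrightarrow> 0 < v j" and herm': "\<And>k l. k < d \<Longrightarrow> l < d \<Longrightarrow> C' l k = cnj (C' k l)"
    and IH: "\<And>y a. (\<integral>\<omega>. exp (of_real (- (\<Sum>j<i. (cmod (y j - Z j \<omega>))\<^sup>2)) + \<i> * of_real (Re (\<Sum>k<d. a k * Z k \<omega>))) \<partial>M)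
        = exp (of_real (- (\<Sum>j<i. ln (v j) + (cmod (y j - (\<Sum>l<j. b j l * y l)))\<^sup>2 / v j) - Re (hform d C' a) / 4)
           + \<i> * of_real (Re (\<Sum>k<d. a k * (\<Sum>j<i. B k j * y j))))"
    apply (elim exE conjE)
    apply (rule that)
      prefer 3
      apply (drule spec, drule spec, assumption)
     apply blast
    apply blast
    done
  define vi where "vi = 1 + Re (C' i i)"
  have Em: "(\<lambda>\<omega>. - (\<Sum>j<i. (cmod (y j - Z j \<omega>))\<^sup>2)) \<in> borel_measurable M" for y
  proof (intro borel_measurable_uminus borel_measurable_sum)
    fix j assume "j \<in> {..<i}"
    then have [measurable]: "Z j \<in> borel_measurable M"
      using i by (intro Z) simp
    show "(\<lambda>\<omega>. (cmod (y j - Z j \<omega>))\<^sup>2) \<in> borel_measurable M"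
      by measurable
  qed
  \<comment> \<open>The posterior variance does not involve the observed values, so the observation
    step may be invoked at y = 0.\<close>
  have vi: "0 < vi"
    unfolding vi_def
  proof (rule gaussian_observation_step(1)[where Z=Z and d=d and i=i and C=C' and E="\<lambda>\<omega>. - (\<Sum>j<i. (cmod (0 - Z j \<omega>))\<^sup>2)"
      and K="- (\<Sum>j<i. ln (v j) + (cmod (0 - (\<Sum>l<j. b j l * 0)))\<^sup>2 / v j)" and m="\<lambda>k. \<Sum>j<i. B k j * 0"])
    show "Z k \<in> borel_measurable M" if "k < d" for k using Z that .
    show "C' l k = cnj (C' k l)" if "k < d" "l < d" for k l using herm' that .
    show "- (\<Sum>j<i. (cmod (0 - Z j \<omega>))\<^sup>2) \<le> 0" for \<omega> by (simp add: sum_nonneg)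
  qed (rule Em[of "\<lambda>_. 0"], rule IH[of "\<lambda>_. 0"], rule i)
  have st: "(\<integral>\<omega>. exp (of_real (- (\<Sum>j<i. (cmod (y j - Z j \<omega>))\<^sup>2) - (cmod (y i - Z i \<omega>))\<^sup>2) + \<i> * of_real (Re (\<Sum>k<d. a k * Z k \<omega>))) \<partial>M)
    = exp (of_real (- (\<Sum>j<i. ln (v j) + (cmod (y j - (\<Sum>l<j. b j l * y l)))\<^sup>2 / v j) - ln vi - (cmod (y i - (\<Sum>j<i. B i j * y j)))\<^sup>2 / vi
         - Re (hform d (\<lambda>k l. C' k l - C' k i * C' i l / of_real vi) a) / 4)
            + \<i> * of_real (Re (\<Sum>k<d. a k * ((\<Sum>j<i. B k j * y j) + C' k i / of_real vi * (y i - (\<Sum>j<i. B i j * y j))))))" for y a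
    unfolding vi_def
  proof (rule gaussian_observation_step(2)[where Z=Z and d=d and i=i and C=C' and E="\<lambda>\<omega>. - (\<Sum>j<i. (cmod (y j - Z j \<omega>))\<^sup>2)"
      and K="- (\<Sum>j<i. ln (v j) + (cmod (y j - (\<Sum>l<j. b j l * y l)))\<^sup>2 / v j)" and m="\<lambda>k. \<Sum>j<i. B k j * y j" and y="y i"])
    show "Z k \<in> borel_measurable M" if "k < d" for k using Z that .
    show "C' l k = cnj (C' k l)" if "k < d" "l < d" for k l using herm' that .
    show "- (\<Sum>j<i. (cmod (y j - Z j \<omega>))\<^sup>2) \<le> 0" for \<omega> by (simp add: sum_nonneg)
  qed (rule Em, rule IH, rule i)
  show ?case
  \<comment> \<open>The posterior mean of coordinate i is the predictor of its observation, so row i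
    of \<open>B\<close> becomes row i of \<open>b\<close>. The update of \<open>B\<close> adds the
    Kalman gain C'_ki / v_i times the innovation, that is y_i minus its prediction.\<close>
  proof (rule exI[of _ "v(i := vi)"], rule exI[of _ "b(i := B i)"],
      rule exI[of _ "\<lambda>k j. if j = i then C' k i / of_real vi else B k j - C' k i / of_real vi * B i j"],
      rule exI[of _ "\<lambda>k l. C' k l - C' k i * C' i l / of_real vi"], intro conjI allI impI)
    show "0 < (v(i := vi)) j" if "j < Suc i" for j
      using that v vi by auto
    show "C' l k - C' l i * C' i k / of_real vi = cnj (C' k l - C' k i * C' i l / of_real vi)" if "k < d" "l < d" for k l
    proof -
      have "C' l k = cnj (C' k l)" "C' l i = cnj (C' i l)" "C' i k = cnj (C' k i)"
        by (rule herm'; fact)+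
      then show ?thesis by (simp only: complex_cnj_diff complex_cnj_divide complex_cnj_mult complex_cnj_cnj complex_cnj_complex_of_real mult.commute)
    qed
    fix y a
    have s1: "(\<Sum>j<Suc i. ln ((v(i := vi)) j) + (cmod (y j - (\<Sum>l<j. (b(i := B i)) j l * y l)))\<^sup>2 / (v(i := vi)) j)
       = (\<Sum>j<i. ln (v j) + (cmod (y j - (\<Sum>l<j. b j l * y l)))\<^sup>2 / v j) + ln vi + (cmod (y i - (\<Sum>j<i. B i j * y j)))\<^sup>2 / vi"
      by simp
    have e1: "- (\<Sum>j<Suc i. (cmod (y j - Z j \<omega>))\<^sup>2) = - (\<Sum>j<i. (cmod (y j - Z j \<omega>))\<^sup>2) - (cmod (y i - Z i \<omega>))\<^sup>2" for \<omega>
      by simp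
    have s2: "(\<Sum>j<Suc i. (if j = i then C' k i / of_real vi else B k j - C' k i / of_real vi * B i j) * y j)
       = (\<Sum>j<i. B k j * y j) + C' k i / of_real vi * (y i - (\<Sum>j<i. B i j * y j))" for k
    proof -
      have "(\<Sum>j<i. (if j = i then C' k i / of_real vi else B k j - C' k i / of_real vi * B i j) * y j)
         = (\<Sum>j<i. B k j * y j - C' k i / of_real vi * (B i j * y j))"
        by (intro sum.cong) (auto simp: algebra_simps)
      then show ?thesis
        by (simp add: sum_subtractf sum_distrib_left right_diff_distrib)
    qed
    show "(\<integral>\<omega>. exp (of_real (- (\<Sum>j<Suc i. (cmod (y j - Z j \<omega>))\<^sup>2)) + \<i> * of_real (Re (\<Sum>k<d. a k * Z k \<omega>))) \<partial>M)
        = exp (of_real (- (\<Sum>j<Suc i. ln ((v(i := vi)) j) + (cmod (y j - (\<Sum>l<j. (b(i := B i)) j l * y l)))\<^sup>2 / (v(i := vi)) j)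
            - Re (hform d (\<lambda>k l. C' k l - C' k i * C' i l / of_real vi) a) / 4)
           + \<i> * of_real (Re (\<Sum>k<d. a k * (\<Sum>j<Suc i. (if j = i then C' k i / of_real vi else B k j - C' k i / of_real vi * B i j) * y j))))"
      unfolding s1 s2 e1 st by (rule exp_of_real_imag_cong) simp_all
  qed
qed

text \<open>At a = 0 the characteristic function is the total mass of the posterior. As a function
  of y it is, up to the normalising constant of the noise density, the density of Z plus noise,
  factored into innovations.\<close>

lemma (in prob_space) gaussian_likelihood:
  fixes Z :: "nat \<Rightarrow> 'a \<Rightarrow> complex"
  assumes Z[measurable]: "\<And>k. k < d \<Longrightarrow> Z k \<in> borel_measurable M"
    and herm: "\<And>k l. k < d \<Longrightarrow> l < d \<Longrightarrow> C l k = cnj (C k l)"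
    and char: "\<And>a. (\<integral>\<omega>. iexp (Re (\<Sum>k<d. a k * Z k \<omega>)) \<partial>M) = exp (of_real (- Re (hform d C a) / 4))"
  shows "\<exists>v b. (\<forall>j<d. 0 < (v j :: real)) \<and>
     (\<forall>y. (\<integral>\<omega>. exp (- (\<Sum>j<d. (cmod (y j - Z j \<omega>))\<^sup>2)) \<partial>M)
        = exp (- (\<Sum>j<d. ln (v j) + (cmod (y j - (\<Sum>l<j. b j l * y l)))\<^sup>2 / v j)))"
proof -
  obtain v b B C' where v: "\<forall>j<d. 0 < (v j :: real)"
    and f: "\<And>y a. (\<integral>\<omega>. exp (of_real (- (\<Sum>j<d. (cmod (y j - Z j \<omega>))\<^sup>2)) + \<i> * of_real (Re (\<Sum>k<d. a k * Z k \<omega>))) \<partial>M)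
        = exp (of_real (- (\<Sum>j<d. ln (v j) + (cmod (y j - (\<Sum>l<j. b j l * y l)))\<^sup>2 / v j) - Re (hform d C' a) / 4)
           + \<i> * of_real (Re (\<Sum>k<d. a k * (\<Sum>j<d. B k j * y j))))"
    apply (rule exE[OF gaussian_innovations[where i=d and Z=Z and C=C and d=d]])
        apply (rule Z, assumption)
       apply (rule herm, assumption+)
      apply (rule char)
     apply (rule order_refl)
    apply (elim exE conjE)
    apply (rule that, assumption)
    apply (drule spec, drule spec, assumption)
    done
  have "complex_of_real (\<integral>\<omega>. exp (- (\<Sum>j<d. (cmod (y j - Z j \<omega>))\<^sup>2)) \<partial>M)
        = of_real (exp (- (\<Sum>j<d. ln (v j) + (cmod (y j - (\<Sum>l<j. b j l * y l)))\<^sup>2 / v j)))" for y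
    using f[of y "\<lambda>_. 0"] unfolding integral_complex_of_real[symmetric] by (simp add: hform_def exp_of_real[symmetric])
  then show ?thesis
    using v unfolding of_real_eq_iff by blast
qed

text \<open>The one-dimensional case with the variance made explicit; it serves to compute the
  Laplace transform of the squared modulus of a channel coefficient.\<close>

lemma (in prob_space) gaussian_exp_norm_square:
  fixes Z :: "'a \<Rightarrow> complex"
  assumes Z[measurable]: "Z \<in> borel_measurable M" and c: "0 \<le> c"
    and char: "\<And>a. (\<integral>\<omega>. iexp (Re (a * Z \<omega>)) \<partial>M) = exp (of_real (- ((cmod a)\<^sup>2 * c) / 4))"
  shows "(\<integral>\<omega>. exp (- (cmod (y - Z \<omega>))\<^sup>2) \<partial>M) = exp (- ln (1 + c) - (cmod y)\<^sup>2 / (1 + c))"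
proof -
  have h: "hform (Suc 0) (\<lambda>_ _. of_real c) a = of_real ((cmod (a 0))\<^sup>2 * c)" for a
    by (simp add: hform_def complex_norm_square[symmetric])
  have ch: "(\<integral>\<omega>. exp (of_real 0 + \<i> * of_real (Re (\<Sum>k<Suc 0. a k * Z \<omega>))) \<partial>M)
      = exp (of_real (0 - Re (hform (Suc 0) (\<lambda>_ _. of_real c) a) / 4) + \<i> * of_real (Re (\<Sum>k<Suc 0. a k * 0)))" for a
    using char[of "a 0"] by (simp add: h)
  have "(\<integral>\<omega>. exp (of_real (0 - (cmod (y - Z \<omega>))\<^sup>2) + \<i> * of_real (Re (\<Sum>k<Suc 0. 0 * Z \<omega>))) \<partial>M)
    = exp (of_real (0 - ln (1 + Re (of_real c)) - (cmod (y - 0))\<^sup>2 / (1 + Re (of_real c)) - Re (hform (Suc 0) (\<lambda>k l. of_real c - of_real c * of_real c / of_real (1 + Re (of_real c))) (\<lambda>_. 0)) / 4)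
            + \<i> * of_real (Re (\<Sum>k<Suc 0. 0 * (0 + of_real c / of_real (1 + Re (of_real c)) * (y - 0)))))"
    by (rule gaussian_observation_step(2)[where Z="\<lambda>_. Z" and d="Suc 0" and i=0 and C="\<lambda>_ _. of_real c" and E="\<lambda>_. 0" and K=0 and m="\<lambda>_. 0" and a="\<lambda>_. 0"])
       (rule ch | simp)+
  then have "complex_of_real (\<integral>\<omega>. exp (- (cmod (y - Z \<omega>))\<^sup>2) \<partial>M) = of_real (exp (- ln (1 + c) - (cmod y)\<^sup>2 / (1 + c)))"
    unfolding integral_complex_of_real[symmetric] by (simp add: hform_def exp_of_real[symmetric])
  then show ?thesis by (simp only: of_real_eq_iff)
qed

section \<open>The noise law\<close>

text \<open>Gibbs' inequality, from ln f \<le> f - 1. Every information inequality below applies it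
  to a likelihood ratio whose mean is computed by a change of measure.\<close>

lemma (in prob_space) expectation_ln_nonpos:
  assumes [measurable]: "f \<in> borel_measurable M"
    and pos: "\<And>\<omega>. \<omega> \<in> space M \<Longrightarrow> 0 < f \<omega>"
    and le: "(\<integral>\<^sup>+\<omega>. ennreal (f \<omega>) \<partial>M) \<le> 1"
    and int: "integrable M (\<lambda>\<omega>. ln (f \<omega>))"
  shows "(\<integral>\<omega>. ln (f \<omega>) \<partial>M) \<le> 0"
proof -
  have f: "integrable M f"
    by (rule integrableI_nonneg) (use pos le in \<open>auto intro!: AE_I2 less_imp_le elim: le_less_trans\<close>)
  have "ennreal (\<integral>\<omega>. f \<omega> \<partial>M) \<le> 1"
    using le by (subst nn_integral_eq_integral[OF f, symmetric]) (auto intro!: AE_I2 less_imp_le pos)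
  then have "(\<integral>\<omega>. f \<omega> \<partial>M) \<le> 1"
    by (simp add: ennreal_le_iff flip: ennreal_1)
  moreover have "(\<integral>\<omega>. ln (f \<omega>) \<partial>M) \<le> (\<integral>\<omega>. f \<omega> - 1 \<partial>M)"
    using int f pos by (intro integral_mono) (auto intro!: ln_le_minus_one)
  ultimately show ?thesis
    using f by (simp add: prob_space)
qed

text \<open>A finite measure on a finite product is determined by rectangles, and on these both
  sides factor into one-dimensional terms. Applied first over subcarriers and then over times, it
  lifts the Cameron-Martin formula and the sign symmetry to the noise law.\<close>

lemma (in product_prob_space) distr_PiM_eq_density:
  assumes I: "finite I"
    and T[measurable]: "\<And>i. T i \<in> M i \<rightarrow>\<^sub>M M i"
    and d[measurable]: "\<And>i. d i \<in> borel_measurable (M i)"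
    and eq: "\<And>i. distr (M i) (M i) (T i) = density (M i) (d i)"
  shows "distr (PiM I M) (PiM I M) (\<lambda>w. \<lambda>i\<in>I. T i (w i)) = density (PiM I M) (\<lambda>w. \<Prod>i\<in>I. d i (w i))"
proof (rule measure_eqI_PiM_finite[OF I])
  interpret prob_space "PiM I M" by (rule prob_space_PiM) unfold_locales
  have [measurable]: "(\<lambda>w. \<lambda>i\<in>I. T i (w i)) \<in> PiM I M \<rightarrow>\<^sub>M PiM I M"
    by measurable
  fix A assume A[measurable]: "\<And>i. i \<in> I \<Longrightarrow> A i \<in> sets (M i)"
  have AI[measurable]: "Pi\<^sub>E I A \<in> sets (PiM I M)"
    using I A by (rule sets_PiM_I_finite)
  have "(\<lambda>w. \<lambda>i\<in>I. T i (w i)) -` Pi\<^sub>E I A \<inter> space (PiM I M) = (\<Pi>\<^sub>E i\<in>I. T i -` A i \<inter> space (M i))"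
    using T[THEN measurable_space] A[THEN sets.sets_into_space]
    by (auto simp: space_PiM PiE_iff Pi_iff extensional_def)
  then have "emeasure (distr (PiM I M) (PiM I M) (\<lambda>w. \<lambda>i\<in>I. T i (w i))) (Pi\<^sub>E I A)
     = emeasure (PiM I M) (\<Pi>\<^sub>E i\<in>I. T i -` A i \<inter> space (M i))"
    by (subst emeasure_distr) simp_all
  also have "\<dots> = (\<Prod>i\<in>I. emeasure (M i) (T i -` A i \<inter> space (M i)))"
    using I by (intro emeasure_PiM) auto
  also have "\<dots> = (\<Prod>i\<in>I. emeasure (distr (M i) (M i) (T i)) (A i))"
    by (intro prod.cong refl) (simp add: emeasure_distr)
  also have "\<dots> = (\<Prod>i\<in>I. \<integral>\<^sup>+x. d i x * indicator (A i) x \<partial>M i)"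
    by (intro prod.cong refl) (simp add: eq emeasure_density)
  also have "\<dots> = (\<integral>\<^sup>+w. (\<Prod>i\<in>I. d i (w i) * indicator (A i) (w i)) \<partial>PiM I M)"
    using I by (intro product_nn_integral_prod[symmetric]) auto
  also have "\<dots> = (\<integral>\<^sup>+w. (\<Prod>i\<in>I. d i (w i)) * indicator (Pi\<^sub>E I A) w \<partial>PiM I M)"
  proof (intro nn_integral_cong)
    fix w assume w: "w \<in> space (PiM I M)"
    have "(\<Prod>i\<in>I. indicator (A i) (w i)) = (indicator (Pi\<^sub>E I A) w :: ennreal)"
    proof (cases "w \<in> Pi\<^sub>E I A")
      case False
      then obtain i where "i \<in> I" "w i \<notin> A i"
        using w by (auto simp: space_PiM PiE_iff)
      then have "(\<Prod>i\<in>I. indicator (A i) (w i)) = (0::ennreal)"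
        using I by (intro prod_zero bexI[of _ i]) auto
      then show ?thesis using False by simp
    qed (auto simp: PiE_iff intro!: prod.neutral)
    then show "(\<Prod>i\<in>I. d i (w i) * indicator (A i) (w i)) = (\<Prod>i\<in>I. d i (w i)) * indicator (Pi\<^sub>E I A) w"
      by (simp add: prod.distrib)
  qed
  also have "\<dots> = emeasure (density (PiM I M) (\<lambda>w. \<Prod>i\<in>I. d i (w i))) (Pi\<^sub>E I A)"
    by (subst emeasure_density) auto
  finally show "emeasure (distr (PiM I M) (PiM I M) (\<lambda>w. \<lambda>i\<in>I. T i (w i))) (Pi\<^sub>E I A)
     = emeasure (density (PiM I M) (\<lambda>w. \<Prod>i\<in>I. d i (w i))) (Pi\<^sub>E I A)" .
next
  interpret prob_space "PiM I M" by (rule prob_space_PiM) unfold_locales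
  have "(\<lambda>w. \<lambda>i\<in>I. T i (w i)) \<in> PiM I M \<rightarrow>\<^sub>M PiM I M"
    by measurable
  then interpret D: prob_space "distr (PiM I M) (PiM I M) (\<lambda>w. \<lambda>i\<in>I. T i (w i))"
    by (rule prob_space_distr)
  show "range (\<lambda>_::nat. space (PiM I M)) \<subseteq> prod_algebra I M"
    using I by (auto simp: space_PiM intro!: prod_algebraI_finite)
  show "(\<Union>i::nat. space (PiM I M)) = space (PiM I M)" by simp
  show "emeasure (distr (PiM I M) (PiM I M) (\<lambda>w. \<lambda>i\<in>I. T i (w i))) (space (PiM I M)) \<noteq> \<infinity>"
    using D.emeasure_finite by simp
qed simp_all

interpretation noise_vector: product_prob_space "\<lambda>_::nat. std_complex_normal" "{..<N}" for N
  by unfold_locales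

abbreviation noise_vec :: "nat \<Rightarrow> (nat \<Rightarrow> complex) measure" where
  "noise_vec N \<equiv> (\<Pi>\<^sub>M m\<in>{..<N}. std_complex_normal)"

lemma prob_space_noise_vec: "prob_space (noise_vec N)"
  by (rule prob_space_PiM) unfold_locales

interpretation noise_block: product_prob_space "\<lambda>_::nat. noise_vec N" "{..n}" for N n
proof -
  interpret prob_space "noise_vec N" by (rule prob_space_noise_vec)
  show "product_prob_space (\<lambda>_::nat. noise_vec N)"
    by unfold_locales
qed

lemma sets_noise_vec[measurable_cong, simp]: "sets (noise_vec N) = sets (cvec_space N)"
  by (intro sets_PiM_cong) auto

lemma sets_noise_law[measurable_cong, simp]: "sets (noise_law N n) = sets (block_space N n)"
  unfolding noise_law_def by (intro sets_PiM_cong) auto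

lemma space_noise_law[simp]: "space (noise_law N n) = space (block_space N n)"
  by (rule sets_eq_imp_space_eq) simp

lemma prob_space_noise_law: "prob_space (noise_law N n)"
  unfolding noise_law_def by (rule prob_space_PiM) (rule prob_space_noise_vec)

lemma measurable_block_component:
  "k \<le> n \<Longrightarrow> m < N \<Longrightarrow> (\<lambda>x. x k m) \<in> borel_measurable (block_space N n)"
  by (rule measurable_compose[where f="\<lambda>x. x k" and N="cvec_space N"]) (auto intro!: measurable_component_singleton)

lemma noise_law_shift:
  "distr (noise_law N n) (noise_law N n) (\<lambda>w. \<lambda>k\<in>{..n}. \<lambda>m\<in>{..<N}. s k m + w k m)
   = density (noise_law N n) (\<lambda>w. ennreal (exp (\<Sum>k\<le>n. \<Sum>m<N. 2 * Re (cnj (s k m) * w k m) - (cmod (s k m))\<^sup>2)))"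
proof -
  let ?d = "\<lambda>k m z. ennreal (exp (2 * Re (cnj (s k m) * z) - (cmod (s k m))\<^sup>2))"
  have vec: "distr (noise_vec N) (noise_vec N) (\<lambda>w. \<lambda>m\<in>{..<N}. s k m + w m)
      = density (noise_vec N) (\<lambda>w. \<Prod>m<N. ?d k m (w m))" for k
  proof (rule noise_vector.distr_PiM_eq_density)
    show "?d k m \<in> borel_measurable std_complex_normal" for m by measurable
    show "(+) (s k m) \<in> std_complex_normal \<rightarrow>\<^sub>M std_complex_normal" for m by measurable
  qed (simp_all add: std_complex_normal_shift)
  have "distr (noise_law N n) (noise_law N n) (\<lambda>w. \<lambda>k\<in>{..n}. (\<lambda>w. \<lambda>m\<in>{..<N}. s k m + w m) (w k))
      = density (noise_law N n) (\<lambda>w. \<Prod>k\<le>n. \<Prod>m<N. ?d k m (w k m))"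
    unfolding noise_law_def
    by (rule noise_block.distr_PiM_eq_density[where d="\<lambda>k w. \<Prod>m<N. ?d k m (w m)" and T="\<lambda>k w. \<lambda>m\<in>{..<N}. s k m + w m", OF _ _ _ vec]) auto
  moreover have "(\<Prod>k\<le>n. \<Prod>m<N. ?d k m (w k m)) = ennreal (exp (\<Sum>k\<le>n. \<Sum>m<N. 2 * Re (cnj (s k m) * w k m) - (cmod (s k m))\<^sup>2))" for w
    by (simp add: exp_sum prod_ennreal prod_nonneg)
  ultimately show ?thesis by simp
qed

text \<open>The density 1 puts the symmetry into the form that the product rule for maps and
  densities expects.\<close>

lemma std_complex_normal_uminus: "distr std_complex_normal std_complex_normal (\<lambda>z. - z) = density std_complex_normal (\<lambda>_. 1)"
proof -
  have "(lborel :: complex measure) = density (distr lborel borel (\<lambda>x. 0 + (-1) *\<^sub>R x)) (\<lambda>_. 1)"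
    using lborel_affine[of "-1" "0::complex"] by simp
  then have l: "distr lborel borel (\<lambda>x::complex. - x) = lborel"
    by (simp add: density_1)
  have "density (distr lborel borel uminus) (\<lambda>z::complex. ennreal (exp (- (cmod z)\<^sup>2) / pi))
     = distr (density lborel (\<lambda>z. ennreal (exp (- (cmod (- z))\<^sup>2) / pi))) borel uminus"
    by (subst density_distr) auto
  then have "std_complex_normal = distr std_complex_normal borel uminus"
    unfolding std_complex_normal_def l by simp
  then show ?thesis
    by (simp add: density_1 cong: distr_cong)
qed

text \<open>The coordinates of the noise are symmetric and independent, so reversing the sign of one
  of them preserves the law. This yields uncorrelated components without integrating out the other
  coordinates.\<close>

lemma noise_law_flip:
  "distr (noise_law N n) (noise_law N n) (\<lambda>w. \<lambda>k\<in>{..n}. \<lambda>m\<in>{..<N}. if k = k0 \<and> m = m0 then - w k m else w k m) = noise_law N n"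
proof -
  have vec: "distr (noise_vec N) (noise_vec N) (\<lambda>w. \<lambda>m\<in>{..<N}. (if k = k0 \<and> m = m0 then uminus else (\<lambda>z. z)) (w m))
      = density (noise_vec N) (\<lambda>w. \<Prod>m<N. 1)" for k
  proof (rule noise_vector.distr_PiM_eq_density)
    show "(if k = k0 \<and> m = m0 then uminus else (\<lambda>z. z)) \<in> std_complex_normal \<rightarrow>\<^sub>M std_complex_normal" for m
      by (cases "k = k0 \<and> m = m0") (simp_all, measurable)
  qed (simp_all add: std_complex_normal_uminus density_1 distr_id2)
  have "distr (noise_law N n) (noise_law N n) (\<lambda>w. \<lambda>k\<in>{..n}. (\<lambda>w. \<lambda>m\<in>{..<N}. (if k = k0 \<and> m = m0 then uminus else (\<lambda>z. z)) (w m)) (w k))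
      = density (noise_law N n) (\<lambda>w. \<Prod>k\<le>n. \<Prod>m<N. 1)"
    unfolding noise_law_def
    by (rule noise_block.distr_PiM_eq_density[where d="\<lambda>k w. \<Prod>m<N. 1" and T="\<lambda>k w. \<lambda>m\<in>{..<N}. (if k = k0 \<and> m = m0 then uminus else (\<lambda>z. z)) (w m)", OF _ _ _ vec])
      (auto intro!: measurable_restrict simp: if_distribR)
  moreover have "(if k = k0 \<and> m = m0 then uminus else (\<lambda>z. z)) (w k m) = (if k = k0 \<and> m = m0 then - w k m else w k m)" for k m and w :: "nat \<Rightarrow> nat \<Rightarrow> complex"
    by simp
  ultimately show ?thesis
    by (simp add: density_1 cong: restrict_cong)
qed

lemma noise_law_component:
  assumes "k \<le> n" "m < N"
  shows "distr (noise_law N n) std_complex_normal (\<lambda>w. w k m) = std_complex_normal"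
proof -
  have 1: "distr (noise_law N n) (noise_vec N) (\<lambda>w. w k) = noise_vec N"
    unfolding noise_law_def using assms by (intro distr_PiM_component prob_space_noise_vec) auto
  have 2: "distr (noise_vec N) std_complex_normal (\<lambda>w. w m) = std_complex_normal"
    using assms by (intro distr_PiM_component) (auto intro: std_complex_normal.prob_space_axioms)
  have m: "(\<lambda>w. w k) \<in> noise_law N n \<rightarrow>\<^sub>M noise_vec N"
    unfolding noise_law_def using assms by (intro measurable_component_singleton) auto
  have "(\<lambda>w. w m) \<in> noise_vec N \<rightarrow>\<^sub>M std_complex_normal"
    using assms by (intro measurable_component_singleton) auto
  then have "distr (distr (noise_law N n) (noise_vec N) (\<lambda>w. w k)) std_complex_normal (\<lambda>w. w m)
     = distr (noise_law N n) std_complex_normal (\<lambda>w. w k m)"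
    using m by (subst distr_distr) (auto simp: comp_def)
  then show ?thesis unfolding 1 2 by simp
qed

lemma noise_law_moments:
  assumes km: "k \<le> n" "m < N"
  shows "integrable (noise_law N n) (\<lambda>w. w k m)" "(\<integral>w. w k m \<partial>noise_law N n) = 0"
    "integrable (noise_law N n) (\<lambda>w. (cmod (w k m))\<^sup>2)" "(\<integral>w. (cmod (w k m))\<^sup>2 \<partial>noise_law N n) = 1"
proof -
  have [measurable]: "(\<lambda>w. w k m) \<in> borel_measurable (noise_law N n)"
    using measurable_block_component[OF km] by simp
  then have m: "(\<lambda>w. w k m) \<in> noise_law N n \<rightarrow>\<^sub>M std_complex_normal"
    by (simp add: measurable_cong_sets[OF refl sets_std_complex_normal])
  note c = noise_law_component[OF km]
  show "integrable (noise_law N n) (\<lambda>w. w k m)"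
    using integrable_distr_eq[OF m, of "\<lambda>z. z"] std_complex_normal_moments(1) unfolding c by (simp add: measurable_ident_sets)
  show "(\<integral>w. w k m \<partial>noise_law N n) = 0"
    using integral_distr[OF m, of "\<lambda>z. z"] std_complex_normal_moments(2) unfolding c by (simp add: measurable_ident_sets)
  show "integrable (noise_law N n) (\<lambda>w. (cmod (w k m))\<^sup>2)"
    using integrable_distr_eq[OF m, of "\<lambda>z. (cmod z)\<^sup>2"] std_complex_normal_moments(3) unfolding c by simp
  show "(\<integral>w. (cmod (w k m))\<^sup>2 \<partial>noise_law N n) = 1"
    using integral_distr[OF m, of "\<lambda>z. (cmod z)\<^sup>2"] std_complex_normal_moments(4)
      borel_measurable_integrable[OF std_complex_normal_moments(3)] unfolding c by simp
qed

lemma borel_measurable_cnj'[measurable]: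
  "f \<in> borel_measurable M \<Longrightarrow> (\<lambda>x. cnj (f x)) \<in> borel_measurable M"
  by (rule measurable_compose[OF _ borel_measurable_continuous_onI]) (auto intro: continuous_intros)

lemma integrable_mult_cnj:
  fixes f g :: "'a \<Rightarrow> complex"
  assumes [measurable]: "f \<in> borel_measurable M" "g \<in> borel_measurable M"
    and "integrable M (\<lambda>x. (cmod (f x))\<^sup>2)" "integrable M (\<lambda>x. (cmod (g x))\<^sup>2)"
  shows "integrable M (\<lambda>x. f x * cnj (g x))"
proof (rule Bochner_Integration.integrable_bound)
  show "integrable M (\<lambda>x. (cmod (f x))\<^sup>2 + (cmod (g x))\<^sup>2)"
    using assms by simp
  have "cmod (f x) * cmod (g x) \<le> (cmod (f x))\<^sup>2 + (cmod (g x))\<^sup>2" for x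
    using sum_squares_bound[of "cmod (f x)" "cmod (g x)"] mult_nonneg_nonneg[OF norm_ge_zero[of "f x"] norm_ge_zero[of "g x"]]
    unfolding mult.assoc by linarith
  then show "AE x in M. norm (f x * cnj (g x)) \<le> norm ((cmod (f x))\<^sup>2 + (cmod (g x))\<^sup>2)"
    by (simp add: norm_mult)
qed (use assms in measurable)

lemma noise_law_cross_moment:
  assumes km: "k \<le> n" "m < N" and km': "k' \<le> n" "m' < N"
  shows "integrable (noise_law N n) (\<lambda>w. w k m * cnj (w k' m'))"
    "(\<integral>w. w k m * cnj (w k' m') \<partial>noise_law N n) = (if k = k' \<and> m = m' then 1 else 0)"
proof -
  have [measurable]: "(\<lambda>w. w k m) \<in> borel_measurable (noise_law N n)" "(\<lambda>w. w k' m') \<in> borel_measurable (noise_law N n)"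
    using measurable_block_component[OF km] measurable_block_component[OF km'] by simp_all
  show i: "integrable (noise_law N n) (\<lambda>w. w k m * cnj (w k' m'))"
    by (rule integrable_mult_cnj) (use noise_law_moments[OF km] noise_law_moments[OF km'] in auto)
  show "(\<integral>w. w k m * cnj (w k' m') \<partial>noise_law N n) = (if k = k' \<and> m = m' then 1 else 0)"
  proof (cases "k = k' \<and> m = m'")
    case True
    then have "(\<integral>w. w k m * cnj (w k' m') \<partial>noise_law N n) = (\<integral>w. of_real ((cmod (w k m))\<^sup>2) \<partial>noise_law N n)"
      by (simp only: complex_norm_square)
    then show ?thesis
      using True noise_law_moments(4)[OF km] by (simp only: integral_complex_of_real) simp
  next
    case False
    \<comment> \<open>\<open>?T\<close> reverses exactly one of the two components, so the integral
      of their product equals its own negative.\<close>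
    let ?T = "\<lambda>w. \<lambda>i\<in>{..n}. \<lambda>j\<in>{..<N}. if i = k \<and> j = m then - w i j else (w i j :: complex)"
    have [measurable]: "?T \<in> noise_law N n \<rightarrow>\<^sub>M noise_law N n"
      unfolding measurable_cong_sets[OF sets_noise_law sets_noise_law]
    proof (intro measurable_restrict)
      fix i j assume "i \<in> {..n}" "j \<in> {..<N}"
      then have [measurable]: "(\<lambda>x. x i j) \<in> borel_measurable (block_space N n)"
        by (intro measurable_block_component) auto
      show "(\<lambda>x. if i = k \<and> j = m then - x i j else x i j) \<in> borel_measurable (block_space N n)"
        by measurable
    qed
    have m[measurable]: "(\<lambda>w. w k m * cnj (w k' m')) \<in> borel_measurable (noise_law N n)"
      using i by (rule borel_measurable_integrable)
    have "(\<integral>w. w k m * cnj (w k' m') \<partial>noise_law N n) = (\<integral>w. w k m * cnj (w k' m') \<partial>distr (noise_law N n) (noise_law N n) ?T)"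
      unfolding noise_law_flip ..
    also have "\<dots> = (\<integral>w. ?T w k m * cnj (?T w k' m') \<partial>noise_law N n)"
      by (rule integral_distr) measurable
    also have "\<dots> = (\<integral>w. - (w k m * cnj (w k' m')) \<partial>noise_law N n)"
      using assms False by (intro Bochner_Integration.integral_cong refl) auto
    finally show ?thesis
      using False by simp
  qed
qed

section \<open>Laplace transforms and superadditive sequences\<close>

lemma nn_integral_exp_atLeast_0:
  assumes a: "0 < (a::real)"
  shows "(\<integral>\<^sup>+t. ennreal (exp (- (t * a))) * indicator {0..} t \<partial>lborel) = ennreal (1 / a)"
proof -
  have "(\<integral>\<^sup>+t. ennreal (exp (- (t * a))) * indicator {0..} t \<partial>lborel) = ennreal (0 - (- exp (- (0 * a)) / a))"
  proof (rule nn_integral_FTC_atLeast[where F="\<lambda>t. - exp (- (t * a)) / a"])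
    show "((\<lambda>t. - exp (- (t * a)) / a) has_real_derivative exp (- (t * a))) (at t)" for t
      using a by (auto intro!: derivative_eq_intros)
    have "((\<lambda>t. exp (- (t * a))) \<longlongrightarrow> 0) at_top"
      using a by real_asymp
    then show "((\<lambda>t. - exp (- (t * a)) / a) \<longlongrightarrow> 0) at_top"
      using tendsto_divide[OF tendsto_minus tendsto_const[of a]] a by fastforce
  qed auto
  then show ?thesis using a by simp
qed

lemma nn_integral_ln_one_plus:
  assumes s: "0 \<le> (s::real)"
  shows "(\<integral>\<^sup>+t. ennreal (s / (1 + s * t)) * indicator {0..1} t \<partial>lborel) = ennreal (ln (1 + s))"
proof -
  have "(\<integral>\<^sup>+t. ennreal (s / (1 + s * t)) * indicator {0..1} t \<partial>lborel) = ennreal (ln (1 + s * 1) - ln (1 + s * 0))"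
  proof (rule nn_integral_FTC_Icc[where F="\<lambda>t. ln (1 + s * t)"])
    fix t :: real assume t: "t \<in> {0..1}"
    have "0 < 1 + s * t" using s t by (simp add: add_pos_nonneg)
    then show "((\<lambda>t. ln (1 + s * t)) has_real_derivative s / (1 + s * t)) (at t)"
      by (auto intro!: derivative_eq_intros)
  qed (use s in auto)
  then show ?thesis by simp
qed

context prob_space
begin

text \<open>Since 1/(1 + cS) is the integral of exp(-t) exp(-tcS) over t \<ge> 0, its expectation is
  a functional of the Laplace transform of S. Comparing such functionals directly avoids the
  uniqueness theorem for Laplace transforms.\<close>

lemma laplace_eq_imp_inverse_eq:
  fixes S S' :: "'a \<Rightarrow> real" and c :: real
  assumes [measurable]: "S \<in> borel_measurable M" "S' \<in> borel_measurable M"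
    and nn: "\<And>\<omega>. 0 \<le> S \<omega>" "\<And>\<omega>. 0 \<le> S' \<omega>"
    and eq: "\<And>u. 0 \<le> u \<Longrightarrow> (\<integral>\<omega>. exp (- (u * S \<omega>)) \<partial>M) = (\<integral>\<omega>. exp (- (u * S' \<omega>)) \<partial>M)"
    and c: "0 \<le> c"
  shows "(\<integral>\<omega>. 1 / (1 + c * S \<omega>) \<partial>M) = (\<integral>\<omega>. 1 / (1 + c * S' \<omega>) \<partial>M)"
proof -
  interpret pair_sigma_finite M lborel
    by (intro pair_sigma_finite.intro sigma_finite_lborel sigma_finite_measure_axioms)
  have *: "(\<integral>\<omega>. 1 / (1 + c * S \<omega>) \<partial>M) = enn2real (\<integral>\<^sup>+t. ennreal (exp (- t)) * ennreal (\<integral>\<omega>. exp (- (t * c * S \<omega>)) \<partial>M) * indicator {0..} t \<partial>lborel)"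
    if [measurable]: "S \<in> borel_measurable M" and nn: "\<And>\<omega>. 0 \<le> S \<omega>" for S
  proof -
    have pos: "0 < 1 + c * S \<omega>" for \<omega> using c nn[of \<omega>] by (simp add: add_pos_nonneg)
    have "(\<integral>\<^sup>+\<omega>. ennreal (1 / (1 + c * S \<omega>)) \<partial>M) = (\<integral>\<^sup>+\<omega>. (\<integral>\<^sup>+t. ennreal (exp (- (t * (1 + c * S \<omega>)))) * indicator {0..} t \<partial>lborel) \<partial>M)"
      by (intro nn_integral_cong nn_integral_exp_atLeast_0[symmetric] pos)
    also have "\<dots> = (\<integral>\<^sup>+t. (\<integral>\<^sup>+\<omega>. ennreal (exp (- (t * (1 + c * S \<omega>)))) * indicator {0..} t \<partial>M) \<partial>lborel)"
      by (rule Fubini'[symmetric]) simp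
    also have "\<dots> = (\<integral>\<^sup>+t. ennreal (exp (- t)) * ennreal (\<integral>\<omega>. exp (- (t * c * S \<omega>)) \<partial>M) * indicator {0..} t \<partial>lborel)"
    proof (intro nn_integral_cong)
      fix t :: real
      show "(\<integral>\<^sup>+\<omega>. ennreal (exp (- (t * (1 + c * S \<omega>)))) * indicator {0..} t \<partial>M)
        = ennreal (exp (- t)) * ennreal (\<integral>\<omega>. exp (- (t * c * S \<omega>)) \<partial>M) * indicator {0..} t"
      proof (cases "0 \<le> t")
        case True
        have i: "integrable M (\<lambda>\<omega>. exp (- (t * c * S \<omega>)))"
          by (rule integrable_const_bound[where B=1]) (use True c nn in auto)
        have "exp (- (t * (1 + c * S \<omega>))) = exp (- t) * exp (- (t * c * S \<omega>))" for \<omega>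
          by (simp add: exp_add[symmetric] algebra_simps)
        then show ?thesis
          using nn_integral_eq_integral[OF i] True by (simp add: ennreal_mult' nn_integral_cmult)
      qed simp
    qed
    finally show ?thesis
      using pos by (subst integral_eq_nn_integral) (auto simp: less_imp_le)
  qed
  have "(\<integral>\<^sup>+t. ennreal (exp (- t)) * ennreal (\<integral>\<omega>. exp (- (t * c * S \<omega>)) \<partial>M) * indicator {0..} t \<partial>lborel)
    = (\<integral>\<^sup>+t. ennreal (exp (- t)) * ennreal (\<integral>\<omega>. exp (- (t * c * S' \<omega>)) \<partial>M) * indicator {0..} t \<partial>lborel)"
    by (intro nn_integral_cong) (use eq c in \<open>auto simp: indicator_def\<close>)
  then show ?thesis using * nn by simp
qed

text \<open>Here ln(1 + cS) is the integral over t in (0,1] of (1 - 1/(1 + ctS))/t, whose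
  expectation involves only the functionals of the preceding lemma.\<close>

lemma laplace_eq_imp_ln_eq:
  fixes S S' :: "'a \<Rightarrow> real" and c :: real
  assumes [measurable]: "S \<in> borel_measurable M" "S' \<in> borel_measurable M"
    and nn: "\<And>\<omega>. 0 \<le> S \<omega>" "\<And>\<omega>. 0 \<le> S' \<omega>"
    and eq: "\<And>u. 0 \<le> u \<Longrightarrow> (\<integral>\<omega>. exp (- (u * S \<omega>)) \<partial>M) = (\<integral>\<omega>. exp (- (u * S' \<omega>)) \<partial>M)"
    and c: "0 \<le> c"
  shows "(\<integral>\<omega>. ln (1 + c * S \<omega>) \<partial>M) = (\<integral>\<omega>. ln (1 + c * S' \<omega>) \<partial>M)"
proof -
  interpret pair_sigma_finite M lborel
    by (intro pair_sigma_finite.intro sigma_finite_lborel sigma_finite_measure_axioms)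
  \<comment> \<open>No integrability of S is assumed: an infinite expectation becomes 0 both in the
    Bochner integral and under \<open>enn2real\<close>, so the equation remains true.\<close>
  have *: "(\<integral>\<omega>. ln (1 + c * S \<omega>) \<partial>M) = enn2real (\<integral>\<^sup>+t. ennreal ((1 - (\<integral>\<omega>. 1 / (1 + (c * t) * S \<omega>) \<partial>M)) / t) * indicator {0<..1} t \<partial>lborel)"
    if [measurable]: "S \<in> borel_measurable M" and nn: "\<And>\<omega>. 0 \<le> S \<omega>" for S
  proof -
    have "(\<integral>\<^sup>+\<omega>. ennreal (ln (1 + c * S \<omega>)) \<partial>M) = (\<integral>\<^sup>+\<omega>. (\<integral>\<^sup>+t. ennreal (c * S \<omega> / (1 + c * S \<omega> * t)) * indicator {0..1} t \<partial>lborel) \<partial>M)"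
      by (intro nn_integral_cong nn_integral_ln_one_plus[symmetric]) (use c nn in simp)
    also have "\<dots> = (\<integral>\<^sup>+t. (\<integral>\<^sup>+\<omega>. ennreal (c * S \<omega> / (1 + c * S \<omega> * t)) * indicator {0..1} t \<partial>M) \<partial>lborel)"
      by (rule Fubini'[symmetric]) simp
    also have "\<dots> = (\<integral>\<^sup>+t. ennreal ((1 - (\<integral>\<omega>. 1 / (1 + (c * t) * S \<omega>) \<partial>M)) / t) * indicator {0<..1} t \<partial>lborel)"
    proof (intro nn_integral_cong_AE)
      have "AE t in lborel. t \<noteq> (0::real)" by (rule AE_lborel_singleton)
      then show "AE t in lborel. (\<integral>\<^sup>+\<omega>. ennreal (c * S \<omega> / (1 + c * S \<omega> * t)) * indicator {0..1} t \<partial>M)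
          = ennreal ((1 - (\<integral>\<omega>. 1 / (1 + (c * t) * S \<omega>) \<partial>M)) / t) * indicator {0<..1} t"
      proof eventually_elim
        case (elim t)
        show ?case
        proof (cases "0 < t \<and> t \<le> 1")
          case True
          have pos: "1 \<le> 1 + c * t * S \<omega>" for \<omega> using c nn[of \<omega>] True by simp
          have i: "integrable M (\<lambda>\<omega>. 1 / (1 + (c * t) * S \<omega>))"
          proof (rule integrable_const_bound[where B=1])
            show "AE \<omega> in M. norm (1 / (1 + (c * t) * S \<omega>)) \<le> 1"
            proof (rule AE_I2)
              fix \<omega> show "norm (1 / (1 + (c * t) * S \<omega>)) \<le> 1"
                using pos[of \<omega>] by simp
            qed
          qed simp
          have "c * S \<omega> / (1 + c * S \<omega> * t) = (1 - 1 / (1 + (c * t) * S \<omega>)) / t" for \<omega>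
          proof -
            have "1 - 1 / (1 + (c * t) * S \<omega>) = c * S \<omega> * t / (1 + c * S \<omega> * t)"
              using pos[of \<omega>] by (simp add: field_simps)
            then show ?thesis using True by simp
          qed
          moreover have "0 \<le> (1 - 1 / (1 + (c * t) * S \<omega>)) / t" for \<omega>
            using True pos[of \<omega>] by (intro divide_nonneg_pos) simp_all
          moreover have "integrable M (\<lambda>\<omega>. (1 - 1 / (1 + (c * t) * S \<omega>)) / t)"
            using i by simp
          ultimately show ?thesis
            using True i nn_integral_eq_integral[of M "\<lambda>\<omega>. (1 - 1 / (1 + (c * t) * S \<omega>)) / t"]
            by (simp add: prob_space)
        qed (use elim in auto)
      qed
    qed
    finally show ?thesis
      using nn c by (subst integral_eq_nn_integral) (auto intro!: AE_I2)
  qed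
  have "(\<integral>\<^sup>+t. ennreal ((1 - (\<integral>\<omega>. 1 / (1 + (c * t) * S \<omega>) \<partial>M)) / t) * indicator {0<..1} t \<partial>lborel)
    = (\<integral>\<^sup>+t. ennreal ((1 - (\<integral>\<omega>. 1 / (1 + (c * t) * S' \<omega>) \<partial>M)) / t) * indicator {0<..1} t \<partial>lborel)"
    by (intro nn_integral_cong) (use laplace_eq_imp_inverse_eq[OF assms(1-4) eq] c in \<open>auto simp: indicator_def\<close>)
  then show ?thesis using * nn by simp
qed

end

text \<open>The limit is the supremum of b_n/n. For n = qm + s with s < m, superadditivity and b_s
  \<ge> 0 give b_n \<ge> q b_m, and dividing by n loses at most b_m/n against b_m/m. Only positive
  indices matter, as n will be a number of symbols.\<close>

lemma fekete_superadditive: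
  fixes b :: "nat \<Rightarrow> real"
  assumes super: "\<And>m n. 0 < m \<Longrightarrow> 0 < n \<Longrightarrow> b m + b n \<le> b (m + n)"
    and nn: "\<And>n. 0 < n \<Longrightarrow> 0 \<le> b n" and bound: "\<And>n. 0 < n \<Longrightarrow> b n \<le> B * real n"
  shows "\<exists>l. (\<lambda>n. b n / real n) \<longlonglongrightarrow> l"
proof -
  define l where "l = (SUP n\<in>{0<..}. b n / real n)"
  have bdd: "bdd_above ((\<lambda>n. b n / real n) ` {0<..})"
    using bound by (intro bdd_aboveI2[where M=B]) (simp add: field_simps)
  have le: "b n / real n \<le> l" if "0 < n" for n
    unfolding l_def using that by (intro cSUP_upper bdd) auto
  have mult: "real q * b m \<le> b (q * m)" if "0 < m" "0 < q" for q m
    using that(2)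
  proof (induction q)
    case (Suc q)
    show ?case
    proof (cases "q = 0")
      case False
      then have "real q * b m + b m \<le> b (q * m) + b m" using Suc by simp
      also have "\<dots> \<le> b (q * m + m)" using False that(1) by (intro super) auto
      finally show ?thesis by (simp add: algebra_simps)
    qed simp
  qed simp
  have lower: "b m / real m - b m / real n \<le> b n / real n" if m: "0 < m" and n: "m \<le> n" for m n
  proof -
    define q s where "q = n div m" and "s = n mod m"
    have q: "0 < q" using m n by (simp add: q_def div_greater_zero_iff)
    have nq: "n = q * m + s" by (simp add: q_def s_def)
    have s: "s < m" using m by (simp add: s_def)
    have "real q * b m \<le> b n"
    proof (cases "s = 0")
      case True then show ?thesis using mult[OF m q] nq by simp
    next
      case False
      then have "b (q * m) + b s \<le> b n" using super[of "q * m" s] m q nq by simp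
      then show ?thesis using mult[OF m q] nn[of s] False by simp
    qed
    moreover have "(real n - real m) / real m * b m \<le> real q * b m"
    proof (rule mult_right_mono[OF _ nn[OF m]])
      have "real n \<le> real q * real m + real m" unfolding nq using s by simp
      then show "(real n - real m) / real m \<le> real q" using m by (simp add: field_simps)
    qed
    ultimately have "(real n - real m) / real m * b m / real n \<le> b n / real n"
      by (intro divide_right_mono) auto
    then show ?thesis using m n by (simp add: field_simps)
  qed
  have "(\<lambda>n. b n / real n) \<longlonglongrightarrow> l"
  proof (rule LIMSEQ_I)
    fix e :: real assume e: "0 < e"
    then have "l - e / 2 < l" by simp
    then obtain m where m: "0 < m" and mb: "l - e / 2 < b m / real m"
      unfolding l_def by (subst (asm) less_cSUP_iff[OF _ bdd]) auto
    define M where "M = max m (nat \<lceil>2 * b m / e\<rceil> + 1)"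
    show "\<exists>no. \<forall>n\<ge>no. norm (b n / real n - l) < e"
    proof (intro exI[of _ M] allI impI)
      fix n assume n: "M \<le> n"
      then have n1: "m \<le> n" "0 < n" using m by (auto simp: M_def)
      have "2 * b m / e < real n" using n unfolding M_def by linarith
      then have "b m / real n < e / 2" using e n1 by (simp add: field_simps)
      then have "l - e < b n / real n" using lower[OF m n1(1)] mb by linarith
      then show "norm (b n / real n - l) < e" using le[OF n1(2)] by (simp add: abs_if)
    qed
  qed
  then show ?thesis by blast
qed

section \<open>Linear prediction of a stationary sequence\<close>

lemma hform_add:
  assumes herm: "\<And>k l. k < d \<Longrightarrow> l < d \<Longrightarrow> C l k = cnj (C k l)"
  shows "Re (hform d C (\<lambda>k. a k + b k)) = Re (hform d C a) + 2 * Re (\<Sum>k<d. a k * (\<Sum>l<d. cnj (b l) * C k l)) + Re (hform d C b)"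
proof -
  have 1: "(\<Sum>k<d. \<Sum>l<d. b k * cnj (a l) * C k l) = cnj (\<Sum>k<d. \<Sum>l<d. a k * cnj (b l) * C k l)"
  proof -
    have "(\<Sum>k<d. \<Sum>l<d. b k * cnj (a l) * C k l) = (\<Sum>k<d. \<Sum>l<d. cnj (a l * cnj (b k) * C l k))"
    proof (intro sum.cong refl)
      fix k l assume "k \<in> {..<d}" "l \<in> {..<d}"
      then have "C l k = cnj (C k l)" using herm[of k l] by simp
      then show "b k * cnj (a l) * C k l = cnj (a l * cnj (b k) * C l k)" by simp
    qed
    also have "\<dots> = (\<Sum>l<d. \<Sum>k<d. cnj (a l * cnj (b k) * C l k))"
      by (rule sum.swap)
    finally show ?thesis by simp
  qed
  have "hform d C (\<lambda>k. a k + b k) = hform d C a + (\<Sum>k<d. \<Sum>l<d. a k * cnj (b l) * C k l)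
     + (\<Sum>k<d. \<Sum>l<d. b k * cnj (a l) * C k l) + hform d C b"
    unfolding hform_def sum.distrib[symmetric]
    by (intro sum.cong refl) (simp add: algebra_simps)
  moreover have "(\<Sum>k<d. \<Sum>l<d. a k * cnj (b l) * C k l) = (\<Sum>k<d. a k * (\<Sum>l<d. cnj (b l) * C k l))"
    by (simp add: sum_distrib_left mult.assoc)
  ultimately show ?thesis
    unfolding 1 by (simp only: plus_complex.simps complex_cnj complex.sel cnj.sel)
qed

lemma hform_mono_dim:
  assumes "e \<le> d" "\<And>k. e \<le> k \<Longrightarrow> k < d \<Longrightarrow> a k = 0"
  shows "hform d C a = hform e C a"
proof -
  have "(\<Sum>l<d. a k * cnj (a l) * C k l) = (\<Sum>l<e. a k * cnj (a l) * C k l)" for k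
    using assms by (intro sum.mono_neutral_right) auto
  moreover have "(\<Sum>k<d. \<Sum>l<e. a k * cnj (a l) * C k l) = (\<Sum>k<e. \<Sum>l<e. a k * cnj (a l) * C k l)"
    using assms by (intro sum.mono_neutral_right) auto
  ultimately show ?thesis unfolding hform_def by simp
qed

text \<open>The normalised fading process enters only through its autocorrelation. The form is the
  variance of a combination of d consecutive samples; its positivity for all d replaces an
  underlying process.\<close>

locale psd_autocorrelation =
  fixes r :: "int \<Rightarrow> complex"
  assumes r_zero: "r 0 = 1"
    and r_herm: "r (- z) = cnj (r z)"
    and r_psd: "0 \<le> Re (hform d (\<lambda>k l. r (int k - int l)) a)"
begin

abbreviation rform :: "nat \<Rightarrow> (nat \<Rightarrow> complex) \<Rightarrow> real" where
  "rform d a \<equiv> Re (hform d (\<lambda>k l. r (int k - int l)) a)"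

lemma r_herm': "r (int l - int k) = cnj (r (int k - int l))"
  using r_herm[of "int k - int l"] by simp

lemma rform_Suc:
  "rform (Suc k) a = rform k a + 2 * Re (\<Sum>j<k. a j * cnj (a k) * r (int j - int k)) + (cmod (a k))\<^sup>2"
proof -
  define b where "b j = (if j = k then a k else 0)" for j
  define a' where "a' j = (if j = k then 0 else a j)" for j
  have "rform (Suc k) a = rform (Suc k) (\<lambda>j. a' j + b j)"
    by (rule arg_cong[where f="\<lambda>f. rform (Suc k) f"]) (auto simp: a'_def b_def)
  also have "\<dots> = rform (Suc k) a' + 2 * Re (\<Sum>j<Suc k. a' j * (\<Sum>l<Suc k. cnj (b l) * r (int j - int l))) + rform (Suc k) b"
    by (rule hform_add) (rule r_herm')
  also have "rform (Suc k) a' = rform k a'"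
    by (subst hform_mono_dim[of k]) (auto simp: a'_def)
  also have "\<dots> = rform k a"
    unfolding hform_def by (auto intro!: arg_cong[where f=Re] sum.cong simp: a'_def)
  also have "(\<Sum>j<Suc k. a' j * (\<Sum>l<Suc k. cnj (b l) * r (int j - int l))) = (\<Sum>j<k. a j * cnj (a k) * r (int j - int k))"
    by (auto simp: a'_def b_def mult.assoc intro!: sum.cong)
  also have "rform (Suc k) b = (cmod (a k))\<^sup>2"
  proof -
    have "hform (Suc k) (\<lambda>k l. r (int k - int l)) b = of_real ((cmod (a k))\<^sup>2)"
      unfolding complex_norm_square by (simp add: hform_def b_def r_zero)
    then show ?thesis by simp
  qed
  finally show ?thesis .
qed

text \<open>Completing the square around \<open>w\<close> bounds the error of estimating \<open>c\<close> times the current sample from noisy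
  past samples, whatever the linear estimator \<open>A\<close>. The dual certificate \<open>w\<close> is optimal when all energies equal \<open>q\<close>.\<close>

lemma estimation_error_ge:
  assumes w: "\<And>j. j < k \<Longrightarrow> (\<Sum>l<k. r (int j - int l) * w l) + w j / of_real q = r (int j - int k)"
    and q: "0 < q"
    and A: "\<And>j. j < k \<Longrightarrow> A j = (\<Sum>m<N. U j m * g j m)"
  shows "(cmod (A k))\<^sup>2 * (1 - (rform k (\<lambda>j. cnj (w j)) + (\<Sum>j<k. (cmod (w j))\<^sup>2 * (\<Sum>m<N. (cmod (g j m))\<^sup>2) / q\<^sup>2)))
      \<le> rform (Suc k) A + (\<Sum>j<k. \<Sum>m<N. (cmod (U j m))\<^sup>2)"
proof -
  let ?c = "A k"
  \<comment> \<open>First square, taken over the past samples. The equation for \<open>w\<close>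
    turns its cross term into the wanted correlation with sample k, minus a remainder proportional
    to w_j/q.\<close>
  have "0 \<le> rform k (\<lambda>j. A j + ?c * cnj (w j))" by (rule r_psd)
  also have "\<dots> = rform k A + 2 * Re (\<Sum>j<k. A j * (\<Sum>l<k. cnj (?c * cnj (w l)) * r (int j - int l))) + rform k (\<lambda>j. ?c * cnj (w j))"
    by (rule hform_add) (rule r_herm')
  also have "rform k (\<lambda>j. ?c * cnj (w j)) = (cmod ?c)\<^sup>2 * rform k (\<lambda>j. cnj (w j))"
  proof -
    have "hform k (\<lambda>k l. r (int k - int l)) (\<lambda>j. ?c * cnj (w j)) = of_real ((cmod ?c)\<^sup>2) * hform k (\<lambda>k l. r (int k - int l)) (\<lambda>j. cnj (w j))"
      unfolding hform_def complex_norm_square sum_distrib_left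
      by (intro sum.cong refl) (simp add: mult_ac)
    then show ?thesis by simp
  qed
  also have "(\<Sum>j<k. A j * (\<Sum>l<k. cnj (?c * cnj (w l)) * r (int j - int l)))
      = (\<Sum>j<k. A j * cnj ?c * r (int j - int k)) - (\<Sum>j<k. A j * cnj ?c * w j / of_real q)"
    unfolding sum_subtractf[symmetric]
  proof (intro sum.cong refl)
    fix j assume "j \<in> {..<k}"
    then have e: "(\<Sum>l<k. r (int j - int l) * w l) = r (int j - int k) - w j / of_real q"
      using w[of j] by (simp add: algebra_simps)
    have "(\<Sum>l<k. cnj (?c * cnj (w l)) * r (int j - int l)) = cnj ?c * (\<Sum>l<k. r (int j - int l) * w l)"
      unfolding sum_distrib_left by (intro sum.cong refl) (simp add: mult_ac)
    then show "A j * (\<Sum>l<k. cnj (?c * cnj (w l)) * r (int j - int l)) = A j * cnj ?c * r (int j - int k) - A j * cnj ?c * w j / of_real q"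
      by (simp only: e) (simp add: algebra_simps)
  qed
  finally have 1: "0 \<le> rform k A + 2 * (Re (\<Sum>j<k. A j * cnj ?c * r (int j - int k)) - Re (\<Sum>j<k. A j * cnj ?c * w j / of_real q))
      + (cmod ?c)\<^sup>2 * rform k (\<lambda>j. cnj (w j))"
    by (simp only: minus_complex.simps)
  \<comment> \<open>Second square, over the noise coefficients of symbol j. The shift
    \<open>?z\<close> is chosen so that the cross term cancels the remainder of the first square;
    its own square is the term that is linear in the energy of symbol j.\<close>
  have 2: "0 \<le> (\<Sum>m<N. (cmod (U j m))\<^sup>2) + 2 * Re (A j * cnj ?c * w j / of_real q) + (cmod ?c)\<^sup>2 * ((cmod (w j))\<^sup>2 * (\<Sum>m<N. (cmod (g j m))\<^sup>2) / q\<^sup>2)"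
    if j: "j < k" for j
  proof -
    let ?z = "?c * cnj (w j) / of_real q"
    have sq: "(cmod (U j m + cnj (g j m) * ?z))\<^sup>2 = (cmod (U j m))\<^sup>2 + 2 * Re (U j m * g j m * cnj ?z) + (cmod ?z)\<^sup>2 * (cmod (g j m))\<^sup>2" for m
    proof -
      have "(cmod (U j m + cnj (g j m) * ?z))\<^sup>2 = (cmod (U j m))\<^sup>2 + 2 * Re (U j m * cnj (cnj (g j m) * ?z)) + (cmod (cnj (g j m) * ?z))\<^sup>2"
        unfolding cmod_power2 by (simp only: power2_eq_square plus_complex.simps times_complex.simps cnj.simps) (simp add: algebra_simps)
      moreover have "(cmod (cnj (g j m) * ?z))\<^sup>2 = (cmod ?z)\<^sup>2 * (cmod (g j m))\<^sup>2"
        unfolding norm_mult complex_mod_cnj power_mult_distrib by (simp only: mult.commute)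
      moreover have "U j m * cnj (cnj (g j m) * ?z) = U j m * g j m * cnj ?z"
        unfolding complex_cnj_mult complex_cnj_cnj by (simp only: mult.assoc)
      ultimately show ?thesis by (simp only:)
    qed
    have "0 \<le> (\<Sum>m<N. (cmod (U j m + cnj (g j m) * ?z))\<^sup>2)"
      by (simp add: sum_nonneg)
    also have "\<dots> = (\<Sum>m<N. (cmod (U j m))\<^sup>2) + 2 * Re ((\<Sum>m<N. U j m * g j m) * cnj ?z) + (cmod ?z)\<^sup>2 * (\<Sum>m<N. (cmod (g j m))\<^sup>2)"
      unfolding sq sum.distrib by (simp only: sum_distrib_left[symmetric] sum_distrib_right[symmetric] Re_sum[symmetric])
    also have "(\<Sum>m<N. U j m * g j m) = A j" using A[OF j] by simp
    also have "A j * cnj ?z = A j * cnj ?c * w j / of_real q" by simp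
    also have "(cmod ?z)\<^sup>2 = (cmod ?c)\<^sup>2 * (cmod (w j))\<^sup>2 / q\<^sup>2"
      by (simp add: norm_mult norm_divide power_mult_distrib power_divide)
    finally show ?thesis by (simp add: mult_ac)
  qed
  have "0 \<le> (\<Sum>j<k. (\<Sum>m<N. (cmod (U j m))\<^sup>2) + 2 * Re (A j * cnj ?c * w j / of_real q) + (cmod ?c)\<^sup>2 * ((cmod (w j))\<^sup>2 * (\<Sum>m<N. (cmod (g j m))\<^sup>2) / q\<^sup>2))"
    by (intro sum_nonneg) (use 2 in auto)
  also have "\<dots> = (\<Sum>j<k. \<Sum>m<N. (cmod (U j m))\<^sup>2) + 2 * Re (\<Sum>j<k. A j * cnj ?c * w j / of_real q)
      + (cmod ?c)\<^sup>2 * (\<Sum>j<k. (cmod (w j))\<^sup>2 * (\<Sum>m<N. (cmod (g j m))\<^sup>2) / q\<^sup>2)"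
    unfolding sum.distrib by (simp only: sum_distrib_left[symmetric] Re_sum[symmetric])
  finally show ?thesis
    using 1 unfolding rform_Suc by (simp add: algebra_simps del: Re_sum)
qed

end

text \<open>Estimation inside one symbol: the earlier subcarriers, of total energy t, contribute b
  at a noise cost u, and \<epsilon> weighs what is left of the fading coefficient. With x = |a + b|
  and y = |b|, Cauchy-Schwarz reads \<epsilon>(x + y)^2 \<le> (1 + \<epsilon>t)(\<epsilon>x^2 +
  y^2/t), the difference being (y - \<epsilon>tx)^2/t. The ratio is written so that it telescopes
  over subcarriers.\<close>

lemma scalar_estimation_error_ge:
  fixes a b :: complex
  assumes e: "0 \<le> \<epsilon>" and t: "0 \<le> t" and b: "(cmod b)\<^sup>2 \<le> u * t" and u: "0 \<le> u"
  shows "(1 + \<epsilon> * (t + (cmod a)\<^sup>2)) / (1 + \<epsilon> * t) \<le> \<epsilon> * (cmod (a + b))\<^sup>2 + 1 + u"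
proof -
  define x y where "x = cmod (a + b)" and "y = cmod b"
  have tri: "cmod a \<le> x + y"
    unfolding x_def y_def using norm_triangle_ineq4[of "a + b" b] by simp
  have nn: "0 \<le> x" "0 \<le> y" by (simp_all add: x_def y_def)
  have "(cmod a)\<^sup>2 \<le> (x + y)\<^sup>2"
    using tri by (intro power_mono) auto
  have "\<epsilon> * (x + y)\<^sup>2 \<le> (1 + \<epsilon> * t) * (\<epsilon> * x\<^sup>2 + u)"
  proof (cases "t = 0")
    case True
    then have "y = 0" using b by (simp add: y_def)
    then show ?thesis using True u by simp
  next
    case False
    then have t': "0 < t" using t by simp
    have yu: "y\<^sup>2 / t \<le> u" using b t' by (simp add: y_def field_simps)
    have "0 \<le> \<epsilon> * (\<epsilon> * t * x - y)\<^sup>2 + (1 - \<epsilon> + \<epsilon>) * (y - \<epsilon> * t * x)\<^sup>2 / t" using t' e by simp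
    have "\<epsilon> * (x + y)\<^sup>2 + (y - \<epsilon> * t * x)\<^sup>2 / t = (1 + \<epsilon> * t) * (\<epsilon> * x\<^sup>2 + y\<^sup>2 / t)"
      using t' by (simp add: field_simps power2_eq_square)
    then have "\<epsilon> * (x + y)\<^sup>2 \<le> (1 + \<epsilon> * t) * (\<epsilon> * x\<^sup>2 + y\<^sup>2 / t)"
      using t' by (smt (verit) divide_nonneg_pos zero_le_power2)
    also have "\<dots> \<le> (1 + \<epsilon> * t) * (\<epsilon> * x\<^sup>2 + u)"
      using yu e t by (intro mult_left_mono) auto
    finally show ?thesis .
  qed
  moreover have "\<epsilon> * (cmod a)\<^sup>2 \<le> \<epsilon> * (x + y)\<^sup>2"
    using \<open>(cmod a)\<^sup>2 \<le> (x + y)\<^sup>2\<close> e by (rule mult_left_mono)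
  ultimately have "1 + \<epsilon> * (t + (cmod a)\<^sup>2) \<le> (\<epsilon> * x\<^sup>2 + 1 + u) * (1 + \<epsilon> * t)"
    by (simp add: algebra_simps)
  moreover have "0 < 1 + \<epsilon> * t" using e t by (simp add: add_pos_nonneg)
  ultimately show ?thesis
    unfolding x_def by (simp add: pos_divide_le_eq)
qed

lemma norm_sum_mult_square_le:
  "(cmod (\<Sum>m<M. u m * g m))\<^sup>2 \<le> (\<Sum>m<M. (cmod (u m))\<^sup>2) * (\<Sum>m<M. (cmod (g m))\<^sup>2)"
proof -
  have "cmod (\<Sum>m<M. u m * g m) \<le> (\<Sum>m<M. cmod (u m) * cmod (g m))"
    by (rule order_trans[OF norm_sum]) (simp add: norm_mult)
  then have "(cmod (\<Sum>m<M. u m * g m))\<^sup>2 \<le> (\<Sum>m<M. cmod (u m) * cmod (g m))\<^sup>2"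
    by (intro power_mono) auto
  also have "\<dots> \<le> (\<Sum>m<M. (cmod (u m))\<^sup>2) * (\<Sum>m<M. (cmod (g m))\<^sup>2)"
    by (rule Cauchy_Schwarz_ineq_sum)
  finally show ?thesis .
qed

context psd_autocorrelation
begin

text \<open>Here U ranges over all combinations whose leading coefficient, at subcarrier m of symbol
  k, is 1. The earlier symbols leave at least \<epsilon>|A_k|^2 by the dual certificate, and the
  earlier subcarriers of symbol k are handled by the scalar estimate. Energies e stand in for the
  gains because only moduli matter, and these will be the same for all taps.\<close>

lemma innovation_variance_ge:
  assumes w: "\<And>j. j < k \<Longrightarrow> (\<Sum>l<k. r (int j - int l) * w l) + w j / of_real q = r (int j - int k)"
    and q: "0 < q" and k: "k \<le> n" and m: "m < N"
    and U: "U k m = 1" "\<And>m'. m < m' \<Longrightarrow> U k m' = 0" "\<And>j m'. k < j \<Longrightarrow> U j m' = 0"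
    and g: "\<And>j m. m < N \<Longrightarrow> (cmod (g j m))\<^sup>2 = e j m"
    and eps: "\<epsilon> = max 0 (1 - (rform k (\<lambda>j. cnj (w j)) + (\<Sum>j<k. (cmod (w j))\<^sup>2 * (\<Sum>m<N. e j m) / q\<^sup>2)))"
  shows "(1 + \<epsilon> * (\<Sum>m'<Suc m. e k m')) / (1 + \<epsilon> * (\<Sum>m'<m. e k m'))
     \<le> rform (Suc n) (\<lambda>j. \<Sum>m<N. U j m * g j m) + (\<Sum>j<Suc n. \<Sum>m<N. (cmod (U j m))\<^sup>2)"
proof -
  define A where "A j = (\<Sum>m<N. U j m * g j m)" for j
  have eps0: "0 \<le> \<epsilon>" by (simp add: eps)
  have "rform (Suc n) A = rform (Suc k) A"
    using k U(3) by (subst hform_mono_dim[of "Suc k"]) (auto simp: A_def)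
  have e1: "(\<Sum>j<k. (cmod (w j))\<^sup>2 * (\<Sum>m<N. (cmod (g j m))\<^sup>2) / q\<^sup>2) = (\<Sum>j<k. (cmod (w j))\<^sup>2 * (\<Sum>m<N. e j m) / q\<^sup>2)"
    by (simp add: g)
  \<comment> \<open>The maximum with 0 covers past energies so large that the affine certificate
    turns negative; there positive semidefiniteness alone gives the bound.\<close>
  have past: "(cmod (A k))\<^sup>2 * \<epsilon> \<le> rform (Suc k) A + (\<Sum>j<k. \<Sum>m<N. (cmod (U j m))\<^sup>2)"
    using estimation_error_ge[OF w q, where A=A and N=N and U=U and g=g, unfolded e1] r_psd[of "Suc k" A]
    by (auto simp: eps A_def max_def intro!: add_nonneg_nonneg sum_nonneg)
  have split: "(\<Sum>m'<N. f m') = (\<Sum>m'<m. f m') + f m" if "\<And>m'. m < m' \<Longrightarrow> f m' = 0" for f :: "nat \<Rightarrow> 'b::comm_monoid_add"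
  proof -
    have "(\<Sum>m'<N. f m') = (\<Sum>m'<Suc m. f m')"
      using m that by (intro sum.mono_neutral_right) auto
    then show ?thesis by simp
  qed
  have Ak: "A k = g k m + (\<Sum>m'<m. U k m' * g k m')"
    unfolding A_def by (subst split) (auto simp: U)
  have Uk: "(\<Sum>m'<N. (cmod (U k m'))\<^sup>2) = (\<Sum>m'<m. (cmod (U k m'))\<^sup>2) + 1"
    by (subst split) (auto simp: U)
  have "(\<Sum>j<Suc n. \<Sum>m<N. (cmod (U j m))\<^sup>2) = (\<Sum>j<Suc k. \<Sum>m<N. (cmod (U j m))\<^sup>2)"
    using k U(3) by (intro sum.mono_neutral_right) auto
  also have "\<dots> = (\<Sum>j<k. \<Sum>m<N. (cmod (U j m))\<^sup>2) + (\<Sum>m'<m. (cmod (U k m'))\<^sup>2) + 1"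
    using Uk by simp
  finally have tot: "(cmod (A k))\<^sup>2 * \<epsilon> + (\<Sum>m'<m. (cmod (U k m'))\<^sup>2) + 1 \<le> rform (Suc n) A + (\<Sum>j<Suc n. \<Sum>m<N. (cmod (U j m))\<^sup>2)"
    using past \<open>rform (Suc n) A = rform (Suc k) A\<close> by simp
  have em: "(\<Sum>m'<m. (cmod (g k m'))\<^sup>2) = (\<Sum>m'<m. e k m')"
    using m by (intro sum.cong) (auto intro!: g)
  have enn: "0 \<le> (\<Sum>m'<m. e k m')" unfolding em[symmetric] by (simp add: sum_nonneg)
  have "(1 + \<epsilon> * ((\<Sum>m'<m. e k m') + (cmod (g k m))\<^sup>2)) / (1 + \<epsilon> * (\<Sum>m'<m. e k m'))
     \<le> \<epsilon> * (cmod (g k m + (\<Sum>m'<m. U k m' * g k m')))\<^sup>2 + 1 + (\<Sum>m'<m. (cmod (U k m'))\<^sup>2)"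
    by (rule scalar_estimation_error_ge[OF eps0 enn])
       (use norm_sum_mult_square_le[of "U k" "g k" m] in \<open>auto simp: em sum_nonneg\<close>)
  then show ?thesis
    using tot unfolding Ak A_def[symmetric] by (simp add: g[OF m] mult.commute)
qed

end

text \<open>Multiplied over the subcarriers of a symbol, the innovation bounds collapse to one
  factor in the total energy, so the distribution of the energy over subcarriers disappears from the
  bound.\<close>

lemma sum_ln_telescope:
  assumes e: "0 \<le> (\<epsilon>::real)" and nn: "\<And>m. m < M \<Longrightarrow> 0 \<le> e m"
  shows "(\<Sum>m<M. ln ((1 + \<epsilon> * (\<Sum>m'<Suc m. e m')) / (1 + \<epsilon> * (\<Sum>m'<m. e m')))) = ln (1 + \<epsilon> * (\<Sum>m<M. e m))"
proof -
  have pos: "0 < 1 + \<epsilon> * (\<Sum>m'<m. e m')" if "m \<le> M" for m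
    using that e nn by (intro add_pos_nonneg mult_nonneg_nonneg sum_nonneg) auto
  have "(\<Sum>m<M. ln ((1 + \<epsilon> * (\<Sum>m'<Suc m. e m')) / (1 + \<epsilon> * (\<Sum>m'<m. e m'))))
     = (\<Sum>m<M. ln (1 + \<epsilon> * (\<Sum>m'<Suc m. e m')) - ln (1 + \<epsilon> * (\<Sum>m'<m. e m')))"
  proof (intro sum.cong refl)
    fix m assume "m \<in> {..<M}"
    then show "ln ((1 + \<epsilon> * (\<Sum>m'<Suc m. e m')) / (1 + \<epsilon> * (\<Sum>m'<m. e m'))) = ln (1 + \<epsilon> * (\<Sum>m'<Suc m. e m')) - ln (1 + \<epsilon> * (\<Sum>m'<m. e m'))"
      using pos[of "Suc m"] pos[of m] by (subst ln_divide_pos) auto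
  qed
  also have "\<dots> = ln (1 + \<epsilon> * (\<Sum>m<M. e m)) - ln (1 + \<epsilon> * (\<Sum>m<0. e m))"
    by (rule sum_lessThan_telescope)
  finally show ?thesis by simp
qed

text \<open>For a Toeplitz C the shifted matrix is C again: delaying the coefficients by one step
  leaves the variance unchanged.\<close>

lemma hform_shift_index:
  assumes "a 0 = 0"
  shows "hform (Suc d) C a = hform d (\<lambda>k l. C (Suc k) (Suc l)) (\<lambda>k. a (Suc k))"
  unfolding hform_def sum.lessThan_Suc_shift using assms by simp

text \<open>Prepares polarisation: coefficients 1, 1 and then 1, i at the times 0 and n turn
  realness of the form into the imaginary and the real part of Hermitian symmetry.\<close>

lemma hform_two_points:
  assumes "0 < n"
  shows "hform (Suc n) C (\<lambda>j. if j = 0 then x else if j = n then y else 0)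
     = x * cnj x * C 0 0 + x * cnj y * C 0 n + y * cnj x * C n 0 + y * cnj y * C n n"
proof -
  let ?a = "\<lambda>j. if j = 0 then x else if j = n then y else 0"
  have s: "(\<Sum>l<Suc n. f l) = f 0 + f n" if "\<And>l. l \<noteq> 0 \<Longrightarrow> l \<noteq> n \<Longrightarrow> f l = 0" for f :: "nat \<Rightarrow> complex"
  proof -
    have "(\<Sum>l<Suc n. f l) = (\<Sum>l\<in>{0, n}. f l)"
      using that assms by (intro sum.mono_neutral_right) auto
    then show ?thesis using assms by simp
  qed
  have "(\<Sum>l<Suc n. ?a k * cnj (?a l) * C k l) = ?a k * cnj (?a 0) * C k 0 + ?a k * cnj (?a n) * C k n" for k
    by (rule s) auto
  then have "hform (Suc n) C ?a = (\<Sum>k<Suc n. ?a k * cnj (?a 0) * C k 0 + ?a k * cnj (?a n) * C k n)"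
    unfolding hform_def by (intro sum.cong refl)
  also have "\<dots> = (?a 0 * cnj (?a 0) * C 0 0 + ?a 0 * cnj (?a n) * C 0 n) + (?a n * cnj (?a 0) * C n 0 + ?a n * cnj (?a n) * C n n)"
    by (rule s) auto
  finally show ?thesis using assms by simp
qed

lemma Delta_quadratic_form:
  "(Delta r k *\<^sub>v Matrix.vec (k + 1) (\<lambda>i. cnj (a i))) \<bullet>c Matrix.vec (k + 1) (\<lambda>i. cnj (a i)) = hform (Suc k) (\<lambda>k l. r (int k - int l)) a"
  by (simp add: Delta_def scalar_prod_def hform_def sum_distrib_left sum_distrib_right mult_ac lessThan_atLeast0 del: sum.atLeast0_lessThan_Suc sum.op_ivl_Suc)

text \<open>Hermitian symmetry of r is derived rather than postulated: \<open>psd_mat\<close>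
  includes that the quadratic form is real, and polarisation does the rest.\<close>

lemma psd_autocorrelationI:
  assumes one: "r 0 = 1" and psd: "\<And>k. psd_mat (Delta r k)"
  shows "psd_autocorrelation r"
proof
  have P: "Im (hform (Suc k) (\<lambda>k l. r (int k - int l)) a) = 0" "0 \<le> Re (hform (Suc k) (\<lambda>k l. r (int k - int l)) a)" for k a
    using psd[of k] unfolding psd_mat_def Delta_quadratic_form[symmetric]
    by (auto simp: Delta_def)
  show "r 0 = 1" by fact
  show "0 \<le> Re (hform d (\<lambda>k l. r (int k - int l)) a)" for d a
    using P(2)[of "d - 1" a] by (cases d) (auto simp: hform_def)
  have H: "r (- int n) = cnj (r (int n))" for n :: nat
  proof (cases "n = 0")
    case False
    then have n: "0 < n" by simp
    have "Im (r (- int n)) + Im (r (int n)) = 0"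
      using P(1)[of n, unfolded] hform_two_points[OF n, of "\<lambda>k l. r (int k - int l)" 1 1] P(1)[of n "\<lambda>j. if j = 0 then 1 else if j = n then 1 else 0"]
      by (simp add: one)
    moreover have "Re (r (- int n)) = Re (r (int n))"
      using hform_two_points[OF n, of "\<lambda>k l. r (int k - int l)" 1 \<i>] P(1)[of n "\<lambda>j. if j = 0 then 1 else if j = n then \<i> else 0"]
      by (simp add: one)
    ultimately show ?thesis by (simp add: complex_eq_iff)
  qed (simp add: one)
  show "r (- z) = cnj (r z)" for z
  proof (cases "0 \<le> z")
    case True
    then show ?thesis using H[of "nat z"] by simp
  next
    case False
    then show ?thesis using H[of "nat (- z)"] by simp
  qed
qed

section \<open>The coherence form as a prediction error\<close>

context psd_autocorrelation
begin

lemma hform_real: "hform d (\<lambda>k l. r (int k - int l)) a = of_real (rform d a)"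
proof -
  have "cnj (hform d (\<lambda>k l. r (int k - int l)) a) = (\<Sum>k<d. \<Sum>l<d. cnj (a k) * a l * r (int l - int k))"
    unfolding hform_def by (simp add: r_herm'[symmetric])
  also have "\<dots> = hform d (\<lambda>k l. r (int k - int l)) a"
    unfolding hform_def by (subst sum.swap) (simp add: mult_ac)
  finally show ?thesis
    by (simp add: complex_eq_iff)
qed

text \<open>In vector notation, with ^H the adjoint, z solves [p(\<Delta> - D D^H) + I] z = t D, and
  s = D^H z. Pairing the equation with z gives the energy identity; the inequality says that
  \<Delta> - D D^H is positive semidefinite, a Schur complement of the matrix of size k + 1. The
  case t = 0 gives invertibility, the case t = 1 evaluates the coherence form.\<close>

lemma prediction_equation:
  fixes z :: "nat \<Rightarrow> complex"
  assumes p: "0 < p"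
    and eq: "\<And>i. i < k \<Longrightarrow> of_real p * ((\<Sum>j<k. r (int i - int j) * z j) - r (int i - int k) * s) + z i = t * r (int i - int k)"
    and s: "s = (\<Sum>j<k. cnj (r (int j - int k)) * z j)"
  shows "of_real (p * (rform k (\<lambda>j. cnj (z j)) - (cmod s)\<^sup>2) + (\<Sum>j<k. (cmod (z j))\<^sup>2)) = t * cnj s"
    and "(cmod s)\<^sup>2 \<le> rform k (\<lambda>j. cnj (z j))"
proof -
  have cs: "cnj s = (\<Sum>j<k. cnj (z j) * r (int j - int k))"
    unfolding s by (simp add: mult.commute)
  have F: "(\<Sum>i<k. cnj (z i) * (\<Sum>j<k. r (int i - int j) * z j)) = of_real (rform k (\<lambda>j. cnj (z j)))"
    unfolding hform_real[symmetric] unfolding hform_def sum_distrib_left by (simp add: mult_ac)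
  have "(\<Sum>i<k. cnj (z i) * (of_real p * ((\<Sum>j<k. r (int i - int j) * z j) - r (int i - int k) * s) + z i)) = (\<Sum>i<k. cnj (z i) * (t * r (int i - int k)))"
    by (intro sum.cong refl) (simp only: eq lessThan_iff)
  also have "\<dots> = t * cnj s"
    unfolding cs sum_distrib_left by (simp add: mult_ac)
  also have "(\<Sum>i<k. cnj (z i) * (of_real p * ((\<Sum>j<k. r (int i - int j) * z j) - r (int i - int k) * s) + z i))
     = of_real p * (\<Sum>i<k. cnj (z i) * (\<Sum>j<k. r (int i - int j) * z j)) - of_real p * (cnj s * s) + (\<Sum>i<k. cnj (z i) * z i)"
  proof -
    have "cnj (z i) * (of_real p * (S - d * s) + z i) = of_real p * (cnj (z i) * S) - of_real p * s * (cnj (z i) * d) + cnj (z i) * z i" for i S d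
      by (simp add: algebra_simps)
    then show ?thesis
      unfolding cs by (simp only: sum.distrib sum_subtractf sum_distrib_left[symmetric]) (simp add: mult_ac)
  qed
  also have "cnj s * s = of_real ((cmod s)\<^sup>2)"
    unfolding complex_norm_square by (simp only: mult.commute)
  also have "(\<Sum>i<k. cnj (z i) * z i) = of_real (\<Sum>j<k. (cmod (z j))\<^sup>2)"
    unfolding of_real_sum complex_norm_square by (simp only: mult.commute)
  finally show "of_real (p * (rform k (\<lambda>j. cnj (z j)) - (cmod s)\<^sup>2) + (\<Sum>j<k. (cmod (z j))\<^sup>2)) = t * cnj s"
    unfolding F by (simp add: algebra_simps)
  \<comment> \<open>Coefficients of the combination z^H of the past samples minus its projection on
    sample k; the variance of this residual is the difference of the two sides.\<close>
  define A where "A j = (if j < k then cnj (z j) else - cnj s)" for j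
  have "0 \<le> rform (Suc k) A" by (rule r_psd)
  also have "\<dots> = rform k A + 2 * Re (\<Sum>j<k. A j * cnj (A k) * r (int j - int k)) + (cmod (A k))\<^sup>2"
    by (rule rform_Suc)
  also have "rform k A = rform k (\<lambda>j. cnj (z j))"
    unfolding hform_def by (intro arg_cong[where f=Re] sum.cong refl) (auto simp: A_def)
  also have "(\<Sum>j<k. A j * cnj (A k) * r (int j - int k)) = - (cnj s * s)"
    unfolding cs sum_distrib_right sum_negf[symmetric] by (intro sum.cong refl) (simp add: A_def mult_ac)
  also have "Re (- (cnj s * s)) = - (cmod s)\<^sup>2"
    by (simp only: mult.commute[of "cnj s"] complex_norm_square[symmetric] uminus_complex.simps Re_complex_of_real)
  finally show "(cmod s)\<^sup>2 \<le> rform k (\<lambda>j. cnj (z j))"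
    by (simp add: A_def)
qed

text \<open>Let M be the matrix inverted in the coherence form and z = M^{-1} D. As in the
  Sherman-Morrison formula, (q\<Delta> + I) z = (1 + qQ) D, so w = qz/(1 + qQ) solves the Wiener
  equation for past samples received at constant energy q. The value of the certificate is
  w^H(\<Delta> + I/q)w = D^H w = qQ/(1 + qQ), and one minus it is the prediction error 1/(1 +
  qQ).\<close>

lemma coh_form_certificate:
  fixes p :: real
  assumes p: "0 < p" and N: "0 < N" and k: "0 < k"
  defines "q \<equiv> real N * p" and "Q \<equiv> coh_form N r p k"
  shows "0 \<le> Q"
    and "\<exists>w. (\<forall>j<k. (\<Sum>l<k. r (int j - int l) * w l) + w j / of_real q = r (int j - int k)) \<and>
       rform k (\<lambda>j. cnj (w j)) + (\<Sum>j<k. (cmod (w j))\<^sup>2) / q = q * Q / (1 + q * Q)"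
proof -
  have q: "0 < q" using p N by (simp add: q_def)
  define D where "D = Dcol r k"
  define M where "M = of_real q \<cdot>\<^sub>m (Delta r (k - 1) - D * mat_adjoint D) + 1\<^sub>m k"
  have D: "D \<in> carrier_mat k 1" "\<And>i. i < k \<Longrightarrow> D $$ (i, 0) = r (int i - int k)"
    by (auto simp: D_def Dcol_def Delta_def)
  have Ds: "mat_adjoint D \<in> carrier_mat 1 k" "\<And>i. i < k \<Longrightarrow> mat_adjoint D $$ (0, i) = cnj (r (int i - int k))"
    using D by (auto simp: mat_adjoint_def mat_of_rows_def)
  have Dl: "Delta r (k - 1) \<in> carrier_mat k k" "\<And>i j. i < k \<Longrightarrow> j < k \<Longrightarrow> Delta r (k - 1) $$ (i, j) = r (int i - int j)"
    using k by (auto simp: Delta_def)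
  have DD: "(D * mat_adjoint D) $$ (i, j) = r (int i - int k) * cnj (r (int j - int k))" if "i < k" "j < k" for i j
    using that D Ds by (simp add: scalar_prod_def)
  have M: "M \<in> carrier_mat k k"
    unfolding M_def using D Ds Dl by simp
  have Mij: "M $$ (i, j) = of_real q * (r (int i - int j) - r (int i - int k) * cnj (r (int j - int k))) + (if i = j then 1 else 0)" if "i < k" "j < k" for i j
    unfolding M_def using that D(1) Ds(1) Dl DD[OF that] by simp
  have row: "(\<Sum>j<k. M $$ (i, j) * z j) = of_real q * ((\<Sum>j<k. r (int i - int j) * z j) - r (int i - int k) * (\<Sum>j<k. cnj (r (int j - int k)) * z j)) + z i"
    if i: "i < k" for i z
  proof -
    have "(\<Sum>j<k. M $$ (i, j) * z j) = (\<Sum>j<k. of_real q * (r (int i - int j) * z j) - of_real q * r (int i - int k) * (cnj (r (int j - int k)) * z j) + (if i = j then z j else 0))"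
      by (intro sum.cong refl) (use i in \<open>simp add: Mij algebra_simps\<close>)
    then show ?thesis
      using i by (simp add: sum.distrib sum_subtractf sum_distrib_left[symmetric] right_diff_distrib mult.assoc)
  qed
  \<comment> \<open>A kernel vector satisfies the prediction equation with t = 0, whose energy
    identity makes two nonnegative terms sum to 0. Invertibility gives
    \<open>the (mat_inverse ...)\<close> in the coherence form its intended value.\<close>
  have "Determinant.det M \<noteq> 0"
  proof
    assume "Determinant.det M = 0"
    then obtain v where v: "v \<in> carrier_vec k" "v \<noteq> 0\<^sub>v k" "M *\<^sub>v v = 0\<^sub>v k"
      using det_0_iff_vec_prod_zero_field[OF M] by blast
    have "(\<Sum>j<k. M $$ (i, j) * v $ j) = 0" if "i < k" for i
    proof -
      have "(M *\<^sub>v v) $ i = 0" using v(3) that by simp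
      then show ?thesis using that v(1) M by (simp add: scalar_prod_def lessThan_atLeast0)
    qed
    then have eq: "of_real q * ((\<Sum>j<k. r (int i - int j) * v $ j) - r (int i - int k) * (\<Sum>j<k. cnj (r (int j - int k)) * v $ j)) + v $ i = 0 * r (int i - int k)" if "i < k" for i
      using row[of i "\<lambda>j. v $ j"] that by simp
    note pe = prediction_equation[OF q eq refl]
    have "q * (rform k (\<lambda>j. cnj (v $ j)) - (cmod (\<Sum>j<k. cnj (r (int j - int k)) * v $ j))\<^sup>2) + (\<Sum>j<k. (cmod (v $ j))\<^sup>2) = 0"
      using pe(1) by (simp only: mult_zero_left of_real_eq_0_iff)
    moreover have "0 \<le> q * (rform k (\<lambda>j. cnj (v $ j)) - (cmod (\<Sum>j<k. cnj (r (int j - int k)) * v $ j))\<^sup>2)"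
      using pe(2) q by simp
    ultimately have "(\<Sum>j<k. (cmod (v $ j))\<^sup>2) = 0"
      using sum_nonneg[of "{..<k}" "\<lambda>j. (cmod (v $ j))\<^sup>2"] by simp
    then have "\<forall>j<k. v $ j = 0"
      by (subst (asm) sum_nonneg_eq_0_iff) auto
    then have "v = 0\<^sub>v k" using v(1) by (intro eq_vecI) auto
    then show False using v(2) by simp
  qed
  then have "M \<in> Units (ring_mat TYPE(complex) k ())"
    by (rule det_non_zero_imp_unit[OF M])
  then obtain B where B: "mat_inverse M = Some B"
    using mat_inverse(1)[OF M, where b="()"] by (cases "mat_inverse M") auto
  then have MB: "M * B = 1\<^sub>m k" and Bc: "B \<in> carrier_mat k k"
    using mat_inverse(2)[OF M B] by auto
  define z where "z i = (B * D) $$ (i, 0)" for i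
  define s where "s = (\<Sum>j<k. cnj (r (int j - int k)) * z j)"
  have "M * (B * D) = D"
    using M Bc D MB by (simp flip: assoc_mult_mat)
  then have "(M * (B * D)) $$ (i, 0) = r (int i - int k)" if "i < k" for i
    using D(2) that by simp
  then have "(\<Sum>j<k. M $$ (i, j) * z j) = r (int i - int k)" if "i < k" for i
    using that M Bc D(1) by (simp add: scalar_prod_def z_def lessThan_atLeast0)
  then have eq: "of_real q * ((\<Sum>j<k. r (int i - int j) * z j) - r (int i - int k) * s) + z i = 1 * r (int i - int k)" if "i < k" for i
    using that row[of i z] unfolding s_def by simp
  have "coh_form N r p k = Re ((mat_adjoint D * (B * D)) $$ (0, 0))"
    unfolding coh_form_def D_def[symmetric] q_def[symmetric] M_def[symmetric] B option.sel
    using Ds(1) Bc D(1) by (simp add: assoc_mult_mat)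
  also have "(mat_adjoint D * (B * D)) $$ (0, 0) = s"
    using Ds Bc D(1) by (simp add: scalar_prod_def s_def z_def lessThan_atLeast0)
  finally have Q: "Q = Re s" by (simp add: Q_def)
  note pe = prediction_equation[OF q eq s_def]
  define F where "F = rform k (\<lambda>j. cnj (z j))"
  define Z where "Z = (\<Sum>j<k. (cmod (z j))\<^sup>2)"
  have cs: "of_real (q * (F - (cmod s)\<^sup>2) + Z) = cnj s"
    using pe(1) unfolding F_def Z_def by simp
  have "s = cnj (cnj s)" by simp
  also have "\<dots> = of_real (q * (F - (cmod s)\<^sup>2) + Z)"
    unfolding cs[symmetric] by (rule complex_cnj_complex_of_real)
  \<comment> \<open>The energy identity equates the conjugate of s with a real number, so s is real
    and equals Q.\<close>
  finally have sr: "s = of_real Q" unfolding Q by (metis Re_complex_of_real)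
  then have Qe: "Q = q * (F - Q\<^sup>2) + Z"
    using cs by (metis Re_complex_of_real complex_cnj_complex_of_real norm_of_real power2_abs)
  have "Q\<^sup>2 \<le> F" using pe(2) unfolding F_def[symmetric] sr by simp
  then have "0 \<le> q * (F - Q\<^sup>2)" using q by simp
  moreover have "0 \<le> Z" by (simp add: Z_def sum_nonneg)
  ultimately show Qnn: "0 \<le> Q" using Qe by linarith
  then have pos: "0 < 1 + q * Q" using q by (simp add: add_pos_nonneg)
  define c where "c = q / (1 + q * Q)"
  define w where "w j = of_real c * z j" for j
  show "\<exists>w. (\<forall>j<k. (\<Sum>l<k. r (int j - int l) * w l) + w j / of_real q = r (int j - int k)) \<and>
       rform k (\<lambda>j. cnj (w j)) + (\<Sum>j<k. (cmod (w j))\<^sup>2) / q = q * Q / (1 + q * Q)"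
  proof (intro exI[of _ w] conjI allI impI)
    fix j assume j: "j < k"
    have "of_real q * (\<Sum>l<k. r (int j - int l) * z l) + z j = of_real (1 + q * Q) * r (int j - int k)"
      using eq[OF j] unfolding sr by (simp add: algebra_simps)
    moreover define u where "u = complex_of_real (1 / (1 + q * Q))"
    moreover have "u * of_real (1 + q * Q) = 1"
      unfolding u_def of_real_mult[symmetric] using pos by simp
    ultimately have u: "u * (of_real q * (\<Sum>l<k. r (int j - int l) * z l) + z j) = r (int j - int k)"
      by (simp only: mult.assoc[symmetric] mult_1_left)
    have "of_real c = of_real q * u"
      unfolding c_def u_def by simp
    then have "of_real c * ((\<Sum>l<k. r (int j - int l) * z l) + z j / of_real q) = r (int j - int k)"
      using q u by (simp add: algebra_simps)
    then show "(\<Sum>l<k. r (int j - int l) * w l) + w j / of_real q = r (int j - int k)"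
      unfolding w_def by (simp add: distrib_left sum_distrib_left mult_ac)
  next
    have "rform k (\<lambda>j. cnj (w j)) = c\<^sup>2 * F"
    proof -
      have "hform k (\<lambda>k l. r (int k - int l)) (\<lambda>j. cnj (w j)) = of_real (c\<^sup>2) * hform k (\<lambda>k l. r (int k - int l)) (\<lambda>j. cnj (z j))"
        unfolding hform_def sum_distrib_left w_def by (intro sum.cong refl) (simp add: power2_eq_square mult_ac)
      then show ?thesis unfolding F_def by simp
    qed
    moreover have "(\<Sum>j<k. (cmod (w j))\<^sup>2) = c\<^sup>2 * Z"
      unfolding w_def Z_def by (simp add: norm_mult power_mult_distrib sum_distrib_left)
    moreover have "c\<^sup>2 * F + c\<^sup>2 * Z / q = c\<^sup>2 / q * (q * F + Z)"
      using q by (simp add: field_simps)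
    moreover have "q * F + Z = Q * (1 + q * Q)"
      using Qe by (simp add: algebra_simps power2_eq_square)
    moreover have "c\<^sup>2 / q * (Q * (1 + q * Q)) = q * Q / (1 + q * Q)"
      using q pos unfolding c_def by (simp add: power2_eq_square)
    ultimately show "rform k (\<lambda>j. cnj (w j)) + (\<Sum>j<k. (cmod (w j))\<^sup>2) / q = q * Q / (1 + q * Q)"
      by simp
  qed
qed

text \<open>More past cannot hurt prediction. The optimal filter for k past samples, delayed by one
  step, is a linear estimator from k + 1 past samples that ignores the oldest one; by the
  certificate for k + 1 its error is at least the optimal one. As 1 - qQ/(1 + qQ) decreases in Q,
  the forms increase.\<close>

lemma coh_form_Suc_mono:
  assumes p: "0 < p" and N: "0 < N" and k: "0 < k"
  shows "coh_form N r p k \<le> coh_form N r p (Suc k)"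
proof -
  define q where "q = real N * p"
  have q: "0 < q" using p N by (simp add: q_def)
  obtain w where w: "\<And>j. j < k \<Longrightarrow> (\<Sum>l<k. r (int j - int l) * w l) + w j / of_real q = r (int j - int k)"
    and wv: "rform k (\<lambda>j. cnj (w j)) + (\<Sum>j<k. (cmod (w j))\<^sup>2) / q = q * coh_form N r p k / (1 + q * coh_form N r p k)"
    using coh_form_certificate(2)[OF p N k] unfolding q_def by blast
  obtain w' where w': "\<And>j. j < Suc k \<Longrightarrow> (\<Sum>l<Suc k. r (int j - int l) * w' l) + w' j / of_real q = r (int j - int (Suc k))"
    and wv': "rform (Suc k) (\<lambda>j. cnj (w' j)) + (\<Sum>j<Suc k. (cmod (w' j))\<^sup>2) / q = q * coh_form N r p (Suc k) / (1 + q * coh_form N r p (Suc k))"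
    using coh_form_certificate(2)[OF p N, of "Suc k"] unfolding q_def by blast
  define A where "A j = (if j < k then - cnj (w j) else 1)" for j
  define A' where "A' j = (case j of 0 \<Rightarrow> 0 | Suc i \<Rightarrow> A i)" for j
  let ?f = "rform k (\<lambda>j. cnj (w j))" and ?W = "\<Sum>j<k. (cmod (w j))\<^sup>2"
  have rA: "rform (Suc k) A = ?f - 2 * (?f + ?W / q) + 1"
  proof -
    have "rform k A = ?f"
      unfolding hform_def by (intro arg_cong[where f=Re] sum.cong refl) (simp add: A_def)
    moreover have "(\<Sum>j<k. A j * cnj (A k) * r (int j - int k)) = - of_real (?f + ?W / q)"
    proof -
      have "(\<Sum>j<k. A j * cnj (A k) * r (int j - int k)) = - (\<Sum>j<k. cnj (w j) * (\<Sum>l<k. r (int j - int l) * w l)) - (\<Sum>j<k. of_real ((cmod (w j))\<^sup>2)) / of_real q"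
        unfolding sum_divide_distrib sum_negf[symmetric] sum_subtractf[symmetric]
      proof (intro sum.cong refl)
        fix j assume j: "j \<in> {..<k}"
        have *: "- c * (S + x / y) = - (c * S) - x * c / y" for c S x y :: complex
          by (simp add: algebra_simps)
        have "A j * cnj (A k) * r (int j - int k) = - cnj (w j) * ((\<Sum>l<k. r (int j - int l) * w l) + w j / of_real q)"
          using j w[of j] by (simp add: A_def)
        then show "A j * cnj (A k) * r (int j - int k) = - (cnj (w j) * (\<Sum>l<k. r (int j - int l) * w l)) - of_real ((cmod (w j))\<^sup>2) / of_real q"
          unfolding complex_norm_square by (simp only: *)
      qed
      also have "(\<Sum>j<k. cnj (w j) * (\<Sum>l<k. r (int j - int l) * w l)) = of_real ?f"
        unfolding hform_real[symmetric] unfolding hform_def sum_distrib_left by (simp add: mult_ac)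
      finally show ?thesis by simp
    qed
    moreover have "Re (- of_real (?f + ?W / q)) = - (?f + ?W / q)"
      by (simp del: of_real_add)
    ultimately show ?thesis
      unfolding rform_Suc by (simp add: A_def)
  qed
  have nz: "complex_of_real (sqrt q) \<noteq> 0" using q by simp
  \<comment> \<open>Constant energy q is modelled by one subcarrier per symbol with gain sqrt(q), so
    the noise coefficients are those of \<open>A'\<close> divided by sqrt(q).\<close>
  have "(cmod (A' (Suc k)))\<^sup>2 * (1 - (rform (Suc k) (\<lambda>j. cnj (w' j)) + (\<Sum>j<Suc k. (cmod (w' j))\<^sup>2 * (\<Sum>m<Suc 0. (cmod (of_real (sqrt q) :: complex))\<^sup>2) / q\<^sup>2)))
      \<le> rform (Suc (Suc k)) A' + (\<Sum>j<Suc k. \<Sum>m<Suc 0. (cmod (A' j / of_real (sqrt q)))\<^sup>2)"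
    by (rule estimation_error_ge[OF w' q]) (use q in simp_all)
  moreover have "rform (Suc (Suc k)) A' = rform (Suc k) A"
    by (subst hform_shift_index) (simp_all add: A'_def)
  moreover have "(\<Sum>j<Suc k. \<Sum>m<Suc 0. (cmod (A' j / of_real (sqrt q)))\<^sup>2) = ?W / q"
    unfolding sum.lessThan_Suc_shift[of _ k] using q
    by (simp add: A'_def A_def norm_divide power_divide sum_divide_distrib)
  moreover have "(\<Sum>j<Suc k. (cmod (w' j))\<^sup>2 * (\<Sum>m<Suc 0. (cmod (of_real (sqrt q) :: complex))\<^sup>2) / q\<^sup>2) = (\<Sum>j<Suc k. (cmod (w' j))\<^sup>2) / q"
    unfolding sum_divide_distrib using q by (intro sum.cong refl) (simp add: power2_eq_square)
  ultimately have "1 - q * coh_form N r p (Suc k) / (1 + q * coh_form N r p (Suc k)) \<le> 1 - q * coh_form N r p k / (1 + q * coh_form N r p k)"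
    using wv wv' unfolding rA by (simp add: A'_def A_def)
  moreover have "0 \<le> q * coh_form N r p k" "0 \<le> q * coh_form N r p (Suc k)"
    using coh_form_certificate(1)[OF p N] k q by simp_all
  ultimately have "q * coh_form N r p k \<le> q * coh_form N r p (Suc k)"
    by (simp add: frac_le_eq divide_simps)
  then show ?thesis using q by simp
qed

text \<open>Monotonicity makes the \<open>lim\<close> in the coherence time a genuine limit in the
  extended reals, the supremum over k \<ge> 1. It may be infinite: for constant autocorrelation the
  form at k equals k.\<close>

lemma coh_form_limit:
  assumes p: "0 < p" and N: "0 < N"
  defines "Q \<equiv> lim (\<lambda>k. ereal (coh_form N r p k))"
  shows "0 < k \<Longrightarrow> ereal (coh_form N r p k) \<le> Q" and "0 \<le> Q"
proof -
  have inc: "incseq (\<lambda>k. ereal (coh_form N r p (Suc k)))"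
    by (intro incseq_SucI) (use coh_form_Suc_mono[OF p N] in simp)
  then have "(\<lambda>k. ereal (coh_form N r p (Suc k))) \<longlonglongrightarrow> (SUP k. ereal (coh_form N r p (Suc k)))"
    by (rule LIMSEQ_SUP)
  then have "(\<lambda>k. ereal (coh_form N r p k)) \<longlonglongrightarrow> (SUP k. ereal (coh_form N r p (Suc k)))"
    by (rule LIMSEQ_imp_Suc)
  then have Q: "Q = (SUP k. ereal (coh_form N r p (Suc k)))"
    unfolding Q_def by (rule limI)
  show *: "ereal (coh_form N r p k) \<le> Q" if "0 < k" for k
    unfolding Q using that by (cases k) (auto intro: SUP_upper)
  have "0 \<le> ereal (coh_form N r p 1)" using coh_form_certificate(1)[OF p N, of 1] by simp
  then show "0 \<le> Q" using *[of 1] by (rule order_trans) simp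
qed

end

section \<open>Moments of the channel\<close>

context prob_space
begin

text \<open>The degenerate case is separate; there both sides of the last equation are 1. The
  characteristic function at the single point 1 suffices, because multiples of the combinations
  considered are Gaussian as well.\<close>

lemma gaussian_rv_moments:
  assumes "gaussian_rv M X"
  shows "integrable M X" "integrable M (\<lambda>\<omega>. (X \<omega>)\<^sup>2)"
    and "(\<integral>\<omega>. iexp (X \<omega> - expectation X) \<partial>M) = of_real (exp (- (variance X / 2)))"
proof -
  have X[measurable]: "X \<in> borel_measurable M" using assms by (simp add: gaussian_rv_def)
  have "integrable M X \<and> integrable M (\<lambda>\<omega>. (X \<omega>)\<^sup>2) \<and> (\<integral>\<omega>. iexp (X \<omega> - expectation X) \<partial>M) = of_real (exp (- (variance X / 2)))"
  proof (cases "\<exists>m. AE \<omega> in M. X \<omega> = m")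
    case True
    then obtain m where m: "AE \<omega> in M. X \<omega> = m" by blast
    have 1: "integrable M X" by (subst integrable_cong_AE[where g="\<lambda>_. m"]) (use m in auto)
    have 2: "integrable M (\<lambda>\<omega>. (X \<omega>)\<^sup>2)" by (subst integrable_cong_AE[where g="\<lambda>_. m\<^sup>2"]) (use m in auto)
    have e: "expectation X = m"
      by (subst integral_cong_AE[where g="\<lambda>_. m"]) (use m in \<open>auto simp: prob_space\<close>)
    have "(\<integral>\<omega>. iexp (X \<omega> - m) \<partial>M) = (\<integral>\<omega>. 1 \<partial>M)"
      by (intro integral_cong_AE) (use m in auto)
    moreover have "expectation (\<lambda>\<omega>. (X \<omega> - m)\<^sup>2) = expectation (\<lambda>_. 0)"
      by (intro integral_cong_AE) (use m in auto)
    ultimately show ?thesis using 1 2 e by (simp add: prob_space)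
  next
    case False
    then obtain \<mu> \<sigma> where \<sigma>: "0 < \<sigma>" and D: "distributed M lborel X (\<lambda>x. ennreal (normal_density \<mu> \<sigma> x))"
      using assms unfolding gaussian_rv_def by blast
    have 1: "integrable M X"
      using distributed_integrable[OF D, of "\<lambda>x. x"] integrable_normal_moment_nz_1[OF \<sigma>, of \<mu>] by simp
    have "integrable M (\<lambda>\<omega>. (X \<omega> - \<mu>)\<^sup>2)"
      using distributed_integrable[OF D, of "\<lambda>x. (x - \<mu>)\<^sup>2"] integrable_normal_moment[OF \<sigma>, of \<mu> 2] by simp
    then have "integrable M (\<lambda>\<omega>. (X \<omega> - \<mu>)\<^sup>2 + (2 * \<mu> * X \<omega> - \<mu>\<^sup>2))"
      using 1 by (intro Bochner_Integration.integrable_add Bochner_Integration.integrable_diff) auto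
    moreover have "(x - \<mu>)\<^sup>2 + (2 * \<mu> * x - \<mu>\<^sup>2) = x\<^sup>2" for x
      by (simp add: power2_eq_square algebra_simps)
    ultimately have 2: "integrable M (\<lambda>\<omega>. (X \<omega>)\<^sup>2)" by simp
    have e: "expectation X = \<mu>" by (rule normal_distributed_expectation[OF \<sigma> D])
    have v: "variance X = \<sigma>\<^sup>2" by (rule normal_distributed_variance[OF \<sigma> D])
    have "(\<integral>\<omega>. iexp (X \<omega> - \<mu>) \<partial>M) = (\<integral>\<omega>. iexp (- \<mu>) * iexp (1 * X \<omega>) \<partial>M)"
      unfolding exp_add[symmetric] by (simp add: algebra_simps)
    also have "\<dots> = iexp (- \<mu>) * exp (\<i> * of_real (1 * \<mu>) - of_real (\<sigma>\<^sup>2 * 1\<^sup>2 / 2))"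
      unfolding integral_mult_right_zero normal_distributed_char[OF \<sigma> D] ..
    also have "\<dots> = of_real (exp (- (\<sigma>\<^sup>2 / 2)))"
      unfolding exp_add[symmetric] by (simp add: exp_of_real[symmetric])
    finally show ?thesis using 1 2 unfolding v unfolding e by simp
  qed
  then show "integrable M X" "integrable M (\<lambda>\<omega>. (X \<omega>)\<^sup>2)"
    and "(\<integral>\<omega>. iexp (X \<omega> - expectation X) \<partial>M) = of_real (exp (- (variance X / 2)))"
    by auto
qed

lemma jointly_proper_gaussian_square_integrable:
  assumes J: "jointly_proper_gaussian M I Z" and i: "i \<in> I"
  shows "Z i \<in> borel_measurable M" "integrable M (Z i)" "integrable M (\<lambda>\<omega>. (cmod (Z i \<omega> - c))\<^sup>2)"
proof -
  show Zm[measurable]: "Z i \<in> borel_measurable M"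
    using J i by (simp add: jointly_proper_gaussian_def)
  have g: "gaussian_rv M (\<lambda>\<omega>. Re (\<Sum>j\<in>{i}. a j * Z j \<omega>))" for a
    using J i unfolding jointly_proper_gaussian_def by (meson bot_least finite.intros insert_subsetI)
  have R: "gaussian_rv M (\<lambda>\<omega>. Re (Z i \<omega>))" using g[of "\<lambda>_. 1"] by simp
  have I: "gaussian_rv M (\<lambda>\<omega>. Im (Z i \<omega>))" using g[of "\<lambda>_. - \<i>"] by simp
  have "integrable M (\<lambda>\<omega>. of_real (Re (Z i \<omega>)) + \<i> * of_real (Im (Z i \<omega>)))"
    using gaussian_rv_moments(1)[OF R] gaussian_rv_moments(1)[OF I] by (intro Bochner_Integration.integrable_add integrable_mult_right) auto
  then show 1: "integrable M (Z i)" by (simp add: complex_eq[symmetric])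
  have "integrable M (\<lambda>\<omega>. (Re (Z i \<omega>))\<^sup>2 + (Im (Z i \<omega>))\<^sup>2)"
    using gaussian_rv_moments(2)[OF R] gaussian_rv_moments(2)[OF I] by simp
  then have "integrable M (\<lambda>\<omega>. (cmod (Z i \<omega>))\<^sup>2)" by (simp add: cmod_power2)
  moreover have "integrable M (\<lambda>\<omega>. Re (cnj c * Z i \<omega>))"
    using 1 by (intro integrable_Re integrable_mult_right)
  ultimately show "integrable M (\<lambda>\<omega>. (cmod (Z i \<omega> - c))\<^sup>2)"
    unfolding cmod_diff_power2 by (intro Bochner_Integration.integrable_add Bochner_Integration.integrable_diff integrable_mult_right) auto
qed

text \<open>Properness lets the covariance alone determine the centred law: with E[U U] = 0, the
  real part of the centred combination U has half of E|U|^2 as variance, and the normal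
  characteristic function contributes another half, whence the factor 1/4.\<close>

lemma jointly_proper_gaussian_char:
  assumes J: "jointly_proper_gaussian M I Z" and A: "finite A" "A \<subseteq> I"
  shows "(\<integral>\<omega>. iexp (Re (\<Sum>i\<in>A. a i * (Z i \<omega> - (\<integral>\<xi>. Z i \<xi> \<partial>M)))) \<partial>M)
      = exp (of_real (- Re (\<Sum>i\<in>A. \<Sum>j\<in>A. a i * cnj (a j) * ccov M (Z i) (Z j)) / 4))"
proof -
  define m where "m i = (\<integral>\<xi>. Z i \<xi> \<partial>M)" for i
  define V where "V i \<omega> = Z i \<omega> - m i" for i \<omega>
  define U where "U \<omega> = (\<Sum>i\<in>A. a i * V i \<omega>)" for \<omega>
  define X where "X \<omega> = Re (\<Sum>i\<in>A. a i * Z i \<omega>)" for \<omega>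
  have X: "gaussian_rv M X"
    using J A unfolding X_def jointly_proper_gaussian_def by blast
  have Zi: "integrable M (Z i)" and Vm[measurable]: "V i \<in> borel_measurable M" and V2: "integrable M (\<lambda>\<omega>. (cmod (V i \<omega>))\<^sup>2)" if "i \<in> A" for i
    using jointly_proper_gaussian_square_integrable(1,2)[OF J, of i] jointly_proper_gaussian_square_integrable(3)[OF J, of i "m i"] that A(2)
    by (auto simp: V_def[abs_def])
  have "complex_of_real (expectation X) = of_real (Re (\<Sum>i\<in>A. a i * m i))"
  proof -
    have "integrable M (\<lambda>\<omega>. \<Sum>i\<in>A. a i * Z i \<omega>)" using Zi by (intro Bochner_Integration.integrable_sum integrable_mult_right)
    then have "expectation X = Re (\<integral>\<omega>. (\<Sum>i\<in>A. a i * Z i \<omega>) \<partial>M)" unfolding X_def by (rule integral_Re)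
    also have "(\<integral>\<omega>. (\<Sum>i\<in>A. a i * Z i \<omega>) \<partial>M) = (\<Sum>i\<in>A. a i * m i)"
      using Zi by (subst Bochner_Integration.integral_sum) (auto simp: m_def)
    finally show ?thesis by simp
  qed
  then have EX: "expectation X = Re (\<Sum>i\<in>A. a i * m i)" by (simp only: of_real_eq_iff)
  have XU: "X \<omega> - expectation X = Re (U \<omega>)" for \<omega>
    unfolding EX X_def U_def V_def by (simp only: minus_complex.simps[symmetric] sum_subtractf[symmetric] right_diff_distrib)
  have i1: "integrable M (\<lambda>\<omega>. V i \<omega> * cnj (V j \<omega>))" if "i \<in> A" "j \<in> A" for i j
    using that by (intro integrable_mult_cnj V2) auto
  have i2: "integrable M (\<lambda>\<omega>. V i \<omega> * V j \<omega>)" if "i \<in> A" "j \<in> A" for i j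
    using integrable_mult_cnj[where f="V i" and g="\<lambda>\<omega>. cnj (V j \<omega>)" and M=M] V2[OF that(1)] V2[OF that(2)] that by simp
  have e1: "U \<omega> * cnj (U \<omega>) = (\<Sum>i\<in>A. \<Sum>j\<in>A. a i * cnj (a j) * (V i \<omega> * cnj (V j \<omega>)))" for \<omega>
    unfolding U_def cnj_sum sum_product by (simp add: mult_ac)
  have e2: "U \<omega> * U \<omega> = (\<Sum>i\<in>A. \<Sum>j\<in>A. a i * a j * (V i \<omega> * V j \<omega>))" for \<omega>
    unfolding U_def sum_product by (simp add: mult_ac)
  have I1: "integrable M (\<lambda>\<omega>. U \<omega> * cnj (U \<omega>))" and I2: "integrable M (\<lambda>\<omega>. U \<omega> * U \<omega>)"
    unfolding e1 e2 using i1 i2 by (auto intro!: Bochner_Integration.integrable_sum)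
  have cc: "ccov M (Z i) (Z j) = (\<integral>\<omega>. V i \<omega> * cnj (V j \<omega>) \<partial>M)" for i j
    by (simp add: ccov_def V_def m_def)
  have "(\<integral>\<omega>. U \<omega> * cnj (U \<omega>) \<partial>M) = (\<Sum>i\<in>A. \<Sum>j\<in>A. a i * cnj (a j) * ccov M (Z i) (Z j))"
    unfolding e1 cc using i1
    by (simp add: Bochner_Integration.integral_sum Bochner_Integration.integrable_sum)
  moreover have "(\<integral>\<omega>. U \<omega> * U \<omega> \<partial>M) = 0"
  proof -
    have "(\<integral>\<omega>. V i \<omega> * V j \<omega> \<partial>M) = 0" if "i \<in> A" "j \<in> A" for i j
      using J that A(2) unfolding jointly_proper_gaussian_def pseudo_cov_def V_def m_def by blast
    then show ?thesis
      unfolding e2 using i2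
      by (simp add: Bochner_Integration.integral_sum Bochner_Integration.integrable_sum)
  qed
  moreover have "(Re (U \<omega>))\<^sup>2 = (Re (U \<omega> * cnj (U \<omega>)) + Re (U \<omega> * U \<omega>)) / 2" for \<omega>
    by (simp add: power2_eq_square)
  then have "variance X = (Re (\<integral>\<omega>. U \<omega> * cnj (U \<omega>) \<partial>M) + Re (\<integral>\<omega>. U \<omega> * U \<omega> \<partial>M)) / 2"
    unfolding XU using I1 I2 by (simp only: integral_divide_zero Bochner_Integration.integral_add integrable_Re integral_Re)
  ultimately have "variance X = Re (\<Sum>i\<in>A. \<Sum>j\<in>A. a i * cnj (a j) * ccov M (Z i) (Z j)) / 2"
    by simp
  then show ?thesis
    using gaussian_rv_moments(3)[OF X] unfolding XU unfolding U_def V_def m_def exp_of_real by simp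
qed

end

lemma sum_flatten:
  fixes f :: "nat \<Rightarrow> 'b::comm_monoid_add"
  shows "(\<Sum>i<n * N. f i) = (\<Sum>k<n. \<Sum>m<N. f (k * N + m))"
proof -
  have "sum f {k * N..<k * N + N} = (\<Sum>m<N. f (k * N + m))" for k
    using sum.shift_bounds_nat_ivl[of f 0 "k * N" N] by (simp add: lessThan_atLeast0 add.commute)
  then show ?thesis using sum.nat_group[of f N n] by simp
qed

lemma norm_dft: "0 < N \<Longrightarrow> (cmod (dft N m n))\<^sup>2 = 1 / real N"
proof -
  assume N: "0 < N"
  have "- 2 * complex_of_real pi * \<i> * of_nat m * of_nat n / of_nat N = \<i> * of_real (- 2 * pi * real m * real n / real N)"
    by simp
  then have "cmod (exp (- 2 * of_real pi * \<i> * of_nat m * of_nat n / of_nat N)) = 1"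
    by (metis norm_exp_i_times)
  then show ?thesis using N by (simp add: dft_def norm_divide power_divide)
qed

section \<open>Second-order statistics of taps, subcarriers and signals\<close>

context ofdm_channel
begin

lemma N_pos: "0 < N" using L_ge_1 L_le_N by simp

sublocale psd_autocorrelation r
  by (rule psd_autocorrelationI[OF Delta_unit_diag Delta_psd])

abbreviation tap :: "nat \<Rightarrow> nat \<Rightarrow> 'w \<Rightarrow> complex" where
  "tap k l \<omega> \<equiv> impulse_response N L h k \<omega> l"

abbreviation freq :: "nat \<Rightarrow> nat \<Rightarrow> 'w \<Rightarrow> complex" where
  "freq k m \<omega> \<equiv> freq_response N L h k m \<omega>"

definition tap_mean :: "nat \<Rightarrow> complex" where
  "tap_mean l = (\<integral>\<omega>. tap 0 l \<omega> \<partial>P)"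

definition tap_var :: "nat \<Rightarrow> real" where
  "tap_var l = CH $$ (l, l)"

lemma tap_measurable[measurable]: "l < N \<Longrightarrow> tap k l \<in> borel_measurable P"
  and tap_integrable: "l < N \<Longrightarrow> integrable P (tap k l)"
  and tap_square_integrable: "l < N \<Longrightarrow> integrable P (\<lambda>\<omega>. (cmod (tap k l \<omega> - c))\<^sup>2)"
  using jointly_proper_gaussian_square_integrable[OF gaussian, of "(k, l)"] by auto

lemma tap_expectation: "l < N \<Longrightarrow> (\<integral>\<omega>. tap k l \<omega> \<partial>P) = tap_mean l"
  unfolding tap_mean_def by (rule mean_const)

text \<open>One entry is read off the Kronecker product; any horizon that contains both times
  serves.\<close>

lemma tap_ccov:
  assumes l: "l < N" "l' < N"
  shows "ccov P (tap k l) (tap k' l') = (if l = l' then r (int k - int k') * of_real (tap_var l) else 0)"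
proof -
  define K where "K = max k k'"
  have a: "k * N + l < (K + 1) * N" "k' * N + l' < (K + 1) * N"
  proof -
    have "k * N + l < (k + 1) * N" "k' * N + l' < (k' + 1) * N" using l by auto
    moreover have "(k + 1) * N \<le> (K + 1) * N" "(k' + 1) * N \<le> (K + 1) * N"
      unfolding K_def by (intro mult_right_mono; simp)+
    ultimately show "k * N + l < (K + 1) * N" "k' * N + l' < (K + 1) * N" by linarith+
  qed
  have CH: "CH $$ (l, l') = (if l = l' then tap_var l else 0)"
    using CH_diagonal CH_carrier l unfolding diagonal_mat_def tap_var_def by auto
  have "ccov P (tap k l) (tap k' l') = stacked_cov P N (impulse_response N L h) K $$ (k * N + l, k' * N + l')"
    using a l by (simp add: stacked_cov_def)
  also have "\<dots> = Delta r K $$ (k, k') * of_real (CH $$ (l, l'))"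
    unfolding covariance kronecker_def using a l CH_carrier by (simp add: Delta_def)
  also have "Delta r K $$ (k, k') = r (int k - int k')"
    by (simp add: Delta_def K_def)
  finally show ?thesis unfolding CH by simp
qed

definition freq_mean :: "nat \<Rightarrow> complex" where
  "freq_mean m = (\<Sum>l<N. cnj (dft N l m) * tap_mean l)"

lemma freq_eq: "freq k m \<omega> = (\<Sum>l<N. cnj (dft N l m) * tap k l \<omega>)"
  unfolding freq_response_def ..

lemma freq_measurable[measurable]: "freq k m \<in> borel_measurable P"
  unfolding freq_eq by measurable

lemma freq_expectation: "(\<integral>\<omega>. freq k m \<omega> \<partial>P) = freq_mean m"
  unfolding freq_eq freq_mean_def
  by (subst Bochner_Integration.integral_sum) (auto simp: tap_integrable tap_expectation)

text \<open>The frequency-flat mean enters here: with at most one nonzero tap mean, and DFT entries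
  of equal modulus, the mean gain is the same on every subcarrier.\<close>

lemma norm_freq_mean: "(cmod (freq_mean m))\<^sup>2 = mean_gain P N L h"
proof -
  have *: "(cmod (freq_mean m))\<^sup>2 = (\<Sum>l<N. (cmod (tap_mean l))\<^sup>2) / real N" for m
  proof -
    define S where "S = {l. l < N \<and> tap_mean l \<noteq> 0}"
    have S: "card S \<le> 1" "finite S" using mean_flat by (simp_all add: S_def tap_mean_def)
    have "freq_mean m = (\<Sum>l\<in>S. cnj (dft N l m) * tap_mean l)"
      unfolding freq_mean_def by (intro sum.mono_neutral_right) (auto simp: S_def)
    moreover have "(\<Sum>l<N. (cmod (tap_mean l))\<^sup>2) = (\<Sum>l\<in>S. (cmod (tap_mean l))\<^sup>2)"
      by (intro sum.mono_neutral_right) (auto simp: S_def)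
    moreover have "S = {} \<or> (\<exists>l. S = {l})"
      using S by (metis One_nat_def card_0_eq card_1_singletonE le_Suc_eq le_zero_eq)
    ultimately show ?thesis
      using norm_dft[OF N_pos] by (auto simp: norm_mult power_mult_distrib)
  qed
  show ?thesis
    unfolding mean_gain_def freq_expectation * ..
qed

text \<open>The coefficient with which tap l enters component m of received symbol k. The factor
  sqrt(N) cancels the modulus of the DFT entry, so every tap sees the same input energies.\<close>

definition gain :: "(nat \<Rightarrow> nat \<Rightarrow> complex) \<Rightarrow> nat \<Rightarrow> nat \<Rightarrow> nat \<Rightarrow> complex" where
  "gain x l k m = of_real (sqrt (real N)) * x k m * cnj (dft N l m)"

definition signal :: "(nat \<Rightarrow> nat \<Rightarrow> complex) \<Rightarrow> nat \<Rightarrow> nat \<Rightarrow> 'w \<Rightarrow> complex" where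
  "signal x k m \<omega> = of_real (sqrt (real N)) * freq k m \<omega> * x k m"

definition signal_mean :: "(nat \<Rightarrow> nat \<Rightarrow> complex) \<Rightarrow> nat \<Rightarrow> nat \<Rightarrow> complex" where
  "signal_mean x k m = of_real (sqrt (real N)) * freq_mean m * x k m"

definition signal_cov :: "(nat \<Rightarrow> nat \<Rightarrow> complex) \<Rightarrow> nat \<Rightarrow> nat \<Rightarrow> complex" where
  "signal_cov x i j = (\<Sum>l<N. of_real (tap_var l) * r (int (i div N) - int (j div N))
      * gain x l (i div N) (i mod N) * cnj (gain x l (j div N) (j mod N)))"

lemma norm_gain: "(cmod (gain x l k m))\<^sup>2 = (cmod (x k m))\<^sup>2"
  using norm_dft[OF N_pos] N_pos by (simp add: gain_def norm_mult power_mult_distrib)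

lemma signal_measurable[measurable]: "signal x k m \<in> borel_measurable P"
  unfolding signal_def by measurable

lemma signal_centred: "signal x k m \<omega> - signal_mean x k m = (\<Sum>l<N. gain x l k m * (tap k l \<omega> - tap_mean l))"
  unfolding signal_def signal_mean_def freq_eq freq_mean_def gain_def
  by (simp add: sum_distrib_left sum_distrib_right sum_subtractf algebra_simps)

lemma signal_cov_herm: "signal_cov x j i = cnj (signal_cov x i j)"
  unfolding signal_cov_def by (simp add: r_herm'[symmetric] mult_ac)

lemma tap_var_nonneg: "l < N \<Longrightarrow> 0 \<le> tap_var l"
  unfolding tap_var_def by (rule CH_nonneg)

lemma sum_tap_var: "(\<Sum>l<N. tap_var l) = 1"
  unfolding tap_var_def by (rule CH_trace)

lemma signal_cov_diag: "signal_cov x i i = of_real ((cmod (x (i div N) (i mod N)))\<^sup>2)"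
proof -
  have "signal_cov x i i = (\<Sum>l<N. of_real (tap_var l) * of_real ((cmod (x (i div N) (i mod N)))\<^sup>2))"
    unfolding signal_cov_def
    by (simp add: r_zero mult.assoc complex_norm_square[symmetric] norm_gain del: of_real_power)
  then show ?thesis
    using sum_tap_var by (simp flip: sum_distrib_right of_real_sum)
qed

text \<open>Uncorrelated taps with a common autocorrelation: the variance of a combination of
  received signal components is an average, with the weights \<open>tap_var\<close> of sum 1, of
  variances for one scalar fading process. Bounds for the scalar process therefore carry over to the
  channel.\<close>

lemma hform_signal_cov:
  "hform (n * N) (signal_cov x) a
    = (\<Sum>l<N. of_real (tap_var l * rform n (\<lambda>k. \<Sum>m<N. a (k * N + m) * gain x l k m)))"
proof -
  have "hform (n * N) (signal_cov x) a = (\<Sum>k<n. \<Sum>m<N. \<Sum>k'<n. \<Sum>m'<N. \<Sum>l<N. of_real (tap_var l) *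
      ((a (k * N + m) * gain x l k m) * cnj (a (k' * N + m') * gain x l k' m') * r (int k - int k')))"
    unfolding hform_def sum_flatten signal_cov_def sum_distrib_left
    by (intro sum.cong refl) (simp add: mult_ac)
  also have "\<dots> = (\<Sum>l<N. \<Sum>k<n. \<Sum>k'<n. \<Sum>m<N. \<Sum>m'<N. of_real (tap_var l) *
      ((a (k * N + m) * gain x l k m) * cnj (a (k' * N + m') * gain x l k' m') * r (int k - int k')))"
  proof -
    have "(\<Sum>k<n. \<Sum>m<N. \<Sum>k'<n. \<Sum>m'<N. \<Sum>l<N. f k m k' m' l) = (\<Sum>l<N. \<Sum>k<n. \<Sum>k'<n. \<Sum>m<N. \<Sum>m'<N. f k m k' m' l)"
      for f :: "nat \<Rightarrow> nat \<Rightarrow> nat \<Rightarrow> nat \<Rightarrow> nat \<Rightarrow> complex"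
    proof -
      have "(\<Sum>k<n. \<Sum>m<N. \<Sum>k'<n. \<Sum>m'<N. \<Sum>l<N. f k m k' m' l) = (\<Sum>k<n. \<Sum>k'<n. \<Sum>m<N. \<Sum>m'<N. \<Sum>l<N. f k m k' m' l)"
        by (intro sum.cong refl sum.swap)
      also have "\<dots> = (\<Sum>k<n. \<Sum>k'<n. \<Sum>m<N. \<Sum>l<N. \<Sum>m'<N. f k m k' m' l)"
        by (intro sum.cong refl sum.swap)
      also have "\<dots> = (\<Sum>k<n. \<Sum>k'<n. \<Sum>l<N. \<Sum>m<N. \<Sum>m'<N. f k m k' m' l)"
        by (intro sum.cong refl sum.swap)
      also have "\<dots> = (\<Sum>k<n. \<Sum>l<N. \<Sum>k'<n. \<Sum>m<N. \<Sum>m'<N. f k m k' m' l)"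
        by (intro sum.cong refl sum.swap)
      also have "\<dots> = (\<Sum>l<N. \<Sum>k<n. \<Sum>k'<n. \<Sum>m<N. \<Sum>m'<N. f k m k' m' l)"
        by (rule sum.swap)
      finally show ?thesis .
    qed
    then show ?thesis .
  qed
  also have "\<dots> = (\<Sum>l<N. of_real (tap_var l) * hform n (\<lambda>k l. r (int k - int l)) (\<lambda>k. \<Sum>m<N. a (k * N + m) * gain x l k m))"
  proof -
    have "(\<Sum>m<N. \<Sum>m'<N. t * (f m * cnj (g m') * w)) = t * ((\<Sum>m<N. f m) * cnj (\<Sum>m'<N. g m') * w)"
      for t w :: complex and f g :: "nat \<Rightarrow> complex"
      unfolding cnj_sum sum_product
      unfolding sum_distrib_left sum_distrib_right ..
    then show ?thesis
      unfolding hform_def sum_distrib_left by (simp only:)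
  qed
  finally show ?thesis
    by (simp only: of_real_sum of_real_mult hform_real[symmetric])
qed

text \<open>Given the input, the centred signal is linear in the centred taps, so its joint
  characteristic function is that of the taps at the coefficients \<open>c\<close>, the input
  coefficients filtered by the gains.\<close>

lemma signal_char:
  "(\<integral>\<omega>. iexp (Re (\<Sum>i<n * N. a i * (signal x (i div N) (i mod N) \<omega> - signal_mean x (i div N) (i mod N)))) \<partial>P)
   = exp (of_real (- Re (hform (n * N) (signal_cov x) a) / 4))"
proof -
  define c where "c = (\<lambda>(k, l). \<Sum>m<N. a (k * N + m) * gain x l k m)"
  let ?A = "{..<n} \<times> {..<N}"
  have e: "(\<Sum>i<n * N. a i * (signal x (i div N) (i mod N) \<omega> - signal_mean x (i div N) (i mod N)))
     = (\<Sum>i\<in>?A. c i * ((\<lambda>(k, l) \<omega>. tap k l \<omega>) i \<omega> - (\<integral>\<xi>. (\<lambda>(k, l) \<omega>. tap k l \<omega>) i \<xi> \<partial>P)))" for \<omega>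
  proof -
    have "(\<Sum>i<n * N. a i * (signal x (i div N) (i mod N) \<omega> - signal_mean x (i div N) (i mod N)))
        = (\<Sum>k<n. \<Sum>m<N. \<Sum>l<N. a (k * N + m) * gain x l k m * (tap k l \<omega> - tap_mean l))"
      unfolding sum_flatten by (simp add: signal_centred sum_distrib_left mult.assoc)
    also have "\<dots> = (\<Sum>k<n. \<Sum>l<N. \<Sum>m<N. a (k * N + m) * gain x l k m * (tap k l \<omega> - tap_mean l))"
      by (intro sum.cong refl sum.swap)
    also have "\<dots> = (\<Sum>k<n. \<Sum>l<N. c (k, l) * (tap k l \<omega> - tap_mean l))"
      by (simp add: c_def sum_distrib_right)
    finally show ?thesis
      by (simp add: sum.cartesian_product' tap_expectation)
  qed
  have "(\<Sum>i\<in>?A. \<Sum>j\<in>?A. c i * cnj (c j) * ccov P ((\<lambda>(k, l) \<omega>. tap k l \<omega>) i) ((\<lambda>(k, l) \<omega>. tap k l \<omega>) j))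
     = (\<Sum>k<n. \<Sum>l<N. \<Sum>k'<n. \<Sum>l'<N. if l = l' then of_real (tap_var l) * (c (k, l) * cnj (c (k', l)) * r (int k - int k')) else 0)"
    unfolding sum.cartesian_product' split_beta' by (intro sum.cong refl) (auto simp: tap_ccov mult_ac)
  also have "\<dots> = (\<Sum>k<n. \<Sum>l<N. \<Sum>k'<n. of_real (tap_var l) * (c (k, l) * cnj (c (k', l)) * r (int k - int k')))"
    by (intro sum.cong refl) simp
  also have "\<dots> = (\<Sum>l<N. \<Sum>k<n. \<Sum>k'<n. of_real (tap_var l) * (c (k, l) * cnj (c (k', l)) * r (int k - int k')))"
    by (rule sum.swap)
  also have "\<dots> = hform (n * N) (signal_cov x) a"
    unfolding hform_signal_cov of_real_mult hform_real[symmetric]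
    unfolding hform_def by (simp add: sum_distrib_left c_def)
  finally have cov: "(\<Sum>i\<in>?A. \<Sum>j\<in>?A. c i * cnj (c j) * ccov P ((\<lambda>(k, l) \<omega>. tap k l \<omega>) i) ((\<lambda>(k, l) \<omega>. tap k l \<omega>) j))
     = hform (n * N) (signal_cov x) a" .
  have A: "finite ?A" "?A \<subseteq> UNIV \<times> {..<N}" by auto
  show ?thesis
    unfolding e jointly_proper_gaussian_char[OF gaussian A] cov ..
qed

end

section \<open>The density of the output given the input\<close>

lemma (in pair_prob_space) integral_mult_fst_snd:
  fixes f :: "'a \<Rightarrow> 'c::{real_normed_field,banach,second_countable_topology}" and g :: "'b \<Rightarrow> 'c"
  assumes f: "integrable M1 f" and g: "integrable M2 g"
  shows "integrable (M1 \<Otimes>\<^sub>M M2) (\<lambda>z. f (fst z) * g (snd z))"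
    and "(\<integral>z. f (fst z) * g (snd z) \<partial>(M1 \<Otimes>\<^sub>M M2)) = (\<integral>x. f x \<partial>M1) * (\<integral>y. g y \<partial>M2)"
proof -
  have [measurable]: "f \<in> borel_measurable M1" "g \<in> borel_measurable M2" using f g by auto
  show i: "integrable (M1 \<Otimes>\<^sub>M M2) (\<lambda>z. f (fst z) * g (snd z))"
  proof (rule Fubini_integrable)
    show "integrable M1 (\<lambda>x. \<integral>y. norm (f (fst (x, y)) * g (snd (x, y))) \<partial>M2)"
      using f by (simp add: norm_mult)
  qed (use g in \<open>simp_all add: split_beta'\<close>)
  show "(\<integral>z. f (fst z) * g (snd z) \<partial>(M1 \<Otimes>\<^sub>M M2)) = (\<integral>x. f x \<partial>M1) * (\<integral>y. g y \<partial>M2)"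
    using integral_fst'[OF i] by simp
qed

lemma integral_double_sum:
  fixes f :: "nat \<Rightarrow> nat \<Rightarrow> 'a \<Rightarrow> complex"
  assumes i: "\<And>i j. i < d \<Longrightarrow> j < e \<Longrightarrow> integrable M (f i j)"
  shows "(\<integral>\<omega>. (\<Sum>i<d. \<Sum>j<e. c i j * f i j \<omega>) \<partial>M) = (\<Sum>i<d. \<Sum>j<e. c i j * (\<integral>\<omega>. f i j \<omega> \<partial>M))"
proof -
  have "(\<integral>\<omega>. (\<Sum>i<d. \<Sum>j<e. c i j * f i j \<omega>) \<partial>M) = (\<Sum>i<d. \<integral>\<omega>. (\<Sum>j<e. c i j * f i j \<omega>) \<partial>M)"
    by (intro Bochner_Integration.integral_sum Bochner_Integration.integrable_sum integrable_mult_right i) auto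
  also have "\<dots> = (\<Sum>i<d. \<Sum>j<e. \<integral>\<omega>. c i j * f i j \<omega> \<partial>M)"
    by (intro sum.cong refl Bochner_Integration.integral_sum integrable_mult_right i) auto
  finally show ?thesis by simp
qed

lemma norm_sum_square_expectation:
  fixes V :: "nat \<Rightarrow> 'a \<Rightarrow> complex"
  assumes i: "\<And>i j. i < d \<Longrightarrow> j < d \<Longrightarrow> integrable M (\<lambda>\<omega>. V i \<omega> * cnj (V j \<omega>))"
    and K: "\<And>i j. i < d \<Longrightarrow> j < d \<Longrightarrow> (\<integral>\<omega>. V i \<omega> * cnj (V j \<omega>) \<partial>M) = K i j"
  shows "integrable M (\<lambda>\<omega>. (cmod (\<Sum>i<d. u i * V i \<omega>))\<^sup>2)"
    and "(\<integral>\<omega>. (cmod (\<Sum>i<d. u i * V i \<omega>))\<^sup>2 \<partial>M) = Re (hform d K u)"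
proof -
  have e: "complex_of_real ((cmod (\<Sum>i<d. u i * V i \<omega>))\<^sup>2) = (\<Sum>i<d. \<Sum>j<d. u i * cnj (u j) * (V i \<omega> * cnj (V j \<omega>)))" for \<omega>
    unfolding complex_norm_square cnj_sum sum_product by (simp add: mult_ac)
  have I: "integrable M (\<lambda>\<omega>. complex_of_real ((cmod (\<Sum>i<d. u i * V i \<omega>))\<^sup>2))"
    unfolding e by (intro Bochner_Integration.integrable_sum integrable_mult_right i) auto
  then show "integrable M (\<lambda>\<omega>. (cmod (\<Sum>i<d. u i * V i \<omega>))\<^sup>2)"
    using integrable_Re[OF I] by (simp only: Re_complex_of_real)
  have "complex_of_real (\<integral>\<omega>. (cmod (\<Sum>i<d. u i * V i \<omega>))\<^sup>2 \<partial>M) = hform d K u"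
    unfolding integral_complex_of_real[symmetric] e hform_def
    by (subst integral_double_sum) (auto intro: i simp: K)
  then show "(\<integral>\<omega>. (cmod (\<Sum>i<d. u i * V i \<omega>))\<^sup>2 \<partial>M) = Re (hform d K u)"
    by (metis Re_complex_of_real)
qed

lemma div_mod_less: "i < n * N \<Longrightarrow> i div N < n \<and> i mod N < (N::nat)"
  by (cases "N = 0") (auto simp: less_mult_imp_div_less)

context ofdm_channel
begin

definition centred :: "(nat \<Rightarrow> nat \<Rightarrow> complex) \<Rightarrow> nat \<Rightarrow> 'w \<Rightarrow> complex" where
  "centred x i \<omega> = signal x (i div N) (i mod N) \<omega> - signal_mean x (i div N) (i mod N)"

lemma centred_measurable[measurable]: "centred x i \<in> borel_measurable P"
  unfolding centred_def by measurable

lemma tap_cov_integrable: "l < N \<Longrightarrow> l' < N \<Longrightarrow> integrable P (\<lambda>\<omega>. (tap k l \<omega> - c) * cnj (tap k' l' \<omega> - c'))"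
  using tap_measurable by (intro integrable_mult_cnj tap_square_integrable borel_measurable_diff borel_measurable_const) auto

lemma centred_eq: "centred x i \<omega> = (\<Sum>l<N. gain x l (i div N) (i mod N) * (tap (i div N) l \<omega> - tap_mean l))"
  unfolding centred_def signal_centred ..

lemma centred_expectation: "integrable P (centred x i)" "(\<integral>\<omega>. centred x i \<omega> \<partial>P) = 0"
proof -
  have i: "integrable P (\<lambda>\<omega>. tap k l \<omega> - tap_mean l)" if "l < N" for k l
    using tap_integrable[OF that] by (intro Bochner_Integration.integrable_diff) auto
  have z: "(\<integral>\<omega>. tap k l \<omega> - tap_mean l \<partial>P) = 0" if "l < N" for k l
    using tap_integrable[OF that] tap_expectation[OF that] by (subst Bochner_Integration.integral_diff) (auto simp: prob_space)
  show "integrable P (centred x i)"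
    unfolding centred_eq[abs_def] by (intro Bochner_Integration.integrable_sum integrable_mult_right i) auto
  show "(\<integral>\<omega>. centred x i \<omega> \<partial>P) = 0"
    unfolding centred_eq[abs_def]
    by (subst Bochner_Integration.integral_sum) (auto intro!: integrable_mult_right i sum.neutral simp: z)
qed

lemma centred_cov:
  "integrable P (\<lambda>\<omega>. centred x i \<omega> * cnj (centred x j \<omega>))"
  "(\<integral>\<omega>. centred x i \<omega> * cnj (centred x j \<omega>) \<partial>P) = signal_cov x i j"
proof -
  let ?g = "\<lambda>i l. gain x l (i div N) (i mod N)" and ?t = "\<lambda>i l \<omega>. tap (i div N) l \<omega> - tap_mean l"
  have e: "centred x i \<omega> * cnj (centred x j \<omega>) = (\<Sum>l<N. \<Sum>l'<N. ?g i l * cnj (?g j l') * (?t i l \<omega> * cnj (?t j l' \<omega>)))" for \<omega>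
    unfolding centred_eq cnj_sum sum_product by (simp add: mult_ac)
  have I: "integrable P (\<lambda>\<omega>. ?t i l \<omega> * cnj (?t j l' \<omega>))" if "l < N" "l' < N" for l l'
    using that by (rule tap_cov_integrable)
  show "integrable P (\<lambda>\<omega>. centred x i \<omega> * cnj (centred x j \<omega>))"
    unfolding e using I by (intro Bochner_Integration.integrable_sum integrable_mult_right) auto
  have c: "(\<integral>\<omega>. ?t i l \<omega> * cnj (?t j l' \<omega>) \<partial>P) = (if l = l' then r (int (i div N) - int (j div N)) * of_real (tap_var l) else 0)" if "l < N" "l' < N" for l l'
    using tap_ccov[OF that, of "i div N" "j div N"] unfolding ccov_def tap_expectation[OF that(1)] tap_expectation[OF that(2)] .
  have "(\<integral>\<omega>. centred x i \<omega> * cnj (centred x j \<omega>) \<partial>P) = (\<Sum>l<N. \<Sum>l'<N. ?g i l * cnj (?g j l') * (\<integral>\<omega>. ?t i l \<omega> * cnj (?t j l' \<omega>) \<partial>P))"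
    unfolding e by (rule integral_double_sum) (rule I)
  also have "\<dots> = (\<Sum>l<N. \<Sum>l'<N. if l = l' then of_real (tap_var l) * r (int (i div N) - int (j div N)) * ?g i l * cnj (?g j l) else 0)"
    by (intro sum.cong refl) (auto simp: c simp del: complex_cnj_diff)
  also have "\<dots> = signal_cov x i j"
    unfolding signal_cov_def by (intro sum.cong refl) simp
  finally show "(\<integral>\<omega>. centred x i \<omega> * cnj (centred x j \<omega>) \<partial>P) = signal_cov x i j" .
qed

lemma centred_square: "(\<integral>\<omega>. (cmod (centred x i \<omega>))\<^sup>2 \<partial>P) = (cmod (x (i div N) (i mod N)))\<^sup>2"
  "integrable P (\<lambda>\<omega>. (cmod (centred x i \<omega>))\<^sup>2)"
proof -
  have I: "integrable P (\<lambda>\<omega>. complex_of_real ((cmod (centred x i \<omega>))\<^sup>2))"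
    unfolding complex_norm_square by (rule centred_cov)
  then show "integrable P (\<lambda>\<omega>. (cmod (centred x i \<omega>))\<^sup>2)"
    using integrable_Re[OF I] by (simp only: Re_complex_of_real)
  have "complex_of_real (\<integral>\<omega>. (cmod (centred x i \<omega>))\<^sup>2 \<partial>P) = of_real ((cmod (x (i div N) (i mod N)))\<^sup>2)"
    unfolding integral_complex_of_real[symmetric] unfolding complex_norm_square centred_cov signal_cov_diag ..
  then show "(\<integral>\<omega>. (cmod (centred x i \<omega>))\<^sup>2 \<partial>P) = (cmod (x (i div N) (i mod N)))\<^sup>2"
    by (simp only: of_real_eq_iff)
qed

text \<open>The received component minus its conditional mean given the input; the flat index i
  stands for subcarrier i mod N at time i div N.\<close>

definition noisy :: "(nat \<Rightarrow> nat \<Rightarrow> complex) \<Rightarrow> nat \<Rightarrow> 'w \<times> (nat \<Rightarrow> nat \<Rightarrow> complex) \<Rightarrow> complex" where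
  "noisy x i = (\<lambda>(\<omega>, w). centred x i \<omega> + w (i div N) (i mod N))"

lemma noisy_moments:
  assumes i: "i < Suc n * N" and j: "j < Suc n * N"
  shows "integrable (P \<Otimes>\<^sub>M noise_law N n) (noisy x i)" "(\<integral>z. noisy x i z \<partial>(P \<Otimes>\<^sub>M noise_law N n)) = 0"
    "integrable (P \<Otimes>\<^sub>M noise_law N n) (\<lambda>z. noisy x i z * cnj (noisy x j z))"
    "(\<integral>z. noisy x i z * cnj (noisy x j z) \<partial>(P \<Otimes>\<^sub>M noise_law N n)) = signal_cov x i j + (if i = j then 1 else 0)"
proof -
  interpret R: prob_space "noise_law N n" by (rule prob_space_noise_law)
  interpret PR: pair_prob_space P "noise_law N n" ..
  have bi: "i div N \<le> n" "i mod N < N" and bj: "j div N \<le> n" "j mod N < N"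
    using div_mod_less[OF i] div_mod_less[OF j] by auto
  let ?W = "\<lambda>i w. w (i div N) (i mod N) :: complex"
  note Wi = noise_law_moments[OF bi] and Wj = noise_law_moments[OF bj]
  have one: "integrable P (\<lambda>_. 1::complex)" "integrable (noise_law N n) (\<lambda>_. 1::complex)"
    "(\<integral>_. 1 \<partial>P) = (1::complex)" "(\<integral>_. 1 \<partial>noise_law N n) = (1::complex)"
    by (simp_all add: prob_space R.prob_space del: space_noise_law)
  have cn: "integrable P (\<lambda>\<omega>. cnj (centred x j \<omega>))" "(\<integral>\<omega>. cnj (centred x j \<omega>) \<partial>P) = 0"
    "integrable (noise_law N n) (\<lambda>w. cnj (?W j w))" "(\<integral>w. cnj (?W j w) \<partial>noise_law N n) = 0"
    using centred_expectation[of x j] Wj by simp_all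
  note m1 = PR.integral_mult_fst_snd[OF centred_expectation(1) one(2), of x i]
    and m2 = PR.integral_mult_fst_snd[OF one(1) Wi(1)]
    and m3 = PR.integral_mult_fst_snd[OF centred_cov(1) one(2), of x i j]
    and m4 = PR.integral_mult_fst_snd[OF centred_expectation(1) cn(3), of x i]
    and m5 = PR.integral_mult_fst_snd[OF cn(1) Wi(1)]
    and m6 = PR.integral_mult_fst_snd[OF one(1) noise_law_cross_moment(1)[OF bi bj]]
  have e: "noisy x i = (\<lambda>z. centred x i (fst z) * 1 + 1 * ?W i (snd z))"
    by (auto simp: noisy_def)
  have e2: "noisy x i z * cnj (noisy x j z) = (centred x i (fst z) * cnj (centred x j (fst z))) * 1
      + centred x i (fst z) * cnj (?W j (snd z)) + cnj (centred x j (fst z)) * ?W i (snd z) + 1 * (?W i (snd z) * cnj (?W j (snd z)))" for z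
    by (simp add: noisy_def split_beta' algebra_simps)
  show "integrable (P \<Otimes>\<^sub>M noise_law N n) (noisy x i)"
    unfolding e by (intro Bochner_Integration.integrable_add m1 m2)
  show "(\<integral>z. noisy x i z \<partial>(P \<Otimes>\<^sub>M noise_law N n)) = 0"
    unfolding e Bochner_Integration.integral_add[OF m1(1) m2(1)] m1(2) m2(2) by (simp add: centred_expectation Wi)
  show "integrable (P \<Otimes>\<^sub>M noise_law N n) (\<lambda>z. noisy x i z * cnj (noisy x j z))"
    unfolding e2 by (intro Bochner_Integration.integrable_add m3 m4 m5 m6)
  have "i div N = j div N \<and> i mod N = j mod N \<longleftrightarrow> i = j"
    by (metis div_mult_mod_eq)
  then show "(\<integral>z. noisy x i z * cnj (noisy x j z) \<partial>(P \<Otimes>\<^sub>M noise_law N n)) = signal_cov x i j + (if i = j then 1 else 0)"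
    unfolding e2 Bochner_Integration.integral_add[OF Bochner_Integration.integrable_add[OF Bochner_Integration.integrable_add[OF m3(1) m4(1)] m5(1)] m6(1)]
      Bochner_Integration.integral_add[OF Bochner_Integration.integrable_add[OF m3(1) m4(1)] m5(1)]
      Bochner_Integration.integral_add[OF m3(1) m4(1)] m3(2) m4(2) m5(2) m6(2)
    using noise_law_cross_moment(2)[OF bi bj] by (simp add: centred_cov centred_expectation Wi prob_space R.prob_space del: space_noise_law)
qed

lemma hform_noisy:
  "Re (hform d (\<lambda>i j. signal_cov x i j + (if i = j then 1 else 0)) u) = Re (hform d (signal_cov x) u) + (\<Sum>j<d. (cmod (u j))\<^sup>2)"
proof -
  have "hform d (\<lambda>i j. signal_cov x i j + (if i = j then 1 else 0)) u
      = hform d (signal_cov x) u + (\<Sum>i<d. \<Sum>j<d. if i = j then of_real ((cmod (u i))\<^sup>2) else 0)"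
    unfolding hform_def sum.distrib[symmetric] complex_norm_square
    by (intro sum.cong refl) (auto simp: distrib_left)
  also have "(\<Sum>i<d. \<Sum>j<d. if i = j then complex_of_real ((cmod (u i))\<^sup>2) else 0) = of_real (\<Sum>i<d. (cmod (u i))\<^sup>2)"
    unfolding of_real_sum by (intro sum.cong refl) simp
  finally show ?thesis by simp
qed

text \<open>The logarithm of the density of the shifted noise \<open>s + W\<close> relative to the law of \<open>W\<close>.\<close>

definition shift_exp :: "nat \<Rightarrow> (nat \<Rightarrow> nat \<Rightarrow> complex) \<Rightarrow> (nat \<Rightarrow> nat \<Rightarrow> complex) \<Rightarrow> real" where
  "shift_exp n s y = (\<Sum>k\<le>n. \<Sum>m<N. 2 * Re (cnj (s k m) * y k m) - (cmod (s k m))\<^sup>2)"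

definition energy :: "nat \<Rightarrow> (nat \<Rightarrow> nat \<Rightarrow> complex) \<Rightarrow> real" where
  "energy n y = (\<Sum>k\<le>n. \<Sum>m<N. (cmod (y k m))\<^sup>2)"

text \<open>The density of the output given the input, relative to the law of the noise.\<close>

definition lik :: "nat \<Rightarrow> (nat \<Rightarrow> nat \<Rightarrow> complex) \<Rightarrow> (nat \<Rightarrow> nat \<Rightarrow> complex) \<Rightarrow> real" where
  "lik n x y = (\<integral>\<omega>. exp (shift_exp n (\<lambda>k m. signal x k m \<omega>) y) \<partial>P)"

lemma shift_exp_eq: "shift_exp n s y = energy n y - (\<Sum>k\<le>n. \<Sum>m<N. (cmod (y k m - s k m))\<^sup>2)"
  unfolding shift_exp_def energy_def cmod_diff_power2 sum_subtractf[symmetric] by (intro sum.cong refl) simp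

lemma shift_exp_le: "shift_exp n s y \<le> energy n y"
  unfolding shift_exp_eq by (simp add: sum_nonneg)

text \<open>Together with the upper bound this controls the exponent by the output and signal
  energies, on which integrability of all log-likelihoods rests.\<close>

lemma shift_exp_ge: "- energy n y - 2 * energy n s \<le> shift_exp n s y"
proof -
  have "- (cmod y)\<^sup>2 - 2 * (cmod s)\<^sup>2 \<le> 2 * Re (cnj s * y) - (cmod s)\<^sup>2" for y s :: complex
    using cmod_diff_power2[of y "- s"] by simp (smt (verit) zero_le_power2)
  then have "(\<Sum>k\<le>n. \<Sum>m<N. - (cmod (y k m))\<^sup>2 - 2 * (cmod (s k m))\<^sup>2) \<le> shift_exp n s y"
    unfolding shift_exp_def by (intro sum_mono)
  then show ?thesis
    unfolding energy_def by (simp add: sum_subtractf sum_negf sum_distrib_left)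
qed

lemma shift_exp_measurable[measurable]: "(\<lambda>\<omega>. shift_exp n (\<lambda>k m. signal x k m \<omega>) y) \<in> borel_measurable P"
  unfolding shift_exp_def by measurable

lemma integrable_exp_shift: "integrable P (\<lambda>\<omega>. exp (shift_exp n (\<lambda>k m. signal x k m \<omega>) y))"
  by (rule integrable_const_bound[where B="exp (energy n y)"]) (auto intro: shift_exp_le)

lemma energy_flatten: "energy n y = (\<Sum>i<Suc n * N. (cmod (y (i div N) (i mod N)))\<^sup>2)"
  unfolding energy_def sum_flatten lessThan_Suc_atMost by simp

lemma signal_energy:
  "integrable P (\<lambda>\<omega>. (cmod (signal x k m \<omega>))\<^sup>2)"
  "m < N \<Longrightarrow> (\<integral>\<omega>. (cmod (signal x k m \<omega>))\<^sup>2 \<partial>P) = (cmod (x k m))\<^sup>2 * (1 + real N * mean_gain P N L h)"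
proof -
  have "integrable P (\<lambda>\<omega>. (cmod (\<Sum>l<N. gain x l k m * tap k l \<omega>))\<^sup>2)"
    by (rule norm_sum_square_expectation(1)[OF _ refl]) (use tap_cov_integrable[of _ _ k 0 k 0] in simp)
  moreover have "signal x k m \<omega> = (\<Sum>l<N. gain x l k m * tap k l \<omega>)" for \<omega>
    unfolding signal_def freq_eq gain_def by (simp add: sum_distrib_left sum_distrib_right mult_ac)
  ultimately show "integrable P (\<lambda>\<omega>. (cmod (signal x k m \<omega>))\<^sup>2)" by simp
  show "(\<integral>\<omega>. (cmod (signal x k m \<omega>))\<^sup>2 \<partial>P) = (cmod (x k m))\<^sup>2 * (1 + real N * mean_gain P N L h)" if m: "m < N"
  proof -
    define i where "i = k * N + m"
    have i: "i div N = k" "i mod N = m" using m by (auto simp: i_def)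
    define \<mu> where "\<mu> = signal_mean x k m"
    have s: "(cmod (signal x k m \<omega>))\<^sup>2 = (cmod (centred x i \<omega>))\<^sup>2 + 2 * Re (cnj \<mu> * centred x i \<omega>) + (cmod \<mu>)\<^sup>2" for \<omega>
      using cmod_diff_power2[of "centred x i \<omega>" "- \<mu>"] by (simp add: centred_def i \<mu>_def)
    have "(cmod \<mu>)\<^sup>2 = (cmod (x k m))\<^sup>2 * (real N * mean_gain P N L h)"
      unfolding \<mu>_def signal_mean_def using norm_freq_mean[of m] by (simp add: norm_mult power_mult_distrib)
    moreover have "(\<integral>\<omega>. Re (cnj \<mu> * centred x i \<omega>) \<partial>P) = 0"
      using centred_expectation[of x i] by (subst integral_Re) auto
    moreover have "integrable P (\<lambda>\<omega>. Re (cnj \<mu> * centred x i \<omega>))"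
      using centred_expectation[of x i] by (intro integrable_Re integrable_mult_right)
    ultimately show ?thesis
      unfolding s using centred_square[of x i] by (simp add: i prob_space algebra_simps del: times_complex.simps)
  qed
qed

text \<open>The upper bound holds before averaging over the channel; the lower one is Jensen's
  inequality. Both are needed to dominate |ln \<open>lik\<close>| by energies.\<close>

lemma lik_bounds:
  shows "0 < lik n x y" "lik n x y \<le> exp (energy n y)"
    and "- energy n y - 2 * (1 + real N * mean_gain P N L h) * energy n x \<le> ln (lik n x y)"
proof -
  let ?X = "\<lambda>\<omega>. shift_exp n (\<lambda>k m. signal x k m \<omega>) y"
  have E: "integrable P (\<lambda>\<omega>. energy n (\<lambda>k m. signal x k m \<omega>))"
    "(\<integral>\<omega>. energy n (\<lambda>k m. signal x k m \<omega>) \<partial>P) = (1 + real N * mean_gain P N L h) * energy n x"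
    unfolding energy_def using signal_energy
    by (simp_all add: Bochner_Integration.integral_sum Bochner_Integration.integrable_sum sum_distrib_left mult.commute)
  have X: "integrable P ?X"
  proof (rule Bochner_Integration.integrable_bound)
    show "integrable P (\<lambda>\<omega>. energy n y + 2 * energy n (\<lambda>k m. signal x k m \<omega>))"
      using E by simp
    have en: "0 \<le> energy n z" for z by (simp add: energy_def sum_nonneg)
    have "\<bar>?X \<omega>\<bar> \<le> energy n y + 2 * energy n (\<lambda>k m. signal x k m \<omega>)" for \<omega>
      using shift_exp_le[of n "\<lambda>k m. signal x k m \<omega>" y] shift_exp_ge[of n y "\<lambda>k m. signal x k m \<omega>"] en[of y] en[of "\<lambda>k m. signal x k m \<omega>"]
      by (auto simp: abs_if)
    then show "AE \<omega> in P. norm (?X \<omega>) \<le> norm (energy n y + 2 * energy n (\<lambda>k m. signal x k m \<omega>))"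
      by (intro AE_I2) (smt (verit) real_norm_def)
  qed simp
  define c where "c = (\<integral>\<omega>. ?X \<omega> \<partial>P)"
  \<comment> \<open>Jensen's inequality, from the tangent of exp at the mean exponent c.\<close>
  have "exp c = (\<integral>\<omega>. exp c * (1 + (?X \<omega> - c)) \<partial>P)"
    using X by (simp add: prob_space c_def)
  also have "\<dots> \<le> lik n x y"
    unfolding lik_def
  proof (intro integral_mono integrable_exp_shift)
    show "integrable P (\<lambda>\<omega>. exp c * (1 + (?X \<omega> - c)))" using X by simp
    fix \<omega>
    have "exp c * (1 + (?X \<omega> - c)) \<le> exp c * exp (?X \<omega> - c)"
      by (intro mult_left_mono exp_ge_add_one_self) simp
    then show "exp c * (1 + (?X \<omega> - c)) \<le> exp (?X \<omega>)"
      by (simp add: exp_add[symmetric])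
  qed
  finally have c: "exp c \<le> lik n x y" .
  then show pos: "0 < lik n x y" using exp_gt_zero[of c] by linarith
  have "- energy n y - 2 * ((1 + real N * mean_gain P N L h) * energy n x) = (\<integral>\<omega>. - energy n y - 2 * energy n (\<lambda>k m. signal x k m \<omega>) \<partial>P)"
    using E by (simp add: prob_space)
  also have "\<dots> \<le> c"
    unfolding c_def using E X by (intro integral_mono shift_exp_ge) auto
  also have "c \<le> ln (lik n x y)" using c pos by (simp add: ln_ge_iff)
  finally show "- energy n y - 2 * (1 + real N * mean_gain P N L h) * energy n x \<le> ln (lik n x y)" by (simp only: mult.assoc)
  have "lik n x y \<le> (\<integral>\<omega>. exp (energy n y) \<partial>P)"
    unfolding lik_def by (intro integral_mono integrable_exp_shift) (auto intro: shift_exp_le)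
  then show "lik n x y \<le> exp (energy n y)" by (simp add: prob_space)
qed

text \<open>Apart from the factor exp(energy) the likelihood is that of the centred signal observed
  in noise at y minus the signal mean, so it has the innovations form. The flat index orders
  components by time and, within a symbol, by subcarrier.\<close>

lemma ln_lik_formula:
  "\<exists>v b. (\<forall>i<Suc n * N. 0 < (v i :: real)) \<and>
     (\<forall>y. ln (lik n x y) = energy n y - (\<Sum>i<Suc n * N. ln (v i) + (cmod (y (i div N) (i mod N) - signal_mean x (i div N) (i mod N)
         - (\<Sum>j<i. b i j * (y (j div N) (j mod N) - signal_mean x (j div N) (j mod N)))))\<^sup>2 / v i))"
proof -
  have ch: "(\<integral>\<omega>. iexp (Re (\<Sum>i<Suc n * N. a i * centred x i \<omega>)) \<partial>P) = exp (of_real (- Re (hform (Suc n * N) (signal_cov x) a) / 4))" for a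
    unfolding centred_def by (rule signal_char)
  obtain v b where v: "\<forall>i<Suc n * N. 0 < (v i :: real)"
    and f: "\<forall>y. (\<integral>\<omega>. exp (- (\<Sum>i<Suc n * N. (cmod (y i - centred x i \<omega>))\<^sup>2)) \<partial>P)
        = exp (- (\<Sum>i<Suc n * N. ln (v i) + (cmod (y i - (\<Sum>l<i. b i l * y l)))\<^sup>2 / v i))"
    using gaussian_likelihood[where Z="centred x" and C="signal_cov x" and d="Suc n * N", OF centred_measurable signal_cov_herm ch] by blast
  have "ln (lik n x y) = energy n y - (\<Sum>i<Suc n * N. ln (v i) + (cmod (y (i div N) (i mod N) - signal_mean x (i div N) (i mod N)
         - (\<Sum>j<i. b i j * (y (j div N) (j mod N) - signal_mean x (j div N) (j mod N)))))\<^sup>2 / v i)" for y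
  proof -
    let ?y = "\<lambda>i. y (i div N) (i mod N) - signal_mean x (i div N) (i mod N)"
    have "shift_exp n (\<lambda>k m. signal x k m \<omega>) y = energy n y + - (\<Sum>i<Suc n * N. (cmod (?y i - centred x i \<omega>))\<^sup>2)" for \<omega>
      unfolding shift_exp_eq sum_flatten lessThan_Suc_atMost centred_def by simp
    then have "lik n x y = exp (energy n y) * (\<integral>\<omega>. exp (- (\<Sum>i<Suc n * N. (cmod (?y i - centred x i \<omega>))\<^sup>2)) \<partial>P)"
      unfolding lik_def by (simp only: exp_add integral_mult_right_zero)
    also have "\<dots> = exp (energy n y + - (\<Sum>i<Suc n * N. ln (v i) + (cmod (?y i - (\<Sum>l<i. b i l * ?y l)))\<^sup>2 / v i))"
      unfolding exp_add using f[rule_format, of ?y] by (simp only:)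
    finally show ?thesis by (simp only: ln_exp)
  qed
  then show ?thesis using v by blast
qed

lemma received_component:
  "k \<le> n \<Longrightarrow> m < N \<Longrightarrow> received N L h n (x, \<omega>, w) k m = signal x k m \<omega> + w k m"
  by (simp add: received_def signal_def)

text \<open>The bound for a scalar process holds for each tap with the same left-hand side, as the
  moduli of the gains do not involve the tap; averaging with the weights \<open>tap_var\<close>
  gives it for the channel.\<close>

lemma innovation_ge:
  fixes x :: "nat \<Rightarrow> nat \<Rightarrow> complex" and u :: "nat \<Rightarrow> complex"
  assumes w: "\<And>j. j < k \<Longrightarrow> (\<Sum>l<k. r (int j - int l) * w l) + w j / of_real q = r (int j - int k)"
    and q: "0 < q" and k: "k \<le> n" and m: "m < N"
    and u: "u (k * N + m) = 1" "\<And>j. k * N + m < j \<Longrightarrow> u j = 0"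
    and eps: "\<epsilon> = max 0 (1 - (rform k (\<lambda>j. cnj (w j)) + (\<Sum>j<k. (cmod (w j))\<^sup>2 * symbol_energy N x j / q\<^sup>2)))"
  shows "(1 + \<epsilon> * (\<Sum>m'<Suc m. (cmod (x k m'))\<^sup>2)) / (1 + \<epsilon> * (\<Sum>m'<m. (cmod (x k m'))\<^sup>2))
    \<le> Re (hform (Suc n * N) (\<lambda>i j. signal_cov x i j + (if i = j then 1 else 0)) u)" (is "?r \<le> _")
proof -
  define U where "U j m' = u (j * N + m')" for j m'
  define S where "S = (\<Sum>j<Suc n. \<Sum>m<N. (cmod (U j m))\<^sup>2)"
  have U: "U k m = 1" "\<And>m'. m < m' \<Longrightarrow> U k m' = 0" "\<And>j m'. k < j \<Longrightarrow> U j m' = 0"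
  proof -
    show "U k m = 1" "\<And>m'. m < m' \<Longrightarrow> U k m' = 0" using u by (auto simp: U_def)
    fix j m' assume "k < j"
    then have "(k + 1) * N \<le> j * N" by (intro mult_right_mono) auto
    then show "U j m' = 0" unfolding U_def using m by (intro u) auto
  qed
  have b: "?r \<le> rform (Suc n) (\<lambda>j. \<Sum>m<N. U j m * gain x l j m) + S" for l
    unfolding S_def
    by (rule innovation_variance_ge[where w=w and q=q and N=N and k=k and n=n and m=m and U=U and g="gain x l"
          and e="\<lambda>k m. (cmod (x k m))\<^sup>2" and \<epsilon>=\<epsilon>, OF w q k m U norm_gain])
       (use eps in \<open>auto simp: symbol_energy_def\<close>)
  have sv: "(\<Sum>l<N. tap_var l * c) = c" for c
    by (simp add: sum_distrib_right[symmetric] sum_tap_var)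
  have "?r = (\<Sum>l<N. tap_var l * ?r)"
    unfolding sv ..
  also have "\<dots> \<le> (\<Sum>l<N. tap_var l * (rform (Suc n) (\<lambda>j. \<Sum>m<N. U j m * gain x l j m) + S))"
    by (intro sum_mono mult_left_mono b) (use tap_var_nonneg in auto)
  also have "\<dots> = (\<Sum>l<N. tap_var l * rform (Suc n) (\<lambda>j. \<Sum>m<N. U j m * gain x l j m)) + S"
    unfolding distrib_left sum.distrib sv ..
  also have "\<dots> = Re (hform (Suc n * N) (\<lambda>i j. signal_cov x i j + (if i = j then 1 else 0)) u)"
    unfolding hform_noisy hform_signal_cov S_def U_def sum_flatten by simp
  finally show ?thesis .
qed

text \<open>The variances \<open>v\<close> and filters \<open>b\<close> of the likelihood are never
  computed. Component i contributes ln v_i + s_i/v_i, where s_i is the true variance of the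
  combination that is divided by v_i, and this is at least 1 + ln s_i whatever v_i is. The 1 cancels
  the noise energy of the component, and since the combination has leading coefficient 1, the
  innovation bound applies to s_i.\<close>

lemma expected_ln_lik_le:
  fixes x :: "nat \<Rightarrow> nat \<Rightarrow> complex" and w :: "nat \<Rightarrow> nat \<Rightarrow> complex"
  assumes w: "\<And>k j. k \<le> n \<Longrightarrow> j < k \<Longrightarrow> (\<Sum>l<k. r (int j - int l) * w k l) + w k j / of_real q = r (int j - int k)"
    and q: "0 < q"
    and eps: "\<And>k. k \<le> n \<Longrightarrow> \<epsilon> k = max 0 (1 - (rform k (\<lambda>j. cnj (w k j)) + (\<Sum>j<k. (cmod (w k j))\<^sup>2 * symbol_energy N x j / q\<^sup>2)))"
  shows "(\<integral>z. ln (lik n x (received N L h n (x, z))) \<partial>(P \<Otimes>\<^sub>M noise_law N n))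
      \<le> (\<Sum>k\<le>n. (1 + real N * mean_gain P N L h) * symbol_energy N x k - ln (1 + \<epsilon> k * symbol_energy N x k))"
proof -
  let ?d = "Suc n * N" and ?Q = "P \<Otimes>\<^sub>M noise_law N n"
  let ?K = "\<lambda>i j. signal_cov x i j + (if i = j then 1 else 0)"
  let ?m = "\<lambda>i. signal_mean x (i div N) (i mod N)" and ?x = "\<lambda>i. x (i div N) (i mod N)"
  interpret R: prob_space "noise_law N n" by (rule prob_space_noise_law)
  interpret PR: pair_prob_space P "noise_law N n" ..
  obtain v b where v: "\<And>i. i < ?d \<Longrightarrow> 0 < (v i :: real)" and f: "\<And>y. ln (lik n x y) = energy n y - (\<Sum>i<?d. ln (v i) + (cmod (y (i div N) (i mod N) - ?m i
         - (\<Sum>j<i. b i j * (y (j div N) (j mod N) - ?m j))))\<^sup>2 / v i)"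
    using ln_lik_formula[of n x] by blast
  \<comment> \<open>Row i of the innovations filter: coefficient 1 at i and nothing later, as the
    innovation bound requires.\<close>
  define u where "u i j = (if j = i then 1 else if j < i then - b i j else 0)" for i j
  define s where "s i = Re (hform ?d ?K (u i))" for i
  have Y: "received N L h n (x, z) (i div N) (i mod N) = noisy x i z + ?m i" if "i < ?d" for i z
    using div_mod_less[OF that] by (cases z) (simp add: received_component noisy_def centred_def)
  have inn: "noisy x i z - (\<Sum>j<i. b i j * noisy x j z) = (\<Sum>j<?d. u i j * noisy x j z)" if i: "i < ?d" for i z
  proof -
    have "(\<Sum>j<?d. u i j * noisy x j z) = (\<Sum>j<Suc i. u i j * noisy x j z)"
      using i by (intro sum.mono_neutral_right) (auto simp: u_def)
    also have "\<dots> = (\<Sum>j<i. - b i j * noisy x j z) + noisy x i z"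
      by (simp add: u_def)
    finally show ?thesis by (simp add: sum_negf)
  qed
  have F: "ln (lik n x (received N L h n (x, z))) = (\<Sum>i<?d. (cmod (noisy x i z + ?m i))\<^sup>2 - (ln (v i) + (cmod (\<Sum>j<?d. u i j * noisy x j z))\<^sup>2 / v i))" for z
  proof -
    have "(\<Sum>i<?d. ln (v i) + (cmod (received N L h n (x, z) (i div N) (i mod N) - ?m i - (\<Sum>j<i. b i j * (received N L h n (x, z) (j div N) (j mod N) - ?m j))))\<^sup>2 / v i)
       = (\<Sum>i<?d. ln (v i) + (cmod (\<Sum>j<?d. u i j * noisy x j z))\<^sup>2 / v i)"
    proof (intro sum.cong refl)
      fix i assume "i \<in> {..<?d}"
      then have i: "i < ?d" by simp
      have "(\<Sum>j<i. b i j * (received N L h n (x, z) (j div N) (j mod N) - ?m j)) = (\<Sum>j<i. b i j * noisy x j z)"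
        using i by (intro sum.cong refl) (simp add: Y)
      then show "ln (v i) + (cmod (received N L h n (x, z) (i div N) (i mod N) - ?m i - (\<Sum>j<i. b i j * (received N L h n (x, z) (j div N) (j mod N) - ?m j))))\<^sup>2 / v i
        = ln (v i) + (cmod (\<Sum>j<?d. u i j * noisy x j z))\<^sup>2 / v i"
        unfolding inn[OF i, symmetric] by (simp add: Y[OF i])
    qed
    moreover have "energy n (received N L h n (x, z)) = (\<Sum>i<?d. (cmod (noisy x i z + ?m i))\<^sup>2)"
      unfolding energy_flatten by (intro sum.cong refl) (simp add: Y)
    ultimately show ?thesis
      unfolding f by (simp only: sum_subtractf)
  qed
  have sI: "integrable ?Q (\<lambda>z. (cmod (\<Sum>j<?d. u i j * noisy x j z))\<^sup>2)"
    and sE: "(\<integral>z. (cmod (\<Sum>j<?d. u i j * noisy x j z))\<^sup>2 \<partial>?Q) = s i" for i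
    using norm_sum_square_expectation[of ?d ?Q "noisy x" ?K "u i", OF noisy_moments(3) noisy_moments(4)] unfolding s_def by auto
  have nI: "integrable ?Q (\<lambda>z. (cmod (noisy x i z))\<^sup>2)" and nE: "(\<integral>z. (cmod (noisy x i z))\<^sup>2 \<partial>?Q) = (cmod (?x i))\<^sup>2 + 1" if i: "i < ?d" for i
  proof -
    have I: "integrable ?Q (\<lambda>z. complex_of_real ((cmod (noisy x i z))\<^sup>2))"
      unfolding complex_norm_square by (rule noisy_moments(3)[OF i i])
    then show "integrable ?Q (\<lambda>z. (cmod (noisy x i z))\<^sup>2)"
      using integrable_Re[OF I] by (simp only: Re_complex_of_real)
    have "complex_of_real (\<integral>z. (cmod (noisy x i z))\<^sup>2 \<partial>?Q) = of_real ((cmod (?x i))\<^sup>2 + 1)"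
      unfolding integral_complex_of_real[symmetric] unfolding complex_norm_square noisy_moments(4)[OF i i] by (simp add: signal_cov_diag)
    then show "(\<integral>z. (cmod (noisy x i z))\<^sup>2 \<partial>?Q) = (cmod (?x i))\<^sup>2 + 1"
      by (simp only: of_real_eq_iff)
  qed
  have mI: "integrable ?Q (\<lambda>z. (cmod (noisy x i z + ?m i))\<^sup>2)"
    and mE: "(\<integral>z. (cmod (noisy x i z + ?m i))\<^sup>2 \<partial>?Q) = (cmod (?x i))\<^sup>2 * (1 + real N * mean_gain P N L h) + 1" if i: "i < ?d" for i
  proof -
    have e: "(cmod (noisy x i z + ?m i))\<^sup>2 = (cmod (noisy x i z))\<^sup>2 + 2 * Re (cnj (?m i) * noisy x i z) + (cmod (?m i))\<^sup>2" for z
      using cmod_diff_power2[of "noisy x i z" "- ?m i"] by simp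
    have r: "integrable ?Q (\<lambda>z. Re (cnj (?m i) * noisy x i z))"
      using noisy_moments(1)[OF i i] by (intro integrable_Re integrable_mult_right)
    have r0: "(\<integral>z. Re (cnj (?m i) * noisy x i z) \<partial>?Q) = 0"
      using noisy_moments(1,2)[OF i i] by (subst integral_Re) auto
    have m: "(cmod (?m i))\<^sup>2 = (cmod (?x i))\<^sup>2 * (real N * mean_gain P N L h)"
      unfolding signal_mean_def using norm_freq_mean[of "i mod N"] by (simp add: norm_mult power_mult_distrib)
    show "integrable ?Q (\<lambda>z. (cmod (noisy x i z + ?m i))\<^sup>2)"
      unfolding e using nI[OF i] r by (intro Bochner_Integration.integrable_add integrable_mult_right) auto
    show "(\<integral>z. (cmod (noisy x i z + ?m i))\<^sup>2 \<partial>?Q) = (cmod (?x i))\<^sup>2 * (1 + real N * mean_gain P N L h) + 1"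
      unfolding e m using nI[OF i] r r0 nE[OF i] by (simp add: PR.prob_space algebra_simps del: times_complex.simps)
  qed
  define \<rho> where "\<rho> k m = (1 + \<epsilon> k * (\<Sum>m'<Suc m. (cmod (x k m'))\<^sup>2)) / (1 + \<epsilon> k * (\<Sum>m'<m. (cmod (x k m'))\<^sup>2))" for k m
  have eps0: "0 \<le> \<epsilon> k" if "k \<le> n" for k using eps[OF that] by simp
  have \<rho>_pos: "0 < \<rho> k m" if "k \<le> n" for k m
    unfolding \<rho>_def using eps0[OF that] by (intro divide_pos_pos add_pos_nonneg mult_nonneg_nonneg sum_nonneg) auto
  have \<rho>: "\<rho> (i div N) (i mod N) \<le> s i" if i: "i < ?d" for i
  proof -
    have km: "i div N \<le> n" "i mod N < N" using div_mod_less[OF i] by auto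
    show ?thesis
      unfolding \<rho>_def s_def
      by (rule innovation_ge[where w="w (i div N)" and q=q, OF w q km])
         (use km eps[OF km(1)] in \<open>auto simp: u_def\<close>)
  qed
  have "(\<integral>z. ln (lik n x (received N L h n (x, z))) \<partial>?Q)
     = (\<Sum>i<?d. (cmod (?x i))\<^sup>2 * (1 + real N * mean_gain P N L h) + 1 - (ln (v i) + s i / v i))"
  proof -
    have "(\<integral>z. ln (lik n x (received N L h n (x, z))) \<partial>?Q) = (\<Sum>i<?d. \<integral>z. (cmod (noisy x i z + ?m i))\<^sup>2 - (ln (v i) + (cmod (\<Sum>j<?d. u i j * noisy x j z))\<^sup>2 / v i) \<partial>?Q)"
      unfolding F using mI sI by (intro Bochner_Integration.integral_sum) auto
    also have "\<dots> = (\<Sum>i<?d. (cmod (?x i))\<^sup>2 * (1 + real N * mean_gain P N L h) + 1 - (ln (v i) + s i / v i))"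
      using mI sI mE sE by (intro sum.cong refl) (simp add: PR.prob_space)
    finally show ?thesis .
  qed
  also have "\<dots> \<le> (\<Sum>i<?d. (cmod (?x i))\<^sup>2 * (1 + real N * mean_gain P N L h) - ln (\<rho> (i div N) (i mod N)))"
  proof (intro sum_mono)
    fix i assume "i \<in> {..<?d}"
    then have i: "i < ?d" by simp
    have k: "i div N \<le> n" using div_mod_less[OF i] by auto
    have sp: "0 < s i" using \<rho>[OF i] \<rho>_pos[OF k, of "i mod N"] by linarith
    have "ln (s i / v i) \<le> s i / v i - 1"
      using sp v[OF i] by (intro ln_le_minus_one) simp
    then have "1 + ln (s i) \<le> ln (v i) + s i / v i"
      using sp v[OF i] by (simp add: ln_divide_pos)
    moreover have "ln (\<rho> (i div N) (i mod N)) \<le> ln (s i)"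
      using \<rho>[OF i] \<rho>_pos[OF k, of "i mod N"] sp by (subst ln_le_cancel_iff) auto
    ultimately show "(cmod (?x i))\<^sup>2 * (1 + real N * mean_gain P N L h) + 1 - (ln (v i) + s i / v i)
       \<le> (cmod (?x i))\<^sup>2 * (1 + real N * mean_gain P N L h) - ln (\<rho> (i div N) (i mod N))"
      by linarith
  qed
  also have "\<dots> = (\<Sum>k\<le>n. (\<Sum>m<N. (cmod (x k m))\<^sup>2 * (1 + real N * mean_gain P N L h)) - (\<Sum>m<N. ln (\<rho> k m)))"
    unfolding sum_flatten lessThan_Suc_atMost by (simp add: sum_subtractf)
  also have "\<dots> = (\<Sum>k\<le>n. (1 + real N * mean_gain P N L h) * symbol_energy N x k - ln (1 + \<epsilon> k * symbol_energy N x k))"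
  proof (intro sum.cong refl arg_cong2[where f=minus])
    fix k assume "k \<in> {..n}"
    then have k: "k \<le> n" by simp
    show "(\<Sum>m<N. (cmod (x k m))\<^sup>2 * (1 + real N * mean_gain P N L h)) = (1 + real N * mean_gain P N L h) * symbol_energy N x k"
      unfolding symbol_energy_def by (simp add: sum_distrib_left mult.commute)
    show "(\<Sum>m<N. ln (\<rho> k m)) = ln (1 + \<epsilon> k * symbol_energy N x k)"
      unfolding \<rho>_def symbol_energy_def by (rule sum_ln_telescope) (use eps0[OF k] in auto)
  qed
  finally show ?thesis .
qed

end

section \<open>The mutual information\<close>

lemma measurable_signal_shift:
  assumes [measurable]: "X \<in> M \<rightarrow>\<^sub>M block_space N n" "Y \<in> M \<rightarrow>\<^sub>M block_space N n"
    and [measurable]: "\<And>k m. S k m \<in> borel_measurable M"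
  shows "(\<lambda>z. \<Sum>k\<le>n. \<Sum>m<N. 2 * Re (cnj (S k m z * X z k m) * Y z k m) - (cmod (S k m z * X z k m))\<^sup>2) \<in> borel_measurable M"
proof (intro borel_measurable_sum)
  fix k m assume "k \<in> {..n}" "m \<in> {..<N}"
  then have c: "(\<lambda>x. x k m) \<in> borel_measurable (block_space N n)"
    by (intro measurable_block_component) auto
  have [measurable]: "(\<lambda>z. X z k m) \<in> borel_measurable M" "(\<lambda>z. Y z k m) \<in> borel_measurable M"
    using measurable_compose[OF assms(1) c] measurable_compose[OF assms(2) c] by auto
  show "(\<lambda>z. 2 * Re (cnj (S k m z * X z k m) * Y z k m) - (cmod (S k m z * X z k m))\<^sup>2) \<in> borel_measurable M"
    by measurable
qed

section \<open>Output densities and the information density\<close>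

context ofdm_channel
begin

abbreviation block :: "nat \<Rightarrow> (nat \<Rightarrow> nat \<Rightarrow> complex) measure" where
  "block n \<equiv> block_space N n"

abbreviation noise :: "nat \<Rightarrow> (nat \<Rightarrow> nat \<Rightarrow> complex) measure" where
  "noise n \<equiv> noise_law N n"

lemma measurable_shift_exp:
  assumes X: "X \<in> M \<rightarrow>\<^sub>M block n" and Y: "Y \<in> M \<rightarrow>\<^sub>M block n" and W: "W \<in> M \<rightarrow>\<^sub>M P"
  shows "(\<lambda>z. shift_exp n (\<lambda>k m. signal (X z) k m (W z)) (Y z)) \<in> borel_measurable M"
  unfolding shift_exp_def signal_def
  by (rule measurable_signal_shift[OF X Y]) (intro borel_measurable_times borel_measurable_const measurable_compose[OF W freq_measurable])

lemma measurable_lik: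
  assumes [measurable]: "X \<in> M \<rightarrow>\<^sub>M block n" "Y \<in> M \<rightarrow>\<^sub>M block n"
  shows "(\<lambda>z. lik n (X z) (Y z)) \<in> borel_measurable M"
  unfolding lik_def
proof (rule borel_measurable_lebesgue_integral)
  have "(\<lambda>z. exp (shift_exp n (\<lambda>k m. signal (X (fst z)) k m (snd z)) (Y (fst z)))) \<in> borel_measurable (M \<Otimes>\<^sub>M P)"
    by (intro borel_measurable_exp measurable_compose[OF measurable_shift_exp borel_measurable_exp] measurable_shift_exp) measurable
  then show "(\<lambda>(z, \<omega>). exp (shift_exp n (\<lambda>k m. signal (X z) k m \<omega>) (Y z))) \<in> borel_measurable (M \<Otimes>\<^sub>M P)"
    by (simp add: split_beta')
qed

lemma measurable_energy:
  assumes X: "X \<in> M \<rightarrow>\<^sub>M block n"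
  shows "(\<lambda>z. energy n (X z)) \<in> borel_measurable M"
  unfolding energy_def
proof (intro borel_measurable_sum)
  fix k m assume "k \<in> {..n}" "m \<in> {..<N}"
  then have [measurable]: "(\<lambda>z. X z k m) \<in> borel_measurable M"
    by (intro measurable_compose[OF X measurable_block_component]) auto
  show "(\<lambda>z. (cmod (X z k m))\<^sup>2) \<in> borel_measurable M" by measurable
qed

lemma measurable_received:
  assumes X: "X \<in> M \<rightarrow>\<^sub>M block n" and W: "W \<in> M \<rightarrow>\<^sub>M P" and Z: "Z \<in> M \<rightarrow>\<^sub>M block n"
  shows "(\<lambda>z. received N L h n (X z, W z, Z z)) \<in> M \<rightarrow>\<^sub>M block n"
  unfolding received_def prod.case
proof (intro measurable_restrict)
  fix k m assume "k \<in> {..n}" "m \<in> {..<N}"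
  then have [measurable]: "(\<lambda>z. X z k m) \<in> borel_measurable M" "(\<lambda>z. Z z k m) \<in> borel_measurable M"
    by (auto intro!: measurable_compose[OF X measurable_block_component] measurable_compose[OF Z measurable_block_component])
  have [measurable]: "(\<lambda>z. freq k m (W z)) \<in> borel_measurable M"
    by (rule measurable_compose[OF W freq_measurable])
  show "(\<lambda>z. of_real (sqrt (real N)) * freq k m (W z) * X z k m + Z z k m) \<in> borel_measurable M"
    by measurable
qed

text \<open>For fixed input and channel the output is translated noise, and the Cameron-Martin
  density trades the translation for a weight.\<close>

lemma nn_integral_noise_shift:
  assumes g[measurable]: "g \<in> borel_measurable (block n)"
  shows "(\<integral>\<^sup>+w. g (received N L h n (x, \<omega>, w)) \<partial>noise n)
    = (\<integral>\<^sup>+y. ennreal (exp (shift_exp n (\<lambda>k m. signal x k m \<omega>) y)) * g y \<partial>noise n)"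
proof -
  let ?T = "\<lambda>w. \<lambda>k\<in>{..n}. \<lambda>m\<in>{..<N}. signal x k m \<omega> + w k m"
  have T: "?T \<in> noise n \<rightarrow>\<^sub>M noise n"
    unfolding measurable_cong_sets[OF sets_noise_law sets_noise_law]
  proof (intro measurable_restrict)
    fix k m assume "k \<in> {..n}" "m \<in> {..<N}"
    then have [measurable]: "(\<lambda>x. x k m) \<in> borel_measurable (block n)"
      by (intro measurable_block_component) auto
    show "(\<lambda>w. signal x k m \<omega> + w k m) \<in> borel_measurable (block n)" by measurable
  qed
  have g': "g \<in> borel_measurable (noise n)" by measurable
  have e: "(\<lambda>y. ennreal (exp (shift_exp n (\<lambda>k m. signal x k m \<omega>) y))) \<in> borel_measurable (noise n)"
    unfolding measurable_cong_sets[OF sets_noise_law refl]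
  proof -
    have "(\<lambda>y. \<Sum>k\<le>n. \<Sum>m<N. 2 * Re (cnj (signal x k m \<omega>) * y k m) - (cmod (signal x k m \<omega>))\<^sup>2) \<in> borel_measurable (block n)"
    proof (intro borel_measurable_sum)
      fix k m assume "k \<in> {..n}" "m \<in> {..<N}"
      then have [measurable]: "(\<lambda>x. x k m) \<in> borel_measurable (block n)"
        by (intro measurable_block_component) auto
      show "(\<lambda>y. 2 * Re (cnj (signal x k m \<omega>) * y k m) - (cmod (signal x k m \<omega>))\<^sup>2) \<in> borel_measurable (block n)" by measurable
    qed
    then show "(\<lambda>y. ennreal (exp (shift_exp n (\<lambda>k m. signal x k m \<omega>) y))) \<in> borel_measurable (block n)"
      unfolding shift_exp_def by measurable
  qed
  have "(\<integral>\<^sup>+w. g (received N L h n (x, \<omega>, w)) \<partial>noise n) = (\<integral>\<^sup>+w. g (?T w) \<partial>noise n)"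
    by (simp add: received_def signal_def)
  also have "\<dots> = (\<integral>\<^sup>+y. g y \<partial>distr (noise n) (noise n) ?T)"
    by (rule nn_integral_distr[OF T, symmetric]) (simp add: g')
  also have "\<dots> = (\<integral>\<^sup>+y. g y \<partial>density (noise n) (\<lambda>y. ennreal (exp (shift_exp n (\<lambda>k m. signal x k m \<omega>) y))))"
    unfolding noise_law_shift shift_exp_def ..
  finally show ?thesis
    by (simp add: nn_integral_density[OF e g'])
qed

lemma sets_input_law: "\<mu> \<in> input_laws N n \<Longrightarrow> sets \<mu> = sets (block n)"
  and prob_space_input_law: "\<mu> \<in> input_laws N n \<Longrightarrow> prob_space \<mu>"
  by (auto simp: input_laws_def)

definition sample :: "nat \<Rightarrow> (nat \<Rightarrow> nat \<Rightarrow> complex) measure \<Rightarrow> ((nat \<Rightarrow> nat \<Rightarrow> complex) \<times> 'w \<times> (nat \<Rightarrow> nat \<Rightarrow> complex)) measure" where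
  "sample n \<mu> = \<mu> \<Otimes>\<^sub>M (P \<Otimes>\<^sub>M noise n)"

abbreviation rec :: "nat \<Rightarrow> (nat \<Rightarrow> nat \<Rightarrow> complex) \<times> 'w \<times> (nat \<Rightarrow> nat \<Rightarrow> complex) \<Rightarrow> nat \<Rightarrow> nat \<Rightarrow> complex" where
  "rec n z \<equiv> received N L h n z"

text \<open>The density of the output relative to the noise law, by averaging over the
  input.\<close>

definition marg :: "nat \<Rightarrow> (nat \<Rightarrow> nat \<Rightarrow> complex) measure \<Rightarrow> (nat \<Rightarrow> nat \<Rightarrow> complex) \<Rightarrow> real" where
  "marg n \<mu> y = (\<integral>x. lik n x y \<partial>\<mu>)"

lemma noise_prob: "prob_space (noise n)"
  by (rule prob_space_noise_law)

lemma channel_prob: "prob_space (P \<Otimes>\<^sub>M noise n)"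
proof -
  interpret R: prob_space "noise n" by (rule noise_prob)
  interpret PR: pair_prob_space P "noise n" ..
  show ?thesis by (rule PR.P.prob_space_axioms)
qed

lemma sample_prob:
  assumes "\<mu> \<in> input_laws N n"
  shows "prob_space (sample n \<mu>)"
proof -
  interpret \<mu>: prob_space \<mu> by (rule prob_space_input_law[OF assms])
  interpret PR: prob_space "P \<Otimes>\<^sub>M noise n" by (rule channel_prob)
  interpret S: pair_prob_space \<mu> "P \<Otimes>\<^sub>M noise n" ..
  show ?thesis unfolding sample_def by (rule S.P.prob_space_axioms)
qed

lemma sample_measurable:
  assumes \<mu>: "\<mu> \<in> input_laws N n"
  shows "fst \<in> sample n \<mu> \<rightarrow>\<^sub>M block n" "(\<lambda>z. fst (snd z)) \<in> sample n \<mu> \<rightarrow>\<^sub>M P"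
    "(\<lambda>z. snd (snd z)) \<in> sample n \<mu> \<rightarrow>\<^sub>M block n" "rec n \<in> sample n \<mu> \<rightarrow>\<^sub>M block n"
proof -
  note [measurable_cong] = sets_input_law[OF \<mu>]
  show 1: "fst \<in> sample n \<mu> \<rightarrow>\<^sub>M block n" and 2: "(\<lambda>z. fst (snd z)) \<in> sample n \<mu> \<rightarrow>\<^sub>M P"
    and 3: "(\<lambda>z. snd (snd z)) \<in> sample n \<mu> \<rightarrow>\<^sub>M block n"
    unfolding sample_def by measurable
  show "rec n \<in> sample n \<mu> \<rightarrow>\<^sub>M block n"
    using measurable_received[OF 1 2 3] by simp
qed

lemma nn_integral_sample:
  assumes \<mu>: "\<mu> \<in> input_laws N n"
    and f[measurable]: "(\<lambda>(x, \<omega>, y). f x \<omega> y) \<in> borel_measurable (block n \<Otimes>\<^sub>M (P \<Otimes>\<^sub>M block n))"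
  shows "(\<integral>\<^sup>+z. f (fst z) (fst (snd z)) (rec n z) \<partial>sample n \<mu>)
    = (\<integral>\<^sup>+x. (\<integral>\<^sup>+\<omega>. (\<integral>\<^sup>+y. ennreal (exp (shift_exp n (\<lambda>k m. signal x k m \<omega>) y)) * f x \<omega> y \<partial>noise n) \<partial>P) \<partial>\<mu>)"
proof -
  note [measurable_cong] = sets_input_law[OF \<mu>]
  interpret \<mu>: prob_space \<mu> by (rule prob_space_input_law[OF \<mu>])
  interpret R: prob_space "noise n" by (rule noise_prob)
  interpret PR: pair_prob_space P "noise n" ..

  have [measurable]: "(\<lambda>z. rec n (fst z, fst (snd z), snd (snd z))) \<in> block n \<Otimes>\<^sub>M (P \<Otimes>\<^sub>M block n) \<rightarrow>\<^sub>M block n"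
    by (rule measurable_received) measurable
  have m[measurable]: "(\<lambda>z. f (fst z) (fst (snd z)) (rec n (fst z, fst (snd z), snd (snd z)))) \<in> borel_measurable (block n \<Otimes>\<^sub>M (P \<Otimes>\<^sub>M block n))"
  proof -
    have "(\<lambda>z. (fst z, fst (snd z), rec n (fst z, fst (snd z), snd (snd z)))) \<in> block n \<Otimes>\<^sub>M (P \<Otimes>\<^sub>M block n) \<rightarrow>\<^sub>M block n \<Otimes>\<^sub>M (P \<Otimes>\<^sub>M block n)"
      by measurable
    from measurable_compose[OF this f] show ?thesis by simp
  qed
  have "sets (\<mu> \<Otimes>\<^sub>M (P \<Otimes>\<^sub>M noise n)) = sets (block n \<Otimes>\<^sub>M (P \<Otimes>\<^sub>M block n))"
    by (intro sets_pair_measure_cong) (simp_all add: sets_input_law[OF \<mu>])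
  then have m': "(\<lambda>z. f (fst z) (fst (snd z)) (rec n (fst z, fst (snd z), snd (snd z)))) \<in> borel_measurable (\<mu> \<Otimes>\<^sub>M (P \<Otimes>\<^sub>M noise n))"
    using m measurable_cong_sets by blast
  have "(\<integral>\<^sup>+z. f (fst z) (fst (snd z)) (rec n z) \<partial>sample n \<mu>)
     = (\<integral>\<^sup>+z. f (fst z) (fst (snd z)) (rec n (fst z, fst (snd z), snd (snd z))) \<partial>(\<mu> \<Otimes>\<^sub>M (P \<Otimes>\<^sub>M noise n)))"
    unfolding sample_def by simp
  also have "\<dots> = (\<integral>\<^sup>+x. (\<integral>\<^sup>+v. f x (fst v) (rec n (x, fst v, snd v)) \<partial>(P \<Otimes>\<^sub>M noise n)) \<partial>\<mu>)"
    by (subst PR.P.nn_integral_fst[OF m', symmetric]) simp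
  also have "\<dots> = (\<integral>\<^sup>+x. (\<integral>\<^sup>+\<omega>. (\<integral>\<^sup>+w. f x \<omega> (rec n (x, \<omega>, w)) \<partial>noise n) \<partial>P) \<partial>\<mu>)"
  proof (intro nn_integral_cong)
    fix x assume "x \<in> space \<mu>"
    then have x: "x \<in> space (block n)" using sets_eq_imp_space_eq[OF sets_input_law[OF \<mu>]] by simp
    have "(\<lambda>v. (x, v)) \<in> P \<Otimes>\<^sub>M block n \<rightarrow>\<^sub>M block n \<Otimes>\<^sub>M (P \<Otimes>\<^sub>M block n)"
      using x by measurable
    from measurable_compose[OF this m] have mm: "(\<lambda>v. f x (fst v) (rec n (x, fst v, snd v))) \<in> borel_measurable (P \<Otimes>\<^sub>M noise n)"
      by simp
    show "(\<integral>\<^sup>+v. f x (fst v) (rec n (x, fst v, snd v)) \<partial>(P \<Otimes>\<^sub>M noise n)) = (\<integral>\<^sup>+\<omega>. (\<integral>\<^sup>+w. f x \<omega> (rec n (x, \<omega>, w)) \<partial>noise n) \<partial>P)"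
      using R.nn_integral_fst[OF mm] by simp
  qed
  also have "\<dots> = (\<integral>\<^sup>+x. (\<integral>\<^sup>+\<omega>. (\<integral>\<^sup>+y. ennreal (exp (shift_exp n (\<lambda>k m. signal x k m \<omega>) y)) * f x \<omega> y \<partial>noise n) \<partial>P) \<partial>\<mu>)"
  proof (rule nn_integral_cong, rule nn_integral_cong)
    fix x \<omega> assume "x \<in> space \<mu>" and \<omega>: "\<omega> \<in> space P"
    then have x: "x \<in> space (block n)" using sets_eq_imp_space_eq[OF sets_input_law[OF \<mu>]] by simp
    have "(\<lambda>y. (x, \<omega>, y)) \<in> block n \<rightarrow>\<^sub>M block n \<Otimes>\<^sub>M (P \<Otimes>\<^sub>M block n)"
      using x \<omega> by measurable
    from measurable_compose[OF this f] have "f x \<omega> \<in> borel_measurable (block n)" by simp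
    then show "(\<integral>\<^sup>+w. f x \<omega> (rec n (x, \<omega>, w)) \<partial>noise n) = (\<integral>\<^sup>+y. ennreal (exp (shift_exp n (\<lambda>k m. signal x k m \<omega>) y)) * f x \<omega> y \<partial>noise n)"
      by (rule nn_integral_noise_shift)
  qed
  finally show ?thesis .
qed

text \<open>The integrand does not see the channel, so averaging the Cameron-Martin weight over the
  channel turns it into \<open>lik\<close>.\<close>

lemma nn_integral_sample_lik:
  assumes \<mu>: "\<mu> \<in> input_laws N n"
    and f[measurable]: "(\<lambda>(x, y). f x y) \<in> borel_measurable (block n \<Otimes>\<^sub>M block n)"
  shows "(\<integral>\<^sup>+z. f (fst z) (rec n z) \<partial>sample n \<mu>) = (\<integral>\<^sup>+x. (\<integral>\<^sup>+y. ennreal (lik n x y) * f x y \<partial>noise n) \<partial>\<mu>)"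
proof -
  interpret R: prob_space "noise n" by (rule noise_prob)
  interpret PR: pair_prob_space P "noise n" ..
  have "(\<lambda>(x, \<omega>, y). f x y) \<in> borel_measurable (block n \<Otimes>\<^sub>M (P \<Otimes>\<^sub>M block n))"
  proof -
    have "(\<lambda>z. (fst z, snd (snd z))) \<in> block n \<Otimes>\<^sub>M (P \<Otimes>\<^sub>M block n) \<rightarrow>\<^sub>M block n \<Otimes>\<^sub>M block n" by measurable
    from measurable_compose[OF this f] show ?thesis by (simp add: split_beta')
  qed
  from nn_integral_sample[OF \<mu> this]
  have "(\<integral>\<^sup>+z. f (fst z) (rec n z) \<partial>sample n \<mu>) = (\<integral>\<^sup>+x. (\<integral>\<^sup>+\<omega>. (\<integral>\<^sup>+y. ennreal (exp (shift_exp n (\<lambda>k m. signal x k m \<omega>) y)) * f x y \<partial>noise n) \<partial>P) \<partial>\<mu>)"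
    by simp
  also have "\<dots> = (\<integral>\<^sup>+x. (\<integral>\<^sup>+y. ennreal (lik n x y) * f x y \<partial>noise n) \<partial>\<mu>)"
  proof (intro nn_integral_cong)
    fix x assume "x \<in> space \<mu>"
    then have x: "x \<in> space (block n)" using sets_eq_imp_space_eq[OF sets_input_law[OF \<mu>]] by simp
    have "(\<lambda>y. (x, y)) \<in> block n \<rightarrow>\<^sub>M block n \<Otimes>\<^sub>M block n"
      using x by measurable
    from measurable_compose[OF this f] have [measurable]: "f x \<in> borel_measurable (block n)" by simp
    have [measurable]: "(\<lambda>v. shift_exp n (\<lambda>k m. signal x k m (fst v)) (snd v)) \<in> borel_measurable (P \<Otimes>\<^sub>M noise n)"
      by (rule measurable_shift_exp) (use x in measurable)
    have "(\<integral>\<^sup>+\<omega>. (\<integral>\<^sup>+y. ennreal (exp (shift_exp n (\<lambda>k m. signal x k m \<omega>) y)) * f x y \<partial>noise n) \<partial>P)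
       = (\<integral>\<^sup>+y. (\<integral>\<^sup>+\<omega>. ennreal (exp (shift_exp n (\<lambda>k m. signal x k m \<omega>) y)) * f x y \<partial>P) \<partial>noise n)"
      by (rule PR.Fubini'[symmetric]) (simp add: split_beta')
    also have "\<dots> = (\<integral>\<^sup>+y. ennreal (lik n x y) * f x y \<partial>noise n)"
    proof (intro nn_integral_cong)
      fix y
      have "(\<integral>\<^sup>+\<omega>. ennreal (exp (shift_exp n (\<lambda>k m. signal x k m \<omega>) y)) * f x y \<partial>P) = (\<integral>\<^sup>+\<omega>. ennreal (exp (shift_exp n (\<lambda>k m. signal x k m \<omega>) y)) \<partial>P) * f x y"
        by (rule nn_integral_multc) simp
      also have "(\<integral>\<^sup>+\<omega>. ennreal (exp (shift_exp n (\<lambda>k m. signal x k m \<omega>) y)) \<partial>P) = ennreal (lik n x y)"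
        unfolding lik_def by (rule nn_integral_eq_integral[OF integrable_exp_shift]) simp
      finally show "(\<integral>\<^sup>+\<omega>. ennreal (exp (shift_exp n (\<lambda>k m. signal x k m \<omega>) y)) * f x y \<partial>P) = ennreal (lik n x y) * f x y" .
    qed
    finally show "(\<integral>\<^sup>+\<omega>. (\<integral>\<^sup>+y. ennreal (exp (shift_exp n (\<lambda>k m. signal x k m \<omega>) y)) * f x y \<partial>noise n) \<partial>P) = (\<integral>\<^sup>+y. ennreal (lik n x y) * f x y \<partial>noise n)" .
  qed
  finally show ?thesis .
qed

lemma measurable_lik_fst_rec:
  assumes \<mu>: "\<mu> \<in> input_laws N n"
  shows "(\<lambda>z. lik n (fst z) (rec n z)) \<in> borel_measurable (sample n \<mu>)"
  by (rule measurable_lik[OF sample_measurable(1,4)[OF \<mu>]])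

lemma integrable_lik:
  assumes \<mu>: "\<mu> \<in> input_laws N n" and y: "y \<in> space (block n)"
  shows "integrable \<mu> (\<lambda>x. lik n x y)"
proof -
  interpret \<mu>: prob_space \<mu> by (rule prob_space_input_law[OF \<mu>])
  note [measurable_cong] = sets_input_law[OF \<mu>]
  show ?thesis
  proof (rule \<mu>.integrable_const_bound[where B="exp (energy n y)"])
    show "(\<lambda>x. lik n x y) \<in> borel_measurable \<mu>"
      by (rule measurable_lik) (use y in measurable)
    show "AE x in \<mu>. norm (lik n x y) \<le> exp (energy n y)"
      using lik_bounds(1,2)[of n _ y] by (intro AE_I2) (simp add: less_imp_le)
  qed
qed

lemma marg_bounds:
  assumes \<mu>: "\<mu> \<in> input_laws N n" and y: "y \<in> space (block n)"
  shows "0 < marg n \<mu> y" "marg n \<mu> y \<le> exp (energy n y)"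
proof -
  interpret \<mu>: prob_space \<mu> by (rule prob_space_input_law[OF \<mu>])
  note i = integrable_lik[OF \<mu> y]
  show "0 < marg n \<mu> y"
    unfolding marg_def using lik_bounds(1)[of n _ y] by (intro \<mu>.expectation_greater[OF i]) simp
  have "marg n \<mu> y \<le> (\<integral>x. exp (energy n y) \<partial>\<mu>)"
    unfolding marg_def by (intro integral_mono i lik_bounds(2)) simp
  then show "marg n \<mu> y \<le> exp (energy n y)" by (simp add: \<mu>.prob_space)
qed

lemma measurable_marg:
  assumes \<mu>: "\<mu> \<in> input_laws N n"
  shows "marg n \<mu> \<in> borel_measurable (block n)"
proof -
  interpret \<mu>: prob_space \<mu> by (rule prob_space_input_law[OF \<mu>])
  note [measurable_cong] = sets_input_law[OF \<mu>]
  have "(\<lambda>z. lik n (snd z) (fst z)) \<in> borel_measurable (block n \<Otimes>\<^sub>M \<mu>)"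
    by (rule measurable_lik) measurable
  then show ?thesis
    unfolding marg_def[abs_def] by (intro \<mu>.borel_measurable_lebesgue_integral) (simp add: split_beta')
qed

lemma nn_integral_marg:
  assumes \<mu>: "\<mu> \<in> input_laws N n" and y: "y \<in> space (block n)"
  shows "(\<integral>\<^sup>+x. ennreal (lik n x y) \<partial>\<mu>) = ennreal (marg n \<mu> y)"
  unfolding marg_def by (rule nn_integral_eq_integral[OF integrable_lik[OF \<mu> y]]) (simp add: lik_bounds(1) less_imp_le)

text \<open>On the input side the input law itself is the reference measure, with density 1. Hence
  no input law needs a Lebesgue density, and discrete and continuous inputs are covered
  alike.\<close>

lemma distributed_sample:
  assumes \<mu>: "\<mu> \<in> input_laws N n"
  shows "distributed (sample n \<mu>) \<mu> fst (\<lambda>_. ennreal 1)"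
    and "distributed (sample n \<mu>) (noise n) (rec n) (\<lambda>y. ennreal (marg n \<mu> y))"
    and "distributed (sample n \<mu>) (\<mu> \<Otimes>\<^sub>M noise n) (\<lambda>z. (fst z, rec n z)) (\<lambda>z. ennreal (lik n (fst z) (snd z)))"
proof -
  interpret \<mu>: prob_space \<mu> by (rule prob_space_input_law[OF \<mu>])
  interpret R: prob_space "noise n" by (rule noise_prob)
  interpret S: prob_space "sample n \<mu>" by (rule sample_prob[OF \<mu>])
  interpret MR: pair_prob_space \<mu> "noise n" ..
  note [measurable_cong] = sets_input_law[OF \<mu>]
  note [measurable] = sample_measurable[OF \<mu>]
  have sp: "sets (\<mu> \<Otimes>\<^sub>M noise n) = sets (block n \<Otimes>\<^sub>M block n)"
    by (intro sets_pair_measure_cong) (simp_all add: sets_input_law[OF \<mu>])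
  have spc: "space \<mu> = space (block n)"
    by (rule sets_eq_imp_space_eq[OF sets_input_law[OF \<mu>]])
  have lm[measurable]: "(\<lambda>z. lik n (fst z) (snd z)) \<in> borel_measurable (\<mu> \<Otimes>\<^sub>M noise n)"
    by (rule measurable_lik) measurable
  have XY[measurable]: "(\<lambda>z. (fst z, rec n z)) \<in> sample n \<mu> \<rightarrow>\<^sub>M \<mu> \<Otimes>\<^sub>M noise n"
    using sample_measurable(1,4)[OF \<mu>]
    by (intro measurable_Pair) (simp_all add: measurable_cong_sets[OF refl sets_input_law[OF \<mu>]] measurable_cong_sets[OF refl sets_noise_law])
  show joint: "distributed (sample n \<mu>) (\<mu> \<Otimes>\<^sub>M noise n) (\<lambda>z. (fst z, rec n z)) (\<lambda>z. ennreal (lik n (fst z) (snd z)))"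
    unfolding distributed_def
  proof (intro conjI)
    show "distr (sample n \<mu>) (\<mu> \<Otimes>\<^sub>M noise n) (\<lambda>z. (fst z, rec n z)) = density (\<mu> \<Otimes>\<^sub>M noise n) (\<lambda>z. ennreal (lik n (fst z) (snd z)))"
    proof (rule measure_eqI)
      fix A assume A0: "A \<in> sets (distr (sample n \<mu>) (\<mu> \<Otimes>\<^sub>M noise n) (\<lambda>z. (fst z, rec n z)))"
      then have A[measurable]: "A \<in> sets (\<mu> \<Otimes>\<^sub>M noise n)" by simp
      then have A': "A \<in> sets (block n \<Otimes>\<^sub>M block n)" unfolding sp .
      have "emeasure (distr (sample n \<mu>) (\<mu> \<Otimes>\<^sub>M noise n) (\<lambda>z. (fst z, rec n z))) A
          = (\<integral>\<^sup>+v. indicator A v \<partial>distr (sample n \<mu>) (\<mu> \<Otimes>\<^sub>M noise n) (\<lambda>z. (fst z, rec n z)))"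
        by (rule nn_integral_indicator[OF A0, symmetric])
      also have "\<dots> = (\<integral>\<^sup>+z. indicator A (fst z, rec n z) \<partial>sample n \<mu>)"
        by (subst nn_integral_distr) simp_all
      also have "\<dots> = (\<integral>\<^sup>+x. (\<integral>\<^sup>+y. ennreal (lik n x y) * indicator A (x, y) \<partial>noise n) \<partial>\<mu>)"
        by (rule nn_integral_sample_lik[OF \<mu>]) (use A' in simp)
      also have "\<dots> = (\<integral>\<^sup>+z. ennreal (lik n (fst z) (snd z)) * indicator A z \<partial>(\<mu> \<Otimes>\<^sub>M noise n))"
      proof -
        have "(\<lambda>z. ennreal (lik n (fst z) (snd z)) * indicator A z) \<in> borel_measurable (\<mu> \<Otimes>\<^sub>M noise n)"
          by (intro borel_measurable_times_ennreal measurable_compose[OF lm measurable_ennreal] borel_measurable_indicator A)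
        from R.nn_integral_fst[OF this] show ?thesis by simp
      qed
      also have "\<dots> = emeasure (density (\<mu> \<Otimes>\<^sub>M noise n) (\<lambda>z. ennreal (lik n (fst z) (snd z)))) A"
        by (rule emeasure_density[OF measurable_compose[OF lm measurable_ennreal] A, symmetric])
      finally show "emeasure (distr (sample n \<mu>) (\<mu> \<Otimes>\<^sub>M noise n) (\<lambda>z. (fst z, rec n z))) A
         = emeasure (density (\<mu> \<Otimes>\<^sub>M noise n) (\<lambda>z. ennreal (lik n (fst z) (snd z)))) A" .
    qed simp
  qed simp_all
  have "distributed (sample n \<mu>) (noise n) (rec n) (\<lambda>y. \<integral>\<^sup>+x. ennreal (lik n (fst (x, y)) (snd (x, y))) \<partial>\<mu>)"
    by (rule S.distr_marginal2[OF \<mu>.sigma_finite_measure_axioms R.sigma_finite_measure_axioms joint])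
  then show "distributed (sample n \<mu>) (noise n) (rec n) (\<lambda>y. ennreal (marg n \<mu> y))"
  proof (rule distributed_cong_density[THEN iffD1, rotated -1])
    show "AE y in noise n. (\<integral>\<^sup>+x. ennreal (lik n (fst (x, y)) (snd (x, y))) \<partial>\<mu>) = ennreal (marg n \<mu> y)"
      using nn_integral_marg[OF \<mu>] by (intro AE_I2) simp
    show "(\<lambda>y. ennreal (marg n \<mu> y)) \<in> borel_measurable (noise n)"
      using measurable_marg[OF \<mu>] by simp
    show "(\<lambda>y. \<integral>\<^sup>+x. ennreal (lik n (fst (x, y)) (snd (x, y))) \<partial>\<mu>) \<in> borel_measurable (noise n)"
    proof -
      have "(\<lambda>z. lik n (snd z) (fst z)) \<in> borel_measurable (noise n \<Otimes>\<^sub>M \<mu>)"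
        by (rule measurable_lik) measurable
      then show ?thesis by (intro \<mu>.borel_measurable_nn_integral) (simp add: split_beta')
    qed
  qed
  interpret Q: prob_space "P \<Otimes>\<^sub>M noise n" by (rule channel_prob)
  show "distributed (sample n \<mu>) \<mu> fst (\<lambda>_. ennreal 1)"
    unfolding distributed_def sample_def using Q.distr_pair_fst[of \<mu>] by (simp add: density_1)
qed

text \<open>Mutual information depends on the two reference spaces only through their
  \<sigma>-algebras, so these may be exchanged for the input law and the noise law, relative to
  which densities exist. Positivity of \<open>lik\<close> and \<open>marg\<close> then splits the
  logarithm of their quotient.\<close>

lemma io_information_eq:
  assumes \<mu>: "\<mu> \<in> input_laws N n"
  shows "io_information P N L h n \<mu> = (\<integral>z. ln (lik n (fst z) (rec n z)) - ln (marg n \<mu> (rec n z)) \<partial>sample n \<mu>)"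
proof -
  interpret \<mu>: prob_space \<mu> by (rule prob_space_input_law[OF \<mu>])
  interpret R: prob_space "noise n" by (rule noise_prob)
  interpret S: prob_space "sample n \<mu>" by (rule sample_prob[OF \<mu>])
  interpret I: information_space "sample n \<mu>" "exp 1"
    by unfold_locales simp
  note [measurable_cong] = sets_input_law[OF \<mu>]
  have spc: "space \<mu> = space (block n)"
    by (rule sets_eq_imp_space_eq[OF sets_input_law[OF \<mu>]])
  note D = distributed_sample[OF \<mu>]
  have "io_information P N L h n \<mu> = S.mutual_information (exp 1) (block n) (block n) fst (rec n)"
    by (simp only: io_information_def sample_def)
  also have "\<dots> = S.mutual_information (exp 1) \<mu> (noise n) fst (rec n)"
  proof -
    have s: "sets (block n \<Otimes>\<^sub>M block n) = sets (\<mu> \<Otimes>\<^sub>M noise n)"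
      by (intro sets_pair_measure_cong) (simp_all add: sets_input_law[OF \<mu>])
    have "distr (sample n \<mu>) (block n) fst = distr (sample n \<mu>) \<mu> fst"
      by (rule distr_cong[OF refl _ refl]) (simp add: sets_input_law[OF \<mu>])
    moreover have "distr (sample n \<mu>) (block n) (rec n) = distr (sample n \<mu>) (noise n) (rec n)"
      by (rule distr_cong[OF refl _ refl]) simp
    moreover have "distr (sample n \<mu>) (block n \<Otimes>\<^sub>M block n) (\<lambda>z. (fst z, rec n z)) = distr (sample n \<mu>) (\<mu> \<Otimes>\<^sub>M noise n) (\<lambda>z. (fst z, rec n z))"
      by (rule distr_cong[OF refl s refl])
    ultimately show ?thesis unfolding S.mutual_information_def by (simp only:)
  qed
  also have "\<dots> = (\<integral>z. lik n (fst z) (snd z) * log (exp 1) (lik n (fst z) (snd z) / (1 * marg n \<mu> (snd z))) \<partial>(\<mu> \<Otimes>\<^sub>M noise n))"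
    by (rule I.mutual_information_distr[OF \<mu>.sigma_finite_measure_axioms R.sigma_finite_measure_axioms D(1) _ D(2) _ D(3)])
       (auto simp: lik_bounds(1) less_imp_le marg_bounds[OF \<mu>])
  also have "\<dots> = (\<integral>z. ln (lik n (fst z) (rec n z) / marg n \<mu> (rec n z)) \<partial>sample n \<mu>)"
  proof -
    have [measurable]: "marg n \<mu> \<in> borel_measurable (noise n)" using measurable_marg[OF \<mu>] by simp
    have [measurable]: "(\<lambda>z. lik n (fst z) (snd z)) \<in> borel_measurable (\<mu> \<Otimes>\<^sub>M noise n)"
      by (rule measurable_lik) measurable
    have "(\<integral>z. lik n (fst z) (snd z) * ln (lik n (fst z) (snd z) / marg n \<mu> (snd z)) \<partial>(\<mu> \<Otimes>\<^sub>M noise n))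
       = (\<integral>z. ln (lik n (fst (fst z, rec n z)) (snd (fst z, rec n z)) / marg n \<mu> (snd (fst z, rec n z))) \<partial>sample n \<mu>)"
      by (rule distributed_integral[OF D(3)]) (auto simp: lik_bounds(1) less_imp_le)
    then show ?thesis by (simp add: log_def)
  qed
  also have "\<dots> = (\<integral>z. ln (lik n (fst z) (rec n z)) - ln (marg n \<mu> (rec n z)) \<partial>sample n \<mu>)"
  proof (intro Bochner_Integration.integral_cong refl)
    fix z assume z: "z \<in> space (sample n \<mu>)"
    have "rec n z \<in> space (block n)" using measurable_space[OF sample_measurable(4)[OF \<mu>] z] .
    then show "ln (lik n (fst z) (rec n z) / marg n \<mu> (rec n z)) = ln (lik n (fst z) (rec n z)) - ln (marg n \<mu> (rec n z))"
      by (intro ln_divide_pos lik_bounds(1) marg_bounds(1)[OF \<mu>])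
  qed
  finally show ?thesis .
qed

lemma energy_eq: "energy n x = (\<Sum>k\<le>n. symbol_energy N x k)"
  unfolding energy_def symbol_energy_def ..

lemma energy_nonneg: "0 \<le> energy n x"
  unfolding energy_def by (simp add: sum_nonneg)

lemma component_le_energy:
  assumes "k \<le> n" "m < N"
  shows "(cmod (x k m))\<^sup>2 \<le> energy n x"
proof -
  have "(cmod (x k m))\<^sup>2 \<le> (\<Sum>m<N. (cmod (x k m))\<^sup>2)"
    using assms by (intro member_le_sum) auto
  also have "\<dots> \<le> energy n x"
    unfolding energy_def using assms by (intro member_le_sum[where f="\<lambda>k. \<Sum>m<N. (cmod (x k m))\<^sup>2"]) (auto simp: sum_nonneg)
  finally show ?thesis .
qed

lemma freq_square_integrable: "integrable P (\<lambda>\<omega>. (cmod (freq k m \<omega>))\<^sup>2)"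
  using signal_energy(1)[of "\<lambda>_ _. 1 / of_real (sqrt (real N))" k m] N_pos by (simp add: signal_def)

lemma integrable_component:
  assumes \<mu>: "\<mu> \<in> input_laws N n" and e: "integrable \<mu> (energy n)" and km: "k \<le> n" "m < N"
  shows "integrable \<mu> (\<lambda>x. (cmod (x k m))\<^sup>2)"
proof (rule Bochner_Integration.integrable_bound[OF e])
  have "(\<lambda>x. x k m) \<in> borel_measurable (block n)" by (rule measurable_block_component[OF km])
  then have [measurable]: "(\<lambda>x. x k m) \<in> borel_measurable \<mu>"
    by (simp add: measurable_cong_sets[OF sets_input_law[OF \<mu>] refl])
  show "(\<lambda>x. (cmod (x k m))\<^sup>2) \<in> borel_measurable \<mu>" by measurable
  show "AE x in \<mu>. norm ((cmod (x k m))\<^sup>2) \<le> norm (energy n x)"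
    using component_le_energy[OF km] energy_nonneg by (intro AE_I2) simp
qed

text \<open>Independence of input, channel and noise for products of three functions; all moments of
  the output are reduced to this by expanding squares.\<close>

lemma sample_product:
  fixes f :: "_ \<Rightarrow> 'c::{real_normed_field,banach,second_countable_topology}" and g g2 :: "_ \<Rightarrow> 'c"
  assumes \<mu>: "\<mu> \<in> input_laws N n" and f: "integrable \<mu> f" and g: "integrable P g" and g2: "integrable (noise n) g2"
  shows "integrable (sample n \<mu>) (\<lambda>z. f (fst z) * (g (fst (snd z)) * g2 (snd (snd z))))"
    and "(\<integral>z. f (fst z) * (g (fst (snd z)) * g2 (snd (snd z))) \<partial>sample n \<mu>) = (\<integral>x. f x \<partial>\<mu>) * ((\<integral>\<omega>. g \<omega> \<partial>P) * (\<integral>w. g2 w \<partial>noise n))"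
proof -
  interpret \<mu>: prob_space \<mu> by (rule prob_space_input_law[OF \<mu>])
  interpret R: prob_space "noise n" by (rule noise_prob)
  interpret PR: pair_prob_space P "noise n" ..
  interpret S: pair_prob_space \<mu> "P \<Otimes>\<^sub>M noise n" ..
  note a = PR.integral_mult_fst_snd[OF g g2]
  note b = S.integral_mult_fst_snd[OF f a(1)]
  show "integrable (sample n \<mu>) (\<lambda>z. f (fst z) * (g (fst (snd z)) * g2 (snd (snd z))))"
    "(\<integral>z. f (fst z) * (g (fst (snd z)) * g2 (snd (snd z))) \<partial>sample n \<mu>) = (\<integral>x. f x \<partial>\<mu>) * ((\<integral>\<omega>. g \<omega> \<partial>P) * (\<integral>w. g2 w \<partial>noise n))"
    unfolding sample_def using b a by simp_all
qed

lemma integrable_one: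
  assumes \<mu>: "\<mu> \<in> input_laws N n"
  shows "integrable \<mu> (\<lambda>_. 1::real)" "integrable P (\<lambda>_. 1::real)" "integrable (noise n) (\<lambda>_. 1::real)"
    "(\<integral>_. 1 \<partial>\<mu>) = (1::real)" "(\<integral>_. 1 \<partial>P) = (1::real)" "(\<integral>_. 1 \<partial>noise n) = (1::real)"
proof -
  interpret \<mu>: prob_space \<mu> by (rule prob_space_input_law[OF \<mu>])
  interpret R: prob_space "noise n" by (rule noise_prob)
  show "integrable \<mu> (\<lambda>_. 1::real)" "integrable P (\<lambda>_. 1::real)" "integrable (noise n) (\<lambda>_. 1::real)"
    "(\<integral>_. 1 \<partial>\<mu>) = (1::real)" "(\<integral>_. 1 \<partial>P) = (1::real)" "(\<integral>_. 1 \<partial>noise n) = (1::real)"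
    by (simp_all add: \<mu>.prob_space prob_space R.prob_space del: space_noise_law)
qed

lemma sample_energies:
  assumes \<mu>: "\<mu> \<in> input_laws N n" and e: "integrable \<mu> (energy n)"
  shows "integrable (sample n \<mu>) (\<lambda>z. energy n (fst z))"
    and "integrable (sample n \<mu>) (\<lambda>z. energy n (\<lambda>k m. signal (fst z) k m (fst (snd z))))"
    and "integrable (sample n \<mu>) (\<lambda>z. energy n (snd (snd z)))"
    and "integrable (sample n \<mu>) (\<lambda>z. energy n (rec n z))"
proof -
  note o = integrable_one[OF \<mu>]
  show "integrable (sample n \<mu>) (\<lambda>z. energy n (fst z))"
    using sample_product(1)[OF \<mu> e o(2) o(3)] by simp
  show S: "integrable (sample n \<mu>) (\<lambda>z. energy n (\<lambda>k m. signal (fst z) k m (fst (snd z))))"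
    unfolding energy_def
  proof (intro Bochner_Integration.integrable_sum)
    fix k m assume "k \<in> {..n}" "m \<in> {..<N}"
    then have km: "k \<le> n" "m < N" by auto
    have "integrable P (\<lambda>\<omega>. real N * (cmod (freq k m \<omega>))\<^sup>2)"
      using freq_square_integrable by simp
    from sample_product(1)[OF \<mu> integrable_component[OF \<mu> e km] this o(3)]
    show "integrable (sample n \<mu>) (\<lambda>z. (cmod (signal (fst z) k m (fst (snd z))))\<^sup>2)"
      by (simp add: signal_def norm_mult power_mult_distrib mult_ac)
  qed
  show W: "integrable (sample n \<mu>) (\<lambda>z. energy n (snd (snd z)))"
    unfolding energy_def
  proof (intro Bochner_Integration.integrable_sum)
    fix k m assume "k \<in> {..n}" "m \<in> {..<N}"
    then have km: "k \<le> n" "m < N" by auto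
    from sample_product(1)[OF \<mu> o(1) o(2) noise_law_moments(3)[OF km]]
    show "integrable (sample n \<mu>) (\<lambda>z. (cmod (snd (snd z) k m))\<^sup>2)" by simp
  qed
  show "integrable (sample n \<mu>) (\<lambda>z. energy n (rec n z))"
  proof (rule Bochner_Integration.integrable_bound)
    show "integrable (sample n \<mu>) (\<lambda>z. 2 * energy n (\<lambda>k m. signal (fst z) k m (fst (snd z))) + 2 * energy n (snd (snd z)))"
      using S W by simp
    show "(\<lambda>z. energy n (rec n z)) \<in> borel_measurable (sample n \<mu>)"
      by (rule measurable_energy[OF sample_measurable(4)[OF \<mu>]])
    have "(cmod (a + b))\<^sup>2 \<le> 2 * (cmod a)\<^sup>2 + 2 * (cmod b)\<^sup>2" for a b :: complex
      using cmod_diff_power2[of a "- b"] cmod_diff_power2[of a b] by simp (smt (verit) zero_le_power2)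
    then have "energy n (rec n z) \<le> (\<Sum>k\<le>n. \<Sum>m<N. 2 * (cmod (signal (fst z) k m (fst (snd z))))\<^sup>2 + 2 * (cmod (snd (snd z) k m))\<^sup>2)" for z
      unfolding energy_def by (intro sum_mono) (cases z, auto simp: received_component)
    then have "energy n (rec n z) \<le> 2 * energy n (\<lambda>k m. signal (fst z) k m (fst (snd z))) + 2 * energy n (snd (snd z))" for z
      unfolding energy_def by (simp add: sum.distrib sum_distrib_left)
    then show "AE z in sample n \<mu>. norm (energy n (rec n z)) \<le> norm (2 * energy n (\<lambda>k m. signal (fst z) k m (fst (snd z))) + 2 * energy n (snd (snd z)))"
      using energy_nonneg by (intro AE_I2) (smt (verit) real_norm_def)
  qed
qed

text \<open>The output has density \<open>marg\<close>, which is positive, so the integral reduces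
  to the mass of the noise law.\<close>

lemma sample_inverse_marg:
  assumes \<mu>: "\<mu> \<in> input_laws N n"
  shows "(\<integral>\<^sup>+z. ennreal (1 / marg n \<mu> (rec n z)) \<partial>sample n \<mu>) = 1"
proof -
  interpret R: prob_space "noise n" by (rule noise_prob)
  have [measurable]: "marg n \<mu> \<in> borel_measurable (noise n)" using measurable_marg[OF \<mu>] by simp
  have "(\<integral>\<^sup>+z. ennreal (1 / marg n \<mu> (rec n z)) \<partial>sample n \<mu>) = (\<integral>\<^sup>+y. ennreal (marg n \<mu> y) * ennreal (1 / marg n \<mu> y) \<partial>noise n)"
    by (rule distributed_nn_integral[OF distributed_sample(2)[OF \<mu>], symmetric]) measurable
  also have "\<dots> = (\<integral>\<^sup>+y. 1 \<partial>noise n)"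
  proof (intro nn_integral_cong)
    fix y assume "y \<in> space (noise n)"
    then have "0 < marg n \<mu> y" by (intro marg_bounds(1)[OF \<mu>]) simp
    then show "ennreal (marg n \<mu> y) * ennreal (1 / marg n \<mu> y) = 1"
      by (simp add: ennreal_mult[symmetric])
  qed
  finally show ?thesis using R.emeasure_space_1 by simp
qed

text \<open>Energies dominate |ln \<open>lik\<close>|, but bound ln m, with m the output density,
  only from above. Below, -ln m \<le> 1/m helps, because 1/m has expectation 1 under the output
  law.\<close>

lemma integrable_ln_lik_marg:
  assumes \<mu>: "\<mu> \<in> input_laws N n" and e: "integrable \<mu> (energy n)"
  shows "integrable (sample n \<mu>) (\<lambda>z. ln (lik n (fst z) (rec n z)))"
    and "integrable (sample n \<mu>) (\<lambda>z. ln (marg n \<mu> (rec n z)))"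
proof -
  note E = sample_energies[OF \<mu> e]
  have lm: "(\<lambda>z. lik n (fst z) (rec n z)) \<in> borel_measurable (sample n \<mu>)"
    by (rule measurable_lik_fst_rec[OF \<mu>])
  have mm: "(\<lambda>z. marg n \<mu> (rec n z)) \<in> borel_measurable (sample n \<mu>)"
    by (rule measurable_compose[OF sample_measurable(4)[OF \<mu>] measurable_marg[OF \<mu>]])
  have mg: "0 \<le> mean_gain P N L h" by (simp add: mean_gain_def)
  show "integrable (sample n \<mu>) (\<lambda>z. ln (lik n (fst z) (rec n z)))"
  proof (rule Bochner_Integration.integrable_bound)
    show "integrable (sample n \<mu>) (\<lambda>z. energy n (rec n z) + 2 * (1 + real N * mean_gain P N L h) * energy n (fst z))"
      using E by (intro Bochner_Integration.integrable_add integrable_mult_right) auto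
    show "(\<lambda>z. ln (lik n (fst z) (rec n z))) \<in> borel_measurable (sample n \<mu>)"
      using lm by measurable
    have "\<bar>ln (lik n x y)\<bar> \<le> energy n y + 2 * (1 + real N * mean_gain P N L h) * energy n x" for x y
    proof -
      have "ln (lik n x y) \<le> ln (exp (energy n y))"
        using lik_bounds(1,2)[of n x y] by (subst ln_le_cancel_iff) auto
      moreover have "0 \<le> 2 * (1 + real N * mean_gain P N L h) * energy n x"
        using mg energy_nonneg[of n x] by simp
      ultimately show ?thesis
        using lik_bounds(3)[of n y x] by simp
    qed
    then show "AE z in sample n \<mu>. norm (ln (lik n (fst z) (rec n z))) \<le> norm (energy n (rec n z) + 2 * (1 + real N * mean_gain P N L h) * energy n (fst z))"
      by (intro AE_I2) (smt (verit) real_norm_def)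
  qed
  show "integrable (sample n \<mu>) (\<lambda>z. ln (marg n \<mu> (rec n z)))"
  proof (rule Bochner_Integration.integrable_bound)
    have pos: "0 < marg n \<mu> (rec n z)" if "z \<in> space (sample n \<mu>)" for z
      using measurable_space[OF sample_measurable(4)[OF \<mu>] that] by (rule marg_bounds(1)[OF \<mu>])
    have "integrable (sample n \<mu>) (\<lambda>z. 1 / marg n \<mu> (rec n z))"
      by (rule integrableI_nonneg) (use sample_inverse_marg[OF \<mu>] mm pos in \<open>auto intro!: AE_I2 less_imp_le\<close>)
    then show "integrable (sample n \<mu>) (\<lambda>z. energy n (rec n z) + 1 / marg n \<mu> (rec n z))"
      using E by simp
    show "(\<lambda>z. ln (marg n \<mu> (rec n z))) \<in> borel_measurable (sample n \<mu>)"
      using mm by measurable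
    show "AE z in sample n \<mu>. norm (ln (marg n \<mu> (rec n z))) \<le> norm (energy n (rec n z) + 1 / marg n \<mu> (rec n z))"
    proof (rule AE_I2)
      fix z assume z: "z \<in> space (sample n \<mu>)"
      let ?m = "marg n \<mu> (rec n z)"
      have p: "0 < ?m" by (rule pos[OF z])
      have "ln ?m \<le> ln (exp (energy n (rec n z)))"
        using marg_bounds(2)[OF \<mu> measurable_space[OF sample_measurable(4)[OF \<mu>] z]] p by (subst ln_le_cancel_iff) auto
      moreover have "ln (1 / ?m) \<le> 1 / ?m - 1" using p by (intro ln_le_minus_one) simp
      moreover have "ln (1 / ?m) = - ln ?m" using p by (simp add: ln_divide_pos)
      moreover have "0 < 1 / ?m" using p by simp
      ultimately have "\<bar>ln ?m\<bar> \<le> energy n (rec n z) + 1 / ?m"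
        using energy_nonneg[of n "rec n z"] unfolding ln_exp by linarith
      then show "norm (ln ?m) \<le> norm (energy n (rec n z) + 1 / ?m)"
        by (metis abs_ge_self order_trans real_norm_def)
    qed
  qed
qed

text \<open>The discarded term is minus the divergence of the output law from the noise law, which
  is nonpositive by Gibbs' inequality for 1/\<open>marg\<close>.\<close>

lemma information_le_expected_ln_lik:
  assumes \<mu>: "\<mu> \<in> input_laws N n" and e: "integrable \<mu> (energy n)"
  shows "io_information P N L h n \<mu> \<le> (\<integral>x. (\<integral>v. ln (lik n x (rec n (x, v))) \<partial>(P \<Otimes>\<^sub>M noise n)) \<partial>\<mu>)"
    and "integrable \<mu> (\<lambda>x. \<integral>v. ln (lik n x (rec n (x, v))) \<partial>(P \<Otimes>\<^sub>M noise n))"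
proof -
  interpret \<mu>: prob_space \<mu> by (rule prob_space_input_law[OF \<mu>])
  interpret R: prob_space "noise n" by (rule noise_prob)
  interpret PR: pair_prob_space P "noise n" ..
  interpret MS: pair_prob_space \<mu> "P \<Otimes>\<^sub>M noise n" ..
  interpret S: prob_space "sample n \<mu>" by (rule sample_prob[OF \<mu>])
  note I = integrable_ln_lik_marg[OF \<mu> e]
  have pos: "0 < marg n \<mu> (rec n z)" if "z \<in> space (sample n \<mu>)" for z
    using measurable_space[OF sample_measurable(4)[OF \<mu>] that] by (rule marg_bounds(1)[OF \<mu>])
  have mm: "(\<lambda>z. marg n \<mu> (rec n z)) \<in> borel_measurable (sample n \<mu>)"
    by (rule measurable_compose[OF sample_measurable(4)[OF \<mu>] measurable_marg[OF \<mu>]])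
  have ln: "ln (1 / marg n \<mu> (rec n z)) = - ln (marg n \<mu> (rec n z))" if "z \<in> space (sample n \<mu>)" for z
    using pos[OF that] by (simp add: ln_divide_pos)
  have "(\<integral>z. ln (1 / marg n \<mu> (rec n z)) \<partial>sample n \<mu>) \<le> 0"
  proof (rule S.expectation_ln_nonpos)
    show "integrable (sample n \<mu>) (\<lambda>z. ln (1 / marg n \<mu> (rec n z)))"
      using I(2) by (subst Bochner_Integration.integrable_cong[OF refl ln]) auto
  qed (use mm pos sample_inverse_marg[OF \<mu>] in auto)
  also have "(\<integral>z. ln (1 / marg n \<mu> (rec n z)) \<partial>sample n \<mu>) = - (\<integral>z. ln (marg n \<mu> (rec n z)) \<partial>sample n \<mu>)"
    by (subst Bochner_Integration.integral_cong[OF refl ln]) auto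
  finally have "io_information P N L h n \<mu> \<le> (\<integral>z. ln (lik n (fst z) (rec n z)) \<partial>sample n \<mu>)"
    unfolding io_information_eq[OF \<mu>] Bochner_Integration.integral_diff[OF I] by simp
  moreover have i: "integrable (\<mu> \<Otimes>\<^sub>M (P \<Otimes>\<^sub>M noise n)) (\<lambda>z. ln (lik n (fst z) (rec n z)))"
    using I(1) unfolding sample_def .
  then have "(\<integral>x. (\<integral>v. ln (lik n x (rec n (x, v))) \<partial>(P \<Otimes>\<^sub>M noise n)) \<partial>\<mu>) = (\<integral>z. ln (lik n (fst z) (rec n z)) \<partial>sample n \<mu>)"
    unfolding sample_def using MS.integral_fst'[OF i] by simp
  ultimately show "io_information P N L h n \<mu> \<le> (\<integral>x. (\<integral>v. ln (lik n x (rec n (x, v))) \<partial>(P \<Otimes>\<^sub>M noise n)) \<partial>\<mu>)"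
    by simp
  show "integrable \<mu> (\<lambda>x. \<integral>v. ln (lik n x (rec n (x, v))) \<partial>(P \<Otimes>\<^sub>M noise n))"
    using MS.integrable_fst'[OF i] by simp
qed

text \<open>Gibbs' inequality for \<open>marg\<close>/\<open>lik\<close>, whose mean is 1.
  Nonnegativity is a hypothesis of Fekete's lemma, where it absorbs the incomplete last
  block.\<close>

lemma information_nonneg:
  assumes \<mu>: "\<mu> \<in> input_laws N n" and e: "integrable \<mu> (energy n)"
  shows "0 \<le> io_information P N L h n \<mu>"
proof -
  interpret \<mu>: prob_space \<mu> by (rule prob_space_input_law[OF \<mu>])
  interpret R: prob_space "noise n" by (rule noise_prob)
  interpret S: prob_space "sample n \<mu>" by (rule sample_prob[OF \<mu>])
  note I = integrable_ln_lik_marg[OF \<mu> e]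
  have y: "rec n z \<in> space (block n)" if "z \<in> space (sample n \<mu>)" for z
    by (rule measurable_space[OF sample_measurable(4)[OF \<mu>] that])
  have [measurable]: "(\<lambda>z. marg n \<mu> (rec n z)) \<in> borel_measurable (sample n \<mu>)"
    by (rule measurable_compose[OF sample_measurable(4)[OF \<mu>] measurable_marg[OF \<mu>]])
  have [measurable]: "(\<lambda>z. lik n (fst z) (rec n z)) \<in> borel_measurable (sample n \<mu>)"
    by (rule measurable_lik_fst_rec[OF \<mu>])
  let ?r = "\<lambda>z. marg n \<mu> (rec n z) / lik n (fst z) (rec n z)"
  have ln: "ln (?r z) = ln (marg n \<mu> (rec n z)) - ln (lik n (fst z) (rec n z))" if "z \<in> space (sample n \<mu>)" for z
    by (rule ln_divide_pos[OF marg_bounds(1)[OF \<mu> y[OF that]] lik_bounds(1)])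
  have "(\<integral>z. ln (?r z) \<partial>sample n \<mu>) \<le> 0"
  proof (rule S.expectation_ln_nonpos)
    show "integrable (sample n \<mu>) (\<lambda>z. ln (?r z))"
      using I by (subst Bochner_Integration.integrable_cong[OF refl ln]) auto
    show "0 < ?r z" if "z \<in> space (sample n \<mu>)" for z
      using marg_bounds(1)[OF \<mu> y[OF that]] lik_bounds(1) by (intro divide_pos_pos)
    have "(\<lambda>(x, y). ennreal (marg n \<mu> y / lik n x y)) \<in> borel_measurable (block n \<Otimes>\<^sub>M block n)"
    proof -
      have "(\<lambda>z. lik n (fst z) (snd z)) \<in> borel_measurable (block n \<Otimes>\<^sub>M block n)"
        by (rule measurable_lik) measurable
      moreover have "(\<lambda>z. marg n \<mu> (snd z)) \<in> borel_measurable (block n \<Otimes>\<^sub>M block n)"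
        by (rule measurable_compose[OF measurable_snd measurable_marg[OF \<mu>]])
      ultimately show ?thesis unfolding split_beta' by measurable
    qed
    from nn_integral_sample_lik[OF \<mu> this]
    have "(\<integral>\<^sup>+z. ennreal (?r z) \<partial>sample n \<mu>) = (\<integral>\<^sup>+x. (\<integral>\<^sup>+y. ennreal (lik n x y) * ennreal (marg n \<mu> y / lik n x y) \<partial>noise n) \<partial>\<mu>)" .
    also have "\<dots> = (\<integral>\<^sup>+x. (\<integral>\<^sup>+y. ennreal (marg n \<mu> y) * 1 \<partial>noise n) \<partial>\<mu>)"
    proof (rule nn_integral_cong, rule nn_integral_cong)
      fix x y
      assume "y \<in> space (noise n)"
      then have "0 < marg n \<mu> y" by (intro marg_bounds(1)[OF \<mu>]) simp
      then show "ennreal (lik n x y) * ennreal (marg n \<mu> y / lik n x y) = ennreal (marg n \<mu> y) * 1"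
        using lik_bounds(1)[of n x y] by (simp add: ennreal_mult[symmetric])
    qed
    also have "(\<integral>\<^sup>+y. ennreal (marg n \<mu> y) * 1 \<partial>noise n) = (\<integral>\<^sup>+z. 1 \<partial>sample n \<mu>)"
      by (rule distributed_nn_integral[OF distributed_sample(2)[OF \<mu>]]) simp
    also have "(\<integral>\<^sup>+x. (\<integral>\<^sup>+z. 1 \<partial>sample n \<mu>) \<partial>\<mu>) = 1"
      by (simp add: S.emeasure_space_1 \<mu>.emeasure_space_1)
    finally show "(\<integral>\<^sup>+z. ennreal (?r z) \<partial>sample n \<mu>) \<le> 1" by simp
  qed measurable
  also have "(\<integral>z. ln (?r z) \<partial>sample n \<mu>) = - io_information P N L h n \<mu>"
    using I by (subst Bochner_Integration.integral_cong[OF refl ln]) (auto simp: io_information_eq[OF \<mu>])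
  finally show ?thesis by simp
qed

end

section \<open>The coherent bound\<close>

text \<open>The integrand is the density of CN(0,v) relative to CN(0,1). For v > 1 it grows with
  |z|, which is the case c < 0 of the Gaussian integral.\<close>

lemma nn_integral_std_complex_normal_exp:
  assumes v: "0 < v"
  shows "(\<integral>\<^sup>+z. ennreal (exp ((cmod z)\<^sup>2 * (1 - 1 / v) - ln v)) \<partial>std_complex_normal) = 1"
proof -
  let ?c = "1 / v - 1"
  have c: "0 < 1 + ?c" using v by simp
  have e: "exp (- of_real (?c * (cmod z)\<^sup>2) + of_real (Re z) * 0 + of_real (Im z) * 0) = complex_of_real (exp (- (?c * (cmod z)\<^sup>2)))" for z
    by (simp add: exp_of_real[symmetric])
  have "integrable std_complex_normal (\<lambda>z. complex_of_real (exp (- (?c * (cmod z)\<^sup>2))))"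
    using std_complex_normal_exp(2)[OF c, of 0 0] unfolding e .
  from integrable_Re[OF this] have i: "integrable std_complex_normal (\<lambda>z. exp (- (?c * (cmod z)\<^sup>2)))"
    by (simp only: Re_complex_of_real)
  have "complex_of_real (\<integral>z. exp (- (?c * (cmod z)\<^sup>2)) \<partial>std_complex_normal) = of_real v"
    using std_complex_normal_exp(1)[OF c, of 0 0] v unfolding e by (simp add: integral_complex_of_real)
  then have I: "(\<integral>z. exp (- (?c * (cmod z)\<^sup>2)) \<partial>std_complex_normal) = v"
    by (simp only: of_real_eq_iff)
  have "exp ((cmod z)\<^sup>2 * (1 - 1 / v) - ln v) = exp (- (?c * (cmod z)\<^sup>2)) / v" for z
  proof -
    have "(cmod z)\<^sup>2 * (1 - 1 / v) = - (?c * (cmod z)\<^sup>2)" by (simp add: algebra_simps)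
    then show ?thesis using v by (simp only: exp_diff exp_ln)
  qed
  then have "(\<integral>\<^sup>+z. ennreal (exp ((cmod z)\<^sup>2 * (1 - 1 / v) - ln v)) \<partial>std_complex_normal)
     = ennreal (\<integral>z. exp (- (?c * (cmod z)\<^sup>2)) / v \<partial>std_complex_normal)"
    using i v by (simp add: nn_integral_eq_integral)
  then show ?thesis using I v by simp
qed

lemma nn_integral_noise_law_exp:
  assumes v: "\<And>k m. 0 < v k m"
  shows "(\<integral>\<^sup>+y. ennreal (exp (\<Sum>k\<le>n. \<Sum>m<N. (cmod (y k m))\<^sup>2 * (1 - 1 / v k m) - ln (v k m))) \<partial>noise_law N n) = 1"
proof -
  let ?f = "\<lambda>k m z. ennreal (exp ((cmod z)\<^sup>2 * (1 - 1 / v k m) - ln (v k m)))"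
  have e: "ennreal (exp (\<Sum>k\<le>n. \<Sum>m<N. (cmod (y k m))\<^sup>2 * (1 - 1 / v k m) - ln (v k m))) = (\<Prod>k\<le>n. \<Prod>m<N. ?f k m (y k m))" for y
    by (simp add: exp_sum prod_ennreal prod_nonneg)
  have "(\<integral>\<^sup>+y. (\<Prod>k\<le>n. \<Prod>m<N. ?f k m (y k m)) \<partial>noise_law N n) = (\<Prod>k\<le>n. \<integral>\<^sup>+y. (\<Prod>m<N. ?f k m (y m)) \<partial>noise_vec N)"
    unfolding noise_law_def by (rule noise_block.product_nn_integral_prod) auto
  also have "\<dots> = (\<Prod>k\<le>n. \<Prod>m<N. \<integral>\<^sup>+z. ?f k m z \<partial>std_complex_normal)"
    by (intro prod.cong refl noise_vector.product_nn_integral_prod) auto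
  also have "\<dots> = 1"
    by (simp add: nn_integral_std_complex_normal_exp[OF v])
  finally show ?thesis unfolding e .
qed

context ofdm_channel
begin

text \<open>A constant input of modulus sqrt(u/N) makes the signal equal to sqrt(u) times the
  channel coefficient, so the Laplace transform at u is the likelihood of a single noisy observation
  at the value 0. The result involves neither the time nor the subcarrier.\<close>

lemma freq_laplace:
  assumes u: "0 \<le> u" and m: "m < N"
  shows "(\<integral>\<omega>. exp (- (u * (cmod (freq k m \<omega>))\<^sup>2)) \<partial>P)
    = exp (- ln (1 + u / real N) - u * mean_gain P N L h / (1 + u / real N))"
proof -
  define x where "x = (\<lambda>(_::nat) (_::nat). complex_of_real (sqrt u / sqrt (real N)))"
  define i where "i = k * N + m"
  have i: "i div N = k" "i mod N = m" "i < Suc k * N" using m by (auto simp: i_def)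
  have x2: "(cmod (x k m))\<^sup>2 = u / real N"
    using u unfolding x_def by (simp add: norm_divide power_divide)
  have ch: "(\<integral>\<omega>. iexp (Re (a * centred x i \<omega>)) \<partial>P) = exp (of_real (- ((cmod a)\<^sup>2 * (u / real N)) / 4))" for a
  proof -
    let ?a = "\<lambda>j. if j = i then a else 0"
    have 1: "(\<Sum>j<Suc k * N. ?a j * (signal x (j div N) (j mod N) \<omega> - signal_mean x (j div N) (j mod N))) = a * centred x i \<omega>" for \<omega>
    proof -
      have "(\<Sum>j<Suc k * N. ?a j * (signal x (j div N) (j mod N) \<omega> - signal_mean x (j div N) (j mod N)))
         = (\<Sum>j<Suc k * N. if j = i then a * centred x i \<omega> else 0)"
        by (intro sum.cong refl) (simp add: centred_def)
      then show ?thesis using i(3) by (simp del: mult_Suc)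
    qed
    have "(\<Sum>l<Suc k * N. ?a j * cnj (?a l) * signal_cov x j l) = (if j = i then a * cnj a * signal_cov x i i else 0)" for j
    proof -
      have "(\<Sum>l<Suc k * N. ?a j * cnj (?a l) * signal_cov x j l) = (\<Sum>l<Suc k * N. if l = i then (if j = i then a * cnj a * signal_cov x i i else 0) else 0)"
        by (intro sum.cong refl) simp
      then show ?thesis using i(3) by (simp del: mult_Suc)
    qed
    then have "hform (Suc k * N) (signal_cov x) ?a = a * cnj a * signal_cov x i i"
      unfolding hform_def using i(3) by (simp del: mult_Suc)
    also have "\<dots> = of_real ((cmod a)\<^sup>2 * (u / real N))"
      unfolding signal_cov_diag i x2 of_real_mult complex_norm_square[symmetric] ..
    finally show ?thesis
      using signal_char[where n="Suc k" and a="?a" and x=x] unfolding 1 by simp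
  qed
  have "(\<integral>\<omega>. exp (- (cmod (- signal_mean x k m - centred x i \<omega>))\<^sup>2) \<partial>P) = exp (- ln (1 + u / real N) - (cmod (- signal_mean x k m))\<^sup>2 / (1 + u / real N))"
    by (rule gaussian_exp_norm_square[OF centred_measurable _ ch]) (use u in simp)
  moreover have "(cmod (- signal_mean x k m - centred x i \<omega>))\<^sup>2 = u * (cmod (freq k m \<omega>))\<^sup>2" for \<omega>
  proof -
    have "- signal_mean x k m - centred x i \<omega> = - signal x k m \<omega>"
      by (simp add: centred_def i)
    moreover have "signal x k m \<omega> = of_real (sqrt u) * freq k m \<omega>"
      using N_pos by (simp add: signal_def x_def)
    ultimately show ?thesis using u by (simp add: norm_mult power_mult_distrib)
  qed
  moreover have "(cmod (- signal_mean x k m))\<^sup>2 = u * mean_gain P N L h"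
  proof -
    have "signal_mean x k m = of_real (sqrt u) * freq_mean m"
      using N_pos by (simp add: signal_mean_def x_def)
    then show ?thesis using u norm_freq_mean[of m] by (simp add: norm_mult power_mult_distrib)
  qed
  ultimately show ?thesis by simp
qed

lemma freq_law:
  assumes c: "0 \<le> c" and m: "m < N"
  shows "(\<integral>\<omega>. 1 / (1 + c * (cmod (freq k m \<omega>))\<^sup>2) \<partial>P) = (\<integral>\<omega>. 1 / (1 + c * (cmod (freq 0 0 \<omega>))\<^sup>2) \<partial>P)"
    and "(\<integral>\<omega>. ln (1 + c * (cmod (freq k m \<omega>))\<^sup>2) \<partial>P) = (\<integral>\<omega>. ln (1 + c * (cmod (freq 0 0 \<omega>))\<^sup>2) \<partial>P)"
proof -
  have eq: "(\<integral>\<omega>. exp (- (u * (cmod (freq k m \<omega>))\<^sup>2)) \<partial>P) = (\<integral>\<omega>. exp (- (u * (cmod (freq 0 0 \<omega>))\<^sup>2)) \<partial>P)" if "0 \<le> u" for u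
    unfolding freq_laplace[OF that m] freq_laplace[OF that N_pos] ..
  show "(\<integral>\<omega>. 1 / (1 + c * (cmod (freq k m \<omega>))\<^sup>2) \<partial>P) = (\<integral>\<omega>. 1 / (1 + c * (cmod (freq 0 0 \<omega>))\<^sup>2) \<partial>P)"
    by (rule laplace_eq_imp_inverse_eq[OF _ _ _ _ eq c]) simp_all
  show "(\<integral>\<omega>. ln (1 + c * (cmod (freq k m \<omega>))\<^sup>2) \<partial>P) = (\<integral>\<omega>. ln (1 + c * (cmod (freq 0 0 \<omega>))\<^sup>2) \<partial>P)"
    by (rule laplace_eq_imp_ln_eq[OF _ _ _ _ eq c]) simp_all
qed

text \<open>V is the output variance given the channel under white inputs of power p_x. By N|h|^2/V
  = (1 - 1/V)/p_x the normalised output energy splits into a multiple of the input energy and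
  \<beta> = E[1/V]. Equality in law makes \<beta> the same for all components, so that the
  contributions can later be added up.\<close>

lemma expectation_coherent_term:
  assumes \<mu>: "\<mu> \<in> input_laws N n" and e: "integrable \<mu> (energy n)" and km: "k \<le> n" "m < N" and px: "0 < px"
  defines "V \<equiv> \<lambda>\<omega>. 1 + real N * px * (cmod (freq k m \<omega>))\<^sup>2"
    and "\<beta> \<equiv> \<integral>\<omega>. 1 / (1 + real N * px * (cmod (freq 0 0 \<omega>))\<^sup>2) \<partial>P"
  shows "integrable (sample n \<mu>) (\<lambda>z. (cmod (rec n z k m))\<^sup>2 / V (fst (snd z)))" (is ?I1)
    and "(\<integral>z. (cmod (rec n z k m))\<^sup>2 / V (fst (snd z)) \<partial>sample n \<mu>) = (\<integral>x. (cmod (x k m))\<^sup>2 \<partial>\<mu>) * ((1 - \<beta>) / px) + \<beta>" (is ?E1)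
    and "integrable (sample n \<mu>) (\<lambda>z. ln (V (fst (snd z))))" (is ?I2)
    and "(\<integral>z. ln (V (fst (snd z))) \<partial>sample n \<mu>) = UB_coh P N L h px" (is ?E2)
    and "0 \<le> \<beta>" "\<beta> \<le> 1"
proof -
  interpret \<mu>: prob_space \<mu> by (rule prob_space_input_law[OF \<mu>])
  note o = integrable_one[OF \<mu>]
  have c: "0 < real N * px" using px N_pos by simp
  have V1: "1 \<le> V \<omega>" for \<omega> unfolding V_def using c by simp
  have Vm[measurable]: "V \<in> borel_measurable P" unfolding V_def by measurable
  have iV: "integrable P (\<lambda>\<omega>. 1 / V \<omega>)"
  proof (rule integrable_const_bound[where B=1])
    show "AE \<omega> in P. norm (1 / V \<omega>) \<le> 1"
    proof (rule AE_I2)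
      fix \<omega> show "norm (1 / V \<omega>) \<le> 1" using V1[of \<omega>] by simp
    qed
  qed measurable
  have EV: "(\<integral>\<omega>. 1 / V \<omega> \<partial>P) = \<beta>"
    unfolding V_def \<beta>_def using c km by (intro freq_law) auto
  show "0 \<le> \<beta>" unfolding EV[symmetric] using V1 by (intro Bochner_Integration.integral_nonneg) (smt (verit) divide_nonneg_nonneg)
  have "(\<integral>\<omega>. 1 / V \<omega> \<partial>P) \<le> (\<integral>\<omega>. 1 \<partial>P)"
    using iV V1 by (intro integral_mono) (auto simp: divide_le_eq_1 intro: order_trans[OF zero_le_one])
  then show "\<beta> \<le> 1" unfolding EV by (simp add: prob_space)
  have lnV: "integrable P (\<lambda>\<omega>. ln (V \<omega>))"
  proof (rule Bochner_Integration.integrable_bound)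
    show "integrable P (\<lambda>\<omega>. real N * px * (cmod (freq k m \<omega>))\<^sup>2)"
      using freq_square_integrable by simp
    have "\<bar>ln (V \<omega>)\<bar> \<le> real N * px * (cmod (freq k m \<omega>))\<^sup>2" for \<omega>
    proof -
      have "ln (V \<omega>) \<le> V \<omega> - 1" using V1[of \<omega>] by (intro ln_le_minus_one) simp
      moreover have "0 \<le> ln (V \<omega>)" using V1[of \<omega>] by simp
      ultimately show ?thesis by (simp add: V_def)
    qed
    then show "AE \<omega> in P. norm (ln (V \<omega>)) \<le> norm (real N * px * (cmod (freq k m \<omega>))\<^sup>2)"
      by (intro AE_I2) (smt (verit) real_norm_def)
  qed measurable
  note L = sample_product[OF \<mu> o(1) lnV o(3)]
  show ?I2 using L(1) by simp
  show ?E2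
  proof -
    have "(\<integral>\<omega>. ln (V \<omega>) \<partial>P) = UB_coh P N L h px"
      unfolding V_def UB_coh_def using c km by (intro freq_law) auto
    then show ?thesis using L(2) o by simp
  qed
  define x2 where "x2 x = (cmod (x k m))\<^sup>2" for x :: "nat \<Rightarrow> nat \<Rightarrow> complex"
  have x2: "integrable \<mu> x2" unfolding x2_def by (rule integrable_component[OF \<mu> e km])
  have gV: "real N * (cmod (freq k m \<omega>))\<^sup>2 / V \<omega> = (1 - 1 / V \<omega>) / px" for \<omega>
  proof -
    have "1 - 1 / V \<omega> = (V \<omega> - 1) / V \<omega>" using V1[of \<omega>] by (simp add: field_simps)
    then show ?thesis using px by (simp add: V_def)
  qed
  have ig: "integrable P (\<lambda>\<omega>. real N * (cmod (freq k m \<omega>))\<^sup>2 / V \<omega>)"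
    unfolding gV using iV by simp
  have Eg: "(\<integral>\<omega>. real N * (cmod (freq k m \<omega>))\<^sup>2 / V \<omega> \<partial>P) = (1 - \<beta>) / px"
    unfolding gV using iV EV by (simp add: prob_space)
  note A = sample_product[OF \<mu> x2 ig o(3)]
  note B = sample_product[OF \<mu> o(1) iV noise_law_moments(3)[OF km]]
  have xm: "(\<lambda>x. x k m) \<in> borel_measurable \<mu>"
    using measurable_block_component[OF km] by (simp add: measurable_cong_sets[OF sets_input_law[OF \<mu>] refl])
  have ix: "integrable \<mu> (\<lambda>x. cnj (x k m))"
  proof (rule Bochner_Integration.integrable_bound)
    show "integrable \<mu> (\<lambda>x. 1 + x2 x)" using x2 by simp
    show "(\<lambda>x. cnj (x k m)) \<in> borel_measurable \<mu>" using xm by (rule borel_measurable_cnj')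
    have "a \<le> 1 + a\<^sup>2" for a :: real
      using sum_squares_bound[of a 1] zero_le_power2[of a] unfolding power_one mult_1_right by linarith
    then show "AE x in \<mu>. norm (cnj (x k m)) \<le> norm (1 + x2 x)"
      by (intro AE_I2) (simp add: x2_def)
  qed
  have iF: "integrable P (\<lambda>\<omega>. of_real (sqrt (real N) / V \<omega>) * cnj (freq k m \<omega>))"
  proof (rule Bochner_Integration.integrable_bound)
    show "integrable P (\<lambda>\<omega>. sqrt (real N) * (1 + (cmod (freq k m \<omega>))\<^sup>2))" using freq_square_integrable by simp
    show "(\<lambda>\<omega>. of_real (sqrt (real N) / V \<omega>) * cnj (freq k m \<omega>)) \<in> borel_measurable P" by measurable
    have a: "a \<le> 1 + a\<^sup>2" for a :: real
      using sum_squares_bound[of a 1] zero_le_power2[of a] unfolding power_one mult_1_right by linarith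
    show "AE \<omega> in P. norm (of_real (sqrt (real N) / V \<omega>) * cnj (freq k m \<omega>)) \<le> norm (sqrt (real N) * (1 + (cmod (freq k m \<omega>))\<^sup>2))"
    proof (rule AE_I2)
      fix \<omega>
      have "norm (of_real (sqrt (real N) / V \<omega>) * cnj (freq k m \<omega>)) = sqrt (real N) / V \<omega> * cmod (freq k m \<omega>)"
        using V1[of \<omega>] by (simp add: norm_mult norm_divide)
      also have "\<dots> \<le> sqrt (real N) * (1 + (cmod (freq k m \<omega>))\<^sup>2)"
      proof (intro mult_mono a)
        show "sqrt (real N) / V \<omega> \<le> sqrt (real N)"
          using V1[of \<omega>] by (simp add: divide_le_eq mult_le_cancel_left1)
      qed simp_all
      finally show "norm (of_real (sqrt (real N) / V \<omega>) * cnj (freq k m \<omega>)) \<le> norm (sqrt (real N) * (1 + (cmod (freq k m \<omega>))\<^sup>2))" by simp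
    qed
  qed
  note C = sample_product[OF \<mu> ix iF noise_law_moments(1)[OF km]]
  \<comment> \<open>The cross term of signal and noise divided by V; its mean vanishes because the
    noise is centred and independent of the rest.\<close>
  define cr where "cr z = cnj (fst z k m) * (of_real (sqrt (real N) / V (fst (snd z))) * cnj (freq k m (fst (snd z))) * snd (snd z) k m)"
    for z :: "(nat \<Rightarrow> nat \<Rightarrow> complex) \<times> 'w \<times> (nat \<Rightarrow> nat \<Rightarrow> complex)"
  have cr: "integrable (sample n \<mu>) cr" "(\<integral>z. cr z \<partial>sample n \<mu>) = 0"
    using C noise_law_moments(2)[OF km] unfolding cr_def by simp_all
  have crR: "integrable (sample n \<mu>) (\<lambda>z. Re (cr z))" "(\<integral>z. Re (cr z) \<partial>sample n \<mu>) = 0"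
    using cr integrable_Re[OF cr(1)] integral_Re[OF cr(1)] by simp_all
  have dec: "(cmod (rec n z k m))\<^sup>2 / V (fst (snd z)) =
      x2 (fst z) * (real N * (cmod (freq k m (fst (snd z))))\<^sup>2 / V (fst (snd z)) * 1) + 2 * Re (cr z) + 1 * (1 / V (fst (snd z)) * (cmod (snd (snd z) k m))\<^sup>2)" for z
  proof -
    obtain x \<omega> w where z: "z = (x, \<omega>, w)" by (cases z)
    let ?s = "signal x k m \<omega>"
    have "(cmod (w k m + ?s))\<^sup>2 = (cmod (w k m))\<^sup>2 + 2 * Re (cnj ?s * w k m) + (cmod ?s)\<^sup>2"
      using cmod_diff_power2[of "w k m" "- ?s"] by simp
    moreover have "(cmod ?s)\<^sup>2 = x2 x * (real N * (cmod (freq k m \<omega>))\<^sup>2)"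
      unfolding signal_def x2_def by (simp add: norm_mult power_mult_distrib)
    moreover have "Re (cnj ?s * w k m) / V \<omega> = Re (cr z)"
    proof -
      have "cr z = cnj ?s * w k m / of_real (V \<omega>)"
        unfolding cr_def z signal_def by simp
      then show ?thesis by (simp only: Re_divide_of_real)
    qed
    ultimately have "(cmod (w k m + ?s))\<^sup>2 / V \<omega> = (cmod (w k m))\<^sup>2 / V \<omega> + 2 * Re (cr z) + x2 x * (real N * (cmod (freq k m \<omega>))\<^sup>2) / V \<omega>"
      by (simp add: add_divide_distrib del: times_complex.simps)
    then show ?thesis
      using km by (simp add: z received_component add.commute)
  qed
  show ?I1
    unfolding dec by (intro Bochner_Integration.integrable_add integrable_mult_right A(1) B(1) crR(1))
  have i2: "integrable (sample n \<mu>) (\<lambda>z. 2 * Re (cr z))" using crR(1) by simp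
  show ?E1
    unfolding dec Bochner_Integration.integral_add[OF Bochner_Integration.integrable_add[OF A(1) i2] B(1)] Bochner_Integration.integral_add[OF A(1) i2] A(2) B(2)
    using crR(2) o EV Eg noise_law_moments(4)[OF km] by (simp add: x2_def[abs_def])
qed

text \<open>The usual route through the conditional information I(X;Y|H) is shortcut by one
  application of Gibbs' inequality. The ratio \<open>rr\<close> combines the reference density
  exp(\<open>qe\<close>) given the channel, the true density exp(\<open>sh\<close>) given input and
  channel, and \<open>lik\<close>/\<open>marg\<close>; its logarithm is the information density
  minus \<open>sh\<close> - \<open>qe\<close>, so the information is at most the mean of that
  difference.\<close>

lemma information_le_coherent:
  assumes \<mu>: "\<mu> \<in> input_laws N n" and e: "integrable \<mu> (energy n)" and px: "0 < px"
    and power: "(\<integral>x. energy n x \<partial>\<mu>) \<le> real (n + 1) * (real N * px)"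
  shows "io_information P N L h n \<mu> \<le> real (n + 1) * real N * UB_coh P N L h px"
proof -
  interpret \<mu>: prob_space \<mu> by (rule prob_space_input_law[OF \<mu>])
  interpret R: prob_space "noise n" by (rule noise_prob)
  interpret PR: pair_prob_space P "noise n" ..
  interpret MS: pair_prob_space \<mu> "P \<Otimes>\<^sub>M noise n" ..
  interpret S: prob_space "sample n \<mu>" by (rule sample_prob[OF \<mu>])
  note [measurable_cong] = sets_input_law[OF \<mu>]
  have spc: "space \<mu> = space (block n)"
    by (rule sets_eq_imp_space_eq[OF sets_input_law[OF \<mu>]])
  \<comment> \<open>The reference output law given the channel is the product of the \<open>CN(0, V k m)\<close>, with density \<open>exp qe\<close> relative to the noise.\<close>
  define V where "V k m \<omega> = 1 + real N * px * (cmod (freq k m \<omega>))\<^sup>2" for k m \<omega>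
  define qe where "qe \<omega> y = (\<Sum>k\<le>n. \<Sum>m<N. (cmod (y k m))\<^sup>2 * (1 - 1 / V k m \<omega>) - ln (V k m \<omega>))" for \<omega> y
  define sh where "sh x \<omega> y = shift_exp n (\<lambda>k m. signal x k m \<omega>) y" for x \<omega> y
  have V1: "1 \<le> V k m \<omega>" for k m \<omega>
    unfolding V_def using px by simp
  have V0: "0 < V k m \<omega>" for k m \<omega> using V1[of k m \<omega>] by linarith
  have Vm[measurable]: "V k m \<in> borel_measurable P" for k m unfolding V_def by measurable
  have qm: "(\<lambda>v. qe (W v) (Y v)) \<in> borel_measurable M" if W: "W \<in> M \<rightarrow>\<^sub>M P" and Y: "Y \<in> M \<rightarrow>\<^sub>M block n" for W Y and M :: "'z measure"
    unfolding qe_def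
  proof (intro borel_measurable_sum)
    fix k m assume "k \<in> {..n}" "m \<in> {..<N}"
    then have [measurable]: "(\<lambda>v. Y v k m) \<in> borel_measurable M"
      by (intro measurable_compose[OF Y measurable_block_component]) auto
    have [measurable]: "(\<lambda>v. V k m (W v)) \<in> borel_measurable M"
      by (rule measurable_compose[OF W Vm])
    show "(\<lambda>v. (cmod (Y v k m))\<^sup>2 * (1 - 1 / V k m (W v)) - ln (V k m (W v))) \<in> borel_measurable M"
      by measurable
  qed
  define rr where "rr x \<omega> y = exp (qe \<omega> y) * lik n x y / (exp (sh x \<omega> y) * marg n \<mu> y)" for x \<omega> y
  have rm: "(\<lambda>(x, \<omega>, y). ennreal (rr x \<omega> y)) \<in> borel_measurable (block n \<Otimes>\<^sub>M (P \<Otimes>\<^sub>M block n))"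
  proof -
    have 1: "(\<lambda>z. qe (fst (snd z)) (snd (snd z))) \<in> borel_measurable (block n \<Otimes>\<^sub>M (P \<Otimes>\<^sub>M block n))"
      by (rule qm) measurable
    have 2: "(\<lambda>z. lik n (fst z) (snd (snd z))) \<in> borel_measurable (block n \<Otimes>\<^sub>M (P \<Otimes>\<^sub>M block n))"
      by (rule measurable_lik) measurable
    have 3: "(\<lambda>z. sh (fst z) (fst (snd z)) (snd (snd z))) \<in> borel_measurable (block n \<Otimes>\<^sub>M (P \<Otimes>\<^sub>M block n))"
      unfolding sh_def by (rule measurable_shift_exp) measurable
    have 4: "(\<lambda>z. marg n \<mu> (snd (snd z))) \<in> borel_measurable (block n \<Otimes>\<^sub>M (P \<Otimes>\<^sub>M block n))"
      by (rule measurable_compose[OF _ measurable_marg[OF \<mu>]]) measurable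
    show ?thesis
      unfolding rr_def split_beta' using 1 2 3 4 by measurable
  qed
  define g where "g x v = ennreal (exp (qe (fst v) (snd v)) * lik n x (snd v) / marg n \<mu> (snd v))" for x and v :: "'w \<times> (nat \<Rightarrow> nat \<Rightarrow> complex)"
  have gm: "(\<lambda>z. g (fst z) (snd z)) \<in> borel_measurable (\<mu> \<Otimes>\<^sub>M (P \<Otimes>\<^sub>M noise n))"
  proof -
    have 1: "(\<lambda>z. qe (fst (snd z)) (snd (snd z))) \<in> borel_measurable (\<mu> \<Otimes>\<^sub>M (P \<Otimes>\<^sub>M noise n))"
      by (rule qm) measurable
    have 2: "(\<lambda>z. lik n (fst z) (snd (snd z))) \<in> borel_measurable (\<mu> \<Otimes>\<^sub>M (P \<Otimes>\<^sub>M noise n))"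
      by (rule measurable_lik) measurable
    have 4: "(\<lambda>z. marg n \<mu> (snd (snd z))) \<in> borel_measurable (\<mu> \<Otimes>\<^sub>M (P \<Otimes>\<^sub>M noise n))"
      by (rule measurable_compose[OF _ measurable_marg[OF \<mu>]]) measurable
    show ?thesis
      unfolding g_def using 1 2 4 by measurable
  qed
  have marg0: "0 < marg n \<mu> y" if "y \<in> space (noise n)" for y
    using that by (intro marg_bounds(1)[OF \<mu>]) simp
  \<comment> \<open>The sampling density exp(\<open>sh\<close>) cancels the one in the ratio.
    Integrating over the input first turns \<open>lik\<close> into \<open>marg\<close>, which
    cancels too, and exp(\<open>qe\<close>) is a probability density for every channel
    realisation.\<close>
  have total: "(\<integral>\<^sup>+z. ennreal (rr (fst z) (fst (snd z)) (rec n z)) \<partial>sample n \<mu>) = 1"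
  proof -
    have "(\<integral>\<^sup>+z. ennreal (rr (fst z) (fst (snd z)) (rec n z)) \<partial>sample n \<mu>)
       = (\<integral>\<^sup>+x. (\<integral>\<^sup>+\<omega>. (\<integral>\<^sup>+y. ennreal (exp (sh x \<omega> y)) * ennreal (rr x \<omega> y) \<partial>noise n) \<partial>P) \<partial>\<mu>)"
      unfolding sh_def by (rule nn_integral_sample[OF \<mu> rm])
    also have "\<dots> = (\<integral>\<^sup>+x. (\<integral>\<^sup>+\<omega>. (\<integral>\<^sup>+y. g x (\<omega>, y) \<partial>noise n) \<partial>P) \<partial>\<mu>)"
    proof (rule nn_integral_cong, rule nn_integral_cong, rule nn_integral_cong)
      fix x \<omega> y assume "y \<in> space (noise n)"
      have "0 \<le> rr x \<omega> y"
        unfolding rr_def using marg0[OF \<open>y \<in> space (noise n)\<close>] lik_bounds(1)[of n x y] by simp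
      then show "ennreal (exp (sh x \<omega> y)) * ennreal (rr x \<omega> y) = g x (\<omega>, y)"
        unfolding g_def by (simp add: ennreal_mult[symmetric] rr_def)
    qed
    also have "\<dots> = (\<integral>\<^sup>+x. (\<integral>\<^sup>+v. g x v \<partial>(P \<Otimes>\<^sub>M noise n)) \<partial>\<mu>)"
    proof (rule nn_integral_cong)
      fix x assume x: "x \<in> space \<mu>"
      have "(\<lambda>v. (x, v)) \<in> P \<Otimes>\<^sub>M noise n \<rightarrow>\<^sub>M \<mu> \<Otimes>\<^sub>M (P \<Otimes>\<^sub>M noise n)" using x by measurable
      from measurable_compose[OF this gm] have "g x \<in> borel_measurable (P \<Otimes>\<^sub>M noise n)" by simp
      then show "(\<integral>\<^sup>+\<omega>. (\<integral>\<^sup>+y. g x (\<omega>, y) \<partial>noise n) \<partial>P) = (\<integral>\<^sup>+v. g x v \<partial>(P \<Otimes>\<^sub>M noise n))"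
        by (rule R.nn_integral_fst)
    qed
    also have "\<dots> = (\<integral>\<^sup>+v. (\<integral>\<^sup>+x. g x v \<partial>\<mu>) \<partial>(P \<Otimes>\<^sub>M noise n))"
      by (rule MS.Fubini'[symmetric]) (use gm in \<open>simp add: split_beta'\<close>)
    also have "\<dots> = (\<integral>\<^sup>+v. ennreal (exp (qe (fst v) (snd v))) \<partial>(P \<Otimes>\<^sub>M noise n))"
    proof (rule nn_integral_cong)
      fix v assume v: "v \<in> space (P \<Otimes>\<^sub>M noise n)"
      then have y: "snd v \<in> space (noise n)" by (auto simp: space_pair_measure)
      then have yb: "snd v \<in> space (block n)" by simp
      have lm: "(\<lambda>x. lik n x (snd v)) \<in> borel_measurable \<mu>"
        by (rule borel_measurable_integrable[OF integrable_lik[OF \<mu> yb]])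
      have "(\<integral>\<^sup>+x. g x v \<partial>\<mu>) = (\<integral>\<^sup>+x. ennreal (exp (qe (fst v) (snd v)) / marg n \<mu> (snd v)) * ennreal (lik n x (snd v)) \<partial>\<mu>)"
        unfolding g_def using marg0[OF y] lik_bounds(1) by (intro nn_integral_cong) (simp add: ennreal_mult[symmetric] less_imp_le)
      also have "\<dots> = ennreal (exp (qe (fst v) (snd v)) / marg n \<mu> (snd v)) * ennreal (marg n \<mu> (snd v))"
        using lm by (subst nn_integral_cmult) (simp_all add: nn_integral_marg[OF \<mu> yb])
      also have "\<dots> = ennreal (exp (qe (fst v) (snd v)))"
        using marg0[OF y] by (simp add: ennreal_mult[symmetric])
      finally show "(\<integral>\<^sup>+x. g x v \<partial>\<mu>) = ennreal (exp (qe (fst v) (snd v)))" .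
    qed
    also have "\<dots> = (\<integral>\<^sup>+\<omega>. (\<integral>\<^sup>+y. ennreal (exp (qe \<omega> y)) \<partial>noise n) \<partial>P)"
    proof -
      have "(\<lambda>v. qe (fst v) (snd v)) \<in> borel_measurable (P \<Otimes>\<^sub>M noise n)"
        by (rule qm) measurable
      then have "(\<lambda>v. ennreal (exp (qe (fst v) (snd v)))) \<in> borel_measurable (P \<Otimes>\<^sub>M noise n)"
        by measurable
      from R.nn_integral_fst[OF this] show ?thesis by simp
    qed
    also have "\<dots> = (\<integral>\<^sup>+\<omega>. 1 \<partial>P)"
      unfolding qe_def by (simp only: nn_integral_noise_law_exp[OF V0])
    finally show ?thesis using emeasure_space_1 by simp
  qed
  \<comment> \<open>Output minus signal is the noise, so \<open>sh\<close> - \<open>qe\<close>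
    reduces to |y|^2/V + ln V - |w|^2 per component.\<close>
  define T where "T z = (\<Sum>k\<le>n. \<Sum>m<N. (cmod (rec n z k m))\<^sup>2 / V k m (fst (snd z)) + ln (V k m (fst (snd z))) - (cmod (snd (snd z) k m))\<^sup>2)"
    for z :: "(nat \<Rightarrow> nat \<Rightarrow> complex) \<times> 'w \<times> (nat \<Rightarrow> nat \<Rightarrow> complex)"
  have shT: "sh (fst z) (fst (snd z)) (rec n z) - qe (fst (snd z)) (rec n z) = T z" for z
  proof -
    obtain x \<omega> w where z: "z = (x, \<omega>, w)" by (cases z)
    show ?thesis
      unfolding sh_def shift_exp_eq energy_def qe_def T_def sum_subtractf[symmetric]
      by (intro sum.cong refl) (simp add: z received_component algebra_simps)
  qed
  note I = integrable_ln_lik_marg[OF \<mu> e]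
  define \<beta> where "\<beta> = (\<integral>\<omega>. 1 / V 0 0 \<omega> \<partial>P)"
  note C = expectation_coherent_term[OF \<mu> e _ _ px, folded V_def, folded \<beta>_def]
  have W: "integrable (sample n \<mu>) (\<lambda>z. (cmod (snd (snd z) k m))\<^sup>2)" "(\<integral>z. (cmod (snd (snd z) k m))\<^sup>2 \<partial>sample n \<mu>) = 1"
    if "k \<le> n" "m < N" for k m
    using sample_product[OF \<mu> integrable_one(1,2)[OF \<mu>] noise_law_moments(3)[OF that]] integrable_one[OF \<mu>] noise_law_moments(4)[OF that] by simp_all
  have Tk: "integrable (sample n \<mu>) (\<lambda>z. (cmod (rec n z k m))\<^sup>2 / V k m (fst (snd z)) + ln (V k m (fst (snd z))) - (cmod (snd (snd z) k m))\<^sup>2)"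
    "(\<integral>z. (cmod (rec n z k m))\<^sup>2 / V k m (fst (snd z)) + ln (V k m (fst (snd z))) - (cmod (snd (snd z) k m))\<^sup>2 \<partial>sample n \<mu>)
      = (\<integral>x. (cmod (x k m))\<^sup>2 \<partial>\<mu>) * ((1 - \<beta>) / px) + \<beta> + UB_coh P N L h px - 1"
    if "k \<le> n" "m < N" for k m
    using C(1-4)[OF that] W[OF that] by simp_all
  have Ti: "integrable (sample n \<mu>) T"
    unfolding T_def by (intro Bochner_Integration.integrable_sum Tk) auto
  have TE: "(\<integral>z. T z \<partial>sample n \<mu>) = (\<Sum>k\<le>n. \<Sum>m<N. (\<integral>x. (cmod (x k m))\<^sup>2 \<partial>\<mu>) * ((1 - \<beta>) / px) + \<beta> + UB_coh P N L h px - 1)"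
  proof -
    have "(\<integral>z. T z \<partial>sample n \<mu>) = (\<Sum>k\<le>n. \<integral>z. (\<Sum>m<N. (cmod (rec n z k m))\<^sup>2 / V k m (fst (snd z)) + ln (V k m (fst (snd z))) - (cmod (snd (snd z) k m))\<^sup>2) \<partial>sample n \<mu>)"
      unfolding T_def by (intro Bochner_Integration.integral_sum Bochner_Integration.integrable_sum Tk) auto
    also have "\<dots> = (\<Sum>k\<le>n. \<Sum>m<N. \<integral>z. (cmod (rec n z k m))\<^sup>2 / V k m (fst (snd z)) + ln (V k m (fst (snd z))) - (cmod (snd (snd z) k m))\<^sup>2 \<partial>sample n \<mu>)"
      by (intro sum.cong refl Bochner_Integration.integral_sum Tk) auto
    also have "\<dots> = (\<Sum>k\<le>n. \<Sum>m<N. (\<integral>x. (cmod (x k m))\<^sup>2 \<partial>\<mu>) * ((1 - \<beta>) / px) + \<beta> + UB_coh P N L h px - 1)"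
      by (intro sum.cong refl Tk(2)) auto
    finally show ?thesis .
  qed
  have yz: "rec n z \<in> space (noise n)" if "z \<in> space (sample n \<mu>)" for z
    using measurable_space[OF sample_measurable(4)[OF \<mu>] that] by simp
  have lnr: "ln (rr (fst z) (fst (snd z)) (rec n z)) = (ln (lik n (fst z) (rec n z)) - ln (marg n \<mu> (rec n z))) - T z"
    if z: "z \<in> space (sample n \<mu>)" for z
    unfolding rr_def shT[symmetric] using marg0[OF yz[OF z]] lik_bounds(1)[of n "fst z" "rec n z"]
    by (simp add: ln_divide_pos ln_mult_pos)
  have "(\<integral>z. ln (rr (fst z) (fst (snd z)) (rec n z)) \<partial>sample n \<mu>) \<le> 0"
  proof (rule S.expectation_ln_nonpos)
    show "integrable (sample n \<mu>) (\<lambda>z. ln (rr (fst z) (fst (snd z)) (rec n z)))"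
      using I Ti by (subst Bochner_Integration.integrable_cong[OF refl lnr]) auto
    show "0 < rr (fst z) (fst (snd z)) (rec n z)" if "z \<in> space (sample n \<mu>)" for z
      unfolding rr_def using marg0[OF yz[OF that]] lik_bounds(1)[of n "fst z" "rec n z"] by simp
    show "(\<integral>\<^sup>+z. ennreal (rr (fst z) (fst (snd z)) (rec n z)) \<partial>sample n \<mu>) \<le> 1"
      using total by simp
    have 1: "(\<lambda>z. qe (fst (snd z)) (rec n z)) \<in> borel_measurable (sample n \<mu>)"
      by (rule qm[OF sample_measurable(2,4)[OF \<mu>]])
    have 3: "(\<lambda>z. sh (fst z) (fst (snd z)) (rec n z)) \<in> borel_measurable (sample n \<mu>)"
      unfolding sh_def by (rule measurable_shift_exp[OF sample_measurable(1,4,2)[OF \<mu>]])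
    have 4: "(\<lambda>z. marg n \<mu> (rec n z)) \<in> borel_measurable (sample n \<mu>)"
      by (rule measurable_compose[OF sample_measurable(4)[OF \<mu>] measurable_marg[OF \<mu>]])
    show "(\<lambda>z. rr (fst z) (fst (snd z)) (rec n z)) \<in> borel_measurable (sample n \<mu>)"
      unfolding rr_def using 1 3 4 measurable_lik_fst_rec[OF \<mu>] by measurable
  qed
  also have "(\<integral>z. ln (rr (fst z) (fst (snd z)) (rec n z)) \<partial>sample n \<mu>) = io_information P N L h n \<mu> - (\<integral>z. T z \<partial>sample n \<mu>)"
    using I Ti unfolding io_information_eq[OF \<mu>] by (subst Bochner_Integration.integral_cong[OF refl lnr]) auto
  finally have "io_information P N L h n \<mu> \<le> (\<integral>z. T z \<partial>sample n \<mu>)" by simp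
  also have "\<dots> = (\<integral>x. energy n x \<partial>\<mu>) * ((1 - \<beta>) / px) + real (n + 1) * real N * (\<beta> + UB_coh P N L h px - 1)"
  proof -
    have "(\<integral>x. energy n x \<partial>\<mu>) = (\<Sum>k\<le>n. \<integral>x. (\<Sum>m<N. (cmod (x k m))\<^sup>2) \<partial>\<mu>)"
      unfolding energy_def by (intro Bochner_Integration.integral_sum Bochner_Integration.integrable_sum integrable_component[OF \<mu> e]) auto
    also have "\<dots> = (\<Sum>k\<le>n. \<Sum>m<N. \<integral>x. (cmod (x k m))\<^sup>2 \<partial>\<mu>)"
      by (intro sum.cong refl Bochner_Integration.integral_sum integrable_component[OF \<mu> e]) auto
    finally have E: "(\<integral>x. energy n x \<partial>\<mu>) = (\<Sum>k\<le>n. \<Sum>m<N. \<integral>x. (cmod (x k m))\<^sup>2 \<partial>\<mu>)" .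
    have "(\<Sum>k\<le>n. \<Sum>m<N. a k m * c + \<beta> + u - 1) = (\<Sum>k\<le>n. \<Sum>m<N. a k m) * c + real (n + 1) * real N * (\<beta> + u - 1)" for a :: "nat \<Rightarrow> nat \<Rightarrow> real" and c u
    proof -
      have "(\<Sum>k\<le>n. \<Sum>m<N. a k m * c + \<beta> + u - 1) = (\<Sum>k\<le>n. \<Sum>m<N. a k m * c + (\<beta> + u - 1))"
        by (simp add: algebra_simps)
      also have "\<dots> = (\<Sum>k\<le>n. \<Sum>m<N. a k m) * c + real (n + 1) * real N * (\<beta> + u - 1)"
        by (simp add: sum.distrib sum_distrib_right)
      finally show ?thesis .
    qed
    then show ?thesis unfolding TE E .
  qed
  \<comment> \<open>As \<beta> \<le> 1, the coefficient of the total power is nonnegative; at full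
    power the terms in \<beta> cancel against \<beta> - 1.\<close>
  also have "\<dots> \<le> real (n + 1) * (real N * px) * ((1 - \<beta>) / px) + real (n + 1) * real N * (\<beta> + UB_coh P N L h px - 1)"
    using px C(6)[of 0 0] N_pos by (intro add_right_mono mult_right_mono power) auto
  also have "\<dots> = real (n + 1) * real N * UB_coh P N L h px"
    using px by (simp add: field_simps)
  finally show ?thesis .
qed

end

section \<open>Superadditivity of the information\<close>

context ofdm_channel
begin

abbreviation path_space :: "(nat \<Rightarrow> nat \<Rightarrow> complex) measure" where
  "path_space \<equiv> (\<Pi>\<^sub>M k\<in>(UNIV::nat set). cvec_space N)"

definition delayed_path :: "nat \<Rightarrow> 'w \<Rightarrow> nat \<Rightarrow> nat \<Rightarrow> complex" where
  "delayed_path s \<omega> = (\<lambda>k. impulse_response N L h (k + s) \<omega>)"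

definition window :: "nat \<Rightarrow> nat \<Rightarrow> (nat \<Rightarrow> nat \<Rightarrow> complex) \<Rightarrow> nat \<Rightarrow> nat \<Rightarrow> complex" where
  "window s n x = (\<lambda>k\<in>{..n}. x (k + s))"

text \<open>The received block as a function of the path of impulse responses rather than of the
  sample point: stationarity speaks about the law of the path, so the dependence on \<omega> has to
  factor through it.\<close>

definition path_received :: "nat \<Rightarrow> (nat \<Rightarrow> nat \<Rightarrow> complex) \<times> (nat \<Rightarrow> nat \<Rightarrow> complex) \<times> (nat \<Rightarrow> nat \<Rightarrow> complex) \<Rightarrow> nat \<Rightarrow> nat \<Rightarrow> complex" where
  "path_received n = (\<lambda>(x, \<pi>, w). \<lambda>k\<in>{..n}. \<lambda>m\<in>{..<N}.
     of_real (sqrt (real N)) * (\<Sum>l<N. cnj (dft N l m) * \<pi> k l) * x k m + w k m)"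

lemma received_eq_path_received: "rec n (x, \<omega>, w) = path_received n (x, delayed_path 0 \<omega>, w)"
  unfolding received_def path_received_def delayed_path_def freq_response_def by simp

lemma window_received:
  assumes "s + n' \<le> n"
  shows "window s n' (rec n (x, \<omega>, w)) = path_received n' (window s n' x, delayed_path s \<omega>, window s n' w)"
  using assms unfolding received_def path_received_def delayed_path_def freq_response_def window_def
  by (auto simp: fun_eq_iff)

lemma measurable_delayed_path: "delayed_path s \<in> P \<rightarrow>\<^sub>M path_space"
  unfolding delayed_path_def[abs_def]
proof (rule measurable_abs_UNIV)
  fix k
  have m: "(\<lambda>\<omega>. if l < L then h (k + s) l \<omega> else 0) \<in> borel_measurable P" if "l < N" for l
  proof -
    have "tap (k + s) l = (\<lambda>\<omega>. if l < L then h (k + s) l \<omega> else 0)"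
      using that by (auto simp: impulse_response_def)
    then show ?thesis using tap_measurable[OF that, of "k + s"] by simp
  qed
  show "(\<lambda>\<omega>. impulse_response N L h (k + s) \<omega>) \<in> P \<rightarrow>\<^sub>M cvec_space N"
    unfolding impulse_response_def by (rule measurable_restrict) (use m in auto)
qed

lemma measurable_shift_path: "shift_path \<in> path_space \<rightarrow>\<^sub>M path_space"
  unfolding shift_path_def[abs_def] by (rule measurable_abs_UNIV) simp

lemma distr_delayed_path: "distr P path_space (delayed_path s) = distr P path_space (delayed_path 0)"
proof (induction s)
  case (Suc s)
  have "delayed_path (Suc s) = shift_path \<circ> delayed_path s"
    by (auto simp: delayed_path_def shift_path_def fun_eq_iff)
  then have "distr P path_space (delayed_path (Suc s)) = distr (distr P path_space (delayed_path s)) path_space shift_path"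
    by (simp add: distr_distr[OF measurable_shift_path measurable_delayed_path])
  also have "\<dots> = distr (distr P path_space (delayed_path 0)) path_space shift_path"
    unfolding Suc ..
  also have "\<dots> = distr P path_space (delayed_path 0)"
    using stationary unfolding stationary_process_def path_law_def delayed_path_def[abs_def] by simp
  finally show ?case .
qed simp

lemma measurable_window:
  assumes "s + n' \<le> n"
  shows "window s n' \<in> block n \<rightarrow>\<^sub>M block n'"
  unfolding window_def[abs_def] by (rule measurable_restrict) (use assms in \<open>auto intro: measurable_component_singleton\<close>)

lemma distr_window_noise:
  assumes s: "s + n' \<le> n"
  shows "distr (noise n) (noise n') (window s n') = noise n'"
  unfolding noise_law_def window_def[abs_def]
  using distr_PiM_reindex[where K="{..n}" and I="{..n'}" and f="\<lambda>k. k + s" and M="\<lambda>_. noise_vec N"] s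
  by (auto simp: prob_space_noise_vec inj_on_def)

lemma measurable_path_received:
  "path_received n \<in> block n \<Otimes>\<^sub>M (path_space \<Otimes>\<^sub>M block n) \<rightarrow>\<^sub>M block n"
  unfolding path_received_def split_beta'
proof (intro measurable_restrict)
  fix k m assume "k \<in> {..n}" "m \<in> {..<N}"
  then have km: "(\<lambda>x. x k m) \<in> borel_measurable (block n)" by (intro measurable_block_component) auto
  let ?M = "block n \<Otimes>\<^sub>M (path_space \<Otimes>\<^sub>M block n)"
  have 1: "(\<lambda>z. fst z k m) \<in> borel_measurable ?M"
    by (rule measurable_compose[OF measurable_fst km])
  have 2: "(\<lambda>z. snd (snd z) k m) \<in> borel_measurable ?M"
    by (rule measurable_compose[OF _ km]) measurable
  have 3: "(\<lambda>z. fst (snd z) k l) \<in> borel_measurable ?M" if "l < N" for l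
  proof (rule measurable_compose[of "\<lambda>z. fst (snd z) k" _ "cvec_space N"])
    show "(\<lambda>z. fst (snd z) k) \<in> ?M \<rightarrow>\<^sub>M cvec_space N"
      by (rule measurable_compose[of "\<lambda>z. fst (snd z)" _ path_space]) (auto intro: measurable_component_singleton)
    show "(\<lambda>x. x l) \<in> borel_measurable (cvec_space N)"
      using that by (intro measurable_component_singleton) auto
  qed
  have 4: "(\<lambda>z. \<Sum>l<N. cnj (dft N l m) * fst (snd z) k l) \<in> borel_measurable ?M"
  proof (rule borel_measurable_sum)
    fix l assume "l \<in> {..<N}"
    then have "(\<lambda>z. fst (snd z) k l) \<in> borel_measurable ?M" by (intro 3) simp
    then show "(\<lambda>z. cnj (dft N l m) * fst (snd z) k l) \<in> borel_measurable ?M"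
      by (rule borel_measurable_times[OF borel_measurable_const])
  qed
  show "(\<lambda>z. of_real (sqrt (real N)) * (\<Sum>l<N. cnj (dft N l m) * fst (snd z) k l) * fst z k m + snd (snd z) k m) \<in> borel_measurable ?M"
    by (rule borel_measurable_add[OF borel_measurable_times[OF borel_measurable_times[OF borel_measurable_const 4] 1] 2])
qed

text \<open>Each coordinate is replaced by the law of its image: the windowed noise has the noise
  law of the shorter block, and by stationarity the delayed path has the law of the undelayed
  one.\<close>

lemma nn_integral_sample_path:
  assumes \<mu>: "\<mu> \<in> input_laws N n" and s: "s + n' \<le> n"
    and F[measurable]: "F \<in> borel_measurable (block n' \<Otimes>\<^sub>M (path_space \<Otimes>\<^sub>M block n'))"
  shows "(\<integral>\<^sup>+z. F (window s n' (fst z), delayed_path s (fst (snd z)), window s n' (snd (snd z))) \<partial>sample n \<mu>)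
    = (\<integral>\<^sup>+x. (\<integral>\<^sup>+\<pi>. (\<integral>\<^sup>+w. F (x, \<pi>, w) \<partial>noise n') \<partial>distr P path_space (delayed_path 0)) \<partial>distr \<mu> (block n') (window s n'))"
proof -
  interpret \<mu>: prob_space \<mu> by (rule prob_space_input_law[OF \<mu>])
  interpret R: prob_space "noise n" by (rule noise_prob)
  interpret R': prob_space "noise n'" by (rule noise_prob)
  interpret PR: pair_prob_space P "noise n" ..
  interpret PL: prob_space "distr P path_space (delayed_path 0)"
    by (rule prob_space_distr[OF measurable_delayed_path])
  note [measurable_cong] = sets_input_law[OF \<mu>]
  note [measurable] = measurable_delayed_path[of s] measurable_window[OF s]
  have spc: "space \<mu> = space (block n)"
    by (rule sets_eq_imp_space_eq[OF sets_input_law[OF \<mu>]])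
  let ?p = "window s n'"
  have wn: "?p \<in> noise n \<rightarrow>\<^sub>M noise n'" and w\<mu>: "?p \<in> \<mu> \<rightarrow>\<^sub>M block n'"
    using measurable_window[OF s] by (simp_all add: measurable_cong_sets[OF sets_noise_law sets_noise_law] measurable_cong_sets[OF sets_input_law[OF \<mu>] refl])
  have F2: "(\<lambda>w. F (x, \<pi>, w)) \<in> borel_measurable (noise n')" if "x \<in> space (block n')" "\<pi> \<in> space path_space" for x \<pi>
  proof -
    have "(\<lambda>w. (x, \<pi>, w)) \<in> noise n' \<rightarrow>\<^sub>M block n' \<Otimes>\<^sub>M (path_space \<Otimes>\<^sub>M block n')" using that by measurable
    from measurable_compose[OF this F] show ?thesis .
  qed
  define G where "G x \<pi> = (\<integral>\<^sup>+w. F (x, \<pi>, w) \<partial>noise n')" for x \<pi>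
  have Gm: "(\<lambda>v. G (fst v) (snd v)) \<in> borel_measurable (block n' \<Otimes>\<^sub>M path_space)"
  proof -
    have "(\<lambda>u. (fst (fst u), snd (fst u), snd u)) \<in> (block n' \<Otimes>\<^sub>M path_space) \<Otimes>\<^sub>M noise n' \<rightarrow>\<^sub>M block n' \<Otimes>\<^sub>M (path_space \<Otimes>\<^sub>M block n')"
      by measurable
    from measurable_compose[OF this F] have "(\<lambda>u. F (fst (fst u), snd (fst u), snd u)) \<in> borel_measurable ((block n' \<Otimes>\<^sub>M path_space) \<Otimes>\<^sub>M noise n')" .
    then show ?thesis
      unfolding G_def by (intro R'.borel_measurable_nn_integral) (simp add: split_beta')
  qed
  have G2: "G x \<in> borel_measurable path_space" if "x \<in> space (block n')" for x
  proof -
    have "(\<lambda>\<pi>. (x, \<pi>)) \<in> path_space \<rightarrow>\<^sub>M block n' \<Otimes>\<^sub>M path_space" using that by measurable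
    from measurable_compose[OF this Gm] show ?thesis by simp
  qed
  define K where "K x = (\<integral>\<^sup>+\<pi>. G x \<pi> \<partial>distr P path_space (delayed_path 0))" for x
  have Km: "K \<in> borel_measurable (block n')"
    unfolding K_def[abs_def]
    by (rule PL.borel_measurable_nn_integral) (use Gm in \<open>simp add: split_beta' measurable_cong_sets[OF sets_pair_measure_cong[OF refl sets_distr] refl]\<close>)
  have "(\<lambda>z. (?p (fst z), delayed_path s (fst (snd z)), ?p (snd (snd z)))) \<in> \<mu> \<Otimes>\<^sub>M (P \<Otimes>\<^sub>M noise n) \<rightarrow>\<^sub>M block n' \<Otimes>\<^sub>M (path_space \<Otimes>\<^sub>M block n')"
    by measurable
  from measurable_compose[OF this F]
  have Fm: "(\<lambda>z. F (?p (fst z), delayed_path s (fst (snd z)), ?p (snd (snd z)))) \<in> borel_measurable (\<mu> \<Otimes>\<^sub>M (P \<Otimes>\<^sub>M noise n))" .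
  have "(\<integral>\<^sup>+z. F (?p (fst z), delayed_path s (fst (snd z)), ?p (snd (snd z))) \<partial>sample n \<mu>)
     = (\<integral>\<^sup>+x. (\<integral>\<^sup>+v. F (?p x, delayed_path s (fst v), ?p (snd v)) \<partial>(P \<Otimes>\<^sub>M noise n)) \<partial>\<mu>)"
    unfolding sample_def using PR.P.nn_integral_fst[OF Fm] by simp
  also have "\<dots> = (\<integral>\<^sup>+x. K (?p x) \<partial>\<mu>)"
  proof (rule nn_integral_cong)
    fix x assume x: "x \<in> space \<mu>"
    have px: "?p x \<in> space (block n')" using measurable_space[OF w\<mu> x] .
    have "(\<lambda>v. (x, v)) \<in> P \<Otimes>\<^sub>M noise n \<rightarrow>\<^sub>M \<mu> \<Otimes>\<^sub>M (P \<Otimes>\<^sub>M noise n)" using x by measurable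
    from measurable_compose[OF this Fm] have m: "(\<lambda>v. F (?p x, delayed_path s (fst v), ?p (snd v))) \<in> borel_measurable (P \<Otimes>\<^sub>M noise n)" by simp
    have "(\<integral>\<^sup>+v. F (?p x, delayed_path s (fst v), ?p (snd v)) \<partial>(P \<Otimes>\<^sub>M noise n)) = (\<integral>\<^sup>+\<omega>. (\<integral>\<^sup>+w. F (?p x, delayed_path s \<omega>, ?p w) \<partial>noise n) \<partial>P)"
      using R.nn_integral_fst[OF m] by simp
    also have "\<dots> = (\<integral>\<^sup>+\<omega>. G (?p x) (delayed_path s \<omega>) \<partial>P)"
    proof (rule nn_integral_cong)
      fix \<omega> assume \<omega>: "\<omega> \<in> space P"
      have d: "delayed_path s \<omega> \<in> space path_space" using measurable_space[OF measurable_delayed_path \<omega>] .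
      have "(\<integral>\<^sup>+w. F (?p x, delayed_path s \<omega>, ?p w) \<partial>noise n) = (\<integral>\<^sup>+w. F (?p x, delayed_path s \<omega>, w) \<partial>distr (noise n) (noise n') ?p)"
        by (rule nn_integral_distr[OF wn, symmetric]) (use F2[OF px d] in simp)
      then show "(\<integral>\<^sup>+w. F (?p x, delayed_path s \<omega>, ?p w) \<partial>noise n) = G (?p x) (delayed_path s \<omega>)"
        unfolding distr_window_noise[OF s] G_def .
    qed
    also have "\<dots> = (\<integral>\<^sup>+\<pi>. G (?p x) \<pi> \<partial>distr P path_space (delayed_path s))"
      by (rule nn_integral_distr[OF measurable_delayed_path, symmetric]) (use G2[OF px] in simp)
    also have "\<dots> = K (?p x)"
      unfolding distr_delayed_path[of s] K_def ..
    finally show "(\<integral>\<^sup>+v. F (?p x, delayed_path s (fst v), ?p (snd v)) \<partial>(P \<Otimes>\<^sub>M noise n)) = K (?p x)" .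
  qed
  also have "\<dots> = (\<integral>\<^sup>+x. K x \<partial>distr \<mu> (block n') ?p)"
    by (rule nn_integral_distr[OF w\<mu>, symmetric]) (use Km in simp)
  finally show ?thesis unfolding K_def G_def .
qed

lemma window_input_law:
  assumes \<mu>: "\<mu> \<in> input_laws N n" and s: "s + n' \<le> n"
  shows "distr \<mu> (block n') (window s n') \<in> input_laws N n'"
proof -
  interpret \<mu>: prob_space \<mu> by (rule prob_space_input_law[OF \<mu>])
  have "window s n' \<in> \<mu> \<rightarrow>\<^sub>M block n'"
    using measurable_window[OF s] by (simp add: measurable_cong_sets[OF sets_input_law[OF \<mu>] refl])
  then show ?thesis unfolding input_laws_def using \<mu>.prob_space_distr by simp
qed

lemma window_id: "x \<in> space (block n) \<Longrightarrow> window 0 n x = x"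
  unfolding window_def by (auto simp: space_PiM PiE_def extensional_def fun_eq_iff)

text \<open>By stationarity, what happens in a time window only depends on the law of the inputs in that window.\<close>

lemma distr_window_sample:
  assumes \<mu>: "\<mu> \<in> input_laws N n" and s: "s + n' \<le> n"
  defines "\<mu>' \<equiv> distr \<mu> (block n') (window s n')"
  shows "distr (sample n \<mu>) (block n' \<Otimes>\<^sub>M block n') (\<lambda>z. (window s n' (fst z), window s n' (rec n z)))
     = distr (sample n' \<mu>') (block n' \<Otimes>\<^sub>M block n') (\<lambda>z. (fst z, rec n' z))" (is "?D = ?D'")
proof (rule measure_eqI)
  have \<mu>': "\<mu>' \<in> input_laws N n'" unfolding \<mu>'_def by (rule window_input_law[OF \<mu> s])
  have m1: "(\<lambda>z. (window s n' (fst z), window s n' (rec n z))) \<in> sample n \<mu> \<rightarrow>\<^sub>M block n' \<Otimes>\<^sub>M block n'"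
    by (intro measurable_Pair measurable_compose[OF sample_measurable(1)[OF \<mu>] measurable_window[OF s]]
        measurable_compose[OF sample_measurable(4)[OF \<mu>] measurable_window[OF s]])
  have m2: "(\<lambda>z. (fst z, rec n' z)) \<in> sample n' \<mu>' \<rightarrow>\<^sub>M block n' \<Otimes>\<^sub>M block n'"
    by (intro measurable_Pair sample_measurable[OF \<mu>'])
  have idm: "distr \<mu>' (block n') (window 0 n') = \<mu>'"
  proof -
    have "distr \<mu>' (block n') (window 0 n') = distr \<mu>' \<mu>' (\<lambda>x. x)"
      by (intro distr_cong) (auto simp: \<mu>'_def window_id)
    then show ?thesis by simp
  qed
  fix A assume "A \<in> sets ?D"
  then have A: "A \<in> sets (block n' \<Otimes>\<^sub>M block n')" by simp
  define F where "F v = (indicator A (fst v, path_received n' v) :: ennreal)" for v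
  have "(\<lambda>v. (fst v, path_received n' v)) \<in> block n' \<Otimes>\<^sub>M (path_space \<Otimes>\<^sub>M block n') \<rightarrow>\<^sub>M block n' \<Otimes>\<^sub>M block n'"
    by (intro measurable_Pair measurable_fst measurable_path_received)
  then have F: "F \<in> borel_measurable (block n' \<Otimes>\<^sub>M (path_space \<Otimes>\<^sub>M block n'))"
    unfolding F_def[abs_def] by (rule measurable_compose) (use A in simp)
  have "emeasure ?D A = (\<integral>\<^sup>+z. indicator A (window s n' (fst z), window s n' (rec n z)) \<partial>sample n \<mu>)"
    using A by (subst nn_integral_indicator[symmetric], simp) (subst nn_integral_distr[OF m1], auto)
  also have "\<dots> = (\<integral>\<^sup>+z. F (window s n' (fst z), delayed_path s (fst (snd z)), window s n' (snd (snd z))) \<partial>sample n \<mu>)"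
  proof (rule nn_integral_cong)
    fix z :: "(nat \<Rightarrow> nat \<Rightarrow> complex) \<times> 'w \<times> (nat \<Rightarrow> nat \<Rightarrow> complex)"
    show "indicator A (window s n' (fst z), window s n' (rec n z)) = F (window s n' (fst z), delayed_path s (fst (snd z)), window s n' (snd (snd z)))"
      by (cases z) (simp add: F_def window_received[OF s])
  qed
  also have "\<dots> = (\<integral>\<^sup>+x. (\<integral>\<^sup>+\<pi>. (\<integral>\<^sup>+w. F (x, \<pi>, w) \<partial>noise n') \<partial>distr P path_space (delayed_path 0)) \<partial>\<mu>')"
    unfolding \<mu>'_def by (rule nn_integral_sample_path[OF \<mu> s F])
  also have "\<dots> = (\<integral>\<^sup>+z. F (window 0 n' (fst z), delayed_path 0 (fst (snd z)), window 0 n' (snd (snd z))) \<partial>sample n' \<mu>')"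
    using nn_integral_sample_path[OF \<mu>' _ F, of 0] unfolding idm by simp
  also have "\<dots> = (\<integral>\<^sup>+z. indicator A (fst z, rec n' z) \<partial>sample n' \<mu>')"
  proof (rule nn_integral_cong)
    fix z assume z: "z \<in> space (sample n' \<mu>')"
    have "fst z \<in> space (block n')" "snd (snd z) \<in> space (block n')"
      using measurable_space[OF sample_measurable(1)[OF \<mu>'] z] measurable_space[OF sample_measurable(3)[OF \<mu>'] z] by auto
    then show "F (window 0 n' (fst z), delayed_path 0 (fst (snd z)), window 0 n' (snd (snd z))) = indicator A (fst z, rec n' z)"
      by (cases z) (simp add: F_def window_id received_eq_path_received)
  qed
  also have "\<dots> = emeasure ?D' A"
    using A by (subst nn_integral_indicator[symmetric], simp) (subst nn_integral_distr[OF m2], auto)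
  finally show "emeasure ?D A = emeasure ?D' A" .
qed simp

text \<open>Blocks with last indices a and b have a + 1 and b + 1 symbols, so the glued block has
  last index a + b + 1 and its second part starts at time a + 1.\<close>

definition glue :: "nat \<Rightarrow> nat \<Rightarrow> (nat \<Rightarrow> nat \<Rightarrow> complex) \<times> (nat \<Rightarrow> nat \<Rightarrow> complex) \<Rightarrow> nat \<Rightarrow> nat \<Rightarrow> complex" where
  "glue a b = (\<lambda>(x1, x2). \<lambda>k\<in>{..a + b + 1}. if k \<le> a then x1 k else x2 (k - (a + 1)))"

definition glued :: "nat \<Rightarrow> nat \<Rightarrow> (nat \<Rightarrow> nat \<Rightarrow> complex) measure \<Rightarrow> (nat \<Rightarrow> nat \<Rightarrow> complex) measure \<Rightarrow> (nat \<Rightarrow> nat \<Rightarrow> complex) measure" where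
  "glued a b \<mu>1 \<mu>2 = distr (\<mu>1 \<Otimes>\<^sub>M \<mu>2) (block (a + b + 1)) (glue a b)"

lemma measurable_glue: "glue a b \<in> block a \<Otimes>\<^sub>M block b \<rightarrow>\<^sub>M block (a + b + 1)"
  unfolding glue_def split_beta'
proof (rule measurable_restrict)
  fix k assume k: "k \<in> {..a + b + 1}"
  show "(\<lambda>z. if k \<le> a then fst z k else snd z (k - (a + 1))) \<in> block a \<Otimes>\<^sub>M block b \<rightarrow>\<^sub>M cvec_space N"
  proof (cases "k \<le> a")
    case True
    then have "(\<lambda>x. x k) \<in> block a \<rightarrow>\<^sub>M cvec_space N" by (intro measurable_component_singleton) auto
    from measurable_compose[OF measurable_fst this] show ?thesis using True by simp
  next
    case False
    then have "(\<lambda>x. x (k - (a + 1))) \<in> block b \<rightarrow>\<^sub>M cvec_space N" using k by (intro measurable_component_singleton) auto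
    from measurable_compose[OF measurable_snd this] show ?thesis using False by simp
  qed
qed

lemma window_glue:
  assumes "x1 \<in> space (block a)" "x2 \<in> space (block b)"
  shows "window 0 a (glue a b (x1, x2)) = x1" "window (a + 1) b (glue a b (x1, x2)) = x2"
  using assms unfolding window_def glue_def
  by (auto simp: space_PiM PiE_def extensional_def fun_eq_iff)

lemma measurable_glue':
  assumes "\<mu>1 \<in> input_laws N a" "\<mu>2 \<in> input_laws N b"
  shows "glue a b \<in> \<mu>1 \<Otimes>\<^sub>M \<mu>2 \<rightarrow>\<^sub>M block (a + b + 1)"
  using measurable_glue[of a b]
  by (simp add: measurable_cong_sets[OF sets_pair_measure_cong[OF sets_input_law[OF assms(1)] sets_input_law[OF assms(2)]] refl])

lemma glued_input_law:
  assumes "\<mu>1 \<in> input_laws N a" "\<mu>2 \<in> input_laws N b"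
  shows "glued a b \<mu>1 \<mu>2 \<in> input_laws N (a + b + 1)"
proof -
  interpret M1: prob_space \<mu>1 by (rule prob_space_input_law[OF assms(1)])
  interpret M2: prob_space \<mu>2 by (rule prob_space_input_law[OF assms(2)])
  interpret M: pair_prob_space \<mu>1 \<mu>2 ..
  show ?thesis
    unfolding glued_def input_laws_def using M.P.prob_space_distr[OF measurable_glue'[OF assms]] by simp
qed

text \<open>Independence of the two windows of a glued input, the form in which superadditivity uses
  it.\<close>

lemma nn_integral_glued:
  assumes \<mu>1: "\<mu>1 \<in> input_laws N a" and \<mu>2: "\<mu>2 \<in> input_laws N b"
    and f: "f \<in> borel_measurable (block a)" and g: "g \<in> borel_measurable (block b)"
  shows "(\<integral>\<^sup>+x. f (window 0 a x) * g (window (a + 1) b x) \<partial>glued a b \<mu>1 \<mu>2) = (\<integral>\<^sup>+x. f x \<partial>\<mu>1) * (\<integral>\<^sup>+x. g x \<partial>\<mu>2)"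
proof -
  interpret M1: prob_space \<mu>1 by (rule prob_space_input_law[OF \<mu>1])
  interpret M2: prob_space \<mu>2 by (rule prob_space_input_law[OF \<mu>2])
  have sp: "space \<mu>1 = space (block a)" "space \<mu>2 = space (block b)"
    by (rule sets_eq_imp_space_eq[OF sets_input_law[OF \<mu>1]], rule sets_eq_imp_space_eq[OF sets_input_law[OF \<mu>2]])
  have [measurable]: "f \<in> borel_measurable \<mu>1" "g \<in> borel_measurable \<mu>2"
    using f g by (simp_all add: measurable_cong_sets[OF sets_input_law[OF \<mu>1] refl] measurable_cong_sets[OF sets_input_law[OF \<mu>2] refl])
  have "(\<lambda>x. f (window 0 a x) * g (window (a + 1) b x)) \<in> borel_measurable (block (a + b + 1))"
    by (intro borel_measurable_times_ennreal measurable_compose[OF measurable_window f] measurable_compose[OF measurable_window g]) auto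
  then have "(\<integral>\<^sup>+x. f (window 0 a x) * g (window (a + 1) b x) \<partial>glued a b \<mu>1 \<mu>2)
      = (\<integral>\<^sup>+z. f (window 0 a (glue a b z)) * g (window (a + 1) b (glue a b z)) \<partial>(\<mu>1 \<Otimes>\<^sub>M \<mu>2))"
    unfolding glued_def by (intro nn_integral_distr measurable_glue'[OF \<mu>1 \<mu>2]) simp
  also have "\<dots> = (\<integral>\<^sup>+z. f (fst z) * g (snd z) \<partial>(\<mu>1 \<Otimes>\<^sub>M \<mu>2))"
    by (intro nn_integral_cong) (auto simp: space_pair_measure sp window_glue window_glue[simplified])
  also have "\<dots> = (\<integral>\<^sup>+x. (\<integral>\<^sup>+y. f x * g y \<partial>\<mu>2) \<partial>\<mu>1)"
    by (subst M2.nn_integral_fst[symmetric]) simp_all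
  also have "\<dots> = (\<integral>\<^sup>+x. f x \<partial>\<mu>1) * (\<integral>\<^sup>+x. g x \<partial>\<mu>2)"
    by (simp add: nn_integral_cmult nn_integral_multc)
  finally show ?thesis .
qed

lemma distr_window_glued:
  assumes \<mu>1: "\<mu>1 \<in> input_laws N a" and \<mu>2: "\<mu>2 \<in> input_laws N b"
  shows "distr (glued a b \<mu>1 \<mu>2) (block a) (window 0 a) = \<mu>1"
    and "distr (glued a b \<mu>1 \<mu>2) (block b) (window (a + 1) b) = \<mu>2"
proof -
  interpret M1: prob_space \<mu>1 by (rule prob_space_input_law[OF \<mu>1])
  interpret M2: prob_space \<mu>2 by (rule prob_space_input_law[OF \<mu>2])
  have w: "window 0 a \<in> glued a b \<mu>1 \<mu>2 \<rightarrow>\<^sub>M block a" "window (a + 1) b \<in> glued a b \<mu>1 \<mu>2 \<rightarrow>\<^sub>M block b"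
    unfolding glued_def using measurable_window[of 0 a "a + b + 1"] measurable_window[of "a + 1" b "a + b + 1"] by simp_all
  show "distr (glued a b \<mu>1 \<mu>2) (block a) (window 0 a) = \<mu>1"
  proof (rule measure_eqI)
    fix A assume "A \<in> sets (distr (glued a b \<mu>1 \<mu>2) (block a) (window 0 a))"
    then have A: "A \<in> sets (block a)" by simp
    then have A1: "A \<in> sets \<mu>1" using sets_input_law[OF \<mu>1] by simp
    have "emeasure (distr (glued a b \<mu>1 \<mu>2) (block a) (window 0 a)) A = (\<integral>\<^sup>+x. indicator A (window 0 a x) * 1 \<partial>glued a b \<mu>1 \<mu>2)"
      using A by (subst nn_integral_indicator[symmetric], simp) (subst nn_integral_distr[OF w(1)], auto)
    also have "\<dots> = emeasure \<mu>1 A"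
      using nn_integral_glued[OF \<mu>1 \<mu>2, of "indicator A" "\<lambda>_. 1"] A A1 by (simp add: M2.emeasure_space_1)
    finally show "emeasure (distr (glued a b \<mu>1 \<mu>2) (block a) (window 0 a)) A = emeasure \<mu>1 A" .
  qed (simp add: sets_input_law[OF \<mu>1])
  show "distr (glued a b \<mu>1 \<mu>2) (block b) (window (a + 1) b) = \<mu>2"
  proof (rule measure_eqI)
    fix A assume "A \<in> sets (distr (glued a b \<mu>1 \<mu>2) (block b) (window (a + 1) b))"
    then have A: "A \<in> sets (block b)" by simp
    then have A1: "A \<in> sets \<mu>2" using sets_input_law[OF \<mu>2] by simp
    have "emeasure (distr (glued a b \<mu>1 \<mu>2) (block b) (window (a + 1) b)) A = (\<integral>\<^sup>+x. 1 * indicator A (window (a + 1) b x) \<partial>glued a b \<mu>1 \<mu>2)"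
      using A by (subst nn_integral_indicator[symmetric], simp) (subst nn_integral_distr[OF w(2)], auto)
    also have "\<dots> = emeasure \<mu>2 A"
      using nn_integral_glued[OF \<mu>1 \<mu>2, of "\<lambda>_. 1" "indicator A"] A A1 by (simp add: M1.emeasure_space_1)
    finally show "emeasure (distr (glued a b \<mu>1 \<mu>2) (block b) (window (a + 1) b)) A = emeasure \<mu>2 A" .
  qed (simp add: sets_input_law[OF \<mu>2])
qed

lemma symbol_energy_window: "k \<le> n' \<Longrightarrow> symbol_energy N (window s n' x) k = symbol_energy N x (k + s)"
  unfolding symbol_energy_def window_def by simp

lemma energy_windows: "energy (a + b + 1) x = energy a (window 0 a x) + energy b (window (a + 1) b x)"
proof -
  have split: "(\<Sum>k<p + q. f k) = (\<Sum>k<p. f k) + (\<Sum>k<q. f (k + p))" for f :: "nat \<Rightarrow> real" and p q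
    by (induction q) (simp_all add: add.commute[of p])
  have "energy (a + b + 1) x = (\<Sum>k<(a + 1) + (b + 1). symbol_energy N x k)"
    unfolding energy_eq by (intro sum.cong) auto
  also have "\<dots> = (\<Sum>k<a + 1. symbol_energy N x k) + (\<Sum>k<b + 1. symbol_energy N x (k + (a + 1)))"
    by (rule split)
  also have "(\<Sum>k<a + 1. symbol_energy N x k) = energy a (window 0 a x)"
    unfolding energy_eq by (intro sum.cong) (auto simp: symbol_energy_window)
  also have "(\<Sum>k<b + 1. symbol_energy N x (k + (a + 1))) = energy b (window (a + 1) b x)"
    unfolding energy_eq by (intro sum.cong) (auto simp: symbol_energy_window)
  finally show ?thesis .
qed

lemma integrable_glued_energy:
  assumes \<mu>1: "\<mu>1 \<in> input_laws N a" and \<mu>2: "\<mu>2 \<in> input_laws N b"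
    and e: "integrable \<mu>1 (energy a)" "integrable \<mu>2 (energy b)"
  shows "integrable (glued a b \<mu>1 \<mu>2) (energy (a + b + 1))"
proof -
  have w: "window 0 a \<in> glued a b \<mu>1 \<mu>2 \<rightarrow>\<^sub>M block a" "window (a + 1) b \<in> glued a b \<mu>1 \<mu>2 \<rightarrow>\<^sub>M block b"
    unfolding glued_def using measurable_window[of 0 a "a + b + 1"] measurable_window[of "a + 1" b "a + b + 1"] by simp_all
  have "integrable (glued a b \<mu>1 \<mu>2) (\<lambda>x. energy a (window 0 a x))"
    using integrable_distr[OF w(1), of "energy a"] e(1) unfolding distr_window_glued[OF \<mu>1 \<mu>2] by simp
  moreover have "integrable (glued a b \<mu>1 \<mu>2) (\<lambda>x. energy b (window (a + 1) b x))"
    using integrable_distr[OF w(2), of "energy b"] e(2) unfolding distr_window_glued[OF \<mu>1 \<mu>2] by simp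
  ultimately show ?thesis unfolding energy_windows[abs_def] by simp
qed

text \<open>The information density of a window, evaluated on the long block, has the same law as on
  a block of its own. The informations of both parts thus become integrals over one probability
  space, where they can be compared with that of the whole.\<close>

lemma information_window:
  assumes \<mu>: "\<mu> \<in> input_laws N n" and s: "s + n' \<le> n" and \<mu>': "distr \<mu> (block n') (window s n') = \<mu>'"
    and e: "integrable \<mu>' (energy n')"
  defines "\<phi> \<equiv> \<lambda>x y. ln (lik n' x y) - ln (marg n' \<mu>' y)"
  shows "integrable (sample n \<mu>) (\<lambda>z. \<phi> (window s n' (fst z)) (window s n' (rec n z)))"
    and "(\<integral>z. \<phi> (window s n' (fst z)) (window s n' (rec n z)) \<partial>sample n \<mu>) = io_information P N L h n' \<mu>'"
proof -
  have \<mu>'l: "\<mu>' \<in> input_laws N n'" unfolding \<mu>'[symmetric] by (rule window_input_law[OF \<mu> s])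
  have \<phi>m: "(\<lambda>v. \<phi> (fst v) (snd v)) \<in> borel_measurable (block n' \<Otimes>\<^sub>M block n')"
  proof -
    have "(\<lambda>z. lik n' (fst z) (snd z)) \<in> borel_measurable (block n' \<Otimes>\<^sub>M block n')"
      by (rule measurable_lik) measurable
    moreover have "(\<lambda>z. marg n' \<mu>' (snd z)) \<in> borel_measurable (block n' \<Otimes>\<^sub>M block n')"
      by (rule measurable_compose[OF measurable_snd measurable_marg[OF \<mu>'l]])
    ultimately show ?thesis unfolding \<phi>_def by measurable
  qed
  have m1: "(\<lambda>z. (window s n' (fst z), window s n' (rec n z))) \<in> sample n \<mu> \<rightarrow>\<^sub>M block n' \<Otimes>\<^sub>M block n'"
    by (intro measurable_Pair measurable_compose[OF sample_measurable(1)[OF \<mu>] measurable_window[OF s]]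
        measurable_compose[OF sample_measurable(4)[OF \<mu>] measurable_window[OF s]])
  have m2: "(\<lambda>z. (fst z, rec n' z)) \<in> sample n' \<mu>' \<rightarrow>\<^sub>M block n' \<Otimes>\<^sub>M block n'"
    by (intro measurable_Pair sample_measurable[OF \<mu>'l])
  note I = integrable_ln_lik_marg[OF \<mu>'l e]
  have eq: "distr (sample n \<mu>) (block n' \<Otimes>\<^sub>M block n') (\<lambda>z. (window s n' (fst z), window s n' (rec n z)))
     = distr (sample n' \<mu>') (block n' \<Otimes>\<^sub>M block n') (\<lambda>z. (fst z, rec n' z))"
    using distr_window_sample[OF \<mu> s] unfolding \<mu>' .
  have "integrable (sample n' \<mu>') (\<lambda>z. \<phi> (fst z) (rec n' z))"
    unfolding \<phi>_def using I by simp
  then have "integrable (distr (sample n' \<mu>') (block n' \<Otimes>\<^sub>M block n') (\<lambda>z. (fst z, rec n' z))) (\<lambda>v. \<phi> (fst v) (snd v))"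
    using integrable_distr_eq[OF m2 \<phi>m] by simp
  then show "integrable (sample n \<mu>) (\<lambda>z. \<phi> (window s n' (fst z)) (window s n' (rec n z)))"
    unfolding eq[symmetric] using integrable_distr_eq[OF m1 \<phi>m] by simp
  have "(\<integral>z. \<phi> (window s n' (fst z)) (window s n' (rec n z)) \<partial>sample n \<mu>) = (\<integral>v. \<phi> (fst v) (snd v) \<partial>distr (sample n \<mu>) (block n' \<Otimes>\<^sub>M block n') (\<lambda>z. (window s n' (fst z), window s n' (rec n z))))"
    using integral_distr[OF m1 \<phi>m] by simp
  also have "\<dots> = (\<integral>z. \<phi> (fst z) (rec n' z) \<partial>sample n' \<mu>')"
    unfolding eq using integral_distr[OF m2 \<phi>m] by simp
  finally show "(\<integral>z. \<phi> (window s n' (fst z)) (window s n' (rec n z)) \<partial>sample n \<mu>) = io_information P N L h n' \<mu>'"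
    unfolding io_information_eq[OF \<mu>'l] \<phi>_def .
qed

text \<open>Gibbs' inequality for the ratio \<open>rr\<close> of the window likelihoods
  \<open>f1\<close> \<open>f2\<close>, normalised by \<open>g1\<close> \<open>g2\<close>, to
  \<open>lik\<close>/\<open>marg\<close>. Dependence between the two output blocks through the
  channel memory does no harm: \<open>f1\<close> \<open>f2\<close> is merely a reference, and the
  mean of the ratio is 1 because the input blocks are independent.\<close>

lemma information_superadditive:
  assumes \<mu>1: "\<mu>1 \<in> input_laws N a" and \<mu>2: "\<mu>2 \<in> input_laws N b"
    and e1: "integrable \<mu>1 (energy a)" and e2: "integrable \<mu>2 (energy b)"
  shows "io_information P N L h a \<mu>1 + io_information P N L h b \<mu>2 \<le> io_information P N L h (a + b + 1) (glued a b \<mu>1 \<mu>2)"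
proof -
  define n where "n = a + b + 1"
  define \<mu> where "\<mu> = glued a b \<mu>1 \<mu>2"
  define v1 v2 where "v1 = window 0 a" and "v2 = window (a + 1) b"
  have \<mu>: "\<mu> \<in> input_laws N n" unfolding \<mu>_def n_def by (rule glued_input_law[OF \<mu>1 \<mu>2])
  have e: "integrable \<mu> (energy n)" unfolding \<mu>_def n_def by (rule integrable_glued_energy[OF \<mu>1 \<mu>2 e1 e2])
  interpret \<mu>: prob_space \<mu> by (rule prob_space_input_law[OF \<mu>])
  interpret R: prob_space "noise n" by (rule noise_prob)
  interpret MR: pair_prob_space \<mu> "noise n" ..
  interpret S: prob_space "sample n \<mu>" by (rule sample_prob[OF \<mu>])
  note [measurable_cong] = sets_input_law[OF \<mu>]
  have w1: "v1 \<in> block n \<rightarrow>\<^sub>M block a" and w2: "v2 \<in> block n \<rightarrow>\<^sub>M block b"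
    unfolding v1_def v2_def n_def by (auto intro!: measurable_window)
  have n0: "0 + a \<le> n" "(a + 1) + b \<le> n" by (simp_all add: n_def)
  note W1 = information_window[OF \<mu> n0(1) distr_window_glued(1)[OF \<mu>1 \<mu>2, folded \<mu>_def] e1, folded v1_def]
  note W2 = information_window[OF \<mu> n0(2) distr_window_glued(2)[OF \<mu>1 \<mu>2, folded \<mu>_def] e2, folded v2_def]
  define g1 where "g1 y = marg a \<mu>1 (v1 y)" for y
  define g2 where "g2 y = marg b \<mu>2 (v2 y)" for y
  define f1 where "f1 x y = lik a (v1 x) (v1 y)" for x y
  define f2 where "f2 x y = lik b (v2 x) (v2 y)" for x y
  have g1m: "g1 \<in> borel_measurable (block n)" and g2m: "g2 \<in> borel_measurable (block n)"
    unfolding g1_def[abs_def] g2_def[abs_def]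
    by (rule measurable_compose[OF w1 measurable_marg[OF \<mu>1]], rule measurable_compose[OF w2 measurable_marg[OF \<mu>2]])
  have g1p: "0 < g1 y" and g2p: "0 < g2 y" and gp: "0 < marg n \<mu> y" if "y \<in> space (block n)" for y
    unfolding g1_def g2_def using measurable_space[OF w1 that] measurable_space[OF w2 that] that
    by (auto intro: marg_bounds(1)[OF \<mu>1] marg_bounds(1)[OF \<mu>2] marg_bounds(1)[OF \<mu>])
  have fp: "0 < f1 x y" "0 < f2 x y" for x y unfolding f1_def f2_def by (rule lik_bounds)+
  have f1m: "(\<lambda>z. f1 (X z) (Y z)) \<in> borel_measurable M" and f2m: "(\<lambda>z. f2 (X z) (Y z)) \<in> borel_measurable M"
    if X: "X \<in> M \<rightarrow>\<^sub>M block n" and Y: "Y \<in> M \<rightarrow>\<^sub>M block n" for X Y and M :: "'z measure"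
    unfolding f1_def f2_def
    by (rule measurable_lik[OF measurable_compose[OF X w1] measurable_compose[OF Y w1]],
        rule measurable_lik[OF measurable_compose[OF X w2] measurable_compose[OF Y w2]])
  define rr where "rr x y = (f1 x y * f2 x y * marg n \<mu> y) / (g1 y * g2 y * lik n x y)" for x y
  define t where "t x y = ennreal (f1 x y * f2 x y * (marg n \<mu> y / (g1 y * g2 y)))" for x y
  have rrm: "(\<lambda>z. rr (X z) (Y z)) \<in> borel_measurable M" and tm: "(\<lambda>z. t (X z) (Y z)) \<in> borel_measurable M"
    if X: "X \<in> M \<rightarrow>\<^sub>M block n" and Y: "Y \<in> M \<rightarrow>\<^sub>M block n" for X Y and M :: "'z measure"
  proof -
    note [measurable] = f1m[OF X Y] f2m[OF X Y] measurable_compose[OF Y g1m] measurable_compose[OF Y g2m]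
      measurable_compose[OF Y measurable_marg[OF \<mu>]] measurable_lik[OF X Y]
    show "(\<lambda>z. rr (X z) (Y z)) \<in> borel_measurable M" "(\<lambda>z. t (X z) (Y z)) \<in> borel_measurable M"
      unfolding rr_def t_def by measurable
  qed
  have tot: "(\<integral>\<^sup>+z. ennreal (rr (fst z) (rec n z)) \<partial>sample n \<mu>) = 1"
  proof -
    have "(\<lambda>z. rr (fst z) (snd z)) \<in> borel_measurable (block n \<Otimes>\<^sub>M block n)"
      by (rule rrm) measurable
    then have m: "(\<lambda>(x, y). ennreal (rr x y)) \<in> borel_measurable (block n \<Otimes>\<^sub>M block n)"
      by (simp add: split_beta')
    have "(\<integral>\<^sup>+z. ennreal (rr (fst z) (rec n z)) \<partial>sample n \<mu>) = (\<integral>\<^sup>+x. (\<integral>\<^sup>+y. ennreal (lik n x y) * ennreal (rr x y) \<partial>noise n) \<partial>\<mu>)"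
      by (rule nn_integral_sample_lik[OF \<mu> m])
    also have "\<dots> = (\<integral>\<^sup>+x. (\<integral>\<^sup>+y. t x y \<partial>noise n) \<partial>\<mu>)"
    proof (rule nn_integral_cong, rule nn_integral_cong)
      fix x y assume "y \<in> space (noise n)"
      then have y: "y \<in> space (block n)" by simp
      have "lik n x y * rr x y = f1 x y * f2 x y * (marg n \<mu> y / (g1 y * g2 y))"
        unfolding rr_def using lik_bounds(1)[of n x y] by simp
      moreover have "0 \<le> rr x y"
        unfolding rr_def using fp[of x y] gp[OF y] g1p[OF y] g2p[OF y] lik_bounds(1)[of n x y] by simp
      ultimately show "ennreal (lik n x y) * ennreal (rr x y) = t x y"
        unfolding t_def using lik_bounds(1)[of n x y] by (simp add: ennreal_mult[symmetric])
    qed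
    also have "\<dots> = (\<integral>\<^sup>+y. (\<integral>\<^sup>+x. t x y \<partial>\<mu>) \<partial>noise n)"
    proof (rule MR.Fubini'[symmetric])
      have "(\<lambda>z. t (fst z) (snd z)) \<in> borel_measurable (\<mu> \<Otimes>\<^sub>M noise n)" by (rule tm) measurable
      then show "case_prod t \<in> borel_measurable (\<mu> \<Otimes>\<^sub>M noise n)" by (simp add: split_beta')
    qed
    \<comment> \<open>For fixed y the two window likelihoods depend on different input blocks, so
      the average over the input factors and cancels \<open>g1 y * g2 y\<close>.\<close>
    also have "\<dots> = (\<integral>\<^sup>+y. ennreal (marg n \<mu> y) * 1 \<partial>noise n)"
    proof (rule nn_integral_cong)
      fix y assume "y \<in> space (noise n)"
      then have y: "y \<in> space (block n)" by simp
      have y1: "v1 y \<in> space (block a)" and y2: "v2 y \<in> space (block b)"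
        using measurable_space[OF w1 y] measurable_space[OF w2 y] by auto
      let ?F = "\<lambda>x. ennreal (lik a x (v1 y))" and ?G = "\<lambda>x. ennreal (lik b x (v2 y))"
      have F: "?F \<in> borel_measurable (block a)" "?G \<in> borel_measurable (block b)"
        by (intro measurable_compose[OF measurable_lik measurable_ennreal] measurable_ident measurable_const y1 y2; simp)+
      have FG: "(\<lambda>x. ?F (v1 x) * ?G (v2 x)) \<in> borel_measurable \<mu>"
      proof -
        have "(\<lambda>x. ?F (v1 x) * ?G (v2 x)) \<in> borel_measurable (block n)"
          by (intro borel_measurable_times_ennreal measurable_compose[OF w1 F(1)] measurable_compose[OF w2 F(2)])
        then show ?thesis by (simp add: measurable_cong_sets[OF sets_input_law[OF \<mu>] refl])
      qed
      have "(\<integral>\<^sup>+x. t x y \<partial>\<mu>) = (\<integral>\<^sup>+x. ennreal (marg n \<mu> y / (g1 y * g2 y)) * (?F (v1 x) * ?G (v2 x)) \<partial>\<mu>)"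
        using gp[OF y] g1p[OF y] g2p[OF y] fp
        by (intro nn_integral_cong) (simp add: t_def f1_def f2_def ennreal_mult[symmetric] less_imp_le mult.commute)
      also have "\<dots> = ennreal (marg n \<mu> y / (g1 y * g2 y)) * ((\<integral>\<^sup>+x. ?F x \<partial>\<mu>1) * (\<integral>\<^sup>+x. ?G x \<partial>\<mu>2))"
        using nn_integral_glued[OF \<mu>1 \<mu>2 F] nn_integral_cmult[OF FG] unfolding \<mu>_def v1_def v2_def by simp
      also have "\<dots> = ennreal (marg n \<mu> y / (g1 y * g2 y)) * (ennreal (g1 y) * ennreal (g2 y))"
        unfolding nn_integral_marg[OF \<mu>1 y1] nn_integral_marg[OF \<mu>2 y2] g1_def g2_def ..
      also have "\<dots> = ennreal (marg n \<mu> y) * 1"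
        using gp[OF y] g1p[OF y] g2p[OF y] by (simp add: ennreal_mult[symmetric] less_imp_le)
      finally show "(\<integral>\<^sup>+x. t x y \<partial>\<mu>) = ennreal (marg n \<mu> y) * 1" .
    qed
    also have "\<dots> = (\<integral>\<^sup>+z. 1 \<partial>sample n \<mu>)"
      by (rule distributed_nn_integral[OF distributed_sample(2)[OF \<mu>]]) simp
    finally show ?thesis by (simp add: S.emeasure_space_1)
  qed
  note I = integrable_ln_lik_marg[OF \<mu> e]
  have yz: "rec n z \<in> space (block n)" if "z \<in> space (sample n \<mu>)" for z
    by (rule measurable_space[OF sample_measurable(4)[OF \<mu>] that])
  have lnr: "ln (rr (fst z) (rec n z)) = ((ln (lik a (v1 (fst z)) (v1 (rec n z))) - ln (marg a \<mu>1 (v1 (rec n z))))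
       + (ln (lik b (v2 (fst z)) (v2 (rec n z))) - ln (marg b \<mu>2 (v2 (rec n z)))))
       - (ln (lik n (fst z) (rec n z)) - ln (marg n \<mu> (rec n z)))"
    if z: "z \<in> space (sample n \<mu>)" for z
    using gp[OF yz[OF z]] g1p[OF yz[OF z]] g2p[OF yz[OF z]] fp[of "fst z" "rec n z"] lik_bounds(1)[of n "fst z" "rec n z"]
    unfolding rr_def f1_def f2_def g1_def g2_def by (simp add: ln_divide_pos ln_mult_pos)
  have "(\<integral>z. ln (rr (fst z) (rec n z)) \<partial>sample n \<mu>) \<le> 0"
  proof (rule S.expectation_ln_nonpos)
    show "integrable (sample n \<mu>) (\<lambda>z. ln (rr (fst z) (rec n z)))"
      using I W1(1) W2(1) by (subst Bochner_Integration.integrable_cong[OF refl lnr]) auto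
    show "0 < rr (fst z) (rec n z)" if "z \<in> space (sample n \<mu>)" for z
      unfolding rr_def using fp[of "fst z" "rec n z"] gp[OF yz[OF that]] g1p[OF yz[OF that]] g2p[OF yz[OF that]] lik_bounds(1)[of n "fst z" "rec n z"] by simp
    show "(\<integral>\<^sup>+z. ennreal (rr (fst z) (rec n z)) \<partial>sample n \<mu>) \<le> 1" using tot by simp
    show "(\<lambda>z. rr (fst z) (rec n z)) \<in> borel_measurable (sample n \<mu>)"
      by (rule rrm[OF sample_measurable(1,4)[OF \<mu>]])
  qed
  also have "(\<integral>z. ln (rr (fst z) (rec n z)) \<partial>sample n \<mu>) = io_information P N L h a \<mu>1 + io_information P N L h b \<mu>2 - io_information P N L h n \<mu>"
  proof -
    have "(\<integral>z. ln (rr (fst z) (rec n z)) \<partial>sample n \<mu>) = (\<integral>z. ((ln (lik a (v1 (fst z)) (v1 (rec n z))) - ln (marg a \<mu>1 (v1 (rec n z))))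
       + (ln (lik b (v2 (fst z)) (v2 (rec n z))) - ln (marg b \<mu>2 (v2 (rec n z)))))
       - (ln (lik n (fst z) (rec n z)) - ln (marg n \<mu> (rec n z))) \<partial>sample n \<mu>)"
      by (rule Bochner_Integration.integral_cong[OF refl lnr])
    also have "\<dots> = io_information P N L h a \<mu>1 + io_information P N L h b \<mu>2 - io_information P N L h n \<mu>"
      unfolding Bochner_Integration.integral_diff[OF Bochner_Integration.integrable_add[OF W1(1) W2(1)] Bochner_Integration.integrable_diff[OF I]]
        Bochner_Integration.integral_add[OF W1(1) W2(1)] W1(2) W2(2) io_information_eq[OF \<mu>] ..
    finally show ?thesis .
  qed
  finally show ?thesis unfolding \<mu>_def n_def by simp
qed

end

section \<open>The capacity bounds\<close>

lemma integrable_of_nn_integral_le: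
  fixes f :: "'a \<Rightarrow> real"
  assumes f: "f \<in> borel_measurable M" and nn: "\<And>x. 0 \<le> f x"
    and le: "(\<integral>\<^sup>+x. ennreal (f x) \<partial>M) \<le> ennreal c" and c: "0 \<le> c"
  shows "integrable M f" and "(\<integral>x. f x \<partial>M) \<le> c"
proof -
  show i: "integrable M f"
    using le by (intro integrableI_nonneg f) (auto simp: nn intro: le_less_trans ennreal_less_top)
  have "ennreal (\<integral>x. f x \<partial>M) = (\<integral>\<^sup>+x. ennreal (f x) \<partial>M)"
    by (rule nn_integral_eq_integral[OF i, symmetric]) (simp add: nn)
  with le c show "(\<integral>x. f x \<partial>M) \<le> c" by (metis ennreal_le_iff)
qed

lemma ln_one_plus_ge_quadratic:
  fixes z :: real
  assumes "0 \<le> z"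
  shows "z - z\<^sup>2 / 2 \<le> ln (1 + z)"
proof -
  have "(\<lambda>z. ln (1 + z) - z + z\<^sup>2 / 2) 0 \<le> (\<lambda>z. ln (1 + z) - z + z\<^sup>2 / 2) z"
  proof (rule DERIV_nonneg_imp_nondecreasing[OF assms])
    fix x :: real assume x: "0 \<le> x" "x \<le> z"
    have "((\<lambda>z. ln (1 + z) - z + z\<^sup>2 / 2) has_real_derivative (1 / (1 + x) - 1 + x)) (at x)"
      using x by (auto intro!: derivative_eq_intros simp: field_simps)
    moreover have "1 / (1 + x) - 1 + x = x\<^sup>2 / (1 + x)"
      using x by (simp add: field_simps power2_eq_square)
    ultimately show "\<exists>y. ((\<lambda>z. ln (1 + z) - z + z\<^sup>2 / 2) has_real_derivative y) (at x) \<and> 0 \<le> y"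
      using x by (intro exI[of _ "x\<^sup>2 / (1 + x)"]) simp
  qed
  then show ?thesis by simp
qed

text \<open>For d \<le> 1 the function p - ln(1 + dp) is nondecreasing, so the peak energy is the
  worst case; lowering e to d can only enlarge the expression.\<close>

lemma diff_ln_mono:
  fixes p q e d :: real
  assumes "0 \<le> p" "p \<le> q" "0 \<le> d" "d \<le> e" "d \<le> 1"
  shows "p - ln (1 + e * p) \<le> q - ln (1 + d * q)"
proof -
  have "p - ln (1 + d * p) \<le> q - ln (1 + d * q)"
  proof (rule DERIV_nonneg_imp_nondecreasing[OF \<open>p \<le> q\<close>])
    fix x :: real assume x: "p \<le> x" "x \<le> q"
    have dx: "0 \<le> d * x" using assms x by simp
    have "((\<lambda>x. x - ln (1 + d * x)) has_real_derivative (1 - d / (1 + d * x))) (at x)"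
      using dx by (auto intro!: derivative_eq_intros simp: field_simps)
    moreover have "0 \<le> 1 - d / (1 + d * x)" using dx assms by (simp add: field_simps)
    ultimately show "\<exists>y. ((\<lambda>x. x - ln (1 + d * x)) has_real_derivative y) (at x) \<and> 0 \<le> y" by blast
  qed
  moreover have "ln (1 + d * p) \<le> ln (1 + e * p)"
    using assms mult_right_mono[of d e p] by (simp add: add_pos_nonneg)
  ultimately show ?thesis by simp
qed

section \<open>Power constraints and the resulting rate bounds\<close>

context ofdm_channel
begin

lemma mean_gain_nonneg: "0 \<le> mean_gain P N L h"
  by (simp add: mean_gain_def)

lemma symbol_energy_nonneg: "0 \<le> symbol_energy N x k"
  by (simp add: symbol_energy_def sum_nonneg)

lemma measurable_symbol_energy:
  assumes \<mu>: "\<mu> \<in> input_laws N n" and k: "k \<le> n"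
  shows "(\<lambda>x. symbol_energy N x k) \<in> borel_measurable \<mu>"
proof -
  have "(\<lambda>x. symbol_energy N x k) \<in> borel_measurable (block n)"
    unfolding symbol_energy_def
  proof (rule borel_measurable_sum)
    fix m assume "m \<in> {..<N}"
    then have [measurable]: "(\<lambda>x. x k m) \<in> borel_measurable (block n)"
      by (intro measurable_block_component k) simp
    show "(\<lambda>x. (cmod (x k m))\<^sup>2) \<in> borel_measurable (block n)" by measurable
  qed
  then show ?thesis by (simp add: measurable_cong_sets[OF sets_input_law[OF \<mu>] refl])
qed

text \<open>A \<open>lim\<close> can be bounded only once the sequence is known to converge.
  Fekete's lemma gives this for S, the supremum of the information over a block; nonemptiness and
  the uniform bound make that real supremum meaningful.\<close>

lemma capacity_le:
  assumes law: "\<And>n \<mu>. \<mu> \<in> adm n \<Longrightarrow> \<mu> \<in> input_laws N n"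
    and e: "\<And>n \<mu>. \<mu> \<in> adm n \<Longrightarrow> integrable \<mu> (energy n)"
    and ne: "\<And>n. adm n \<noteq> {}"
    and gl: "\<And>a b \<mu>1 \<mu>2. \<mu>1 \<in> adm a \<Longrightarrow> \<mu>2 \<in> adm b \<Longrightarrow> glued a b \<mu>1 \<mu>2 \<in> adm (a + b + 1)"
    and bound: "\<And>n \<mu>. \<mu> \<in> adm n \<Longrightarrow> io_information P N L h n \<mu> \<le> real (n + 1) * real N * B"
  shows "capacity P N L h adm \<le> ereal B"
proof -
  define S where "S n = (SUP \<mu>\<in>adm n. io_information P N L h n \<mu>)" for n
  \<comment> \<open>Reindexing by the number m = n + 1 of symbols turns S a + S c \<le> S (a + c +
    1) into plain superadditivity.\<close>
  define b where "b m = S (m - 1)" for m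
  have bdd: "bdd_above (io_information P N L h n ` adm n)" for n
    by (rule bdd_aboveI2[OF bound])
  have S_le: "S n \<le> real (n + 1) * real N * B" for n
    unfolding S_def by (rule cSUP_least[OF ne bound])
  have le_S: "io_information P N L h n \<mu> \<le> S n" if "\<mu> \<in> adm n" for n \<mu>
    unfolding S_def by (rule cSUP_upper[OF that bdd])
  have S_nonneg: "0 \<le> S n" for n
  proof -
    obtain \<mu> where \<mu>: "\<mu> \<in> adm n" using ne[of n] by blast
    show ?thesis using information_nonneg[OF law[OF \<mu>] e[OF \<mu>]] le_S[OF \<mu>] by simp
  qed
  have super: "S a + S c \<le> S (a + c + 1)" for a c
  proof -
    have "S a \<le> S (a + c + 1) - io_information P N L h c \<mu>2" if \<mu>2: "\<mu>2 \<in> adm c" for \<mu>2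
      unfolding S_def[of a]
    proof (rule cSUP_least[OF ne])
      fix \<mu>1 assume \<mu>1: "\<mu>1 \<in> adm a"
      show "io_information P N L h a \<mu>1 \<le> S (a + c + 1) - io_information P N L h c \<mu>2"
        using information_superadditive[OF law[OF \<mu>1] law[OF \<mu>2] e[OF \<mu>1] e[OF \<mu>2]] le_S[OF gl[OF \<mu>1 \<mu>2]]
        by linarith
    qed
    then have *: "io_information P N L h c \<mu>2 \<le> S (a + c + 1) - S a" if "\<mu>2 \<in> adm c" for \<mu>2
      using that by (simp add: algebra_simps)
    have "S c \<le> S (a + c + 1) - S a"
      unfolding S_def[of c] by (rule cSUP_least[OF ne *])
    then show ?thesis by simp
  qed
  have "\<exists>l. (\<lambda>n. b n / real n) \<longlonglongrightarrow> l"
  proof (rule fekete_superadditive[where B="real N * B"])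
    fix m n :: nat assume "0 < m" "0 < n"
    then have "m - 1 + (n - 1) + 1 = m + n - 1" by simp
    then show "b m + b n \<le> b (m + n)" unfolding b_def using super[of "m - 1" "n - 1"] by (simp only:)
  next
    fix n :: nat assume "0 < n"
    then show "0 \<le> b n" "b n \<le> real N * B * real n"
      using S_nonneg S_le[of "n - 1"] by (simp_all add: b_def algebra_simps)
  qed
  then obtain l where l: "(\<lambda>n. b n / real n) \<longlonglongrightarrow> l" by blast
  have l': "(\<lambda>n. S n / (real N * real (n + 1))) \<longlonglongrightarrow> l / real N"
  proof -
    have "(\<lambda>n. b (Suc n) / real (Suc n) / real N) \<longlonglongrightarrow> l / real N"
      using LIMSEQ_Suc[OF l] N_pos by (intro tendsto_divide tendsto_const) auto
    then show ?thesis by (simp add: b_def mult.commute)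
  qed
  have "l / real N \<le> B"
  proof (rule LIMSEQ_le_const2[OF l'], intro exI allI impI)
    fix n :: nat
    have "0 < real N * real (n + 1)" using N_pos by simp
    then show "S n / (real N * real (n + 1)) \<le> B"
      using S_le[of n] by (subst pos_divide_le_eq) (simp_all add: mult_ac)
  qed
  \<comment> \<open>The supremum in \<open>capacity\<close> is taken in the extended reals and has
    to be identified with the real one.\<close>
  have "(SUP \<mu>\<in>adm n. ereal (io_information P N L h n \<mu> / (real N * real (n + 1)))) = ereal (S n / (real N * real (n + 1)))" for n
  proof (rule antisym)
    have c: "0 < real N * real (n + 1)" using N_pos by simp
    let ?X = "SUP \<mu>\<in>adm n. ereal (io_information P N L h n \<mu> / (real N * real (n + 1)))"
    show le: "?X \<le> ereal (S n / (real N * real (n + 1)))"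
      using le_S c by (intro SUP_least) (simp add: divide_right_mono)
    have ge: "ereal (io_information P N L h n \<mu> / (real N * real (n + 1))) \<le> ?X" if "\<mu> \<in> adm n" for \<mu>
      using that by (rule SUP_upper)
    show "ereal (S n / (real N * real (n + 1))) \<le> ?X"
    proof (cases ?X)
      case (real u)
      have "S n \<le> u * (real N * real (n + 1))"
        unfolding S_def
      proof (rule cSUP_least[OF ne])
        fix \<mu> assume "\<mu> \<in> adm n"
        from ge[OF this] show "io_information P N L h n \<mu> \<le> u * (real N * real (n + 1))"
          unfolding real ereal_less_eq by (rule pos_divide_le_eq[OF c, THEN iffD1])
      qed
      then show ?thesis unfolding real ereal_less_eq by (rule pos_divide_le_eq[OF c, THEN iffD2])
    next
      case MInf
      obtain \<mu> where "\<mu> \<in> adm n" using ne[of n] by blast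
      from ge[OF this] show ?thesis unfolding MInf by simp
    qed simp
  qed
  then have "capacity P N L h adm = lim (\<lambda>n. ereal (S n / (real N * real (n + 1))))"
    unfolding capacity_def by simp
  also have "\<dots> = ereal (l / real N)" by (intro limI tendsto_ereal l')
  finally show ?thesis using \<open>l / real N \<le> B\<close> by simp
qed

text \<open>Both low-power bounds depend on the coherence time T only through \<phi> = qQ/(1 + qQ),
  because T - N = 2NQ; for infinite Q the prescribed limits amount to \<phi> = 1. In either case
  \<phi> dominates the certificate values of all horizons, so the later estimates need no case
  distinction.\<close>

lemma UB_low_cases:
  fixes px :: real
  assumes px: "0 < px"
  obtains \<phi> where "0 \<le> \<phi>" "\<phi> \<le> 1"
    and "\<And>k. 0 < k \<Longrightarrow> real N * px * coh_form N r px k / (1 + real N * px * coh_form N r px k) \<le> \<phi>"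
    and "real N * UB_low_pk P N L h r px
      = real N * mean_gain P N L h * (real N * px) + real N * px - ln (1 + (1 - \<phi>) * (real N * px))"
    and "\<And>\<alpha>. real N * UB_low_qd P N L h r \<alpha> px
      = real N * mean_gain P N L h * (real N * px) + \<alpha> * (real N * px) * \<phi> + \<alpha> * (real N * px)\<^sup>2 / 2"
proof -
  define q where "q = real N * px"
  define Q where "Q = lim (\<lambda>k. ereal (coh_form N r px k))"
  have n: "0 < real N" using N_pos by simp
  have q: "0 < q" unfolding q_def using n px by simp
  note le_Q = coh_form_limit(1)[OF px N_pos, folded Q_def]
  note Q0 = coh_form_limit(2)[OF px N_pos, folded Q_def]
  note c0 = coh_form_certificate(1)[OF px N_pos]
  have T: "coh_time N r px = 2 * ereal (real N) * Q + ereal (real N)"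
    unfolding coh_time_def Q_def ..
  show thesis
  proof (cases Q)
    case (real c)
    then have c: "0 \<le> c" using Q0 by simp
    have qc: "0 \<le> q * c" using q c by simp
    have T': "coh_time N r px = ereal (2 * real N * c + real N)" unfolding T real by simp
    \<comment> \<open>The expressions in T - N that occur in the two bounds, at T - N = 2Nc with c
      the finite value of Q.\<close>
    have half: "px / 2 * (2 * real N * c + real N - real N) = q * c"
      "px * (2 * real N * c + real N - real N) = 2 * (q * c)"
      "px\<^sup>2 * (2 * real N * c + real N - real N) = 2 * px * (q * c)"
      unfolding q_def by (simp_all add: power2_eq_square)
    show thesis
    proof (rule that[of "q * c / (1 + q * c)"])
      show "0 \<le> q * c / (1 + q * c)" "q * c / (1 + q * c) \<le> 1" using qc by simp_all
      show "real N * px * coh_form N r px k / (1 + real N * px * coh_form N r px k) \<le> q * c / (1 + q * c)" if k: "0 < k" for k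
      proof -
        have 1: "q * coh_form N r px k \<le> q * c" "0 \<le> q * coh_form N r px k"
          using le_Q[OF k] c0[OF k] q unfolding real by simp_all
        show ?thesis unfolding q_def[symmetric] using 1 qc by (simp add: divide_simps) (simp add: algebra_simps)
      qed
      have "1 - q * c / (1 + q * c) = 1 / (1 + q * c)" using qc by (simp add: field_simps)
      then have "1 + (1 - q * c / (1 + q * c)) * q = 1 + q / (1 + q * c)" by simp
      then show "real N * UB_low_pk P N L h r px
          = real N * mean_gain P N L h * (real N * px) + real N * px - ln (1 + (1 - q * c / (1 + q * c)) * (real N * px))"
        unfolding UB_low_pk_def at_coh_time_def T' real_of_ereal.simps half q_def[symmetric]
        using n by (simp add: right_diff_distrib distrib_left) (simp add: q_def)
      have "2 * px * (q * c) / (2 + 2 * (q * c)) = px * (q * c / (1 + q * c))"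
        using qc by (simp add: field_simps)
      then show "real N * UB_low_qd P N L h r \<alpha> px
          = real N * mean_gain P N L h * (real N * px) + \<alpha> * (real N * px) * (q * c / (1 + q * c)) + \<alpha> * (real N * px)\<^sup>2 / 2" for \<alpha>
        unfolding UB_low_qd_def at_coh_time_def T' real_of_ereal.simps half
        by (simp add: algebra_simps power2_eq_square)
    qed
  next
    case PInf
    have T': "coh_time N r px = \<infinity>" unfolding T PInf using n by simp
    have lim: "((\<lambda>T. A + px - 1 / real N * ln (1 + q / (1 + px / 2 * (T - real N)))) \<longlongrightarrow> A + px) at_top"
      "((\<lambda>T. A + \<alpha> * (px\<^sup>2 * (T - real N) / (2 + px * (T - real N))) + D) \<longlongrightarrow> A + \<alpha> * px + D) at_top" for A D \<alpha> :: real
    proof -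
      have f: "filterlim (\<lambda>T. 1 + px / 2 * (T - real N)) at_top at_top" "filterlim (\<lambda>T. 2 + px * (T - real N)) at_top at_top"
        using px by real_asymp+
      have "((\<lambda>T. q / (1 + px / 2 * (T - real N))) \<longlongrightarrow> 0) at_top"
        by (rule tendsto_divide_0[OF tendsto_const]) (rule filterlim_at_top_imp_at_infinity[OF f(1)])
      then have "((\<lambda>T. A + px - 1 / real N * ln (1 + q / (1 + px / 2 * (T - real N)))) \<longlongrightarrow> A + px - 1 / real N * ln (1 + 0)) at_top"
        by (intro tendsto_intros) simp_all
      then show "((\<lambda>T. A + px - 1 / real N * ln (1 + q / (1 + px / 2 * (T - real N)))) \<longlongrightarrow> A + px) at_top" by simp
      have "((\<lambda>T. px - 2 * px / (2 + px * (T - real N))) \<longlongrightarrow> px - 0) at_top"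
        by (intro tendsto_diff tendsto_const tendsto_divide_0[OF tendsto_const] filterlim_at_top_imp_at_infinity f)
      moreover have "\<forall>\<^sub>F T in at_top. px - 2 * px / (2 + px * (T - real N)) = px\<^sup>2 * (T - real N) / (2 + px * (T - real N))"
        using filterlim_at_top_dense[THEN iffD1, OF f(2), rule_format, of 0]
        by eventually_elim (simp add: field_simps power2_eq_square)
      ultimately have "((\<lambda>T. px\<^sup>2 * (T - real N) / (2 + px * (T - real N))) \<longlongrightarrow> px) at_top"
        by (simp add: tendsto_cong)
      then show "((\<lambda>T. A + \<alpha> * (px\<^sup>2 * (T - real N) / (2 + px * (T - real N))) + D) \<longlongrightarrow> A + \<alpha> * px + D) at_top"
        by (intro tendsto_intros)
    qed
    show thesis
    proof (rule that[of 1])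
      show "real N * px * coh_form N r px k / (1 + real N * px * coh_form N r px k) \<le> 1" if k: "0 < k" for k
      proof -
        have "0 \<le> q * coh_form N r px k" using c0[OF k] q by simp
        then show ?thesis unfolding q_def[symmetric] by simp
      qed
      have "UB_low_pk P N L h r px = real N * px * mean_gain P N L h + px"
        unfolding UB_low_pk_def at_coh_time_def T' simp_thms if_True
        by (rule tendsto_Lim[OF trivial_limit_at_top_linorder lim(1)[unfolded q_def]])
      then show "real N * UB_low_pk P N L h r px
          = real N * mean_gain P N L h * (real N * px) + real N * px - ln (1 + (1 - 1) * (real N * px))"
        by (simp add: algebra_simps)
      have "UB_low_qd P N L h r \<alpha> px = real N * px * mean_gain P N L h + \<alpha> * px + 1 / 2 * \<alpha> * real N * px\<^sup>2" for \<alpha>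
        unfolding UB_low_qd_def at_coh_time_def T' simp_thms if_True
        by (rule tendsto_Lim[OF trivial_limit_at_top_linorder lim(2)])
      then show "real N * UB_low_qd P N L h r \<alpha> px
          = real N * mean_gain P N L h * (real N * px) + \<alpha> * (real N * px) * 1 + \<alpha> * (real N * px)\<^sup>2 / 2" for \<alpha>
        by (simp add: algebra_simps power2_eq_square)
    qed simp_all
  next
    case MInf
    then show thesis using Q0 by simp
  qed
qed

text \<open>One certificate for each horizon k, chosen simultaneously. At k = 0 there is no past and
  the value is 0, whence \<phi> \<ge> 0 is required.\<close>

lemma predictor_exists:
  assumes px: "0 < px" and \<phi>0: "0 \<le> \<phi>"
    and \<phi>: "\<And>k. 0 < k \<Longrightarrow> real N * px * coh_form N r px k / (1 + real N * px * coh_form N r px k) \<le> \<phi>"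
  obtains w where "\<And>k j. j < k \<Longrightarrow> (\<Sum>l<k. r (int j - int l) * w k l) + w k j / of_real (real N * px) = r (int j - int k)"
    and "\<And>k. rform k (\<lambda>j. cnj (w k j)) + (\<Sum>j<k. (cmod (w k j))\<^sup>2) / (real N * px) \<le> \<phi>"
proof -
  have "\<forall>k. \<exists>w. (\<forall>j<k. (\<Sum>l<k. r (int j - int l) * w l) + w j / of_real (real N * px) = r (int j - int k)) \<and>
      rform k (\<lambda>j. cnj (w j)) + (\<Sum>j<k. (cmod (w j))\<^sup>2) / (real N * px) \<le> \<phi>"
  proof
    fix k
    show "\<exists>w. (\<forall>j<k. (\<Sum>l<k. r (int j - int l) * w l) + w j / of_real (real N * px) = r (int j - int k)) \<and>
      rform k (\<lambda>j. cnj (w j)) + (\<Sum>j<k. (cmod (w j))\<^sup>2) / (real N * px) \<le> \<phi>"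
    proof (cases "k = 0")
      case True
      then show ?thesis using \<phi>0 by (simp add: hform_def)
    next
      case False
      then have k: "0 < k" by simp
      obtain w where w: "\<forall>j<k. (\<Sum>l<k. r (int j - int l) * w l) + w j / of_real (real N * px) = r (int j - int k)"
        and eq: "rform k (\<lambda>j. cnj (w j)) + (\<Sum>j<k. (cmod (w j))\<^sup>2) / (real N * px)
          = real N * px * coh_form N r px k / (1 + real N * px * coh_form N r px k)"
        using coh_form_certificate(2)[OF px N_pos k] by (elim exE conjE)
      show ?thesis by (intro exI[of _ w] conjI w) (unfold eq, rule \<phi>[OF k])
    qed
  qed
  from choice[OF this] obtain w where w: "\<forall>k. (\<forall>j<k. (\<Sum>l<k. r (int j - int l) * w k l) + w k j / of_real (real N * px) = r (int j - int k)) \<and>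
      rform k (\<lambda>j. cnj (w k j)) + (\<Sum>j<k. (cmod (w k j))\<^sup>2) / (real N * px) \<le> \<phi>" by (elim exE)
  show thesis by (rule that[of w]) (use w in \<open>simp_all only:\<close>)
qed

lemma information_le_integral:
  assumes \<mu>: "\<mu> \<in> input_laws N n" and e: "integrable \<mu> (energy n)" and G: "integrable \<mu> G"
    and le: "AE x in \<mu>. (\<integral>z. ln (lik n x (rec n (x, z))) \<partial>(P \<Otimes>\<^sub>M noise n)) \<le> G x"
  shows "io_information P N L h n \<mu> \<le> (\<integral>x. G x \<partial>\<mu>)"
  using information_le_expected_ln_lik(1)[OF \<mu> e]
    integral_mono_AE[OF information_le_expected_ln_lik(2)[OF \<mu> e] G le] by linarith

text \<open>The certified prediction error decreases in the past energies. These are almost surely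
  at most q, so the error is at least 1 - \<phi> for every symbol.\<close>

lemma peak_information_le:
  assumes \<mu>: "\<mu> \<in> peak_inputs N px n" and px: "0 < px"
  shows "integrable \<mu> (energy n)" and "(\<integral>x. energy n x \<partial>\<mu>) \<le> real (n + 1) * (real N * px)"
    and "io_information P N L h n \<mu> \<le> real (n + 1) * real N * UB_low_pk P N L h r px"
proof -
  define q where "q = real N * px"
  have q: "0 < q" unfolding q_def using N_pos px by simp
  have law: "\<mu> \<in> input_laws N n" and peak: "\<And>k. k \<le> n \<Longrightarrow> AE x in \<mu>. symbol_energy N x k \<le> q"
    using \<mu> unfolding peak_inputs_def q_def by auto
  interpret \<mu>: prob_space \<mu> by (rule prob_space_input_law[OF law])
  have AEp: "AE x in \<mu>. \<forall>k\<in>{..n}. symbol_energy N x k \<le> q"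
    by (rule AE_finite_allI) (use peak in auto)
  have AEe: "AE x in \<mu>. energy n x \<le> real (n + 1) * q"
    using AEp
  proof eventually_elim
    case (elim x)
    then have "energy n x \<le> (\<Sum>k\<le>n. q)" unfolding energy_eq by (intro sum_mono) auto
    then show ?case by simp
  qed
  have em: "energy n \<in> borel_measurable \<mu>"
    unfolding energy_eq[abs_def] by (intro borel_measurable_sum measurable_symbol_energy[OF law]) simp
  show e: "integrable \<mu> (energy n)"
    by (rule \<mu>.integrable_const_bound[OF _ em, where B="real (n + 1) * q"])
       (use AEe in \<open>eventually_elim, simp add: energy_nonneg\<close>)
  show "(\<integral>x. energy n x \<partial>\<mu>) \<le> real (n + 1) * (real N * px)"
    using integral_mono_AE[OF e _ AEe] unfolding q_def by (simp add: \<mu>.prob_space)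
  obtain \<phi> where \<phi>: "0 \<le> \<phi>" "\<phi> \<le> 1"
    and \<phi>k: "\<And>k. 0 < k \<Longrightarrow> real N * px * coh_form N r px k / (1 + real N * px * coh_form N r px k) \<le> \<phi>"
    and UB: "real N * UB_low_pk P N L h r px
      = real N * mean_gain P N L h * (real N * px) + real N * px - ln (1 + (1 - \<phi>) * (real N * px))"
    using UB_low_cases[OF px] by metis
  obtain w where w: "\<And>k j. j < k \<Longrightarrow> (\<Sum>l<k. r (int j - int l) * w k l) + w k j / of_real q = r (int j - int k)"
    and w\<phi>: "\<And>k. rform k (\<lambda>j. cnj (w k j)) + (\<Sum>j<k. (cmod (w k j))\<^sup>2) / q \<le> \<phi>"
    using predictor_exists[OF px \<phi>(1) \<phi>k] unfolding q_def by blast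
  define \<epsilon> where "\<epsilon> x k = max 0 (1 - (rform k (\<lambda>j. cnj (w k j)) + (\<Sum>j<k. (cmod (w k j))\<^sup>2 * symbol_energy N x j / q\<^sup>2)))" for x k
  have "AE x in \<mu>. (\<integral>z. ln (lik n x (rec n (x, z))) \<partial>(P \<Otimes>\<^sub>M noise n)) \<le> real (n + 1) * real N * UB_low_pk P N L h r px"
    using AEp
  proof eventually_elim
    case (elim x)
    have eps: "1 - \<phi> \<le> \<epsilon> x k" if k: "k \<le> n" for k
    proof -
      have "(\<Sum>j<k. (cmod (w k j))\<^sup>2 * symbol_energy N x j / q\<^sup>2) \<le> (\<Sum>j<k. (cmod (w k j))\<^sup>2 * q / q\<^sup>2)"
        using elim k q by (intro sum_mono divide_right_mono mult_left_mono) auto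
      also have "\<dots> = (\<Sum>j<k. (cmod (w k j))\<^sup>2) / q"
        using q by (simp add: sum_divide_distrib power2_eq_square)
      finally show ?thesis using w\<phi>[of k] unfolding \<epsilon>_def by linarith
    qed
    have "(\<integral>z. ln (lik n x (rec n (x, z))) \<partial>(P \<Otimes>\<^sub>M noise n))
        \<le> (\<Sum>k\<le>n. (1 + real N * mean_gain P N L h) * symbol_energy N x k - ln (1 + \<epsilon> x k * symbol_energy N x k))"
      by (rule expected_ln_lik_le[OF w q]) (auto simp: \<epsilon>_def)
    also have "\<dots> \<le> (\<Sum>k\<le>n. real N * mean_gain P N L h * q + q - ln (1 + (1 - \<phi>) * q))"
    proof (rule sum_mono)
      fix k assume "k \<in> {..n}"
      then have k: "k \<le> n" by simp
      have pq: "symbol_energy N x k \<le> q" using elim k by simp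
      have 1: "symbol_energy N x k - ln (1 + \<epsilon> x k * symbol_energy N x k) \<le> q - ln (1 + (1 - \<phi>) * q)"
        using \<phi> eps[OF k] pq by (intro diff_ln_mono) (simp_all add: symbol_energy_nonneg)
      have 2: "real N * mean_gain P N L h * symbol_energy N x k \<le> real N * mean_gain P N L h * q"
        using pq by (intro mult_left_mono) (simp_all add: mean_gain_nonneg)
      show "(1 + real N * mean_gain P N L h) * symbol_energy N x k - ln (1 + \<epsilon> x k * symbol_energy N x k)
          \<le> real N * mean_gain P N L h * q + q - ln (1 + (1 - \<phi>) * q)"
        using 1 2 by (simp add: distrib_right)
    qed
    also have "\<dots> = real (n + 1) * (real N * UB_low_pk P N L h r px)"
      unfolding UB q_def by simp
    finally show ?case by (simp add: mult.assoc)
  qed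
  from information_le_integral[OF law e _ this]
  show "io_information P N L h n \<mu> \<le> real (n + 1) * real N * UB_low_pk P N L h r px"
    by (simp add: \<mu>.prob_space)
qed

text \<open>The joint law of the energies is unconstrained, yet products p_j p_k of past and current
  energies occur. From p - ln(1 + \<epsilon>p) \<le> (1 - \<epsilon>)p + p^2/2 for 0 \<le>
  \<epsilon> \<le> 1 and p_j p_k \<le> (p_j^2 + p_k^2)/2, only single second moments remain, each at
  most \<alpha>q^2.\<close>

lemma quad_information_le:
  assumes \<mu>: "\<mu> \<in> quad_inputs N \<alpha> px n" and px: "0 < px" and \<alpha>: "1 \<le> \<alpha>"
  shows "integrable \<mu> (energy n)" and "(\<integral>x. energy n x \<partial>\<mu>) \<le> real (n + 1) * (real N * px)"
    and "io_information P N L h n \<mu> \<le> real (n + 1) * real N * UB_low_qd P N L h r \<alpha> px"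
proof -
  define q where "q = real N * px"
  let ?p = "\<lambda>x k. symbol_energy N x k" and ?G = "real N * mean_gain P N L h"
  have q: "0 < q" unfolding q_def using N_pos px by simp
  have law: "\<mu> \<in> input_laws N n"
    and nn1: "\<And>k. k \<le> n \<Longrightarrow> (\<integral>\<^sup>+x. ennreal (?p x k) \<partial>\<mu>) \<le> ennreal q"
    and nn2: "\<And>k. k \<le> n \<Longrightarrow> (\<integral>\<^sup>+x. ennreal ((?p x k)\<^sup>2) \<partial>\<mu>) \<le> ennreal (\<alpha> * q\<^sup>2)"
    using \<mu> unfolding quad_inputs_def q_def by (auto simp: power_mult_distrib mult.assoc)
  interpret \<mu>: prob_space \<mu> by (rule prob_space_input_law[OF law])
  note m = measurable_symbol_energy[OF law]
  have aq: "0 \<le> \<alpha> * q\<^sup>2" using \<alpha> by simp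
  have i1: "integrable \<mu> (\<lambda>x. ?p x k)" and E1: "(\<integral>x. ?p x k \<partial>\<mu>) \<le> q" if "k \<le> n" for k
    using integrable_of_nn_integral_le[OF m[OF that] symbol_energy_nonneg nn1[OF that]] q by simp_all
  have i2: "integrable \<mu> (\<lambda>x. (?p x k)\<^sup>2)" and E2: "(\<integral>x. (?p x k)\<^sup>2 \<partial>\<mu>) \<le> \<alpha> * q\<^sup>2" if "k \<le> n" for k
    using integrable_of_nn_integral_le[OF borel_measurable_power[OF m[OF that]] zero_le_power2 nn2[OF that] aq] by simp_all
  show e: "integrable \<mu> (energy n)"
    unfolding energy_eq[abs_def] by (intro Bochner_Integration.integrable_sum i1) simp
  have "(\<integral>x. energy n x \<partial>\<mu>) = (\<Sum>k\<le>n. (\<integral>x. ?p x k \<partial>\<mu>))"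
    unfolding energy_eq[abs_def] by (rule Bochner_Integration.integral_sum) (simp add: i1)
  also have "\<dots> \<le> (\<Sum>k\<le>n. q)" by (intro sum_mono E1) simp
  finally show "(\<integral>x. energy n x \<partial>\<mu>) \<le> real (n + 1) * (real N * px)" by (simp add: q_def)
  obtain \<phi> where \<phi>: "0 \<le> \<phi>" "\<phi> \<le> 1"
    and \<phi>k: "\<And>k. 0 < k \<Longrightarrow> real N * px * coh_form N r px k / (1 + real N * px * coh_form N r px k) \<le> \<phi>"
    and UB: "\<And>\<alpha>. real N * UB_low_qd P N L h r \<alpha> px
      = real N * mean_gain P N L h * (real N * px) + \<alpha> * (real N * px) * \<phi> + \<alpha> * (real N * px)\<^sup>2 / 2"
    using UB_low_cases[OF px] by metis
  obtain w where w: "\<And>k j. j < k \<Longrightarrow> (\<Sum>l<k. r (int j - int l) * w k l) + w k j / of_real q = r (int j - int k)"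
    and w\<phi>: "\<And>k. rform k (\<lambda>j. cnj (w k j)) + (\<Sum>j<k. (cmod (w k j))\<^sup>2) / q \<le> \<phi>"
    using predictor_exists[OF px \<phi>(1) \<phi>k] unfolding q_def by blast
  define R where "R k = rform k (\<lambda>j. cnj (w k j))" for k
  have R: "0 \<le> R k" for k unfolding R_def by (rule r_psd)
  define c where "c k j = (cmod (w k j))\<^sup>2 / q\<^sup>2" for k j
  have c: "0 \<le> c k j" for k j unfolding c_def by simp
  define \<epsilon> where "\<epsilon> x k = max 0 (1 - (R k + (\<Sum>j<k. c k j * ?p x j)))" for x k
  \<comment> \<open>In order: the mean gain, the part of 1 - \<epsilon> that is free of past
    energies, its part linear in them after the arithmetic-geometric inequality, and the quadratic
    remainder of the logarithm.\<close>
  define G where "G x k = ?G * ?p x k + (R k * ?p x k + (\<Sum>j<k. c k j * (((?p x k)\<^sup>2 + (?p x j)\<^sup>2) / 2))) + (?p x k)\<^sup>2 / 2" for x k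
  have le: "(\<integral>z. ln (lik n x (rec n (x, z))) \<partial>(P \<Otimes>\<^sub>M noise n)) \<le> (\<Sum>k\<le>n. G x k)" for x
  proof -
    have "(\<integral>z. ln (lik n x (rec n (x, z))) \<partial>(P \<Otimes>\<^sub>M noise n))
        \<le> (\<Sum>k\<le>n. (1 + ?G) * ?p x k - ln (1 + \<epsilon> x k * ?p x k))"
      by (rule expected_ln_lik_le[OF w q]) (auto simp: \<epsilon>_def R_def c_def)
    also have "\<dots> \<le> (\<Sum>k\<le>n. G x k)"
    proof (rule sum_mono)
      fix k
      have p: "0 \<le> ?p x j" for j by (rule symbol_energy_nonneg)
      have s: "0 \<le> (\<Sum>j<k. c k j * ?p x j)" by (intro sum_nonneg mult_nonneg_nonneg c p)
      have \<epsilon>: "0 \<le> \<epsilon> x k" "\<epsilon> x k \<le> 1" "1 - \<epsilon> x k \<le> R k + (\<Sum>j<k. c k j * ?p x j)"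
        unfolding \<epsilon>_def using R[of k] s by auto
      have "\<epsilon> x k * ?p x k - (\<epsilon> x k * ?p x k)\<^sup>2 / 2 \<le> ln (1 + \<epsilon> x k * ?p x k)"
        using \<epsilon> p by (intro ln_one_plus_ge_quadratic) simp
      moreover have "(\<epsilon> x k * ?p x k)\<^sup>2 \<le> (?p x k)\<^sup>2"
        using mult_right_mono[OF \<epsilon>(2) p[of k]] \<epsilon>(1) p[of k] by (intro power_mono) auto
      moreover have "(1 - \<epsilon> x k) * ?p x k \<le> (R k + (\<Sum>j<k. c k j * ?p x j)) * ?p x k"
        by (rule mult_right_mono[OF \<epsilon>(3) p])
      moreover have "(\<Sum>j<k. c k j * ?p x j) * ?p x k \<le> (\<Sum>j<k. c k j * (((?p x k)\<^sup>2 + (?p x j)\<^sup>2) / 2))"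
        unfolding sum_distrib_right
      proof (rule sum_mono)
        fix j
        have "?p x j * ?p x k \<le> ((?p x k)\<^sup>2 + (?p x j)\<^sup>2) / 2"
          using sum_squares_bound[of "?p x j" "?p x k"] by simp
        from mult_left_mono[OF this c] show "c k j * ?p x j * ?p x k \<le> c k j * (((?p x k)\<^sup>2 + (?p x j)\<^sup>2) / 2)"
          by (simp add: mult.assoc)
      qed
      ultimately show "(1 + ?G) * ?p x k - ln (1 + \<epsilon> x k * ?p x k) \<le> G x k"
        unfolding G_def by (simp add: distrib_right left_diff_distrib)
    qed
    finally show ?thesis .
  qed
  have iG: "integrable \<mu> (\<lambda>x. G x k)" and EG: "(\<integral>x. G x k \<partial>\<mu>) \<le> ?G * q + \<alpha> * q * \<phi> + \<alpha> * q\<^sup>2 / 2" if k: "k \<le> n" for k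
  proof -
    have isum: "integrable \<mu> (\<lambda>x. \<Sum>j<k. c k j * (((?p x k)\<^sup>2 + (?p x j)\<^sup>2) / 2))"
      using k by (intro Bochner_Integration.integrable_sum integrable_mult_right integrable_divide Bochner_Integration.integrable_add i2) auto
    show iG: "integrable \<mu> (\<lambda>x. G x k)"
      unfolding G_def using isum i1[OF k] i2[OF k]
      by (intro Bochner_Integration.integrable_add integrable_mult_right integrable_divide) auto
    have "(\<integral>x. (\<Sum>j<k. c k j * (((?p x k)\<^sup>2 + (?p x j)\<^sup>2) / 2)) \<partial>\<mu>)
        = (\<Sum>j<k. (\<integral>x. c k j * (((?p x k)\<^sup>2 + (?p x j)\<^sup>2) / 2) \<partial>\<mu>))"
      using k by (intro Bochner_Integration.integral_sum integrable_mult_right integrable_divide Bochner_Integration.integrable_add i2) auto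
    also have "\<dots> = (\<Sum>j<k. c k j * (((\<integral>x. (?p x k)\<^sup>2 \<partial>\<mu>) + (\<integral>x. (?p x j)\<^sup>2 \<partial>\<mu>)) / 2))"
      using k by (intro sum.cong refl) (simp add: i2)
    also have "\<dots> \<le> (\<Sum>j<k. c k j * (\<alpha> * q\<^sup>2))"
    proof (intro sum_mono mult_left_mono c)
      fix j assume "j \<in> {..<k}"
      then show "((\<integral>x. (?p x k)\<^sup>2 \<partial>\<mu>) + (\<integral>x. (?p x j)\<^sup>2 \<partial>\<mu>)) / 2 \<le> \<alpha> * q\<^sup>2"
        using E2[OF k] E2[of j] k by simp
    qed
    also have "\<dots> = \<alpha> * q * ((\<Sum>j<k. (cmod (w k j))\<^sup>2) / q)"
      unfolding c_def sum_divide_distrib sum_distrib_left using q by (intro sum.cong refl) (simp add: field_simps power2_eq_square)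
    finally have s: "(\<integral>x. (\<Sum>j<k. c k j * (((?p x k)\<^sup>2 + (?p x j)\<^sup>2) / 2)) \<partial>\<mu>) \<le> \<alpha> * q * ((\<Sum>j<k. (cmod (w k j))\<^sup>2) / q)" .
    \<comment> \<open>Here \<alpha> \<ge> 1 is used: the part R of the certificate meets only a
      first moment, bounded by q, and is raised to the weight \<alpha>q of the other part so that
      the two add up to at most \<phi>.\<close>
    have "q \<le> \<alpha> * q" using \<alpha> q by simp
    then have "R k * (\<integral>x. ?p x k \<partial>\<mu>) \<le> R k * (\<alpha> * q)"
      using E1[OF k] R by (intro mult_left_mono) auto
    moreover have "?G * (\<integral>x. ?p x k \<partial>\<mu>) \<le> ?G * q"
      using E1[OF k] by (intro mult_left_mono) (simp_all add: mean_gain_nonneg)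
    moreover have "\<alpha> * q * (R k + (\<Sum>j<k. (cmod (w k j))\<^sup>2) / q) \<le> \<alpha> * q * \<phi>"
      using w\<phi>[of k] \<alpha> q unfolding R_def by (intro mult_left_mono) auto
    moreover have "(\<integral>x. G x k \<partial>\<mu>) = ?G * (\<integral>x. ?p x k \<partial>\<mu>) + (R k * (\<integral>x. ?p x k \<partial>\<mu>)
        + (\<integral>x. (\<Sum>j<k. c k j * (((?p x k)\<^sup>2 + (?p x j)\<^sup>2) / 2)) \<partial>\<mu>)) + (\<integral>x. (?p x k)\<^sup>2 \<partial>\<mu>) / 2"
      unfolding G_def using isum i1[OF k] i2[OF k]
      by (simp del: Bochner_Integration.integral_sum)
    ultimately show "(\<integral>x. G x k \<partial>\<mu>) \<le> ?G * q + \<alpha> * q * \<phi> + \<alpha> * q\<^sup>2 / 2"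
      using s E2[OF k] by (simp add: distrib_left mult.commute)
  qed
  have "io_information P N L h n \<mu> \<le> (\<integral>x. (\<Sum>k\<le>n. G x k) \<partial>\<mu>)"
    by (rule information_le_integral[OF law e]) (use iG le in auto)
  also have "\<dots> = (\<Sum>k\<le>n. (\<integral>x. G x k \<partial>\<mu>))"
    by (rule Bochner_Integration.integral_sum) (simp add: iG)
  also have "\<dots> \<le> (\<Sum>k\<le>n. ?G * q + \<alpha> * q * \<phi> + \<alpha> * q\<^sup>2 / 2)"
    by (intro sum_mono EG) simp
  also have "\<dots> = real (n + 1) * (real N * UB_low_qd P N L h r \<alpha> px)"
    unfolding UB q_def by simp
  finally show "io_information P N L h n \<mu> \<le> real (n + 1) * real N * UB_low_qd P N L h r \<alpha> px"
    by (simp add: mult.assoc)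
qed

text \<open>A member of both input classes, so that the real suprema over inputs range over nonempty
  sets. The zero block is restricted since elements of the block space are extensional.\<close>

lemma silent_input:
  fixes n :: nat
  defines "\<mu> \<equiv> return (block n) (\<lambda>k\<in>{..n}. \<lambda>m\<in>{..<N}. 0)"
  assumes "0 < px" "1 \<le> \<alpha>"
  shows "\<mu> \<in> peak_inputs N px n" "\<mu> \<in> quad_inputs N \<alpha> px n"
proof -
  let ?x = "(\<lambda>k\<in>{..n}. \<lambda>m\<in>{..<N}. 0) :: nat \<Rightarrow> nat \<Rightarrow> complex"
  have x: "?x \<in> space (block n)" by (simp add: space_PiM)
  have law: "\<mu> \<in> input_laws N n"
    unfolding input_laws_def \<mu>_def using prob_space_return[OF x] by simp
  have p: "symbol_energy N ?x k = 0" if "k \<le> n" for k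
    using that by (simp add: symbol_energy_def)
  have m: "(\<lambda>x. symbol_energy N x k) \<in> borel_measurable (block n)" if "k \<le> n" for k
    using measurable_symbol_energy[OF law that] unfolding \<mu>_def by simp
  have "AE x in \<mu>. symbol_energy N x k \<le> real N * px" if k: "k \<le> n" for k
  proof -
    have "Measurable.pred (block n) (\<lambda>x. symbol_energy N x k \<le> real N * px)"
      using m[OF k] by measurable
    then show ?thesis unfolding \<mu>_def using assms N_pos by (subst AE_return[OF x]) (simp_all add: p[OF k])
  qed
  then show "\<mu> \<in> peak_inputs N px n" unfolding peak_inputs_def using law by simp
  have "(\<integral>\<^sup>+x. ennreal (symbol_energy N x k) \<partial>\<mu>) = 0" "(\<integral>\<^sup>+x. ennreal ((symbol_energy N x k)\<^sup>2) \<partial>\<mu>) = 0" if k: "k \<le> n" for k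
    unfolding \<mu>_def using m[OF k] by (subst nn_integral_return[OF x]; simp add: p[OF k])+
  then show "\<mu> \<in> quad_inputs N \<alpha> px n" unfolding quad_inputs_def using law by simp
qed

text \<open>Both power constraints concern the laws of single symbol energies, and each of these
  survives gluing unchanged. The predicate Q lets one argument serve the peak and the quadratic
  constraint.\<close>

lemma glued_component_law:
  assumes \<mu>1: "\<mu>1 \<in> input_laws N a" and \<mu>2: "\<mu>2 \<in> input_laws N b" and k: "k \<le> a + b + 1"
    and all1: "\<And>k. k \<le> a \<Longrightarrow> Q (distr \<mu>1 borel (\<lambda>x. symbol_energy N x k))"
    and all2: "\<And>k. k \<le> b \<Longrightarrow> Q (distr \<mu>2 borel (\<lambda>x. symbol_energy N x k))"
  shows "Q (distr (glued a b \<mu>1 \<mu>2) borel (\<lambda>x. symbol_energy N x k))"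
proof -
  have w: "window 0 a \<in> glued a b \<mu>1 \<mu>2 \<rightarrow>\<^sub>M block a" "window (a + 1) b \<in> glued a b \<mu>1 \<mu>2 \<rightarrow>\<^sub>M block b"
    unfolding glued_def using measurable_window[of 0 a "a + b + 1"] measurable_window[of "a + 1" b "a + b + 1"] by simp_all
  note D = distr_window_glued[OF \<mu>1 \<mu>2]
  show ?thesis
  proof (cases "k \<le> a")
    case True
    have m: "(\<lambda>x. symbol_energy N x k) \<in> borel_measurable (block a)"
      using measurable_symbol_energy[OF \<mu>1 True] by (simp add: measurable_cong_sets[OF sets_input_law[OF \<mu>1] refl])
    have "distr (glued a b \<mu>1 \<mu>2) borel (\<lambda>x. symbol_energy N x k)
        = distr (distr (glued a b \<mu>1 \<mu>2) (block a) (window 0 a)) borel (\<lambda>x. symbol_energy N x k)"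
      unfolding distr_distr[OF m w(1)] o_def symbol_energy_window[OF True] by simp
    also have "\<dots> = distr \<mu>1 borel (\<lambda>x. symbol_energy N x k)" unfolding D(1) ..
    finally show ?thesis using all1[OF True] by simp
  next
    case False
    then have k': "k - (a + 1) \<le> b" and ka: "k - (a + 1) + (a + 1) = k" using k by auto
    have m: "(\<lambda>x. symbol_energy N x (k - (a + 1))) \<in> borel_measurable (block b)"
      using measurable_symbol_energy[OF \<mu>2 k'] by (simp add: measurable_cong_sets[OF sets_input_law[OF \<mu>2] refl])
    have "distr (glued a b \<mu>1 \<mu>2) borel (\<lambda>x. symbol_energy N x k)
        = distr (distr (glued a b \<mu>1 \<mu>2) (block b) (window (a + 1) b)) borel (\<lambda>x. symbol_energy N x (k - (a + 1)))"
      unfolding distr_distr[OF m w(2)] o_def symbol_energy_window[OF k'] ka ..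
    also have "\<dots> = distr \<mu>2 borel (\<lambda>x. symbol_energy N x (k - (a + 1)))" unfolding D(2) ..
    finally show ?thesis using all2[OF k'] by simp
  qed
qed

lemma glued_peak_inputs:
  assumes \<mu>1: "\<mu>1 \<in> peak_inputs N px a" and \<mu>2: "\<mu>2 \<in> peak_inputs N px b"
  shows "glued a b \<mu>1 \<mu>2 \<in> peak_inputs N px (a + b + 1)"
proof -
  have law: "\<mu>1 \<in> input_laws N a" "\<mu>2 \<in> input_laws N b"
    using \<mu>1 \<mu>2 unfolding peak_inputs_def by auto
  note lawg = glued_input_law[OF law]
  have iff: "(AE u in distr \<nu> borel (\<lambda>x. symbol_energy N x k). u \<le> real N * px) \<longleftrightarrow> (AE x in \<nu>. symbol_energy N x k \<le> real N * px)"
    if "\<nu> \<in> input_laws N n" "k \<le> n" for \<nu> n k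
    by (rule AE_distr_iff[OF measurable_symbol_energy[OF that]]) simp
  have "AE x in glued a b \<mu>1 \<mu>2. symbol_energy N x k \<le> real N * px" if k: "k \<le> a + b + 1" for k
    unfolding iff[OF lawg k, symmetric]
    by (rule glued_component_law[OF law k, where Q="\<lambda>M. AE u in M. u \<le> real N * px"])
       (use \<mu>1 \<mu>2 in \<open>auto simp: peak_inputs_def iff\<close>)
  then show ?thesis unfolding peak_inputs_def using lawg by simp
qed

lemma glued_quad_inputs:
  assumes \<mu>1: "\<mu>1 \<in> quad_inputs N \<alpha> px a" and \<mu>2: "\<mu>2 \<in> quad_inputs N \<alpha> px b"
  shows "glued a b \<mu>1 \<mu>2 \<in> quad_inputs N \<alpha> px (a + b + 1)"
proof -
  define Q where "Q M \<longleftrightarrow> (\<integral>\<^sup>+u. ennreal u \<partial>M) \<le> ennreal (real N * px) \<and>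
      (\<integral>\<^sup>+u. ennreal (u\<^sup>2) \<partial>M) \<le> ennreal (\<alpha> * (real N)\<^sup>2 * px\<^sup>2)" for M :: "real measure"
  have law: "\<mu>1 \<in> input_laws N a" "\<mu>2 \<in> input_laws N b"
    using \<mu>1 \<mu>2 unfolding quad_inputs_def by auto
  note lawg = glued_input_law[OF law]
  have iff: "Q (distr \<nu> borel (\<lambda>x. symbol_energy N x k)) \<longleftrightarrow>
        (\<integral>\<^sup>+x. ennreal (symbol_energy N x k) \<partial>\<nu>) \<le> ennreal (real N * px) \<and>
        (\<integral>\<^sup>+x. ennreal ((symbol_energy N x k)\<^sup>2) \<partial>\<nu>) \<le> ennreal (\<alpha> * (real N)\<^sup>2 * px\<^sup>2)"
    if "\<nu> \<in> input_laws N n" "k \<le> n" for \<nu> n k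
    unfolding Q_def using measurable_symbol_energy[OF that] by (simp add: nn_integral_distr)
  have "Q (distr (glued a b \<mu>1 \<mu>2) borel (\<lambda>x. symbol_energy N x k))" if k: "k \<le> a + b + 1" for k
    by (rule glued_component_law[OF law k])
       (use \<mu>1 \<mu>2 in \<open>auto simp: quad_inputs_def iff[OF law(1)] iff[OF law(2)]\<close>)
  then show ?thesis unfolding quad_inputs_def using lawg iff[OF lawg] by simp
qed

lemma capacity_peak_le:
  assumes px: "0 < px"
  shows "capacity P N L h (peak_inputs N px) \<le> ereal (min (UB_low_pk P N L h r px) (UB_coh P N L h px))"
proof (rule capacity_le)
  fix n \<mu> assume \<mu>: "\<mu> \<in> peak_inputs N px n"
  show law: "\<mu> \<in> input_laws N n" using \<mu> unfolding peak_inputs_def by simp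
  show e: "integrable \<mu> (energy n)" by (rule peak_information_le[OF \<mu> px])
  show "io_information P N L h n \<mu> \<le> real (n + 1) * real N * min (UB_low_pk P N L h r px) (UB_coh P N L h px)"
    using peak_information_le(3)[OF \<mu> px] information_le_coherent[OF law e px peak_information_le(2)[OF \<mu> px]]
    by (simp add: min_def)
qed (use silent_input(1)[OF px order_refl] in blast, rule glued_peak_inputs)

lemma capacity_quad_le:
  assumes px: "0 < px" and \<alpha>: "1 \<le> \<alpha>"
  shows "capacity P N L h (quad_inputs N \<alpha> px) \<le> ereal (min (UB_low_qd P N L h r \<alpha> px) (UB_coh P N L h px))"
proof (rule capacity_le)
  fix n \<mu> assume \<mu>: "\<mu> \<in> quad_inputs N \<alpha> px n"
  show law: "\<mu> \<in> input_laws N n" using \<mu> unfolding quad_inputs_def by simp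
  show e: "integrable \<mu> (energy n)" by (rule quad_information_le[OF \<mu> px \<alpha>])
  show "io_information P N L h n \<mu> \<le> real (n + 1) * real N * min (UB_low_qd P N L h r \<alpha> px) (UB_coh P N L h px)"
    using quad_information_le(3)[OF \<mu> px \<alpha>] information_le_coherent[OF law e px quad_information_le(2)[OF \<mu> px \<alpha>]]
    by (simp add: min_def)
qed (use silent_input(2)[OF px \<alpha>] in blast, rule glued_quad_inputs)

end

theorem theorem1:
  fixes P :: "'w measure" and N L :: nat
    and h :: "nat \<Rightarrow> nat \<Rightarrow> 'w \<Rightarrow> complex"
    and r :: "int \<Rightarrow> complex" and CH :: "real mat" and px :: real
  assumes "ofdm_channel P N L h r CH"
    and "px > 0"
  shows "capacity P N L h (peak_inputs N px)
           \<le> ereal (min (UB_low_pk P N L h r px) (UB_coh P N L h px)) \<and>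
         (\<forall>\<alpha>\<ge>1. capacity P N L h (quad_inputs N \<alpha> px)
           \<le> ereal (min (UB_low_qd P N L h r \<alpha> px) (UB_coh P N L h px)))"
proof -
  interpret ofdm_channel P N L h r CH by (rule assms(1))
  show ?thesis using capacity_peak_le[OF assms(2)] capacity_quad_le[OF assms(2)] by blast
qed

end
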